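(* Assume that $B=\sum_{k=1}^\infty b_k\langle\cdot,e_k\rangle e_k$ where, for some $N\in\mathbb{N}$, $b_k>0$ for all $k\in\{1,\dots,N\}$, and $\frac12(N+1)^2-\lambda>0$. Then for any $c\in(-1,1)$ the limit semigroup $(P^c_t)_{t\ge0}$ on $\mathrm{H}_c$ has a unique invariant measure.
   Context: Setting. $\langle\cdot,\cdot\rangle$ is the scalar product of $L^2(0,1)$. $A$ is the Laplace operator on $L^2(0,1)$ with Neumann boundary conditions, $D(A)=\{h\in W^{2,2}(0,1): h'(0)=h'(1)=0\}$, with complete orthonormal system of eigenvectors $(e_i)_{i\ge 0}$, $e_0=1$, $e_i(\theta)=\sqrt2\cos(i\pi\theta)$, and eigenvalues $\lambda_i=-(i\pi)^2$. For $\gamma\in\mathbb{R}$, $V_\gamma=D((-A)^{\gamma/2})$ (defined by interpolation/completion), and for $h=\sum_i h_ie_i$ set $\bar h=h_0$ (the average of $h$), $|h|_\gamma=\big(\sum_{i\ge1}(-\lambda_i)^\gamma h_i^2\big)^{1/2}$, $\|h\|_\gamma=(|h|_\gamma^2+\bar h^2)^{1/2}$. Put $\mathrm{H}=V_{-1}$ and, for $c\in\mathbb{R}$, $\mathrm{H}_c=\{h\in \mathrm{H}:\bar h=c\}$ with metric $|x-y|_{-1}$. $\mathcal{B}_b(\mathrm{H}_c)$ is the space of bounded Borel functions $\mathrm{H}_c\to\mathbb{R}$. Noise. $W$ is a cylindrical Wiener process on $L^2(0,1)$; $B$ is a covariance operator (nonnegative, self-adjoint; so $b_k\ge0$ for all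 $k$) on $L^2(0,1)$ with $\sqrt B e_0=0$ and $\mathrm{Tr}_{-1}<+\infty$, where $\mathrm{Tr}_\gamma=\mathrm{Tr}[\sqrt B(-A)^\gamma\sqrt B^{*}]$. Approximated equation. Fix $\lambda\in\mathbb{R}$ and for $n\in\mathbb{N}$ let $f_n(u)=-2\sum_{k=0}^n\frac{u^{2k+1}}{2k+1}+\lambda u$. For $x\in \mathrm{H}$, $X^n=X^n(\cdot,x)$ is the unique solution, a.s. in $C([0,T];\mathrm{H})\cap L^{2n+2}((0,T)\times(0,1))$ for every $T>0$, of $$dX^n+\tfrac12\big(A^2X^n+Af_n(X^n)\big)dt=\sqrt B\,dW,\qquad X^n(0)=x.$$ The average of $X^n(t)$ does not depend on $t$. For $c\in\mathbb{R}$ set $P^{n,c}_t\varphi(x)=\mathbb{E}[\varphi(X^n(t,x))]$, $x\in \mathrm{H}_c$, $\varphi\in\mathcal{B}_b(\mathrm{H}_c)$. Limit semigroup. For $c\in(-1,1)$, $(P^c_t)_{t\ge0}$ denotes a transition semigroup on $\mathcal{B}_b(\mathrm{H}_c)$ obtained as limit along a subsequence $(n_k)$: $P^{n_k,c}_t\varphi(x)\to P^c_t\varphi(x)$ as $k\to\infty$ for all $\varphi\in\mathcal{B}_b(\mathrm{H}_c)$, $x\in \mathrm{H}_c$, $t\ge0$ (its existence is established in the paper). An invariant measure is a Borel probability measure $\nu$ on $\mathrm{H}_c$ with $\int P^c_t\varphi\,d\nu=\int\varphi\,d\nu$ for all $t\ge0$, $\varphi\in\mathcal{B}_b(\mathrm{H}_c)$.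 *)

theory Defs
  imports "HOL-Probability.Probability"
begin

definition eig :: "nat \<Rightarrow> real" where
  "eig i = - (real i * pi)\<^sup>2"

definition eigfun :: "nat \<Rightarrow> real \<Rightarrow> real" where
  "eigfun i \<theta> = (if i = 0 then 1 else sqrt 2 * cos (real i * pi * \<theta>))"

lemma deriv_eigfun:
  "deriv (eigfun i) = (\<lambda>\<theta>. if i = 0 then 0 else - (sqrt 2 * (real i * pi) * sin (real i * pi * \<theta>)))"
proof
  fix \<theta> :: real
  have "(eigfun i has_real_derivative
      (if i = 0 then 0 else - (sqrt 2 * (real i * pi) * sin (real i * pi * \<theta>)))) (at \<theta>)"
    by (cases "i = 0") (auto simp: eigfun_def[abs_def] intro!: derivative_eq_intros)
  then show "deriv (eigfun i) \<theta> = (if i = 0 then 0 else - (sqrt 2 * (real i * pi) * sin (real i * pi * \<theta>)))"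
    by (rule DERIV_imp_deriv)
qed

lemma eigfun_neumann: "deriv (eigfun i) 0 = 0" "deriv (eigfun i) 1 = 0"
  by (simp_all add: deriv_eigfun)

lemma eigfun_laplace: "deriv (deriv (eigfun i)) \<theta> = eig i * eigfun i \<theta>"
proof -
  have "(deriv (eigfun i) has_real_derivative eig i * eigfun i \<theta>) (at \<theta>)"
    by (cases "i = 0")
      (auto simp: deriv_eigfun eig_def eigfun_def power2_eq_square intro!: derivative_eq_intros)
  then show ?thesis by (rule DERIV_imp_deriv)
qed

text \<open>
  An element \<open>h = \<Sum>\<^sub>i h\<^sub>i e\<^sub>i\<close> of \<open>V\<^sub>\<gamma>\<close> is identified with its coefficient sequence; for
  \<open>\<gamma> < 0\<close> this is the concrete model of the completion. The coefficient \<open>h\<^sub>0\<close> is the average.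
\<close>

definition V :: "real \<Rightarrow> (nat \<Rightarrow> real) set" where
  "V \<gamma> = {h. summable (\<lambda>i. (- eig (Suc i)) powr \<gamma> * (h (Suc i))\<^sup>2)}"

definition V_seminorm :: "real \<Rightarrow> (nat \<Rightarrow> real) \<Rightarrow> real" where
  "V_seminorm \<gamma> h = sqrt (\<Sum>i. (- eig (Suc i)) powr \<gamma> * (h (Suc i))\<^sup>2)"

definition V_norm :: "real \<Rightarrow> (nat \<Rightarrow> real) \<Rightarrow> real" where
  "V_norm \<gamma> h = sqrt ((V_seminorm \<gamma> h)\<^sup>2 + (h 0)\<^sup>2)"

lemma eig_powr_pos: "(- eig (Suc i)) powr \<gamma> > 0"
  by (simp add: eig_def)

lemma V_summable_mult:
  assumes "h \<in> V \<gamma>" "k \<in> V \<gamma>"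
  shows "summable (\<lambda>i. (- eig (Suc i)) powr \<gamma> * (h (Suc i) * k (Suc i)))"
proof (rule summable_comparison_test)
  let ?w = "\<lambda>i. (- eig (Suc i)) powr \<gamma>"
  show "summable (\<lambda>i. ?w i * (h (Suc i))\<^sup>2 + ?w i * (k (Suc i))\<^sup>2)"
    using assms unfolding V_def by (intro summable_add) auto
  have "norm (?w i * (h (Suc i) * k (Suc i))) \<le> ?w i * (h (Suc i))\<^sup>2 + ?w i * (k (Suc i))\<^sup>2" for i
  proof -
    have *: "\<bar>a * b\<bar> \<le> a\<^sup>2 + b\<^sup>2" for a b :: real
    proof -
      have "2 * (\<bar>a\<bar> * \<bar>b\<bar>) \<le> a\<^sup>2 + b\<^sup>2"
        using sum_squares_bound[of "\<bar>a\<bar>" "\<bar>b\<bar>"] by simp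
      moreover have "0 \<le> \<bar>a\<bar> * \<bar>b\<bar>" by simp
      ultimately show ?thesis unfolding abs_mult by linarith
    qed
    have "norm (?w i * (h (Suc i) * k (Suc i))) = ?w i * \<bar>h (Suc i) * k (Suc i)\<bar>"
      by (simp add: abs_mult)
    also have "\<dots> \<le> ?w i * ((h (Suc i))\<^sup>2 + (k (Suc i))\<^sup>2)"
      by (intro mult_left_mono *) simp
    finally show ?thesis by (simp add: algebra_simps)
  qed
  then show "\<exists>N. \<forall>n\<ge>N. norm (?w n * (h (Suc n) * k (Suc n))) \<le> ?w n * (h (Suc n))\<^sup>2 + ?w n * (k (Suc n))\<^sup>2"
    by blast
qed

lemma V_add: "h \<in> V \<gamma> \<Longrightarrow> k \<in> V \<gamma> \<Longrightarrow> (\<lambda>i. h i + k i) \<in> V \<gamma>"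
proof -
  assume a: "h \<in> V \<gamma>" "k \<in> V \<gamma>"
  have "summable (\<lambda>i. (- eig (Suc i)) powr \<gamma> * (h (Suc i))\<^sup>2
      + 2 * ((- eig (Suc i)) powr \<gamma> * (h (Suc i) * k (Suc i)))
      + (- eig (Suc i)) powr \<gamma> * (k (Suc i))\<^sup>2)"
    using a V_summable_mult[OF a] unfolding V_def by (intro summable_add summable_mult) auto
  then show ?thesis by (simp add: V_def power2_sum algebra_simps)
qed

lemma V_scale: "h \<in> V \<gamma> \<Longrightarrow> (\<lambda>i. a * h i) \<in> V \<gamma>"
  using summable_mult[of "\<lambda>i. (- eig (Suc i)) powr \<gamma> * (h (Suc i))\<^sup>2" "a\<^sup>2"]
  by (simp add: V_def power_mult_distrib mult_ac)

lemma V_zero: "(\<lambda>i. 0) \<in> V \<gamma>"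
  by (simp add: V_def)

typedef H = "V (- 1)" morphisms coef Abs_H
  using V_zero by blast

setup_lifting type_definition_H

instantiation H :: real_inner
begin

lift_definition zero_H :: H is "\<lambda>i. 0" by (rule V_zero)
lift_definition plus_H :: "H \<Rightarrow> H \<Rightarrow> H" is "\<lambda>h k i. h i + k i" by (rule V_add)
lift_definition uminus_H :: "H \<Rightarrow> H" is "\<lambda>h i. - h i"
  using V_scale[of _ _ "-1"] by simp
lift_definition minus_H :: "H \<Rightarrow> H \<Rightarrow> H" is "\<lambda>h k i. h i - k i"
proof -
  fix h k assume "h \<in> V (- 1)" "k \<in> V (- 1)"
  then have "(\<lambda>i. h i + (- 1) * k i) \<in> V (- 1)" by (intro V_add V_scale)
  then show "(\<lambda>i. h i - k i) \<in> V (- 1)" by simp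
qed
lift_definition scaleR_H :: "real \<Rightarrow> H \<Rightarrow> H" is "\<lambda>a h i. a * h i" by (rule V_scale)

definition norm_H :: "H \<Rightarrow> real" where "norm_H h = V_norm (- 1) (coef h)"
definition dist_H :: "H \<Rightarrow> H \<Rightarrow> real" where "dist_H h k = norm (h - k)"
definition sgn_H :: "H \<Rightarrow> H" where "sgn_H h = inverse (norm h) *\<^sub>R h"
definition uniformity_H :: "(H \<times> H) filter" where
  "uniformity_H = (INF e\<in>{0<..}. principal {(x, y). dist x y < e})"
definition open_H :: "H set \<Rightarrow> bool" where
  "open_H U = (\<forall>x\<in>U. eventually (\<lambda>(x', y). x' = x \<longrightarrow> y \<in> U) uniformity)"
definition inner_H :: "H \<Rightarrow> H \<Rightarrow> real" where
  "inner_H h k = coef h 0 * coef k 0 +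
     (\<Sum>i. (- eig (Suc i)) powr (- 1) * (coef h (Suc i) * coef k (Suc i)))"

instance
proof
  fix x y z :: H and r :: real
  let ?w = "\<lambda>i. (- eig (Suc i)) powr (- 1)"
  have S: "summable (\<lambda>i. ?w i * (coef h (Suc i) * coef k (Suc i)))" for h k
    by (intro V_summable_mult coef)
  show "x + y + z = x + (y + z)" "x + y = y + x" "0 + x = x" "- x + x = 0" "x - y = x + - y"
    "1 *\<^sub>R x = x" "r *\<^sub>R (x + y) = r *\<^sub>R x + r *\<^sub>R y"
    by (transfer, simp add: algebra_simps)+
  fix s :: real
  show "(r + s) *\<^sub>R x = r *\<^sub>R x + s *\<^sub>R x" "r *\<^sub>R s *\<^sub>R x = (r * s) *\<^sub>R x"
    by (transfer, simp add: algebra_simps)+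
  show "dist x y = norm (x - y)" by (rule dist_H_def)
  show "sgn x = inverse (norm x) *\<^sub>R x" by (rule sgn_H_def)
  show "uniformity = (INF e\<in>{0<..}. principal {(x, y :: H). dist x y < e})" by (rule uniformity_H_def)
  show "open U = (\<forall>x\<in>U. eventually (\<lambda>(x', y). x' = x \<longrightarrow> y \<in> U) uniformity)" for U :: "H set"
    by (rule open_H_def)
  show "inner x y = inner y x" by (simp add: inner_H_def mult.commute)
  show "inner (x + y) z = inner x z + inner y z"
    using suminf_add[OF S[of x z] S[of y z]]
    by (simp add: inner_H_def plus_H.rep_eq algebra_simps)
  show "inner (r *\<^sub>R x) y = r * inner x y"
    using suminf_mult[OF S[of x y], of r]
    by (simp add: inner_H_def scaleR_H.rep_eq algebra_simps)
  have nn: "(\<Sum>i. ?w i * (coef x (Suc i) * coef x (Suc i))) \<ge> 0"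
    by (intro suminf_nonneg S) simp
  then show "inner x x \<ge> 0" by (simp add: inner_H_def)
  show "(inner x x = 0) = (x = 0)"
  proof
    assume "inner x x = 0"
    then have 0: "coef x 0 * coef x 0 = 0" and "(\<Sum>i. ?w i * (coef x (Suc i) * coef x (Suc i))) = 0"
      using nn zero_le_square[of "coef x 0"] unfolding inner_H_def by linarith+
    then have "\<forall>i. ?w i * (coef x (Suc i) * coef x (Suc i)) = 0"
      by (subst (asm) suminf_eq_zero_iff[OF S]) auto
    then have "coef x (Suc i) = 0" for i using eig_powr_pos[of i "-1"] by auto
    moreover from 0 have "coef x 0 = 0" by simp
    ultimately have "coef x i = 0" for i by (cases i) simp_all
    then have "coef x = coef 0" by (simp add: zero_H.rep_eq fun_eq_iff)
    then show "x = 0" by (simp only: coef_inject)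
  next
    assume "x = 0" then show "inner x x = 0" by (simp add: inner_H_def zero_H.rep_eq)
  qed
  show "norm x = sqrt (inner x x)"
    using nn by (simp add: norm_H_def V_norm_def V_seminorm_def inner_H_def power2_eq_square)
qed

end

definition Hc :: "real \<Rightarrow> H set" where
  "Hc c = {h. coef h 0 = c}"

text \<open>
  The metric of \<open>H\<^sub>c\<close> is \<open>|x - y|\<^sub>-\<^sub>1\<close>, which is the restriction of the metric of \<open>H\<close>.
\<close>

lemma dist_Hc:
  assumes "x \<in> Hc c" "y \<in> Hc c"
  shows "dist x y = V_seminorm (- 1) (\<lambda>i. coef x i - coef y i)"
proof -
  have "V_seminorm (- 1) h \<ge> 0" if "h \<in> V (- 1)" for h
    using that unfolding V_seminorm_def V_def by (auto intro!: suminf_nonneg)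
  moreover have "(\<lambda>i. coef x i - coef y i) \<in> V (- 1)"
    using coef[of "x - y"] by (simp add: minus_H.rep_eq)
  ultimately show ?thesis
    using assms by (simp add: dist_H_def norm_H_def V_norm_def Hc_def minus_H.rep_eq)
qed

abbreviation borel_Hc :: "real \<Rightarrow> H measure" where
  "borel_Hc c \<equiv> restrict_space borel (Hc c)"

definition brownian_motion :: "'w measure \<Rightarrow> (real \<Rightarrow> 'w \<Rightarrow> real) \<Rightarrow> bool" where
  "brownian_motion M \<beta> \<longleftrightarrow>
     prob_space M \<and>
     (\<forall>t\<ge>0. \<beta> t \<in> borel_measurable M) \<and>
     (AE \<omega> in M. \<beta> 0 \<omega> = 0) \<and>
     (\<forall>s t. 0 \<le> s \<and> s < t \<longrightarrow>
        distributed M lborel (\<lambda>\<omega>. \<beta> t \<omega> - \<beta> s \<omega>) (normal_density 0 (sqrt (t - s)))) \<and>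
     (\<forall>(m :: nat) (\<tau> :: nat \<Rightarrow> real). 0 \<le> \<tau> 0 \<and> mono \<tau> \<longrightarrow>
        prob_space.indep_vars M (\<lambda>_. borel) (\<lambda>j \<omega>. \<beta> (\<tau> (Suc j)) \<omega> - \<beta> (\<tau> j) \<omega>) {..<m}) \<and>
     (AE \<omega> in M. continuous_on {0..} (\<lambda>t. \<beta> t \<omega>))"

text \<open>
  A cylindrical Wiener process \<open>W(t) = \<Sum>\<^sub>k \<beta>\<^sub>k(t) e\<^sub>k\<close> on \<open>L\<^sup>2(0,1)\<close> is given by its coordinates
  \<open>W k t = \<beta>\<^sub>k(t)\<close>, which are mutually independent as path-valued random variables.
\<close>

definition cylindrical_wiener :: "'w measure \<Rightarrow> (nat \<Rightarrow> real \<Rightarrow> 'w \<Rightarrow> real) \<Rightarrow> bool" where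
  "cylindrical_wiener M W \<longleftrightarrow>
     prob_space M \<and>
     (\<forall>k. brownian_motion M (W k)) \<and>
     prob_space.indep_vars M (\<lambda>_. Pi\<^sub>M {0..} (\<lambda>_. borel)) (\<lambda>k \<omega>. \<lambda>t\<in>{0..}. W k t \<omega>) UNIV"

text \<open>
  \<open>Tr[\<surd>B (-A)\<^sup>\<gamma> \<surd>B\<^sup>*]\<close> for \<open>B = \<Sum>\<^sub>k b\<^sub>k \<langle>\<cdot>, e\<^sub>k\<rangle> e\<^sub>k\<close> with \<open>b\<^sub>0 = 0\<close>, computed in the basis \<open>(e\<^sub>k)\<close>.
\<close>

definition Tr :: "real \<Rightarrow> (nat \<Rightarrow> real) \<Rightarrow> ennreal" where
  "Tr \<gamma> b = (\<Sum>k. ennreal ((- eig (Suc k)) powr \<gamma> * b (Suc k)))"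

definition fpoly :: "real \<Rightarrow> nat \<Rightarrow> real \<Rightarrow> real" where
  "fpoly lam n u = - 2 * (\<Sum>k\<le>n. u ^ (2 * k + 1) / real (2 * k + 1)) + lam * u"

definition L2_coef :: "(real \<Rightarrow> real) \<Rightarrow> nat \<Rightarrow> real" where
  "L2_coef u i = set_lebesgue_integral lborel {0<..<1} (\<lambda>\<theta>. u \<theta> * eigfun i \<theta>)"

text \<open>
  \<open>x\<close> is the initial value, \<open>w k t = \<langle>W(t), e\<^sub>k\<rangle>\<close> a trajectory of the noise and \<open>\<xi>\<close> the trajectory of the
  solution. The function \<open>u\<close> on \<open>(0,\<infinity>) \<times> (0,1)\<close> represents \<open>\<xi>\<close> as an element of
  \<open>L\<^sup>2\<^sup>n\<^sup>+\<^sup>2((0,T) \<times> (0,1))\<close>; it is needed to give a meaning to \<open>f\<^sub>n(\<xi>)\<close>, since \<open>\<xi> t\<close> is only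
  an element of \<open>V\<^sub>-\<^sub>1\<close>. The equation is understood in the weak sense, tested against the
  eigenvectors \<open>e\<^sub>i\<close>, for which \<open>A e\<^sub>i = eig i e\<^sub>i\<close> and \<open>\<langle>\<surd>B W, e\<^sub>i\<rangle> = \<surd>b\<^sub>i \<beta>\<^sub>i\<close>.
\<close>

definition solution_path ::
  "(nat \<Rightarrow> real) \<Rightarrow> real \<Rightarrow> nat \<Rightarrow> H \<Rightarrow> (nat \<Rightarrow> real \<Rightarrow> real) \<Rightarrow> (real \<Rightarrow> H) \<Rightarrow> bool" where
  "solution_path b lam n x w \<xi> \<longleftrightarrow>
     continuous_on {0..} \<xi> \<and> \<xi> 0 = x \<and>
     (\<exists>u :: real \<Rightarrow> real \<Rightarrow> real.
        case_prod u \<in> borel_measurable (lborel \<Otimes>\<^sub>M lborel) \<and>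
        (\<forall>T>0. set_integrable (lborel \<Otimes>\<^sub>M lborel) ({0<..<T} \<times> {0<..<1})
                 (\<lambda>(t, \<theta>). \<bar>u t \<theta>\<bar> ^ (2 * n + 2))) \<and>
        (AE t in lborel. 0 < t \<longrightarrow> coef (\<xi> t) = L2_coef (u t)) \<and>
        (\<forall>i. \<forall>t\<ge>0.
           coef (\<xi> t) i
           + 1/2 * set_lebesgue_integral lborel {0..t}
               (\<lambda>s. (eig i)\<^sup>2 * coef (\<xi> s) i + eig i * L2_coef (\<lambda>\<theta>. fpoly lam n (u s \<theta>)) i)
           = coef x i + sqrt (b i) * w i t))"

definition solution ::
  "'w measure \<Rightarrow> (nat \<Rightarrow> real \<Rightarrow> 'w \<Rightarrow> real) \<Rightarrow> (nat \<Rightarrow> real) \<Rightarrow> real \<Rightarrow> nat \<Rightarrow> H \<Rightarrow>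
     (real \<Rightarrow> 'w \<Rightarrow> H) \<Rightarrow> bool" where
  "solution M W b lam n x \<Xi> \<longleftrightarrow>
     (\<forall>t\<ge>0. \<Xi> t \<in> borel_measurable M) \<and>
     (AE \<omega> in M. solution_path b lam n x (\<lambda>k t. W k t \<omega>) (\<lambda>t. \<Xi> t \<omega>))"

text \<open>
  Functions in \<open>\<B>\<^sub>b(S)\<close> are total functions on the underlying type; their values outside
  \<open>space S\<close> are irrelevant.
\<close>

definition Bb :: "'a measure \<Rightarrow> ('a \<Rightarrow> real) set" where
  "Bb S = {\<phi> \<in> borel_measurable S. \<exists>K. \<forall>x\<in>space S. \<bar>\<phi> x\<bar> \<le> K}"

text \<open>
  \<open>P\<^sup>n\<^sup>,\<^sup>c\<^sub>t \<phi>(x) = E[\<phi>(X\<^sup>n(t,x))]\<close>. The solution stays in \<open>H\<^sub>c\<close> only almost surely and \<open>\<phi>\<close> is only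
  measurable on \<open>H\<^sub>c\<close>, so the exceptional null set is removed explicitly.
\<close>

definition approx_semigroup ::
  "'w measure \<Rightarrow> (H \<Rightarrow> real \<Rightarrow> 'w \<Rightarrow> H) \<Rightarrow> real \<Rightarrow> real \<Rightarrow> (H \<Rightarrow> real) \<Rightarrow> H \<Rightarrow> real" where
  "approx_semigroup M Xn c t \<phi> x = (\<integral>\<omega>. (if Xn x t \<omega> \<in> Hc c then \<phi> (Xn x t \<omega>) else 0) \<partial>M)"

definition transition_semigroup ::
  "'a measure \<Rightarrow> (real \<Rightarrow> ('a \<Rightarrow> real) \<Rightarrow> 'a \<Rightarrow> real) \<Rightarrow> bool" where
  "transition_semigroup S P \<longleftrightarrow>
     (\<exists>\<kappa>. (\<forall>t\<ge>0. \<kappa> t \<in> S \<rightarrow>\<^sub>M prob_algebra S) \<and>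
          (\<forall>t\<ge>0. \<forall>\<phi>\<in>Bb S. \<forall>x\<in>space S. P t \<phi> x = (\<integral>y. \<phi> y \<partial>\<kappa> t x))) \<and>
     (\<forall>\<phi>\<in>Bb S. \<forall>x\<in>space S. P 0 \<phi> x = \<phi> x) \<and>
     (\<forall>s\<ge>0. \<forall>t\<ge>0. \<forall>\<phi>\<in>Bb S. \<forall>x\<in>space S. P (s + t) \<phi> x = P s (P t \<phi>) x)"

definition limit_semigroup ::
  "(nat \<Rightarrow> real \<Rightarrow> (H \<Rightarrow> real) \<Rightarrow> H \<Rightarrow> real) \<Rightarrow> real \<Rightarrow> (real \<Rightarrow> (H \<Rightarrow> real) \<Rightarrow> H \<Rightarrow> real) \<Rightarrow> bool" where
  "limit_semigroup Pn c P \<longleftrightarrow>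
     transition_semigroup (borel_Hc c) P \<and>
     (\<exists>r :: nat \<Rightarrow> nat. strict_mono r \<and>
        (\<forall>\<phi>\<in>Bb (borel_Hc c). \<forall>x\<in>Hc c. \<forall>t\<ge>0. (\<lambda>k. Pn (r k) t \<phi> x) \<longlonglongrightarrow> P t \<phi> x))"

definition invariant_measure ::
  "'a measure \<Rightarrow> (real \<Rightarrow> ('a \<Rightarrow> real) \<Rightarrow> 'a \<Rightarrow> real) \<Rightarrow> 'a measure \<Rightarrow> bool" where
  "invariant_measure S P \<nu> \<longleftrightarrow>
     prob_space \<nu> \<and> sets \<nu> = sets S \<and>
     (\<forall>t\<ge>0. \<forall>\<phi>\<in>Bb S. (\<integral>x. P t \<phi> x \<partial>\<nu>) = (\<integral>x. \<phi> x \<partial>\<nu>))"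

end

theory Submission
  imports Defs
begin

text \<open>
  Time is discretised by implicit Euler steps \<open>h\<close> and space by a Galerkin scheme in which the nonlinearity is
  damped by Fejer weights \<open>1 - i / (m + 1)\<close>. Since \<open>f\<^sub>n\<close> is \<open>\<lambda>u\<close> plus a decreasing function, one step is a
  contraction up to a defect carried by the first \<open>N\<close> modes, and shifting the Gaussian increments of these modes
  compensates the defect. Iterating the shift gives, uniformly in \<open>m\<close>, \<open>h\<close> and \<open>n\<close>, the asymptotic log-Harnack
  inequality \<open>P\<^sub>t g y \<le> ln (P\<^sub>t e\<^sup>g x) + Lip g |x - y| / \<surd>(1 + t) + C |x - y|\<^sup>2\<close>. Energy estimates
  show that the scheme converges to every solution; the positivity of the Fejer kernel yields the convergence of the
  Fejer means in \<open>L\<^sup>2\<^sup>n\<^sup>+\<^sup>2\<close>.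

  For uniqueness, a Hahn decomposition of the difference of two invariant measures and a test function \<open>g\<close>
  close to \<open>a\<close> on one part and to \<open>0\<close> on the other contradict the inequality as first \<open>t\<close> and then \<open>a\<close>
  tends to infinity. The inequality also gives the Feller property, and the \<open>H\<^sup>1\<close> energy bound gives tightness of
  the time averages; an encoding of \<open>H\<close> into the real line reduces their compactness to Helly's theorem.
\<close>

section \<open>Cosine polynomials and Fejer weights\<close>

text \<open>The noise may vanish in every mode above N, so no smoothing of the semigroup can be
  relied on; what survives is an estimate whose Lipschitz term decays in time. It must not depend on
  n, since the limit semigroup is accessible only through limits of expectations. The hypothesis on
  N makes this possible: above N one has freq i >= 9 (N+1)^2, so the linear part beats lam unaided,
  and only finitely many modes need help. Discretisation turns the change of measure into a shift of
  finitely many Gaussian variables. Fejer weights are preferred to a sharp cut-off for two reasons.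
  Damping the nonlinearity by \<open>fw\<close> is symmetric for the norm with weights 1/(fw freq),
  so monotonicity is kept; and Fejer means do not increase the L^(2n+2) norm, so the integrability
  built into the notion of solution suffices for convergence. The average c is conserved, and |c| <
  1 enters through the bound of f_n(u) (u - c) from above, uniformly in n >= 1. Measurability of the
  semigroup in time is not part of its definition, which is why existence works with the time-1
  kernel and discrete time averages.\<close>

abbreviation ulb :: "real measure" where
 "ulb \<equiv> restrict_space lborel {0<..<1}"

definition fw :: "nat => nat => real" where
 "fw m i = 1 - real i / (real m + 1)"

definition freq :: "nat => real" where
 "freq i = (real i * pi)^2"

definition cospoly :: "nat => (nat => real) => real => real" where
 "cospoly m a th = (\<Sum>i\<le>m. a i * eigfun i th)"

lemma eig_eq_freq: "eig i = - freq i"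
 by (simp add: eig_def freq_def)

lemma freq_0 [simp]: "freq 0 = 0"
 by (simp add: freq_def)

lemma freq_ge_1: "1 <= i ==> 1 <= freq i"
proof -
 assume "1 <= i"
 then have "1 * 1 <= real i * pi" using pi_gt3 by (intro mult_mono) auto
 then show ?thesis unfolding freq_def using one_le_power[of "real i * pi" 2] by simp
qed

lemma fw_bounds: "i <= m ==> 0 < fw m i" "fw m i <= 1" "i <= m ==> 0 <= fw m i"
 by (auto simp: fw_def field_simps)

lemma fw_0 [simp]: "fw m 0 = 1"
 by (simp add: fw_def)

lemma fw_lim: "(%m. fw m i) \<longlonglongrightarrow> 1"
proof -
 have "(%m. 1 - real i * inverse (real (Suc m))) \<longlonglongrightarrow> 1 - real i * 0"
  by (intro tendsto_intros LIMSEQ_inverse_real_of_nat)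
 then show ?thesis by (simp add: fw_def[abs_def] divide_inverse add.commute)
qed

lemma space_ulb [simp]: "space ulb = {0<..<1}"
 by (simp add: space_restrict_space)

lemma borel_measurable_ulb:
 "f \<in> borel_measurable borel ==> f \<in> borel_measurable ulb"
 by (simp add: measurable_restrict_space1)

interpretation ulb: prob_space ulb
 by (rule prob_spaceI) (simp add: emeasure_restrict_space)

lemma integral_ulb:
 "(\<integral>th. f th \<partial>ulb) = set_lebesgue_integral lborel {0<..<1} (f :: real => real)"
 by (simp add: integral_restrict_space set_lebesgue_integral_def)

lemma L2_coef_ulb: "L2_coef u i = (\<integral>th. u th * eigfun i th \<partial>ulb)"
 unfolding L2_coef_def integral_ulb ..

lemma integrable_ulb_continuous:
 fixes f :: "real => real"
 assumes "continuous_on UNIV f"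
 shows "integrable ulb f"
proof -
 have "compact (f ` {0..1})"
  using assms by (intro compact_continuous_image) (auto intro: continuous_on_subset)
 then obtain B where B: "!!x. x \<in> {0..1} ==> norm (f x) <= B"
  by (metis compact_imp_bounded bounded_iff imageI)
 show ?thesis
  using B by (intro ulb.integrable_const_bound[where B=B] AE_I2)
   (auto intro!: borel_measurable_ulb borel_measurable_continuous_onI assms)
qed

lemma continuous_eigfun: "continuous_on A (eigfun i)"
 unfolding eigfun_def[abs_def] by (cases "i = 0") (auto intro!: continuous_intros)

lemma borel_measurable_eigfun [measurable]: "eigfun i \<in> borel_measurable borel"
 by (intro borel_measurable_continuous_onI continuous_eigfun)

lemma abs_eigfun_le: "\<bar>eigfun i th\<bar> <= 2"
proof -
 have "sqrt 2 * \<bar>cos (real i * pi * th)\<bar> <= 2 * 1"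
  by (intro mult_mono real_le_lsqrt) auto
 then show ?thesis by (auto simp: eigfun_def abs_mult)
qed

lemma continuous_cospoly: "continuous_on A (cospoly m a)"
 unfolding cospoly_def[abs_def] by (intro continuous_intros continuous_eigfun)

lemma abs_cospoly_le: "\<bar>cospoly m a th\<bar> <= 2 * (\<Sum>i\<le>m. \<bar>a i\<bar>)"
proof -
 have "\<bar>cospoly m a th\<bar> <= (\<Sum>i\<le>m. \<bar>a i * eigfun i th\<bar>)"
  unfolding cospoly_def by (rule sum_abs)
 also have "\<dots> <= (\<Sum>i\<le>m. \<bar>a i\<bar> * 2)"
  unfolding abs_mult by (intro sum_mono mult_left_mono abs_eigfun_le) simp
 finally show ?thesis by (simp add: sum_distrib_left mult.commute)
qed

lemma continuous_fpoly: "continuous_on A (fpoly lam n)"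
 unfolding fpoly_def[abs_def] by (intro continuous_intros) auto

lemma integral_cos_pi:
 assumes "k \<noteq> 0"
 shows "(\<integral>th. cos (of_int k * pi * th) \<partial>ulb) = 0"
proof -
 have "(LBINT th=0..1. cos (of_int k * pi * th))
   = sin (of_int k * pi * 1) / (of_int k * pi) - sin (of_int k * pi * 0) / (of_int k * pi)"
  using assms
  unfolding zero_ereal_def one_ereal_def
  by (intro interval_integral_FTC_finite)
   (auto intro!: continuous_intros derivative_eq_intros
    simp flip: has_real_derivative_iff_has_vector_derivative simp: field_simps)
 moreover have "sin (of_int k * pi) = 0" 
  using sin_times_pi_eq_0 by auto
 ultimately have "(LBINT th=ereal 0..ereal 1. cos (of_int k * pi * th)) = 0"
  by (simp add: zero_ereal_def one_ereal_def)
 then show ?thesis by (simp add: integral_ulb interval_integral_Ioo)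
qed

lemma eigfun_orthonormal:
 "(\<integral>th. eigfun i th * eigfun j th \<partial>ulb) = (if i = j then 1 else 0)"
proof -
 have c: "(\<integral>th. cos ((real i + real j) * pi * th) \<partial>ulb) = (if i + j = 0 then 1 else 0)"
 proof (cases "i + j = 0")
  case False
  then have "int i + int j \<noteq> 0" by linarith
  then show ?thesis using integral_cos_pi[of "int i + int j"] False by simp
 next
  case True
  then show ?thesis using ulb.prob_space by simp
 qed
 have d: "(\<integral>th. cos ((real i - real j) * pi * th) \<partial>ulb) = (if i = j then 1 else 0)"
  using integral_cos_pi[of "int i - int j"] ulb.prob_space by (cases "i = j") auto
 have cs: "cos (real i * pi * th) * cos (real j * pi * th)
   = (cos ((real i - real j) * pi * th) + cos ((real i + real j) * pi * th)) / 2" for th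
  unfolding cos_times_cos by (simp add: algebra_simps)
 have "(\<integral>th. cos (real i * pi * th) * cos (real j * pi * th) \<partial>ulb)
   = ((if i = j then 1 else 0) + (if i + j = 0 then 1 else 0)) / 2"
  unfolding cs integral_divide_zero c[symmetric] d[symmetric]
  by (subst Bochner_Integration.integral_add)
   (auto intro!: integrable_ulb_continuous continuous_intros)
 moreover have "eigfun i th * eigfun j th = (if i = 0 then 1 else sqrt 2) * (if j = 0 then 1 else sqrt 2)
   * (cos (real i * pi * th) * cos (real j * pi * th))" for th
  by (simp add: eigfun_def)
 ultimately show ?thesis by (auto split: if_splits)
qed

lemma integrable_mult_eigfun:
 assumes "integrable ulb v"
 shows "integrable ulb (%th. v th * eigfun i th)"
proof (rule Bochner_Integration.integrable_bound[where f="%th. 2 * v th"])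
 show "integrable ulb (%th. 2 * v th)" using assms by simp
 have [measurable]: "v \<in> borel_measurable ulb" using assms by simp
 have [measurable]: "eigfun i \<in> borel_measurable ulb"
  by (intro borel_measurable_ulb) measurable
 show "(%th. v th * eigfun i th) \<in> borel_measurable ulb" by measurable
 have "\<bar>v th\<bar> * \<bar>eigfun i th\<bar> <= \<bar>v th\<bar> * 2" for th
  by (intro mult_left_mono abs_eigfun_le) simp
 then show "AE th in ulb. norm (v th * eigfun i th) <= norm (2 * v th)"
  by (simp add: abs_mult mult.commute)
qed

text \<open>Pairing with a cosine polynomial involves finitely many coefficients only. Every energy
  estimate below tests the nonlinearity in this way.\<close>

lemma integral_mult_cospoly:
 assumes "integrable ulb v"
 shows "integrable ulb (%th. v th * cospoly m a th)"
  "(\<integral>th. v th * cospoly m a th \<partial>ulb) = (\<Sum>i\<le>m. a i * L2_coef v i)"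
proof -
 have e: "v th * cospoly m a th = (\<Sum>i\<le>m. a i * (v th * eigfun i th))" for th
  by (simp add: cospoly_def sum_distrib_left mult_ac)
 show "integrable ulb (%th. v th * cospoly m a th)"
  unfolding e by (intro Bochner_Integration.integrable_sum integrable_mult_right
    integrable_mult_eigfun assms)
 show "(\<integral>th. v th * cospoly m a th \<partial>ulb) = (\<Sum>i\<le>m. a i * L2_coef v i)"
  unfolding e
  by (subst Bochner_Integration.integral_sum)
   (auto intro!: integrable_mult_right integrable_mult_eigfun assms simp: L2_coef_ulb)
qed

lemma L2_coef_cospoly: "L2_coef (cospoly m a) i = (if i <= m then a i else 0)"
proof -
 have "L2_coef (cospoly m a) i = (\<integral>th. eigfun i th * cospoly m a th \<partial>ulb)"
  by (simp add: L2_coef_ulb mult.commute)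
 also have "\<dots> = (\<Sum>j\<le>m. a j * L2_coef (eigfun i) j)"
  by (intro integral_mult_cospoly integrable_ulb_continuous continuous_eigfun)
 also have "\<dots> = (\<Sum>j\<le>m. if i = j then a j else 0)"
  by (intro sum.cong) (auto simp: L2_coef_ulb eigfun_orthonormal)
 finally show ?thesis by simp
qed

lemma integral_cospoly_square: "(\<integral>th. (cospoly m a th)^2 \<partial>ulb) = (\<Sum>i\<le>m. (a i)^2)"
 unfolding power2_eq_square
 by (subst integral_mult_cospoly)
  (auto intro!: integrable_ulb_continuous continuous_cospoly simp: L2_coef_cospoly)

lemma L2_coef_diff:
 assumes "integrable ulb u" "integrable ulb v"
 shows "L2_coef (%th. u th - v th) i = L2_coef u i - L2_coef v i"
 unfolding L2_coef_ulb left_diff_distrib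
 by (intro Bochner_Integration.integral_diff integrable_mult_eigfun assms)

lemma cospoly_diff: "cospoly m a th - cospoly m b th = cospoly m (%i. a i - b i) th"
 by (simp add: cospoly_def sum_subtractf left_diff_distrib)

text \<open>The decreasing part of \<open>fpoly\<close>: the odd Taylor polynomial of ln((1 - u)/(1
  + u)).\<close>

definition gpoly :: "nat => real => real" where
 "gpoly n u = - 2 * (\<Sum>k\<le>n. u ^ (2 * k + 1) / real (2 * k + 1))"

lemma fpoly_gpoly: "fpoly lam n u = gpoly n u + lam * u"
 by (simp add: fpoly_def gpoly_def)

lemma gpoly_antimono: "u <= v ==> gpoly n v <= gpoly n u"
proof -
 assume "u <= v"
 then have "(\<Sum>k\<le>n. u ^ (2 * k + 1) / real (2 * k + 1)) <= (\<Sum>k\<le>n. v ^ (2 * k + 1) / real (2 * k + 1))"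
  by (intro sum_mono divide_right_mono power_mono_odd) auto
 then show ?thesis unfolding gpoly_def by linarith
qed

text \<open>Only the linear term can increase, so the one-sided Lipschitz constant is lam for every
  n. This is why the contraction estimates do not see n.\<close>

lemma fpoly_one_sided: "(fpoly lam n u - fpoly lam n v) * (u - v) <= lam * (u - v)^2"
proof -
 have "(gpoly n u - gpoly n v) * (u - v) <= 0"
  using gpoly_antimono[of u v n] gpoly_antimono[of v u n]
  by (cases "u <= v") (auto simp: mult_le_0_iff)
 then show ?thesis by (simp add: fpoly_gpoly power2_eq_square algebra_simps)
qed

section \<open>The implicit Euler step\<close>

text \<open>Vectors are kept as functions on all naturals with the product topology; a bound by
  coordinate differences takes the place of a norm estimate, because its right-hand side is
  continuous and vanishes at the base point.\<close>

lemma continuous_on_coordinate_lipschitz: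
 fixes \<phi> :: "(nat => real) => real"
 assumes "!!a b. a \<in> K ==> b \<in> K ==> \<bar>\<phi> a - \<phi> b\<bar> <= C * (\<Sum>i\<in>I. \<bar>a i - b i\<bar>)"
 shows "continuous_on K \<phi>"
 unfolding continuous_on_def
proof
 fix a assume a: "a \<in> K"
 have "continuous_on K (%b. C * (\<Sum>i\<in>I. \<bar>b i - a i\<bar>))"
  by (intro continuous_intros continuous_on_subset[OF continuous_on_product_coordinates]) auto
 then have "((%b. C * (\<Sum>i\<in>I. \<bar>b i - a i\<bar>)) \<longlongrightarrow> C * (\<Sum>i\<in>I. \<bar>a i - a i\<bar>)) (at a within K)"
  using a unfolding continuous_on_def by blast
 then have lim: "((%b. C * (\<Sum>i\<in>I. \<bar>b i - a i\<bar>)) \<longlongrightarrow> 0) (at a within K)" by simp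
 have "((%b. \<phi> b - \<phi> a) \<longlongrightarrow> 0) (at a within K)"
 proof (rule Lim_null_comparison[OF _ lim])
  show "\<forall>\<^sub>F b in at a within K. norm (\<phi> b - \<phi> a) <= C * (\<Sum>i\<in>I. \<bar>b i - a i\<bar>)"
   unfolding eventually_at_filter using assms a by (auto intro!: always_eventually)
 qed
 then show "(\<phi> \<longlongrightarrow> \<phi> a) (at a within K)" by (simp add: LIM_zero_iff)
qed

lemma DERIV_power_div:
 "((%x. x ^ (2 * k + 1) / real (2 * k + 1)) has_real_derivative z ^ (2 * k)) (at z)"
 using DERIV_cdivide[OF DERIV_pow[of "2 * k + 1" z UNIV], of "real (2 * k + 1)"] by simp

text \<open>Mean value theorem term by term: the intermediate power |z|^(2k) is at most 1 +
  |z|^(2n), and |z| is at most the larger of |u|, |v|. Multiplied by |u - v| once more, the growth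
  is exactly that of L^(2n+2).\<close>

lemma gpoly_lipschitz:
 "\<bar>gpoly n u - gpoly n v\<bar> <= 2 * (real n + 1) * \<bar>u - v\<bar> * (1 + u ^ (2 * n) + v ^ (2 * n))"
proof -
 have k: "\<bar>u ^ (2 * k + 1) / real (2 * k + 1) - v ^ (2 * k + 1) / real (2 * k + 1)\<bar>
   <= \<bar>u - v\<bar> * (1 + u ^ (2 * n) + v ^ (2 * n))" if "k <= n" for k
 proof -
  have *: "\<bar>v ^ (2 * k + 1) / real (2 * k + 1) - u ^ (2 * k + 1) / real (2 * k + 1)\<bar>
   <= \<bar>v - u\<bar> * (1 + u ^ (2 * n) + v ^ (2 * n))" if "u < v" for u v :: real
  proof -
   have "\<exists>z>u. z < v \<and> v ^ (2 * k + 1) / real (2 * k + 1) - u ^ (2 * k + 1) / real (2 * k + 1)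
     = (v - u) * z ^ (2 * k)"
    using that by (intro MVT2 DERIV_power_div)
   then obtain z where z: "u < z" "z < v"
    "v ^ (2 * k + 1) / real (2 * k + 1) - u ^ (2 * k + 1) / real (2 * k + 1) = (v - u) * z ^ (2 * k)"
    by blast
   have "z ^ (2 * k) = \<bar>z\<bar> ^ (2 * k)" by (simp add: power_mult)
   also have "\<dots> <= 1 + \<bar>z\<bar> ^ (2 * n)"
   proof (cases "\<bar>z\<bar> <= 1")
    case True
    then have "\<bar>z\<bar> ^ (2 * k) <= 1" by (intro power_le_one) auto
    then show ?thesis using zero_le_power[of "\<bar>z\<bar>" "2 * n"] by linarith
   next
    case False
    then have "\<bar>z\<bar> ^ (2 * k) <= \<bar>z\<bar> ^ (2 * n)" using \<open>k <= n\<close> by (intro power_increasing) auto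
    then show ?thesis by simp
   qed
   also have "\<bar>z\<bar> ^ (2 * n) <= u ^ (2 * n) + v ^ (2 * n)"
   proof -
    have "\<bar>z\<bar> ^ (2 * n) <= max \<bar>u\<bar> \<bar>v\<bar> ^ (2 * n)"
     using z by (intro power_mono) auto
    also have "\<dots> <= \<bar>u\<bar> ^ (2 * n) + \<bar>v\<bar> ^ (2 * n)"
     by (cases "\<bar>u\<bar> <= \<bar>v\<bar>") (auto simp: max_def)
    finally show ?thesis by (simp add: power_mult)
   qed
   finally have "z ^ (2 * k) <= 1 + u ^ (2 * n) + v ^ (2 * n)" by simp
   moreover have "0 <= z ^ (2 * k)" by (simp add: power_mult)
   ultimately show ?thesis
    unfolding z(3) abs_mult by (intro mult_left_mono) auto
  qed
  show ?thesis
   using *[of u v] *[of v u] by (cases u v rule: linorder_cases) (auto simp: abs_minus_commute algebra_simps)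
 qed
 have "\<bar>gpoly n u - gpoly n v\<bar>
   = 2 * \<bar>\<Sum>k\<le>n. u ^ (2 * k + 1) / real (2 * k + 1) - v ^ (2 * k + 1) / real (2 * k + 1)\<bar>"
  unfolding gpoly_def sum_subtractf by (simp add: abs_if)
 also have "\<dots> <= 2 * (\<Sum>k\<le>n. \<bar>u - v\<bar> * (1 + u ^ (2 * n) + v ^ (2 * n)))"
  using k by (intro mult_left_mono order_trans[OF sum_abs] sum_mono) auto
 finally show ?thesis by (simp add: algebra_simps)
qed

lemma fpoly_lipschitz_on:
 "\<exists>C\<ge>0. \<forall>u v. \<bar>u\<bar> <= B --> \<bar>v\<bar> <= B --> \<bar>fpoly lam n u - fpoly lam n v\<bar> <= C * \<bar>u - v\<bar>"
proof (intro exI conjI allI impI)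
 let ?C = "2 * (real n + 1) * (1 + B ^ (2 * n) + B ^ (2 * n)) + \<bar>lam\<bar>"
 have B: "0 <= B ^ (2 * n)" by (simp add: power_mult)
 then show "0 <= ?C" by simp
 fix u v assume *: "\<bar>u\<bar> <= B" "\<bar>v\<bar> <= B"
 have pow: "w ^ (2 * n) <= B ^ (2 * n)" if "\<bar>w\<bar> <= B" for w
  using power_mono[OF that, of "2 * n"] by (simp add: power_mult)
 have "\<bar>fpoly lam n u - fpoly lam n v\<bar> <= \<bar>gpoly n u - gpoly n v\<bar> + \<bar>lam * (u - v)\<bar>"
  by (simp add: fpoly_gpoly algebra_simps abs_if)
 also have "\<dots> <= 2 * (real n + 1) * \<bar>u - v\<bar> * (1 + B ^ (2 * n) + B ^ (2 * n)) + \<bar>lam\<bar> * \<bar>u - v\<bar>"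
  using pow[OF *(1)] pow[OF *(2)]
  by (intro add_mono order_trans[OF gpoly_lipschitz] mult_left_mono) (auto simp: abs_mult)
 finally show "\<bar>fpoly lam n u - fpoly lam n v\<bar> <= ?C * \<bar>u - v\<bar>" by (simp add: algebra_simps)
qed

text \<open>The antiderivative of \<open>fpoly\<close> vanishing at 0, that is, minus the potential;
  it makes the implicit step a variational problem.\<close>

definition fprim :: "real => nat => real => real" where
 "fprim lam n u = - 2 * (\<Sum>k\<le>n. u ^ (2 * k + 2) / (real (2 * k + 1) * real (2 * k + 2))) + lam / 2 * u^2"

lemma DERIV_fprim: "(fprim lam n has_real_derivative fpoly lam n u) (at u)"
proof -
 have "((%u. u ^ (2 * k + 2) / (real (2 * k + 1) * real (2 * k + 2))) has_real_derivative
   u ^ (2 * k + 1) / real (2 * k + 1)) (at u)" for k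
 proof -
  have "((%u. u ^ (2 * k + 2) / (real (2 * k + 1) * real (2 * k + 2))) has_real_derivative
   (real (2 * k + 2) * u ^ (2 * k + 1)) / (real (2 * k + 1) * real (2 * k + 2))) (at u)"
   using DERIV_pow[of "2 * k + 2" u UNIV] by (intro DERIV_cdivide) simp
  moreover have "(real (2 * k + 2) * X) / (real (2 * k + 1) * real (2 * k + 2)) = X / real (2 * k + 1)" for X
   by (rule nonzero_mult_divide_mult_cancel_left2) auto
  ultimately show ?thesis by metis
 qed
 then have "((%u. \<Sum>k\<le>n. u ^ (2 * k + 2) / (real (2 * k + 1) * real (2 * k + 2))) has_real_derivative
   (\<Sum>k\<le>n. u ^ (2 * k + 1) / real (2 * k + 1))) (at u)"
  by (intro DERIV_sum)
 from DERIV_add[OF DERIV_cmult[OF this, of "- 2"] DERIV_cmult[OF DERIV_pow[of 2 u UNIV], of "lam / 2"]]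
 show ?thesis unfolding fprim_def[abs_def] fpoly_def by simp
qed

lemma fprim_le: "fprim lam n u <= \<bar>lam\<bar> / 2 * u^2"
proof -
 have "0 <= (\<Sum>k\<le>n. u ^ (2 * k + 2) / (real (2 * k + 1) * real (2 * k + 2)))"
  by (intro sum_nonneg divide_nonneg_nonneg zero_le_even_power) auto
 moreover have "lam / 2 * u^2 <= \<bar>lam\<bar> / 2 * u^2"
  by (intro mult_right_mono) auto
 ultimately show ?thesis unfolding fprim_def by linarith
qed

lemma continuous_fprim: "continuous_on A (fprim lam n)"
 using DERIV_fprim by (intro DERIV_continuous_on) (auto intro: has_field_derivative_at_within)

text \<open>The mean value theorem and local Lipschitz continuity of \<open>fpoly\<close> give a
  quadratic remainder, all that the first-order condition at a minimiser requires.\<close>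

lemma fprim_taylor:
 "\<exists>C\<ge>0. \<forall>u s. \<bar>u\<bar> <= B --> \<bar>u + s\<bar> <= B --> \<bar>fprim lam n (u + s) - fprim lam n u - fpoly lam n u * s\<bar> <= C * s^2"
proof -
 obtain C where C: "C \<ge> 0" "!!u v. \<bar>u\<bar> <= B ==> \<bar>v\<bar> <= B ==> \<bar>fpoly lam n u - fpoly lam n v\<bar> <= C * \<bar>u - v\<bar>"
  using fpoly_lipschitz_on[of B lam n] by blast
 have "\<bar>fprim lam n (u + s) - fprim lam n u - fpoly lam n u * s\<bar> <= C * s^2"
  if "\<bar>u\<bar> <= B" "\<bar>u + s\<bar> <= B" for u s
 proof -
  have "\<exists>z. \<bar>z - u\<bar> <= \<bar>s\<bar> \<and> \<bar>z\<bar> <= B \<and> fprim lam n (u + s) - fprim lam n u = fpoly lam n z * s"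
  proof (cases s "0 :: real" rule: linorder_cases)
   case less
   then obtain z where "u + s < z" "z < u" "fprim lam n u - fprim lam n (u + s) = (u - (u + s)) * fpoly lam n z"
    using MVT2[of "u + s" u "fprim lam n" "fpoly lam n"] DERIV_fprim by auto
   then show ?thesis using that by (intro exI[of _ z]) (auto simp: algebra_simps)
  next
   case greater
   then obtain z where "u < z" "z < u + s" "fprim lam n (u + s) - fprim lam n u = (u + s - u) * fpoly lam n z"
    using MVT2[of u "u + s" "fprim lam n" "fpoly lam n"] DERIV_fprim by auto
   then show ?thesis using that by (intro exI[of _ z]) (auto simp: algebra_simps)
  qed (use that in auto)
  then obtain z where z: "\<bar>z - u\<bar> <= \<bar>s\<bar>" "\<bar>z\<bar> <= B" "fprim lam n (u + s) - fprim lam n u = fpoly lam n z * s"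
   by blast
  have "\<bar>fprim lam n (u + s) - fprim lam n u - fpoly lam n u * s\<bar> = \<bar>fpoly lam n z - fpoly lam n u\<bar> * \<bar>s\<bar>"
   unfolding z(3) by (simp add: left_diff_distrib flip: abs_mult)
  also have "\<dots> <= (C * \<bar>s\<bar>) * \<bar>s\<bar>"
   using z that C by (intro mult_right_mono order_trans[OF C(2)] mult_left_mono) auto
  finally show ?thesis by (simp add: power2_eq_square)
 qed
 then show ?thesis using C(1) by blast
qed

text \<open>A backward Euler step for the modes 1..m. The operator A acts as -freq, so A f turns
  into -freq f, damped by \<open>fw\<close>; the average is prescribed instead of evolved.\<close>

definition step_solution ::
 "real => nat => real => nat => real => (nat => real) => (nat => real) => bool" where
 "step_solution lam n c m h x a \<longleftrightarrow> a 0 = c \<and> (\<forall>i>m. a i = 0) \<and>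
  (\<forall>i\<in>{1..m}. a i + h / 2 * ((freq i)^2 * a i
    - freq i * fw m i * L2_coef (%th. fpoly lam n (cospoly m a th)) i) = x i)"

text \<open>Weight of a norm of negative order, chosen with wt * fw * freq = 1: after multiplication
  by \<open>wt\<close> the step equation contains the undamped coefficient of the
  nonlinearity.\<close>

definition wt :: "nat => nat => real" where
 "wt m i = 1 / (fw m i * freq i)"

lemma wt_pos: "i \<in> {1..m} ==> 0 < wt m i"
 using fw_bounds(1)[of i m] freq_ge_1[of i] by (simp add: wt_def)

text \<open>Young's inequality |lam| freq fw <= freq^2 + lam^2/4, divided by fw * freq. The L^2 norm
  is thereby interpolated between the dissipation freq/fw and the weighted norm, so lam is paid for
  by dissipation plus a zero-order term.\<close>

lemma lam_interpolate:
 assumes "i \<in> {1..m}"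
 shows "\<bar>lam\<bar> <= freq i / fw m i + lam^2 / 4 * wt m i"
proof -
 have pos: "0 < freq i" "0 < fw m i" "fw m i <= 1"
  using assms freq_ge_1[of i] fw_bounds[of i m] fw_bounds(2)[of m i] by auto
 have "\<bar>lam\<bar> * (fw m i * freq i) <= (freq i)^2 + lam^2 / 4 * 1"
 proof -
  have "\<bar>lam\<bar> * (fw m i * freq i) <= \<bar>lam\<bar> * (1 * freq i)"
   using pos by (intro mult_left_mono mult_right_mono) auto
  also have "\<dots> <= (freq i)^2 + lam^2 / 4"
   using sum_squares_bound[of "freq i" "\<bar>lam\<bar> / 2"] by (simp add: power_divide mult_ac)
  finally show ?thesis by simp
 qed
 then have "\<bar>lam\<bar> <= ((freq i)^2 + lam^2 / 4) / (fw m i * freq i)"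
  using pos by (simp add: pos_le_divide_eq)
 also have "\<dots> = freq i / fw m i + lam^2 / 4 * wt m i"
  using pos by (simp add: wt_def field_simps power2_eq_square)
 finally show ?thesis .
qed

text \<open>The minimising-movement functional whose Euler-Lagrange equations are the step equations
  multiplied by \<open>wt\<close>.\<close>

definition step_energy ::
 "real => nat => nat => real => (nat => real) => (nat => real) => real" where
 "step_energy lam n m h x a =
  (\<Sum>i=1..m. wt m i * (a i - x i)^2 / 2 + h / 4 * (freq i / fw m i) * (a i)^2)
  - h / 2 * (\<integral>th. fprim lam n (cospoly m a th) \<partial>ulb)"

lemma continuous_on_integral_cospoly:
 fixes f :: "real => real"
 assumes K: "!!a i. a \<in> K ==> \<bar>a i\<bar> <= R"
  and f: "continuous_on UNIV f" and e: "continuous_on UNIV e" "!!th. \<bar>e th\<bar> <= E"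
  and L: "!!B. \<exists>C\<ge>0. \<forall>u v. \<bar>u\<bar> <= B --> \<bar>v\<bar> <= B --> \<bar>f u - f v\<bar> <= C * \<bar>u - v\<bar>"
 shows "continuous_on K (%a. \<integral>th. f (cospoly m a th) * e th \<partial>ulb)"
proof -
 obtain C where C: "C \<ge> 0" "!!u v. \<bar>u\<bar> <= 2 * (\<Sum>i\<le>m. R) ==> \<bar>v\<bar> <= 2 * (\<Sum>i\<le>m. R) ==> \<bar>f u - f v\<bar> <= C * \<bar>u - v\<bar>"
  using L[of "2 * (\<Sum>i\<le>m. R)"] by blast
 have E: "0 <= E" using e(2)[of 0] by simp
 have cont: "continuous_on UNIV (%th. f (cospoly m a th))" for a
  by (intro continuous_on_compose2[OF f] continuous_cospoly) auto
 have int: "integrable ulb (%th. f (cospoly m a th) * e th)" for a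
  by (intro integrable_ulb_continuous continuous_intros cont e)
 have bd: "\<bar>cospoly m a th\<bar> <= 2 * (\<Sum>i\<le>m. R)" if "a \<in> K" for a th
  using K[OF that] by (intro order_trans[OF abs_cospoly_le] mult_left_mono sum_mono) auto
 show ?thesis
 proof (rule continuous_on_coordinate_lipschitz[where I="{..m}" and C="C * 2 * E"])
  fix a b assume ab: "a \<in> K" "b \<in> K"
  have *: "\<bar>f (cospoly m a th) * e th - f (cospoly m b th) * e th\<bar> <= C * 2 * E * (\<Sum>i\<le>m. \<bar>a i - b i\<bar>)" for th
  proof -
   have "\<bar>f (cospoly m a th) * e th - f (cospoly m b th) * e th\<bar> = \<bar>f (cospoly m a th) - f (cospoly m b th)\<bar> * \<bar>e th\<bar>"
    by (simp add: left_diff_distrib flip: abs_mult)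
   also have "\<dots> <= (C * (2 * (\<Sum>i\<le>m. \<bar>a i - b i\<bar>))) * E"
   proof (intro mult_mono e(2))
    show "\<bar>f (cospoly m a th) - f (cospoly m b th)\<bar> <= C * (2 * (\<Sum>i\<le>m. \<bar>a i - b i\<bar>))"
     using abs_cospoly_le[of m "%i. a i - b i" th] C(1)
     by (intro order_trans[OF C(2)] bd ab mult_left_mono) (auto simp: cospoly_diff)
   qed (use C(1) in \<open>auto intro!: mult_nonneg_nonneg sum_nonneg\<close>)
   finally show ?thesis by (simp add: mult_ac)
  qed
  have "\<bar>(\<integral>th. f (cospoly m a th) * e th \<partial>ulb) - (\<integral>th. f (cospoly m b th) * e th \<partial>ulb)\<bar>
    = \<bar>\<integral>th. f (cospoly m a th) * e th - f (cospoly m b th) * e th \<partial>ulb\<bar>"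
   by (subst Bochner_Integration.integral_diff[OF int int]) simp
  also have "\<dots> <= (\<integral>th. \<bar>f (cospoly m a th) * e th - f (cospoly m b th) * e th\<bar> \<partial>ulb)"
   by (rule integral_abs_bound)
  also have "\<dots> <= (\<integral>th. C * 2 * E * (\<Sum>i\<le>m. \<bar>a i - b i\<bar>) \<partial>ulb)"
   by (intro integral_mono * Bochner_Integration.integrable_diff int integrable_abs) auto
  finally show "\<bar>(\<integral>th. f (cospoly m a th) * e th \<partial>ulb) - (\<integral>th. f (cospoly m b th) * e th \<partial>ulb)\<bar>
    <= C * 2 * E * (\<Sum>i\<le>m. \<bar>a i - b i\<bar>)"
   using ulb.prob_space by simp
 qed
qed

lemma fprim_lipschitz_on:
 "\<exists>C\<ge>0. \<forall>u v. \<bar>u\<bar> <= B --> \<bar>v\<bar> <= B --> \<bar>fprim lam n u - fprim lam n v\<bar> <= C * \<bar>u - v\<bar>"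
proof -
 have "compact (fpoly lam n ` {-B..B})"
  by (intro compact_continuous_image continuous_fpoly) auto
 then obtain C where C: "\<forall>x\<in>{-B..B}. norm (fpoly lam n x) <= C"
  by (metis compact_imp_bounded bounded_iff imageI)
 have *: "\<bar>fprim lam n v - fprim lam n u\<bar> <= max 0 C * \<bar>v - u\<bar>" if "\<bar>u\<bar> <= B" "\<bar>v\<bar> <= B" "u < v" for u v
 proof -
  obtain z where z: "u < z" "z < v" "fprim lam n v - fprim lam n u = (v - u) * fpoly lam n z"
   using MVT2[OF \<open>u < v\<close>, of "fprim lam n" "fpoly lam n"] DERIV_fprim by auto
  then have "z \<in> {-B..B}" using that by auto
  then have "\<bar>fpoly lam n z\<bar> <= max 0 C" using C by fastforce
  then show ?thesis unfolding z(3) abs_mult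
   by (subst mult.commute) (intro mult_right_mono, auto)
 qed
 have "\<bar>fprim lam n u - fprim lam n v\<bar> <= max 0 C * \<bar>u - v\<bar>" if "\<bar>u\<bar> <= B" "\<bar>v\<bar> <= B" for u v
  using *[of u v] *[of v u] that
  by (cases u v rule: linorder_cases) (auto simp: abs_minus_commute)
 then show ?thesis by (intro exI[of _ "max 0 C"]) auto
qed

lemma compact_box: "compact {a :: nat => real. \<forall>i. l i <= a i \<and> a i <= r i}"
proof -
 have "compactin (product_topology (%i. euclidean) UNIV) (PiE UNIV (%i. {l i..r i}))"
  unfolding compactin_PiE by simp
 then have "compact (PiE UNIV (%i. {l i..r i}))"
  by (simp add: euclidean_product_topology)
 moreover have "PiE UNIV (%i. {l i..r i}) = {a. \<forall>i. l i <= a i \<and> a i <= r i}"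
  by (auto simp: PiE_def)
 ultimately show ?thesis by simp
qed

text \<open>The direct method of the calculus of variations. For small h the lam part of the
  potential is absorbed, \<open>step_energy\<close> is coercive, and a minimiser over a compact box
  lies far enough from its boundary to satisfy the first-order condition.\<close>

lemma step_solution_ex:
 assumes h: "0 < h" "h * (lam^2 + 1) <= 1 / 2"
 shows "\<exists>a. step_solution lam n c m h x a"
proof -
 let ?\<Phi> = "step_energy lam n m h x"
 let ?a0 = "%i. if i = 0 then c else (0 :: real)"
 define B where "B = ?\<Phi> ?a0 + (\<Sum>i=1..m. wt m i * (x i)^2) + h * \<bar>lam\<bar> * c^2 / 4"
 define R where "R = sqrt (8 * B * freq m)"
 \<comment> \<open>Coordinate 0 and those above m are pinned. The margin 1 around the a priori bound
   R leaves room for variations of size at most 1.\<close>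
 define K where "K = {a :: nat => real. \<forall>i. (if i = 0 then c else if i <= m then - (R + 1) else 0) <= a i
  \<and> a i <= (if i = 0 then c else if i <= m then R + 1 else 0)}"
 \<comment> \<open>Coercivity. Half of the quadratic term is lost to x, and
   \<open>lam_interpolate\<close> with h lam^2 <= 1/2 costs another small fraction; 1/8
   remains.\<close>
 have lower: "(\<Sum>i=1..m. wt m i * (a i)^2 / 8) <= ?\<Phi> a + (\<Sum>i=1..m. wt m i * (x i)^2) + h * \<bar>lam\<bar> * c^2 / 4"
  if "a 0 = c" for a
 proof -
  have "(\<integral>th. fprim lam n (cospoly m a th) \<partial>ulb) <= (\<integral>th. \<bar>lam\<bar> / 2 * (cospoly m a th)^2 \<partial>ulb)"
   by (intro integral_mono fprim_le integrable_ulb_continuous continuous_intros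
     continuous_cospoly continuous_on_compose2[OF continuous_fprim[of UNIV]]) auto
  also have "\<dots> = \<bar>lam\<bar> / 2 * (\<Sum>i\<le>m. (a i)^2)"
   by (simp add: integral_cospoly_square)
  also have "(\<Sum>i\<le>m. (a i)^2) = c^2 + (\<Sum>i=1..m. (a i)^2)"
   using that sum.atLeast1_atMost_eq[of "%i. (a i)^2" m]
   by (simp add: atMost_atLeast0 sum.atLeast_Suc_atMost)
  finally have I: "h / 2 * (\<integral>th. fprim lam n (cospoly m a th) \<partial>ulb)
    <= h / 2 * (\<bar>lam\<bar> / 2 * (c^2 + (\<Sum>i=1..m. (a i)^2)))"
   using h by (intro mult_left_mono) auto
  have "wt m i * (a i)^2 / 8 - wt m i * (x i)^2
    <= wt m i * (a i - x i)^2 / 2 + h / 4 * (freq i / fw m i) * (a i)^2 - h / 4 * \<bar>lam\<bar> * (a i)^2"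
   if i: "i \<in> {1..m}" for i
  proof -
   have "h / 4 * \<bar>lam\<bar> * (a i)^2 <= h / 4 * (freq i / fw m i + lam^2 / 4 * wt m i) * (a i)^2"
    using h lam_interpolate[OF i, of lam] by (intro mult_right_mono mult_left_mono) auto
   also have "\<dots> = h / 4 * (freq i / fw m i) * (a i)^2 + (h * lam^2 / 16) * (wt m i * (a i)^2)"
    by (simp add: algebra_simps)
   also have "(h * lam^2 / 16) * (wt m i * (a i)^2) <= 1 / 32 * (wt m i * (a i)^2)"
    using h wt_pos[OF i] by (intro mult_right_mono) (auto simp: algebra_simps)
   finally have 1: "h / 4 * \<bar>lam\<bar> * (a i)^2 <= h / 4 * (freq i / fw m i) * (a i)^2 + wt m i * (a i)^2 / 32"
    by simp
   have "(a i)^2 / 4 - (x i)^2 / 2 <= (a i - x i)^2 / 2"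
    using zero_le_power2[of "a i - 2 * x i"] by (simp add: power2_eq_square algebra_simps)
   then have "wt m i * ((a i)^2 / 4 - (x i)^2 / 2) <= wt m i * ((a i - x i)^2 / 2)"
    using wt_pos[OF i] by (intro mult_left_mono) auto
   then have "wt m i * (a i)^2 / 4 - wt m i * (x i)^2 / 2 <= wt m i * (a i - x i)^2 / 2"
    by (simp add: right_diff_distrib)
   moreover have "0 <= wt m i * (a i)^2" "0 <= wt m i * (x i)^2" using wt_pos[OF i] by auto
   ultimately show ?thesis using 1 by linarith
  qed
  then have "(\<Sum>i=1..m. wt m i * (a i)^2 / 8 - wt m i * (x i)^2)
    <= (\<Sum>i=1..m. wt m i * (a i - x i)^2 / 2 + h / 4 * (freq i / fw m i) * (a i)^2 - h / 4 * \<bar>lam\<bar> * (a i)^2)"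
   by (rule sum_mono)
  then have "(\<Sum>i=1..m. wt m i * (a i)^2 / 8) - (\<Sum>i=1..m. wt m i * (x i)^2)
    <= (\<Sum>i=1..m. wt m i * (a i - x i)^2 / 2 + h / 4 * (freq i / fw m i) * (a i)^2)
     - h / 4 * \<bar>lam\<bar> * (\<Sum>i=1..m. (a i)^2)"
   by (simp only: sum_subtractf sum_distrib_left)
  moreover have "h / 2 * (\<bar>lam\<bar> / 2 * (c^2 + (\<Sum>i=1..m. (a i)^2)))
    = h * \<bar>lam\<bar> * c^2 / 4 + h / 4 * \<bar>lam\<bar> * (\<Sum>i=1..m. (a i)^2)"
   by (simp add: field_simps)
  ultimately show ?thesis using I unfolding step_energy_def by linarith
 qed
 have "continuous_on K ?\<Phi>"
 proof -
  have bd: "\<bar>a i\<bar> <= max \<bar>c\<bar> \<bar>R + 1\<bar>" if "a \<in> K" for a i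
   using that[unfolded K_def mem_Collect_eq, rule_format, of i] by (auto split: if_splits)
  have "continuous_on K (%a. \<integral>th. fprim lam n (cospoly m a th) * 1 \<partial>ulb)"
   by (rule continuous_on_integral_cospoly[where E=1 and K=K and R="max \<bar>c\<bar> \<bar>R + 1\<bar>"])
    (rule continuous_fprim fprim_lipschitz_on | erule bd | simp)+
  then show ?thesis unfolding step_energy_def
   by (intro continuous_intros continuous_on_subset[OF continuous_on_product_coordinates]) auto
 qed
 moreover have a0: "?a0 \<in> K" 
 proof -
  have "0 <= R" 
   using lower[of ?a0] sum_nonneg[of "{1..m}" "%i. wt m i * (?a0 i)^2 / 8"] 
   unfolding R_def B_def by (auto simp: freq_def)
  then show ?thesis by (auto simp: K_def)
 qed
 moreover have "compact K" unfolding K_def by (rule compact_box)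
 ultimately obtain a where a: "a \<in> K" "!!b. b \<in> K ==> ?\<Phi> a <= ?\<Phi> b"
  using continuous_attains_inf[of K ?\<Phi>] by blast
 have ac: "a 0 = c" "!!i. m < i ==> a i = 0"
  using a(1)[unfolded K_def mem_Collect_eq, rule_format, of 0] 
   a(1)[unfolded K_def mem_Collect_eq, rule_format] by (auto split: if_splits) (smt (verit) less_nat_zero_code not_le)
 have aR: "\<bar>a i\<bar> <= R" if i: "i \<in> {1..m}" for i
 proof -
  have "wt m i * (a i)^2 / 8 <= (\<Sum>i=1..m. wt m i * (a i)^2 / 8)"
   by (rule member_le_sum[OF i]) (auto intro!: mult_nonneg_nonneg less_imp_le[OF wt_pos])
  also have "\<dots> <= B" using lower[of a, OF ac(1)] a(2)[OF a0] unfolding B_def by linarith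
  finally have B: "wt m i * (a i)^2 <= 8 * B" by simp
  have p: "0 < fw m i * freq i" using wt_pos[OF i] by (auto simp: wt_def zero_less_divide_iff)
  have B0: "0 <= 8 * B" using B wt_pos[OF i] by (meson mult_nonneg_nonneg order_trans less_imp_le zero_le_power2)
  have "(a i)^2 <= 8 * B * (fw m i * freq i)"
   using B p unfolding wt_def by (simp add: divide_le_eq)
  also have "\<dots> <= 8 * B * (1 * freq m)"
  proof (rule mult_left_mono[OF _ B0])
   have "freq i <= freq m" unfolding freq_def using i by (intro power_mono mult_right_mono) auto
   then show "fw m i * freq i <= 1 * freq m"
    using i fw_bounds(2)[of m i] by (intro mult_mono) (auto simp: freq_def)
  qed
  finally have "(a i)^2 <= 8 * B * freq m" by simp
  then show ?thesis unfolding R_def by (simp add: real_le_rsqrt)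
 qed
 have "a j + h / 2 * ((freq j)^2 * a j - freq j * fw m j * L2_coef (%th. fpoly lam n (cospoly m a th)) j) = x j"
  if j: "j \<in> {1..m}" for j
 proof -
  let ?f = "%th. fpoly lam n (cospoly m a th)"
  \<comment> \<open>The additional 2 bounds |t e_j| for |t| <= 1, so the varied polynomial stays in
    the range of the Taylor estimate.\<close>
  define B' where "B' = 2 * (\<Sum>i\<le>m. \<bar>a i\<bar>) + 2"
  obtain C where C: "C \<ge> 0" "!!u s. \<bar>u\<bar> <= B' ==> \<bar>u + s\<bar> <= B' ==>
    \<bar>fprim lam n (u + s) - fprim lam n u - fpoly lam n u * s\<bar> <= C * s^2"
   using fprim_taylor[of B' lam n] by blast
  define G where "G = wt m j * (a j - x j) + h / 2 * (freq j / fw m j) * a j - h / 2 * L2_coef ?f j"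
  define D where "D = wt m j / 2 + h / 4 * (freq j / fw m j) + h / 2 * (C * 4)"
  \<comment> \<open>Minimality along the j-th coordinate: G is the partial derivative, D collects
    all quadratic contributions including the Taylor remainder.\<close>
  have var: "0 <= t * G + t^2 * D" if t: "\<bar>t\<bar> <= 1" for t
  proof -
   let ?b = "a(j := a j + t)"
   have aK: "(if i = 0 then c else if i <= m then - (R + 1) else 0) <= a i
     \<and> a i <= (if i = 0 then c else if i <= m then R + 1 else 0)" for i
    using a(1) unfolding K_def by blast
   have "?b \<in> K"
    unfolding K_def mem_Collect_eq
   proof
    fix i
    show "(if i = 0 then c else if i <= m then - (R + 1) else 0) <= ?b i
     \<and> ?b i <= (if i = 0 then c else if i <= m then R + 1 else 0)"
     using aK[of i] j t aR[OF j] by (cases "i = j") (auto simp: abs_le_iff)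
   qed
   then have le: "?\<Phi> a <= ?\<Phi> ?b" by (rule a)
   have cp: "cospoly m ?b th = cospoly m a th + t * eigfun j th" for th
   proof -
    have "cospoly m ?b th = (\<Sum>i\<le>m. a i * eigfun i th + (if i = j then t * eigfun i th else 0))"
     unfolding cospoly_def by (intro sum.cong) (auto simp: algebra_simps)
    then show ?thesis using j by (simp add: sum.distrib cospoly_def)
   qed
   have int: "integrable ulb (%th. fprim lam n (cospoly m b th))" for b
    by (intro integrable_ulb_continuous continuous_cospoly continuous_on_compose2[OF continuous_fprim[of UNIV]]) auto
   have intf: "integrable ulb (%th. ?f th * eigfun j th)"
    by (intro integrable_mult_eigfun integrable_ulb_continuous continuous_cospoly continuous_on_compose2[OF continuous_fpoly[of UNIV]]) auto
   have tay: "fprim lam n (cospoly m a th) + t * (?f th * eigfun j th) - C * 4 * t^2 <= fprim lam n (cospoly m ?b th)" for th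
   proof -
    have "\<bar>t\<bar> * \<bar>eigfun j th\<bar> <= 1 * 2" using t by (intro mult_mono abs_eigfun_le) auto
    then have te: "\<bar>t * eigfun j th\<bar> <= 2" by (simp add: abs_mult)
    have "\<bar>fprim lam n (cospoly m a th + t * eigfun j th) - fprim lam n (cospoly m a th) - ?f th * (t * eigfun j th)\<bar>
     <= C * (t * eigfun j th)^2"
     using abs_cospoly_le[of m a th] te unfolding B'_def
     by (intro C) (auto simp: B'_def)
    also have "\<dots> <= C * (4 * t^2)"
    proof (rule mult_left_mono[OF _ C(1)])
     have "\<bar>eigfun j th\<bar>^2 <= 2^2" by (intro power_mono abs_eigfun_le) auto
     then have "t^2 * (eigfun j th)^2 <= t^2 * 4" by (intro mult_left_mono) auto
     then show "(t * eigfun j th)^2 <= 4 * t^2" by (simp add: power_mult_distrib)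
    qed
    finally show ?thesis unfolding cp by (simp add: algebra_simps)
   qed
   have "(\<integral>th. fprim lam n (cospoly m a th) + t * (?f th * eigfun j th) - C * 4 * t^2 \<partial>ulb)
     <= (\<integral>th. fprim lam n (cospoly m ?b th) \<partial>ulb)"
    by (intro integral_mono tay Bochner_Integration.integrable_diff Bochner_Integration.integrable_add
      integrable_mult_right int intf) auto
   also have "(\<integral>th. fprim lam n (cospoly m a th) + t * (?f th * eigfun j th) - C * 4 * t^2 \<partial>ulb)
     = (\<integral>th. fprim lam n (cospoly m a th) \<partial>ulb) + t * L2_coef ?f j - C * 4 * t^2"
    by (subst Bochner_Integration.integral_diff Bochner_Integration.integral_add;
      (intro Bochner_Integration.integrable_add integrable_mult_right int intf)?)+
     (use ulb.prob_space in \<open>auto simp: L2_coef_ulb int intf\<close>)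
   finally have ib: "h / 2 * ((\<integral>th. fprim lam n (cospoly m a th) \<partial>ulb) + t * L2_coef ?f j - C * 4 * t^2)
     <= h / 2 * (\<integral>th. fprim lam n (cospoly m ?b th) \<partial>ulb)"
    by (rule mult_left_mono) (use h in simp)
   let ?q = "%i b. wt m i * (b - x i)^2 / 2 + h / 4 * (freq i / fw m i) * b^2"
   have "(\<Sum>i=1..m. ?q i (?b i)) = (\<Sum>i=1..m. ?q i (a i)) + (?q j (a j + t) - ?q j (a j))"
   proof -
    have "(\<Sum>i=1..m. ?q i (?b i)) = ?q j (?b j) + (\<Sum>i\<in>{1..m}-{j}. ?q i (?b i))"
     by (rule sum.remove) (use j in auto)
    also have "(\<Sum>i\<in>{1..m}-{j}. ?q i (?b i)) = (\<Sum>i\<in>{1..m}-{j}. ?q i (a i))"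
     by (intro sum.cong) auto
    also have "\<dots> = (\<Sum>i=1..m. ?q i (a i)) - ?q j (a j)"
     using j by (subst sum.remove[of "{1..m}" j]) auto
    finally show ?thesis by simp
   qed
   with le ib have "0 <= (?q j (a j + t) - ?q j (a j)) - h / 2 * (t * L2_coef ?f j - C * 4 * t^2)"
    unfolding step_energy_def by (simp add: algebra_simps)
   also have "\<dots> = t * G + t^2 * D"
   proof -
    have "(w * (a' + t - x')^2 / 2 + h / 4 * F * (a' + t)^2 - (w * (a' - x')^2 / 2 + h / 4 * F * a'^2))
      - h / 2 * (t * L - C * 4 * t^2)
     = t * (w * (a' - x') + h / 2 * F * a' - h / 2 * L) + t^2 * (w / 2 + h / 4 * F + h / 2 * (C * 4))"
     for w a' x' F L :: real
     by (simp add: power2_eq_square field_simps)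
    then show ?thesis unfolding G_def D_def .
   qed
   finally show ?thesis .
  qed
  have "G = 0"
  proof (rule ccontr)
   assume "G \<noteq> 0"
   \<comment> \<open>With t = -G/E one has |t| <= 1 and t G + t^2 D = (G/E)^2 (D - E) < 0, as E
     exceeds D.\<close>
   define E where "E = \<bar>D\<bar> + \<bar>G\<bar> + 1"
   have E: "E > 0" "\<bar>G\<bar> <= E" "D <= E - 1" "E \<noteq> 0" unfolding E_def by auto
   have "\<bar>- G / E\<bar> <= 1" using E by simp
   from var[OF this] have "0 <= (- G / E) * G + (- G / E)^2 * D" .
   also have "\<dots> = G^2 / E^2 * (D - E)"
    using E(4) by (simp add: field_simps power2_eq_square)
   also have "\<dots> < 0" using E \<open>G \<noteq> 0\<close> by (intro mult_pos_neg) auto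
   finally show False by simp
  qed
  moreover have p: "0 < freq j" "0 < fw m j" using j freq_ge_1[of j] fw_bounds[of j m] by auto
  ultimately have "(fw m j * freq j) * G = 0" by simp
  moreover have "(fw m j * freq j) * G = (a j - x j) + h / 2 * ((freq j)^2 * a j - freq j * fw m j * L2_coef ?f j)"
   unfolding G_def wt_def using p by (simp add: field_simps power2_eq_square)
  ultimately show ?thesis by simp
 qed
 then have "step_solution lam n c m h x a" unfolding step_solution_def using ac by blast
 then show ?thesis by (rule exI[of _ a])
qed

section \<open>The step map: monotonicity, contraction and dissipation\<close>

definition implicit_step ::
 "real => nat => real => nat => real => (nat => real) => nat => real" where
 "implicit_step lam n c m h x = (SOME a. step_solution lam n c m h x a)"

definition nrm2 :: "nat => (nat => real) => real" where
 "nrm2 m z = (\<Sum>i=1..m. wt m i * (z i)^2)"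

lemma nrm2_nonneg: "0 <= nrm2 m z"
 unfolding nrm2_def by (auto intro!: sum_nonneg mult_nonneg_nonneg less_imp_le[OF wt_pos])

lemma step_solution_implicit_step:
 assumes "0 < h" "h * (lam^2 + 1) <= 1 / 2"
 shows "step_solution lam n c m h x (implicit_step lam n c m h x)"
 unfolding implicit_step_def using step_solution_ex[OF assms] by (rule someI_ex)

lemma sum_atMost_head: "(\<Sum>i\<le>m. f i) = f 0 + (\<Sum>i=1..m. f (i :: nat) :: real)"
 using sum.atLeast1_atMost_eq[of f m] by (simp add: atMost_atLeast0 sum.atLeast_Suc_atMost)

lemma integrable_fpoly_cospoly: "integrable ulb (%th. fpoly lam n (cospoly m a th))"
 by (intro integrable_ulb_continuous continuous_cospoly
   continuous_on_compose2[OF continuous_fpoly[of UNIV]]) auto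

lemma step_solution_weighted:
 assumes "step_solution lam n c m h x a" "i \<in> {1..m}"
 shows "wt m i * a i + h / 2 * (wt m i * (freq i)^2 * a i - L2_coef (%th. fpoly lam n (cospoly m a th)) i) = wt m i * x i"
proof -
 have p: "0 < freq i" "0 < fw m i" using assms freq_ge_1[of i] fw_bounds[of i m] by auto
 have x: "x i = a i + h / 2 * ((freq i)^2 * a i - freq i * fw m i * L2_coef (%th. fpoly lam n (cospoly m a th)) i)"
  using assms unfolding step_solution_def by simp
 show ?thesis unfolding x wt_def using p by (simp add: field_simps)
qed

text \<open>Test the difference of the two equations with a - b. Its coordinate 0 vanishes because
  both solutions have average c, so the coefficient sum is a full integral and the one-sided bound
  applies pointwise.\<close>

lemma step_monotone:
 assumes h: "0 <= h" and a: "step_solution lam n c m h x a" and b: "step_solution lam n c m h y b"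
 shows "(\<Sum>i=1..m. wt m i * (a i - b i)^2 * (1 + h / 2 * ((freq i)^2 - lam * fw m i * freq i)))
  <= (\<Sum>i=1..m. wt m i * (x i - y i) * (a i - b i))"
proof -
 let ?fa = "%th. fpoly lam n (cospoly m a th)" and ?fb = "%th. fpoly lam n (cospoly m b th)"
 let ?D = "%i. a i - b i"
 have D0: "?D 0 = 0" using a b by (simp add: step_solution_def)
 have "(\<Sum>i=1..m. ?D i * (L2_coef ?fa i - L2_coef ?fb i)) = (\<Sum>i\<le>m. ?D i * L2_coef (%th. ?fa th - ?fb th) i)"
  using D0 by (simp add: sum_atMost_head L2_coef_diff integrable_fpoly_cospoly)
 also have "\<dots> = (\<integral>th. (?fa th - ?fb th) * cospoly m ?D th \<partial>ulb)"
  by (intro integral_mult_cospoly(2)[symmetric] Bochner_Integration.integrable_diff integrable_fpoly_cospoly)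
 also have "\<dots> <= (\<integral>th. lam * (cospoly m ?D th)^2 \<partial>ulb)"
 proof (intro integral_mono integral_mult_cospoly Bochner_Integration.integrable_diff integrable_fpoly_cospoly)
  show "integrable ulb (%th. lam * (cospoly m ?D th)^2)"
   by (intro integrable_ulb_continuous continuous_intros continuous_cospoly)
  show "(?fa th - ?fb th) * cospoly m ?D th <= lam * (cospoly m ?D th)^2" for th
   unfolding cospoly_diff[symmetric] by (rule fpoly_one_sided)
 qed
 also have "\<dots> = lam * (\<Sum>i=1..m. (?D i)^2)"
  using D0 by (simp add: integral_cospoly_square sum_atMost_head)
 also have "\<dots> = (\<Sum>i=1..m. wt m i * (?D i)^2 * (lam * fw m i * freq i))"
  unfolding sum_distrib_left
 proof (intro sum.cong refl)
  fix i assume i: "i \<in> {1..m}"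
  then have "wt m i * (fw m i * freq i) = 1"
   using fw_bounds(1)[of i m] freq_ge_1[of i] by (simp add: wt_def)
  then have "lam * (?D i)^2 = (wt m i * (fw m i * freq i)) * (lam * (?D i)^2)" by simp
  also have "\<dots> = wt m i * (?D i)^2 * (lam * fw m i * freq i)" by (simp only: mult_ac)
  finally show "lam * (?D i)^2 = wt m i * (?D i)^2 * (lam * fw m i * freq i)" .
 qed
 finally have *: "h / 2 * (\<Sum>i=1..m. ?D i * (L2_coef ?fa i - L2_coef ?fb i))
   <= h / 2 * (\<Sum>i=1..m. wt m i * (?D i)^2 * (lam * fw m i * freq i))"
  using h by (intro mult_left_mono) auto
 have "(\<Sum>i=1..m. wt m i * (x i - y i) * ?D i)
   = (\<Sum>i=1..m. wt m i * (?D i)^2 * (1 + h / 2 * (freq i)^2) - h / 2 * (?D i * (L2_coef ?fa i - L2_coef ?fb i)))"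
 proof (intro sum.cong refl)
  fix i assume i: "i \<in> {1..m}"
  have "wt m i * (x i - y i) = wt m i * ?D i + h / 2 * (wt m i * (freq i)^2 * ?D i - (L2_coef ?fa i - L2_coef ?fb i))"
   using step_solution_weighted[OF a i] step_solution_weighted[OF b i] by (simp add: algebra_simps)
  then have eq: "wt m i * (x i - y i) * ?D i
   = (wt m i * ?D i + h / 2 * (wt m i * (freq i)^2 * ?D i - (L2_coef ?fa i - L2_coef ?fb i))) * ?D i"
   by (rule arg_cong)
  have "(w * D + h / 2 * (w * F * D - l)) * D = w * D^2 * (1 + h / 2 * F) - h / 2 * (D * l)" for w D F l :: real
   by (simp add: algebra_simps power2_eq_square)
  then show "wt m i * (x i - y i) * ?D i
   = wt m i * (?D i)^2 * (1 + h / 2 * (freq i)^2) - h / 2 * (?D i * (L2_coef ?fa i - L2_coef ?fb i))"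
   by (rule trans[OF eq])
 qed
 also have "\<dots> \<ge> (\<Sum>i=1..m. wt m i * (?D i)^2 * (1 + h / 2 * (freq i)^2))
   - h / 2 * (\<Sum>i=1..m. wt m i * (?D i)^2 * (lam * fw m i * freq i))"
  unfolding sum_subtractf sum_distrib_left[symmetric] using * by linarith
 also have "(\<Sum>i=1..m. wt m i * (?D i)^2 * (1 + h / 2 * (freq i)^2))
   - h / 2 * (\<Sum>i=1..m. wt m i * (?D i)^2 * (lam * fw m i * freq i))
   = (\<Sum>i=1..m. wt m i * (?D i)^2 * (1 + h / 2 * ((freq i)^2 - lam * fw m i * freq i)))"
  unfolding sum_distrib_left sum_subtractf[symmetric]
  by (intro sum.cong) (auto simp: algebra_simps)
 finally show ?thesis .
qed

text \<open>A crude bound for small h that yields continuity of the step map; for x = y it also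
  shows that the chosen solution is the only one. Young's inequality leaves a quarter of the left
  norm out of a half, hence the factor 4.\<close>

lemma step_lipschitz:
 assumes h: "0 < h" "h * (lam^2 + 1) <= 1 / 2"
  and a: "step_solution lam n c m h x a" and b: "step_solution lam n c m h y b"
 shows "nrm2 m (%i. a i - b i) <= 4 * nrm2 m (%i. x i - y i)"
proof -
 have "(\<Sum>i=1..m. wt m i * (a i - b i)^2 * (1 / 2))
  <= (\<Sum>i=1..m. wt m i * (a i - b i)^2 * (1 + h / 2 * ((freq i)^2 - lam * fw m i * freq i)))"
 proof (intro sum_mono mult_left_mono)
  fix i assume i: "i \<in> {1..m}"
  have p: "0 < freq i" "0 < fw m i" "fw m i <= 1"
   using i freq_ge_1[of i] fw_bounds[of i m] fw_bounds(2)[of m i] by auto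
  have "lam * fw m i * freq i <= \<bar>lam\<bar> * 1 * freq i"
   using p by (intro mult_mono) auto
  also have "\<dots> <= (freq i)^2 + lam^2"
  proof -
   have "2 * (freq i * \<bar>lam\<bar>) <= (freq i)^2 + lam^2" using sum_squares_bound[of "freq i" "\<bar>lam\<bar>"] by simp
   moreover have "0 <= freq i * \<bar>lam\<bar>" using p by (intro mult_nonneg_nonneg) auto
   moreover have "\<bar>lam\<bar> * 1 * freq i = freq i * \<bar>lam\<bar>" by simp
   ultimately show ?thesis by linarith
  qed
  finally have "h / 2 * (- (lam^2)) <= h / 2 * ((freq i)^2 - lam * fw m i * freq i)"
   using h by (intro mult_left_mono) auto
  moreover have "h / 2 * lam^2 <= 1 / 2" using h by (simp add: algebra_simps)
  ultimately show "1 / 2 <= 1 + h / 2 * ((freq i)^2 - lam * fw m i * freq i)" by linarith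
  show "0 <= wt m i * (a i - b i)^2" using wt_pos[OF i] by simp
 qed
 also have "\<dots> <= (\<Sum>i=1..m. wt m i * (x i - y i) * (a i - b i))"
  using step_monotone[OF less_imp_le[OF h(1)] a b] .
 also have "\<dots> <= (\<Sum>i=1..m. wt m i * (x i - y i)^2 + wt m i * (a i - b i)^2 * (1 / 4))"
 proof (intro sum_mono)
  fix i assume i: "i \<in> {1..m}"
  have "(x i - y i) * (a i - b i) <= (x i - y i)^2 + (a i - b i)^2 / 4"
  proof -
   have "p * q <= p^2 + q^2 / 4" for p q :: real
    using zero_le_power2[of "p - q / 2"] unfolding power2_diff by (simp add: power_divide)
   then show ?thesis .
  qed
  then have "wt m i * ((x i - y i) * (a i - b i)) <= wt m i * ((x i - y i)^2 + (a i - b i)^2 / 4)"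
   using wt_pos[OF i] by (intro mult_left_mono) auto
  then show "wt m i * (x i - y i) * (a i - b i) <= wt m i * (x i - y i)^2 + wt m i * (a i - b i)^2 * (1 / 4)"
   by (simp add: distrib_left mult.assoc)
 qed
 finally show ?thesis
  unfolding nrm2_def by (simp add: sum.distrib flip: sum_divide_distrib)
qed

lemma sqrt_nrm2_le_sum: "sqrt (nrm2 m z) <= (\<Sum>j=1..m. sqrt (wt m j)) * (\<Sum>j=1..m. \<bar>z j\<bar>)"
proof -
 have "sqrt (nrm2 m z) = L2_set (%i. sqrt (wt m i) * z i) {1..m}"
  unfolding nrm2_def L2_set_def
  by (intro arg_cong[where f=sqrt] sum.cong) (auto simp: power_mult_distrib less_imp_le[OF wt_pos])
 also have "\<dots> <= (\<Sum>j=1..m. \<bar>sqrt (wt m j) * z j\<bar>)" by (rule L2_set_le_sum_abs)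
 also have "\<dots> <= (\<Sum>j=1..m. (\<Sum>j=1..m. sqrt (wt m j)) * \<bar>z j\<bar>)"
 proof (intro sum_mono)
  fix j assume j: "j \<in> {1..m}"
  have "sqrt (wt m j) <= (\<Sum>j=1..m. sqrt (wt m j))"
   by (rule member_le_sum[OF j]) (auto intro: less_imp_le[OF wt_pos])
  then show "\<bar>sqrt (wt m j) * z j\<bar> <= (\<Sum>j=1..m. sqrt (wt m j)) * \<bar>z j\<bar>"
   using wt_pos[OF j] by (simp add: abs_mult mult_right_mono)
 qed
 finally show ?thesis by (simp add: sum_distrib_left)
qed

lemma coord_le_nrm2: "i \<in> {1..m} ==> \<bar>z i\<bar> <= sqrt (nrm2 m z) / sqrt (wt m i)"
proof -
 assume i: "i \<in> {1..m}"
 have "wt m i * (z i)^2 <= nrm2 m z"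
  unfolding nrm2_def by (rule member_le_sum[OF i]) (auto intro!: mult_nonneg_nonneg less_imp_le[OF wt_pos])
 then have "sqrt (wt m i * (z i)^2) <= sqrt (nrm2 m z)" by (rule real_sqrt_le_mono)
 then show ?thesis using wt_pos[OF i] by (simp add: real_sqrt_mult pos_le_divide_eq mult.commute)
qed

lemma continuous_implicit_step:
 assumes h: "0 < h" "h * (lam^2 + 1) <= 1 / 2"
 shows "continuous_on UNIV (implicit_step lam n c m h)"
proof (rule continuous_on_coordinatewise_then_product)
 fix i
 let ?J = "implicit_step lam n c m h"
 note sol = step_solution_implicit_step[OF h, of n c m]
 show "continuous_on UNIV (%x. ?J x i)"
 proof (cases "i \<in> {1..m}")
  case False
  have "?J x i = (if i = 0 then c else 0)" for x
   using sol[of x] False unfolding step_solution_def by (cases "i = 0") auto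
  then show ?thesis by simp
 next
  case True
  show ?thesis
  proof (rule continuous_on_coordinate_lipschitz[where I="{1..m}"
     and C="2 * (\<Sum>j=1..m. sqrt (wt m j)) / sqrt (wt m i)"])
   fix x y
   have "\<bar>?J x i - ?J y i\<bar> <= sqrt (nrm2 m (%i. ?J x i - ?J y i)) / sqrt (wt m i)"
    using coord_le_nrm2[OF True, of "%i. ?J x i - ?J y i"] .
   also have "\<dots> <= sqrt (4 * nrm2 m (%i. x i - y i)) / sqrt (wt m i)"
    using wt_pos[OF True] by (intro divide_right_mono real_sqrt_le_mono step_lipschitz[OF h sol sol]) auto
   also have "\<dots> <= 2 * ((\<Sum>j=1..m. sqrt (wt m j)) * (\<Sum>j=1..m. \<bar>x j - y j\<bar>)) / sqrt (wt m i)"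
    using wt_pos[OF True] sqrt_nrm2_le_sum[of m "%i. x i - y i"]
    by (intro divide_right_mono) (auto simp: real_sqrt_mult)
   finally show "\<bar>?J x i - ?J y i\<bar> <= 2 * (\<Sum>j=1..m. sqrt (wt m j)) / sqrt (wt m i) * (\<Sum>j=1..m. \<bar>x j - y j\<bar>)"
    by (simp add: mult_ac)
  qed
 qed
qed

text \<open>z is the distance before the noise acts. On modes up to N the shift removes the fraction
  h K of it, which compensates lam there; above N the equation contracts by itself. Both gains are
  normalised to rate 1.\<close>

lemma controlled_contraction:
 assumes h: "0 < h" "h * K <= 1" and lam: "lam < 1 / 2 * (real N + 1)^2"
  and K: "\<bar>lam\<bar> * freq N + 1 <= K"
  and a: "step_solution lam n c m h x a" and b: "step_solution lam n c m h y b"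
  and z: "!!i. i \<in> {1..m} ==> x i - y i = (if i <= N then 1 - h * K else 1) * z i"
 shows "(1 + h) * nrm2 m (%i. a i - b i) <= nrm2 m z"
proof -
 let ?r = "%i. if i <= N then 1 - h * K else 1"
 let ?q = "%i. (freq i)^2 - lam * fw m i * freq i"
 have K0: "0 <= K" using K by (smt (verit) freq_def mult_nonneg_nonneg zero_le_power2 abs_ge_zero)
 have r: "0 <= ?r i" "?r i <= 1" for i using h K0 by auto
 have "(\<Sum>i=1..m. wt m i * (a i - b i)^2 * (1 + h / 2 * ?q i)) <= (\<Sum>i=1..m. wt m i * (x i - y i) * (a i - b i))"
  using step_monotone[OF less_imp_le[OF h(1)] a b] .
 also have "\<dots> <= (\<Sum>i=1..m. wt m i * (a i - b i)^2 * (?r i / 2) + wt m i * (z i)^2 / 2)"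
 proof (intro sum_mono)
  fix i assume i: "i \<in> {1..m}"
  have "?r i * (z i * (a i - b i)) <= ?r i * (((z i)^2 + (a i - b i)^2) / 2)"
   using sum_squares_bound[of "z i" "a i - b i"] by (intro mult_left_mono r) auto
  also have "\<dots> <= (a i - b i)^2 * (?r i / 2) + (z i)^2 / 2"
   using mult_right_mono[OF r(2)[of i], of "(z i)^2"] by (simp add: algebra_simps)
  finally have "wt m i * (?r i * (z i * (a i - b i))) <= wt m i * ((a i - b i)^2 * (?r i / 2) + (z i)^2 / 2)"
   using wt_pos[OF i] by (intro mult_left_mono) auto
  then show "wt m i * (x i - y i) * (a i - b i) <= wt m i * (a i - b i)^2 * (?r i / 2) + wt m i * (z i)^2 / 2"
   unfolding z[OF i] by (simp add: algebra_simps)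
 qed
 finally have "(\<Sum>i=1..m. wt m i * (a i - b i)^2 * (1 + h / 2 * ?q i - ?r i / 2)) <= nrm2 m z / 2"
  by (simp add: nrm2_def sum.distrib sum_subtractf right_diff_distrib flip: sum_divide_distrib)
 moreover have "(\<Sum>i=1..m. wt m i * (a i - b i)^2 * ((1 + h) / 2))
   <= (\<Sum>i=1..m. wt m i * (a i - b i)^2 * (1 + h / 2 * ?q i - ?r i / 2))"
 proof (intro sum_mono mult_left_mono)
  fix i assume i: "i \<in> {1..m}"
  have p: "1 <= freq i" "0 < fw m i" "fw m i <= 1"
   using i freq_ge_1[of i] fw_bounds[of i m] fw_bounds(2)[of m i] by auto
  show "0 <= wt m i * (a i - b i)^2" using wt_pos[OF i] by simp
  show "(1 + h) / 2 <= 1 + h / 2 * ?q i - ?r i / 2"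
  proof (cases "i <= N")
   case True
   have "lam * fw m i * freq i <= \<bar>lam\<bar> * 1 * freq i"
    using p by (intro mult_mono) auto
   also have "\<dots> <= \<bar>lam\<bar> * freq N"
    using True by (auto simp: freq_def intro!: mult_left_mono power_mono mult_right_mono)
   finally have "1 <= K + ?q i" using K zero_le_power2[of "freq i"] by linarith
   then have "h / 2 * 1 <= h / 2 * (K + ?q i)" using h by (intro mult_left_mono) auto
   then show ?thesis using True by (simp add: field_simps)
  next
   case False
   then have "real N + 1 <= real i" by linarith
   then have "(real N + 1) * 1 <= real i * pi" using pi_gt3 by (intro mult_mono) auto
   then have "(real N + 1)^2 <= freq i" unfolding freq_def by (intro power_mono) auto
   moreover have "1 <= (real N + 1)^2" by simp
   moreover have "lam * fw m i <= max 0 lam"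
    using p mult_left_mono[of "fw m i" 1 lam] by (cases "0 <= lam") (auto simp: mult_le_0_iff)
   moreover have "9 * (real i)^2 <= freq i"
   proof -
    have "3 * real i <= real i * pi" using mult_left_mono[of 3 pi "real i"] pi_gt3 by (simp add: mult.commute)
    then have "(3 * real i)^2 <= freq i" unfolding freq_def by (intro power_mono) auto
    then show ?thesis by (simp add: power_mult_distrib)
   qed
   moreover have "(real N + 1)^2 <= (real i)^2" using \<open>real N + 1 <= real i\<close> by (intro power_mono) auto
   \<comment> \<open>freq i >= 9 (N+1)^2 while lam < (N+1)^2 / 2, so a gap of at least 1 is
     left.\<close>
   ultimately have "1 <= freq i - lam * fw m i" using lam by linarith
   then have "1 * 1 <= freq i * (freq i - lam * fw m i)" using p by (intro mult_mono) auto
   then have "h / 2 * 1 <= h / 2 * ?q i" using h by (intro mult_left_mono) (auto simp: algebra_simps power2_eq_square)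
   then show ?thesis using False by (simp add: add_divide_distrib)
  qed
 qed
 ultimately show ?thesis by (simp add: nrm2_def sum_distrib_left mult_ac flip: sum_divide_distrib)
qed

text \<open>If |u| >= |c|, every summand has the good sign and the cubic one, present for n >= 1,
  already outweighs lam u outside a bounded set. If |u| < |c| < 1, the summands are dominated by 2
  (c^2)^k; the geometric series gives 4/(1 - c^2) and prevents any dependence on n.\<close>

lemma fpoly_dissipative:
 assumes c: "\<bar>c\<bar> < 1"
 shows "\<exists>C\<ge>0. \<forall>n\<ge>1. \<forall>u. fpoly lam n u * (u - c) <= C"
proof (intro exI conjI allI impI)
 let ?C = "4 / (1 - c^2) + (3 * \<bar>lam\<bar> + 3) * \<bar>lam\<bar>"
 have c2: "c^2 < 1" using c by (simp add: abs_square_less_1)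
 then show "0 <= ?C" by simp
 fix n :: nat and u :: real assume n: "1 <= n"
 let ?T = "%k. u ^ (2 * k + 1) / real (2 * k + 1) * (u - c)"
 have f: "fpoly lam n u * (u - c) = - 2 * (\<Sum>k\<le>n. ?T k) + lam * (u * (u - c))"
  unfolding fpoly_def sum_distrib_right[symmetric] by (simp add: algebra_simps)
 have T: "?T k = (u^2) ^ k / real (2 * k + 1) * (u * (u - c))" for k
  by (simp add: power_mult)
 show "fpoly lam n u * (u - c) <= ?C"
 proof (cases "\<bar>c\<bar> <= \<bar>u\<bar>")
  case True
  have "\<bar>u * c\<bar> <= \<bar>u * u\<bar>" unfolding abs_mult using True by (intro mult_left_mono) auto
  then have uc: "0 <= u * (u - c)" by (simp add: algebra_simps abs_le_iff)
  have T0: "0 <= ?T k" for k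
   unfolding T by (intro mult_nonneg_nonneg[OF _ uc] divide_nonneg_nonneg) auto
  have "(\<Sum>k\<in>{1}. ?T k) <= (\<Sum>k\<le>n. ?T k)"
   by (intro sum_mono2 T0) (use n in auto)
  then have "fpoly lam n u * (u - c) <= u * (u - c) * (lam - 2 / 3 * u^2)"
   unfolding f T by (simp add: algebra_simps)
  also have "\<dots> <= (3 * \<bar>lam\<bar> + 3) * \<bar>lam\<bar>"
  proof (cases "3 / 2 * \<bar>lam\<bar> <= u^2")
   case True
   then have "u * (u - c) * (lam - 2 / 3 * u^2) <= 0" using uc by (intro mult_nonneg_nonpos) auto
   also have "0 <= (3 * \<bar>lam\<bar> + 3) * \<bar>lam\<bar>" by simp
   finally show ?thesis .
  next
   case False
   have "\<bar>u\<bar> * \<bar>c\<bar> <= \<bar>u\<bar> * 1" using c by (intro mult_left_mono) auto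
   moreover have "\<bar>u\<bar> <= u^2 + 1" using sum_squares_bound[of "\<bar>u\<bar>" 1] zero_le_power2[of u]
    by simp
   moreover have "u * (u - c) <= u^2 + \<bar>u\<bar> * \<bar>c\<bar>"
    using abs_ge_minus_self[of "u * c"] by (simp add: algebra_simps power2_eq_square abs_mult)
   ultimately have "u * (u - c) <= 3 * \<bar>lam\<bar> + 3" using False by linarith
   moreover have "u * (u - c) * (lam - 2 / 3 * u^2) <= u * (u - c) * \<bar>lam\<bar>"
    using uc by (intro mult_left_mono) (auto intro: order_trans[of _ lam])
   ultimately show ?thesis by (meson mult_right_mono abs_ge_zero order_trans)
  qed
  also have "\<dots> <= ?C" using c2 by simp
  finally show ?thesis .
 next
  case False
  have uc: "\<bar>u * (u - c)\<bar> <= 2"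
   using False c unfolding abs_mult by (intro order_trans[OF mult_mono[of "\<bar>u\<bar>" 1 "\<bar>u - c\<bar>" 2]]) auto
  have "- ?T k <= 2 * (c^2) ^ k" for k
  proof -
   have "u^2 <= c^2" using False abs_le_square_iff[of u c] by linarith
   then have "(u^2) ^ k <= (c^2) ^ k" by (rule power_mono) simp
   have "- ?T k <= \<bar>?T k\<bar>" by (rule abs_ge_minus_self)
   also have "\<dots> = (u^2) ^ k / real (2 * k + 1) * \<bar>u * (u - c)\<bar>"
   proof -
    have "0 <= (u^2) ^ k / real (2 * k + 1)" by simp
    then show ?thesis by (simp only: T abs_mult[of "(u^2) ^ k / real (2 * k + 1)"] abs_of_nonneg)
   qed
   also have "\<dots> <= (c^2) ^ k / 1 * 2"
    using uc \<open>(u^2) ^ k <= (c^2) ^ k\<close> by (intro mult_mono frac_le) auto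
   finally show ?thesis by simp
  qed
  then have "(\<Sum>k\<le>n. - ?T k) <= (\<Sum>k\<le>n. 2 * (c^2) ^ k)" by (intro sum_mono)
  also have "\<dots> = 2 * (\<Sum>k<Suc n. (c^2) ^ k)" by (simp add: sum_distrib_left lessThan_Suc_atMost)
  also have "(\<Sum>k<Suc n. (c^2) ^ k) <= (\<Sum>k. (c^2) ^ k)"
   using c2 by (intro sum_le_suminf summable_geometric) auto
  also have "\<dots> = 1 / (1 - c^2)" using c2 by (intro suminf_geometric) auto
  finally have "- 2 * (\<Sum>k\<le>n. ?T k) <= 4 / (1 - c^2)" by (simp add: sum_negf)
  moreover have "lam * (u * (u - c)) <= \<bar>lam\<bar> * 2"
   using mult_left_mono[OF uc, of "\<bar>lam\<bar>"] by (simp flip: abs_mult)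
  moreover have "\<bar>lam\<bar> * 2 <= (3 * \<bar>lam\<bar> + 3) * \<bar>lam\<bar>" by (simp add: algebra_simps)
  ultimately show ?thesis unfolding f by linarith
 qed
qed

text \<open>Testing with a deprived of its average pairs the nonlinearity with u - c, where the
  upper bound C is available.\<close>

lemma step_dissipation:
 assumes h: "0 <= h" and a: "step_solution lam n c m h x a" and C: "!!u. fpoly lam n u * (u - c) <= C"
 shows "nrm2 m a + h * (\<Sum>i=1..m. freq i * (a i)^2) <= nrm2 m x + h * C"
proof -
 let ?f = "%th. fpoly lam n (cospoly m a th)"
 let ?a = "%i. a i - (if i = 0 then c else 0)"
 have a0: "a 0 = c" using a by (simp add: step_solution_def)
 have "cospoly m ?a th = cospoly m a th - c" for th
  unfolding cospoly_def sum_atMost_head using a0 by (simp add: eigfun_def)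
 moreover have "(\<Sum>i\<le>m. ?a i * L2_coef ?f i) = (\<integral>th. ?f th * cospoly m ?a th \<partial>ulb)"
  by (intro integral_mult_cospoly(2)[symmetric] integrable_fpoly_cospoly)
 ultimately have "(\<Sum>i=1..m. a i * L2_coef ?f i) = (\<integral>th. ?f th * (cospoly m a th - c) \<partial>ulb)"
  using a0 by (simp add: sum_atMost_head)
 also have "\<dots> <= (\<integral>th. C \<partial>ulb)"
  by (intro integral_mono C integrable_ulb_continuous continuous_intros continuous_cospoly
   continuous_on_compose2[OF continuous_fpoly[of UNIV]]) auto
 also have "\<dots> = C" using ulb.prob_space by simp
 finally have 1: "h / 2 * (\<Sum>i=1..m. a i * L2_coef ?f i) <= h / 2 * C" using h by (intro mult_left_mono) auto
 have "(\<Sum>i=1..m. wt m i * (a i)^2 / 2 + h / 2 * (freq i * (a i)^2) - wt m i * (x i)^2 / 2)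
   <= (\<Sum>i=1..m. h / 2 * (a i * L2_coef ?f i))"
 proof (intro sum_mono)
  fix i assume i: "i \<in> {1..m}"
  have p: "1 <= freq i" "0 < fw m i" "fw m i <= 1"
   using i freq_ge_1[of i] fw_bounds[of i m] fw_bounds(2)[of m i] by auto
  \<comment> \<open>Dropping the weight leaves the H^1 energy, the same functional for every
    m.\<close>
  have "freq i * (a i)^2 <= (freq i / fw m i) * (a i)^2"
   using p by (intro mult_right_mono) (auto simp: pos_le_divide_eq mult_left_le)
  also have "freq i / fw m i = wt m i * (freq i)^2" using p by (simp add: wt_def power2_eq_square)
  finally have 2: "h / 2 * (freq i * (a i)^2) <= h / 2 * (wt m i * (freq i)^2 * (a i)^2)"
   using h by (intro mult_left_mono) auto
  have "wt m i * (x i * a i) <= wt m i * (((x i)^2 + (a i)^2) / 2)"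
   using sum_squares_bound[of "x i" "a i"] wt_pos[OF i] by (intro mult_left_mono) auto
  then have 3: "wt m i * x i * a i <= wt m i * (x i)^2 / 2 + wt m i * (a i)^2 / 2"
   by (simp add: field_simps)
  have "(wt m i * a i + h / 2 * (wt m i * (freq i)^2 * a i - L2_coef ?f i)) * a i = wt m i * x i * a i"
   unfolding step_solution_weighted[OF a i] ..
  then have "wt m i * (a i)^2 + h / 2 * (wt m i * (freq i)^2 * (a i)^2) - h / 2 * (a i * L2_coef ?f i) = wt m i * x i * a i"
   by (simp add: algebra_simps power2_eq_square)
  then show "wt m i * (a i)^2 / 2 + h / 2 * (freq i * (a i)^2) - wt m i * (x i)^2 / 2 <= h / 2 * (a i * L2_coef ?f i)"
   using 2 3 by linarith
 qed
 also have "\<dots> = h / 2 * (\<Sum>i=1..m. a i * L2_coef ?f i)" by (simp add: sum_distrib_left)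
 finally have "nrm2 m a / 2 + h / 2 * (\<Sum>i=1..m. freq i * (a i)^2) - nrm2 m x / 2 <= h / 2 * C"
  using 1 by (simp add: nrm2_def sum.distrib sum_subtractf sum_distrib_left sum_divide_distrib)
 then show ?thesis by simp
qed

section \<open>The Gaussian log-Harnack inequality\<close>

abbreviation std_normal :: "real measure" where
 "std_normal \<equiv> density lborel std_normal_density"

interpretation std_normal: prob_space std_normal
 by (rule prob_space_normal_density) simp

lemma sets_std_normal: "sets std_normal = sets borel" by simp

lemma std_normal_density_shift:
 "std_normal_density (s + v) * exp (s * v + v^2 / 2) = std_normal_density s"
 by (simp add: std_normal_density_def flip: exp_add) (simp add: power2_eq_square algebra_simps add_divide_distrib)

lemma integral_std_normal:
 "f \<in> borel_measurable borel ==> (\<integral>s. f s \<partial>std_normal) = (\<integral>s. std_normal_density s * f s \<partial>lborel)"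
 "f \<in> borel_measurable borel ==> integrable std_normal f \<longleftrightarrow> integrable lborel (%s. std_normal_density s * f s :: real)"
 by (simp_all add: integral_density integrable_density)

text \<open>The Gibbs variational principle for the Gaussian law shifted by -v; v^2/2 is its
  relative entropy. The logarithm on the right reproduces the shape of the hypothesis on \<psi>,
  which lets the estimate be iterated over coordinates and steps.\<close>

lemma log_harnack_std_normal:
 fixes g \<psi> :: "real => real"
 assumes [measurable]: "g \<in> borel_measurable borel" "\<psi> \<in> borel_measurable borel"
  and B: "!!s. \<bar>g s\<bar> <= B" "!!s. \<bar>\<psi> s\<bar> <= B" and le: "!!s. g (s + v) <= \<psi> s"
 shows "(\<integral>s. g s \<partial>std_normal) <= ln (\<integral>s. exp (\<psi> s) \<partial>std_normal) + v^2 / 2"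
proof -
 let ?\<phi> = std_normal_density
 define Z where "Z = (\<integral>s. exp (\<psi> s) \<partial>std_normal)"
 have int: "integrable std_normal f" if "f \<in> borel_measurable borel" "!!s. \<bar>f s\<bar> <= C" for f and C :: real
  using that by (intro std_normal.integrable_const_bound[where B=C] AE_I2) auto
 have ei: "integrable std_normal (%s. exp (\<psi> s))"
 proof (rule int[where C="exp B"])
  show "\<bar>exp (\<psi> s)\<bar> <= exp B" for s using B(2)[of s] by simp
 qed simp
 have "exp (- B) = (\<integral>s. exp (- B) \<partial>std_normal)" using std_normal.prob_space by simp
 also have "\<dots> <= Z" unfolding Z_def
 proof (intro integral_mono ei)
  show "exp (- B) <= exp (\<psi> s)" for s using B(2)[of s] by (simp add: abs_le_iff)
 qed simp
 finally have Z: "0 < Z" using exp_gt_zero[of "- B"] by linarith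
 have sh: "(\<integral>s. ?\<phi> (s + v) * f (s + v) \<partial>lborel) = (\<integral>s. f s \<partial>std_normal)"
  "integrable std_normal f ==> integrable lborel (%s. ?\<phi> (s + v) * f (s + v))"
  if f: "f \<in> borel_measurable borel" for f
 proof -
  have "(\<integral>s. f s \<partial>std_normal) = (\<integral>s. ?\<phi> s * f s \<partial>lborel)" by (rule integral_std_normal(1)[OF f])
  also have "\<dots> = \<bar>1\<bar> *\<^sub>R (\<integral>s. ?\<phi> (v + 1 * s) * f (v + 1 * s) \<partial>lborel)"
   by (rule lborel_integral_real_affine) simp
  also have "\<dots> = (\<integral>s. ?\<phi> (s + v) * f (s + v) \<partial>lborel)" by (simp add: add.commute)
  finally show "(\<integral>s. ?\<phi> (s + v) * f (s + v) \<partial>lborel) = (\<integral>s. f s \<partial>std_normal)" by (rule sym)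
  assume "integrable std_normal f"
  then have "integrable lborel (%s. ?\<phi> s * f s)" using integral_std_normal(2)[OF f] by blast
  from lborel_integrable_real_affine[OF this, of 1 v]
  show "integrable lborel (%s. ?\<phi> (s + v) * f (s + v))" by (simp add: add.commute)
 qed
 have id: "integrable std_normal (%s. s)" "(\<integral>s. s \<partial>std_normal) = 0"
  using integral_std_normal_moment_odd[of 0] integrable_std_normal_moment[of 1] 
  by (auto simp: integral_std_normal)
 have i1: "integrable lborel (%s. ?\<phi> (s + v) * \<psi> s)"
 proof -
  have m: "(%s. \<psi> (s - v)) \<in> borel_measurable borel" by measurable
  have "integrable std_normal (%s. \<psi> (s - v))" by (rule int[OF m, of B]) (rule B(2))
  from sh(2)[OF m this] show ?thesis by simp
 qed
 have i2: "integrable lborel (%s. ?\<phi> (s + v))" "(\<integral>s. ?\<phi> (s + v) \<partial>lborel) = 1"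
 proof -
  have m: "(%_ :: real. 1 :: real) \<in> borel_measurable borel" by simp
  have "integrable std_normal (%_. 1 :: real)" by (rule int[OF m, of 1]) simp
  from sh(2)[OF m this] show "integrable lborel (%s. ?\<phi> (s + v))" by simp
  have "(\<integral>s. 1 \<partial>std_normal) = (1 :: real)" using std_normal.prob_space by simp
  with sh(1)[OF m] show "(\<integral>s. ?\<phi> (s + v) \<partial>lborel) = 1" by simp
 qed
 have ifun: "integrable std_normal (%s. (s - v) * v + v^2 / 2)"
  by (intro Bochner_Integration.integrable_add integrable_mult_left Bochner_Integration.integrable_diff id) auto
 \<comment> \<open>Under the density centred at -v this is minus the relative entropy:
   E[s v + v^2/2] = -v^2 + v^2/2.\<close>
 have i3: "integrable lborel (%s. ?\<phi> (s + v) * (s * v + v^2 / 2))"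
  "(\<integral>s. ?\<phi> (s + v) * (s * v + v^2 / 2) \<partial>lborel) = - (v^2 / 2)"
 proof -
  show "integrable lborel (%s. ?\<phi> (s + v) * (s * v + v^2 / 2))"
   using sh(2)[OF _ ifun] by simp
  have "(\<integral>s. (s - v) * v + v^2 / 2 \<partial>std_normal) = (\<integral>s. s * v - v^2 / 2 \<partial>std_normal)"
   by (intro Bochner_Integration.integral_cong) (auto simp: power2_eq_square algebra_simps)
  also have "\<dots> = - (v^2 / 2)"
   using id std_normal.prob_space by (subst Bochner_Integration.integral_diff) auto
  finally show "(\<integral>s. ?\<phi> (s + v) * (s * v + v^2 / 2) \<partial>lborel) = - (v^2 / 2)"
   using sh(1)[of "%s. (s - v) * v + v^2 / 2"] by simp
 qed
 have i4: "integrable lborel (%s. ?\<phi> s * exp (\<psi> s) / Z)" "(\<integral>s. ?\<phi> s * exp (\<psi> s) / Z \<partial>lborel) = 1"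
 proof -
  have m: "(%s. exp (\<psi> s)) \<in> borel_measurable borel" by measurable
  have 1: "(\<integral>s. ?\<phi> s * exp (\<psi> s) \<partial>lborel) = Z" unfolding Z_def integral_std_normal(1)[OF m] ..
  have 2: "(\<integral>s. ?\<phi> s * exp (\<psi> s) / Z \<partial>lborel) = (\<integral>s. ?\<phi> s * exp (\<psi> s) \<partial>lborel) / Z"
   by (rule integral_divide_zero)
  show "(\<integral>s. ?\<phi> s * exp (\<psi> s) / Z \<partial>lborel) = 1"
   by (subst 2, subst 1) (use Z in simp)
  show "integrable lborel (%s. ?\<phi> s * exp (\<psi> s) / Z)"
   using ei integral_std_normal(2)[OF m] by simp
 qed
 \<comment> \<open>Gibbs' variational inequality, pointwise: \<open>ln w <= w - 1\<close> for the ratio of the tilted and the shifted density.\<close>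
 have pt: "?\<phi> (s + v) * \<psi> s - ln Z * ?\<phi> (s + v) + ?\<phi> (s + v) * (s * v + v^2 / 2)
   <= ?\<phi> s * exp (\<psi> s) / Z - ?\<phi> (s + v)" for s
 proof -
  define w where "w = exp (\<psi> s) * exp (s * v + v^2 / 2) / Z"
  have "ln w = \<psi> s + (s * v + v^2 / 2) - ln Z"
   unfolding w_def using Z by (simp add: ln_div ln_mult)
  moreover have "ln w <= w - 1" using Z by (intro ln_le_minus_one) (simp add: w_def)
  ultimately have "?\<phi> (s + v) * (\<psi> s + (s * v + v^2 / 2) - ln Z) <= ?\<phi> (s + v) * (w - 1)"
   by (intro mult_left_mono) auto
  moreover have "?\<phi> (s + v) * w = ?\<phi> s * exp (\<psi> s) / Z"
   unfolding w_def std_normal_density_shift[of s v, symmetric] by simp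
  ultimately show ?thesis by (simp add: algebra_simps)
 qed
 have "(\<integral>s. ?\<phi> (s + v) * \<psi> s - ln Z * ?\<phi> (s + v) + ?\<phi> (s + v) * (s * v + v^2 / 2) \<partial>lborel)
   <= (\<integral>s. ?\<phi> s * exp (\<psi> s) / Z - ?\<phi> (s + v) \<partial>lborel)"
  by (intro integral_mono pt Bochner_Integration.integrable_add Bochner_Integration.integrable_diff
    integrable_mult_right i1 i2 i3 i4)
 also have "\<dots> = 0"
  by (simp only: Bochner_Integration.integral_diff[OF i4(1) i2(1)] i4(2) i2(2) diff_self)
 also have "(\<integral>s. ?\<phi> (s + v) * \<psi> s - ln Z * ?\<phi> (s + v) + ?\<phi> (s + v) * (s * v + v^2 / 2) \<partial>lborel)
   = (\<integral>s. ?\<phi> (s + v) * \<psi> s \<partial>lborel) - ln Z - v^2 / 2"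
  by (subst Bochner_Integration.integral_add Bochner_Integration.integral_diff;
    (intro Bochner_Integration.integrable_diff integrable_mult_right i1 i2 i3)?)+
   (simp add: i2 i3)
 finally have "(\<integral>s. ?\<phi> (s + v) * \<psi> s \<partial>lborel) <= ln Z + v^2 / 2" by simp
 moreover have "(\<integral>s. g s \<partial>std_normal) <= (\<integral>s. ?\<phi> (s + v) * \<psi> s \<partial>lborel)"
 proof -
  have "(\<integral>s. g s \<partial>std_normal) = (\<integral>s. ?\<phi> (s + v) * g (s + v) \<partial>lborel)"
   using sh(1)[of g] by simp
  also have "\<dots> <= (\<integral>s. ?\<phi> (s + v) * \<psi> s \<partial>lborel)"
   by (intro integral_mono sh(2) i1 int[of g B] B mult_left_mono le) auto
  finally show ?thesis .
 qed
 ultimately show ?thesis unfolding Z_def by linarith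
qed

abbreviation gauss :: "nat set => (nat => real) measure" where
 "gauss I \<equiv> PiM I (%_. std_normal)"

interpretation gauss: product_prob_space "%_ :: nat. std_normal" UNIV
 by unfold_locales

lemma prob_space_gauss: "prob_space (gauss I)"
 by (intro prob_space_PiM std_normal.prob_space_axioms)

lemma integrable_bounded_prob:
 fixes f :: "_ => real"
 assumes "prob_space M" "f \<in> borel_measurable M" "!!x. x \<in> space M ==> \<bar>f x\<bar> <= B"
 shows "integrable M f"
proof -
 interpret prob_space M by fact
 show ?thesis using assms(2,3) by (intro integrable_const_bound[where B=B] AE_I2) auto
qed

lemma integral_bounded_prob:
 fixes f :: "_ => real"
 assumes "prob_space M" "f \<in> borel_measurable M" "!!x. x \<in> space M ==> A <= f x \<and> f x <= B"
 shows "A <= (\<integral>x. f x \<partial>M) \<and> (\<integral>x. f x \<partial>M) <= B"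
proof -
 interpret prob_space M by fact
 have i: "integrable M f"
  using assms(3) by (intro integrable_bounded_prob[where B="max \<bar>A\<bar> \<bar>B\<bar>"] assms) (force simp: abs_le_iff)
 have "(\<integral>x. A \<partial>M) <= (\<integral>x. f x \<partial>M)" "(\<integral>x. f x \<partial>M) <= (\<integral>x. B \<partial>M)"
  by (rule integral_mono; use assms(3) i in simp)+
 then show ?thesis using prob_space by simp
qed

text \<open>Tensorisation. One coordinate is integrated out by the scalar case, and the resulting
  logarithm plus (v j)^2 / 2 serves as the function \<psi> for the remaining coordinates; the
  entropies add up.\<close>

lemma log_harnack_gauss:
 fixes g \<psi> :: "(nat => real) => real"
 assumes "finite I"
  and "g \<in> borel_measurable (gauss I)" "\<psi> \<in> borel_measurable (gauss I)"
  and "!!\<eta>. \<eta> \<in> space (gauss I) ==> \<bar>g \<eta>\<bar> <= B" "!!\<eta>. \<eta> \<in> space (gauss I) ==> \<bar>\<psi> \<eta>\<bar> <= B"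
  and "!!\<eta>. \<eta> \<in> space (gauss I) ==> g (\<lambda>i\<in>I. \<eta> i + v i) <= \<psi> \<eta>"
 shows "(\<integral>\<eta>. g \<eta> \<partial>gauss I) <= ln (\<integral>\<eta>. exp (\<psi> \<eta>) \<partial>gauss I) + (\<Sum>i\<in>I. (v i)^2 / 2)"
 using assms
proof (induction I arbitrary: g \<psi> B rule: finite_induct)
 case empty
 have "g (%_. undefined) <= \<psi> (%_. undefined)" using empty(5)[of "%_. undefined"]
  by (simp add: restrict_def)
 then show ?case by (simp add: PiM_empty lebesgue_integral_count_space_finite)
next
 case (insert j I)
 note [measurable] = insert.prems(1,2)
 have upd: "x(j := y) \<in> space (gauss (insert j I))" if "x \<in> space (gauss I)" for x y
  using that by (auto simp: space_PiM PiE_iff extensional_def)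
 have m2: "(%(x, y). f (x(j := y))) \<in> borel_measurable (gauss I \<Otimes>\<^sub>M std_normal)"
  if "f \<in> borel_measurable (gauss (insert j I))" for f :: "(nat => real) => real"
  using measurable_compose[OF measurable_add_dim that] by (simp add: case_prod_beta)
 have m1: "(%y. f (x(j := y))) \<in> borel_measurable borel"
  if "f \<in> borel_measurable (gauss (insert j I))" "x \<in> space (gauss I)" for f :: "(nat => real) => real" and x
  using measurable_compose[OF measurable_Pair1'[OF that(2), of std_normal] m2[OF that(1)]] by simp
 have mi: "(%x. \<integral>y. f (x(j := y)) \<partial>std_normal) \<in> borel_measurable (gauss I)"
  if "f \<in> borel_measurable (gauss (insert j I))" for f :: "(nat => real) => real"
  using m2[OF that] by (intro std_normal.borel_measurable_lebesgue_integral)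
 have Eb: "!!x. x \<in> space (gauss (insert j I)) ==> exp (- B) <= exp (\<psi> x) \<and> exp (\<psi> x) <= exp B"
 proof -
  fix x assume "x \<in> space (gauss (insert j I))"
  from insert.prems(4)[OF this] have "- B <= \<psi> x" "\<psi> x <= B" by linarith+
  then show "exp (- B) <= exp (\<psi> x) \<and> exp (\<psi> x) <= exp B" by simp
 qed
 let ?g1 = "%x. \<integral>y. g (x(j := y)) \<partial>std_normal"
 let ?Z = "%x. \<integral>y. exp (\<psi> (x(j := y))) \<partial>std_normal"
 let ?\<psi>1 = "%x. ln (?Z x) + (v j)^2 / 2"
 have Zb: "exp (- B) <= ?Z x \<and> ?Z x <= exp B" if "x \<in> space (gauss I)" for x
  using m1[OF _ that, of "%x. exp (\<psi> x)"] Eb upd[OF that]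
  by (intro integral_bounded_prob std_normal.prob_space_axioms) auto
 have Zpos: "0 < ?Z x" if "x \<in> space (gauss I)" for x
  using Zb[OF that] exp_gt_zero[of "- B"] by linarith
 have lnb: "\<bar>ln (?Z x)\<bar> <= B" if "x \<in> space (gauss I)" for x
 proof -
  have "ln (exp (- B)) <= ln (?Z x)" "ln (?Z x) <= ln (exp B)"
   using Zb[OF that] Zpos[OF that] by (subst ln_le_cancel_iff; simp)+
  then show ?thesis by simp
 qed
 have "(\<integral>x. ?g1 x \<partial>gauss I) <= ln (\<integral>x. exp (?\<psi>1 x) \<partial>gauss I) + (\<Sum>i\<in>I. (v i)^2 / 2)"
 proof (rule insert.IH[where B="B + (v j)^2 / 2"])
  show "?g1 \<in> borel_measurable (gauss I)" by (rule mi) measurable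
  have [measurable]: "?Z \<in> borel_measurable (gauss I)" by (rule mi) measurable
  show "?\<psi>1 \<in> borel_measurable (gauss I)" by measurable
  fix x assume x: "x \<in> space (gauss I)"
  have "- B <= ?g1 x \<and> ?g1 x <= B"
  proof (rule integral_bounded_prob[OF std_normal.prob_space_axioms])
   show "(%y. g (x(j := y))) \<in> borel_measurable std_normal"
    by (subst measurable_cong_sets[OF sets_std_normal refl]) (rule m1[OF insert.prems(1) x])
   show "- B <= g (x(j := y)) \<and> g (x(j := y)) <= B" for y
    using insert.prems(3)[OF upd[OF x], of y] by linarith
  qed
  then have "\<bar>?g1 x\<bar> <= B" by linarith
  moreover have v2: "0 <= (v j)^2 / 2" by simp
  ultimately show "\<bar>?g1 x\<bar> <= B + (v j)^2 / 2" by linarith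
  show "\<bar>?\<psi>1 x\<bar> <= B + (v j)^2 / 2" using lnb[OF x] v2 by linarith
  let ?x' = "\<lambda>i\<in>I. x i + v i"
  have x': "?x' \<in> space (gauss I)" by (auto simp: space_PiM)
  show "?g1 ?x' <= ?\<psi>1 x"
  proof (rule log_harnack_std_normal)
   show "(%y. g (?x'(j := y))) \<in> borel_measurable borel" "(%y. \<psi> (x(j := y))) \<in> borel_measurable borel"
    using m1 x x' by auto
   show "\<bar>g (?x'(j := s))\<bar> <= B" "\<bar>\<psi> (x(j := s))\<bar> <= B" for s
    using insert.prems(3,4) upd x x' by auto
   have eq: "?x'(j := s + v j) = (\<lambda>i\<in>insert j I. (x(j := s)) i + v i)" for s
    using insert.hyps by (auto simp: fun_eq_iff)
   show "g (?x'(j := s + v j)) <= \<psi> (x(j := s))" for s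
    unfolding eq by (rule insert.prems(5)[OF upd[OF x]])
  qed
 qed
 also have "(\<integral>x. exp (?\<psi>1 x) \<partial>gauss I) = (\<integral>x. ?Z x * exp ((v j)^2 / 2) \<partial>gauss I)"
  using Zpos by (intro Bochner_Integration.integral_cong) (auto simp: exp_add)
 also have "\<dots> = (\<integral>x. ?Z x \<partial>gauss I) * exp ((v j)^2 / 2)" by simp
 also have "(\<integral>x. ?Z x \<partial>gauss I) = (\<integral>x. exp (\<psi> x) \<partial>gauss (insert j I))"
  using insert.hyps Eb
  by (intro gauss.product_integral_insert[symmetric]
    integrable_bounded_prob[OF prob_space_gauss, where B="exp B"]) auto
 also have "(\<integral>x. ?g1 x \<partial>gauss I) = (\<integral>x. g x \<partial>gauss (insert j I))"
  using insert.hyps insert.prems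
  by (intro gauss.product_integral_insert[symmetric]
    integrable_bounded_prob[OF prob_space_gauss, where B=B]) auto
 finally have "(\<integral>x. g x \<partial>gauss (insert j I))
   <= ln ((\<integral>x. exp (\<psi> x) \<partial>gauss (insert j I)) * exp ((v j)^2 / 2)) + (\<Sum>i\<in>I. (v i)^2 / 2)" .
 moreover have "0 < (\<integral>x. exp (\<psi> x) \<partial>gauss (insert j I))"
 proof -
  have "exp (- B) <= (\<integral>x. exp (\<psi> x) \<partial>gauss (insert j I))"
   by (rule conjunct1[OF integral_bounded_prob[OF prob_space_gauss _ Eb]]) measurable
  then show ?thesis using exp_gt_zero[of "- B"] by linarith
 qed
 ultimately show ?case using insert.hyps by (simp add: ln_mult)
qed

section \<open>The fully discrete scheme\<close>

text \<open>The increment is damped by the same \<open>fw\<close> as the initial value, so that the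
  scheme tracks the Fejer mean of the solution and the noise cancels exactly in the error equation.
  The value 0 outside 1..m hides the undefined coordinates of points of
  \<open>gauss {1..m}\<close>.\<close>

definition noise_amp :: "(nat => real) => real => nat => nat => real" where
 "noise_amp b h m i = (if i \<in> {1..m} then fw m i * sqrt (b i * h) else 0)"

definition kick :: "(nat => real) => real => nat => (nat => real) => (nat => real) => nat => real" where
 "kick b h m x \<eta> i = x i + noise_amp b h m i * \<eta> i"

text \<open>|lam| freq N bounds the growth rate that lam can cause on modes up to N; the summand 1
  is the contraction rate aimed at.\<close>

definition ctrl_gain :: "real => nat => real" where
 "ctrl_gain lam N = \<bar>lam\<bar> * freq N + 1"

text \<open>Entropy spent by the shift per unit of time and per unit of squared distance. Division
  by b i is where positivity of the first N noise coefficients is used.\<close>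

definition ctrl_cost :: "real => (nat => real) => nat => real" where
 "ctrl_cost lam b N = (ctrl_gain lam N)^2 * (\<Sum>i=1..N. freq i / b i)"

locale scheme =
 fixes lam c :: real and n m :: nat and b :: "nat => real" and h :: real
 assumes h_pos: "0 < h" and h_small: "h * (lam^2 + 1) <= 1 / 2" and b_nonneg: "!!i. 0 <= b i"
begin

abbreviation "J \<equiv> implicit_step lam n c m h"

abbreviation "flow x \<eta> \<equiv> J (kick b h m x \<eta>)"

definition adm :: "(nat => real) => bool" where
 "adm a \<longleftrightarrow> a 0 = c \<and> (\<forall>i>m. a i = 0)"

definition T :: "((nat => real) => real) => (nat => real) => real" where
 "T \<phi> x = (\<integral>\<eta>. \<phi> (flow x \<eta>) \<partial>gauss {1..m})"

lemma h_le: "h <= 1 / 2"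
proof -
 have "h * 1 <= h * (lam^2 + 1)" using h_pos by (intro mult_left_mono) auto
 then show ?thesis using h_small by linarith
qed

lemma step_solution_J: "step_solution lam n c m h x (J x)"
 by (rule step_solution_implicit_step[OF h_pos h_small])

lemma adm_J: "adm (J x)"
 using step_solution_J[of x] by (simp add: adm_def step_solution_def)

lemma measurable_J: "J \<in> borel_measurable borel"
 by (intro borel_measurable_continuous_onI continuous_implicit_step h_pos h_small)

lemma measurable_kick: "(%(x, \<eta>). kick b h m x \<eta>) \<in> borel \<Otimes>\<^sub>M gauss {1..m} \<rightarrow>\<^sub>M borel"
proof (rule measurable_coordinatewise_then_product)
 fix i :: nat
 have "(%p. fst p i) \<in> borel_measurable (borel \<Otimes>\<^sub>M gauss {1..m})"
  by (rule measurable_compose[OF measurable_fst measurable_product_coordinates])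
 moreover have "(%p. noise_amp b h m i * snd p i) \<in> borel_measurable (borel \<Otimes>\<^sub>M gauss {1..m})"
 proof (cases "i \<in> {1..m}")
  case True
  then have "(%\<eta>. \<eta> i) \<in> gauss {1..m} \<rightarrow>\<^sub>M std_normal" by (rule measurable_component_singleton)
  then have "(%\<eta>. \<eta> i) \<in> borel_measurable (gauss {1..m})"
   by (simp cong: measurable_cong_sets)
  then have "(%p. snd p i) \<in> borel_measurable (borel \<Otimes>\<^sub>M gauss {1..m})"
   by (rule measurable_compose[OF measurable_snd])
  then show ?thesis by (intro borel_measurable_times borel_measurable_const)
 next
  case False
  then have "noise_amp b h m i = 0" by (simp only: noise_amp_def if_False)
  then show ?thesis by simp
 qed
 ultimately have "(%p. fst p i + noise_amp b h m i * snd p i) \<in> borel_measurable (borel \<Otimes>\<^sub>M gauss {1..m})"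
  by (rule borel_measurable_add)
 then show "(%p. (case p of (x, \<eta>) => kick b h m x \<eta>) i) \<in> borel_measurable (borel \<Otimes>\<^sub>M gauss {1..m})"
  by (simp add: kick_def case_prod_beta)
qed

lemma measurable_flow: "(%(x, \<eta>). flow x \<eta>) \<in> borel \<Otimes>\<^sub>M gauss {1..m} \<rightarrow>\<^sub>M borel"
 using measurable_compose[OF measurable_kick measurable_J] by (simp add: case_prod_beta)

lemma measurable_flow1: "flow x \<in> gauss {1..m} \<rightarrow>\<^sub>M borel"
 using measurable_compose[OF measurable_Pair1'[of x borel "gauss {1..m}"] measurable_flow] by simp

lemma measurable_T:
 assumes "\<phi> \<in> borel_measurable borel"
 shows "T \<phi> \<in> borel_measurable borel"
proof -
 interpret g: prob_space "gauss {1..m}" by (rule prob_space_gauss)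
 show ?thesis unfolding T_def[abs_def]
  using measurable_compose[OF measurable_flow assms] 
  by (intro g.borel_measurable_lebesgue_integral) (simp add: case_prod_beta)
qed

lemma T_bounds:
 assumes "\<phi> \<in> borel_measurable borel" "!!a. A <= \<phi> a \<and> \<phi> a <= B"
 shows "A <= T \<phi> x \<and> T \<phi> x <= B"
 unfolding T_def
 by (rule integral_bounded_prob[OF prob_space_gauss measurable_compose[OF measurable_flow1 assms(1)] assms(2)])

lemma T_funpow:
 assumes "\<phi> \<in> borel_measurable borel" "!!a. A <= \<phi> a \<and> \<phi> a <= B"
 shows "(T ^^ k) \<phi> \<in> borel_measurable borel" "!!x. A <= (T ^^ k) \<phi> x \<and> (T ^^ k) \<phi> x <= B"
proof (induction k)
 case (Suc k)
 { case 1 show ?case using measurable_T[OF Suc(1)] by simp }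
 { case 2 show ?case using T_bounds[OF Suc(1) Suc(2)] by simp }
qed (use assms in auto)

text \<open>Induction over the steps, peeling off the first one. Its Gaussian vector is shifted by a
  deterministic v depending on x - y; whatever the noise, the distance after the step is smaller by
  the factor 1 + h, and the induction hypothesis applies to the new pair. The costs h/(1 + h)^j form
  a geometric series with sum 1 + h <= 2, which explains the 2.\<close>

lemma chain_log_harnack:
 assumes g: "g \<in> borel_measurable borel" "!!a. \<bar>g a\<bar> <= B"
  and L: "0 <= L" "!!a a'. adm a ==> adm a' ==> \<bar>g a - g a'\<bar> <= L * sqrt (nrm2 m (%i. a i - a' i))"
  and N: "2 * N <= m" "!!i. i \<in> {1..N} ==> 0 < b i" "lam < 1 / 2 * (real N + 1)^2"
  and K: "h * ctrl_gain lam N <= 1"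
  and "adm x" "adm y"
 shows "(T ^^ k) g y <= ln ((T ^^ k) (%a. exp (g a)) x)
  + L * sqrt (nrm2 m (%i. x i - y i) / (1 + h) ^ k) + 2 * ctrl_cost lam b N * nrm2 m (%i. x i - y i)"
 using \<open>adm x\<close> \<open>adm y\<close>
proof (induction k arbitrary: x y)
 case 0
 have "\<bar>g y - g x\<bar> <= L * sqrt (nrm2 m (%i. x i - y i))"
  using L(2)[OF 0] by (simp add: abs_minus_commute)
 moreover have "0 <= ctrl_cost lam b N * nrm2 m (%i. x i - y i)"
  unfolding ctrl_cost_def using N(2) freq_ge_1
  by (intro mult_nonneg_nonneg nrm2_nonneg sum_nonneg divide_nonneg_nonneg)
   (auto simp: freq_def less_imp_le)
 ultimately show ?case by simp
next
 case (Suc k)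
 let ?eg = "%a. exp (g a)"
 have eg: "?eg \<in> borel_measurable borel" using g(1) by simp
 have gB: "- B <= g a \<and> g a <= B" for a using g(2)[of a] by linarith
 have egB: "exp (- B) <= exp (g a) \<and> exp (g a) <= exp B" for a using gB[of a] by simp
 note Tg = T_funpow[OF g(1) gB, of k] and Teg = T_funpow[OF eg egB, of k]
 let ?K = "ctrl_gain lam N" and ?C0 = "ctrl_cost lam b N" and ?z = "%i. x i - y i"
 \<comment> \<open>Solves noise_amp * v = h * gain * z on the modes up to N, turning the difference
   there into (1 - h * gain) z.\<close>
 define v where "v i = (if i <= N then sqrt h * ?K * ?z i / (fw m i * sqrt (b i)) else 0)" for i
 define E where "E = L * sqrt (nrm2 m ?z / (1 + h) ^ Suc k) + 2 * ?C0 * (nrm2 m ?z / (1 + h))"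
 let ?G = "%\<eta>. (T ^^ k) g (flow y \<eta>)"
 let ?\<Psi> = "%\<eta>. ln ((T ^^ k) ?eg (flow x \<eta>)) + E"
 have C0: "0 <= ?C0"
  unfolding ctrl_cost_def using N(2)
  by (intro mult_nonneg_nonneg sum_nonneg divide_nonneg_nonneg) (auto simp: freq_def less_imp_le)
 have pos: "0 < (T ^^ k) ?eg a" for a using Teg(2)[of a] exp_gt_zero[of "- B"] by linarith
 have E0: "0 <= E" unfolding E_def using L(1) C0 nrm2_nonneg[of m ?z] h_pos by simp
 have K0: "0 <= ?K" by (simp add: ctrl_gain_def freq_def)
 have lnB: "\<bar>ln ((T ^^ k) ?eg a)\<bar> <= B" for a
 proof -
  have "ln (exp (- B)) <= ln ((T ^^ k) ?eg a)" "ln ((T ^^ k) ?eg a) <= ln (exp B)"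
   using Teg(2)[of a] pos[of a] by (subst ln_le_cancel_iff; simp)+
  then show ?thesis by simp
 qed
 have "(\<integral>\<eta>. ?G \<eta> \<partial>gauss {1..m}) <= ln (\<integral>\<eta>. exp (?\<Psi> \<eta>) \<partial>gauss {1..m}) + (\<Sum>i\<in>{1..m}. (v i)^2 / 2)"
 proof (rule log_harnack_gauss[where B="B + E"])
  show "?G \<in> borel_measurable (gauss {1..m})"
   by (rule measurable_compose[OF measurable_flow1 Tg(1)])
  have [measurable]: "(%\<eta>. (T ^^ k) ?eg (flow x \<eta>)) \<in> borel_measurable (gauss {1..m})"
   by (rule measurable_compose[OF measurable_flow1 Teg(1)])
  show "?\<Psi> \<in> borel_measurable (gauss {1..m})" by measurable
  fix \<eta> assume \<eta>: "\<eta> \<in> space (gauss {1..m})"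
  show "\<bar>?G \<eta>\<bar> <= B + E" using Tg(2)[of "flow y \<eta>"] E0 by linarith
  show "\<bar>?\<Psi> \<eta>\<bar> <= B + E" using lnB[of "flow x \<eta>"] E0 by linarith
  let ?\<eta>' = "\<lambda>i\<in>{1..m}. \<eta> i + v i"
  let ?D = "%i. flow x \<eta> i - flow y ?\<eta>' i"
  have con: "(1 + h) * nrm2 m ?D <= nrm2 m ?z"
  proof (rule controlled_contraction[OF h_pos K N(3) _ step_solution_J step_solution_J])
   show "\<bar>lam\<bar> * freq N + 1 <= ?K" by (simp add: ctrl_gain_def)
   fix i assume i: "i \<in> {1..m}"
   have "noise_amp b h m i * v i = (if i <= N then h * ?K * ?z i else 0)"
   proof (cases "i <= N")
    case True
    then have "0 < b i" using N(2) i by auto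
    moreover have "0 < fw m i" using i fw_bounds by auto
    moreover have "sqrt h * sqrt h = h" using h_pos by simp
    moreover have "f * (B * S) * (S * k * w / (f * B)) = (S * S) * k * w" if "0 < f" "0 < B" for f B S k w :: real
     using that by simp
    ultimately show ?thesis using True i by (simp add: noise_amp_def v_def real_sqrt_mult)
   qed (simp add: v_def)
   then show "kick b h m x \<eta> i - kick b h m y ?\<eta>' i = (if i <= N then 1 - h * ?K else 1) * ?z i"
    using i by (simp add: kick_def algebra_simps)
  qed
  then have D1: "nrm2 m ?D <= nrm2 m ?z / (1 + h)" using h_pos by (simp add: pos_le_divide_eq mult.commute)
  have "(T ^^ k) g (flow y ?\<eta>') <= ln ((T ^^ k) ?eg (flow x \<eta>))
   + L * sqrt (nrm2 m ?D / (1 + h) ^ k) + 2 * ?C0 * nrm2 m ?D"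
   by (rule Suc.IH) (rule adm_J)+
  also have "\<dots> <= ln ((T ^^ k) ?eg (flow x \<eta>))
   + L * sqrt ((nrm2 m ?z / (1 + h)) / (1 + h) ^ k) + 2 * ?C0 * (nrm2 m ?z / (1 + h))"
   using D1 C0 L(1) h_pos by (intro add_mono mult_left_mono real_sqrt_le_mono divide_right_mono) auto
  also have "\<dots> = ?\<Psi> \<eta>" by (simp add: E_def)
  finally show "?G ?\<eta>' <= ?\<Psi> \<eta>" .
 qed simp
 also have "(\<integral>\<eta>. exp (?\<Psi> \<eta>) \<partial>gauss {1..m}) = (T ^^ Suc k) ?eg x * exp E"
  using pos by (simp add: exp_add T_def)
 also have "(\<integral>\<eta>. ?G \<eta> \<partial>gauss {1..m}) = (T ^^ Suc k) g y" by (simp add: T_def)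
 finally have 1: "(T ^^ Suc k) g y <= ln ((T ^^ Suc k) ?eg x * exp E) + (\<Sum>i\<in>{1..m}. (v i)^2 / 2)" .
 have "0 < (T ^^ Suc k) ?eg x" using T_funpow(2)[OF eg egB, of "Suc k" x] exp_gt_zero[of "- B"] by linarith
 then have 2: "ln ((T ^^ Suc k) ?eg x * exp E) = ln ((T ^^ Suc k) ?eg x) + E" by (simp add: ln_mult)
 have "(\<Sum>i\<in>{1..m}. (v i)^2 / 2) <= (\<Sum>i\<in>{1..m}. h * ?C0 * (wt m i * (?z i)^2))"
 proof (intro sum_mono)
  fix i assume i: "i \<in> {1..m}"
  have w0: "0 <= wt m i * (?z i)^2" using wt_pos[OF i] by simp
  show "(v i)^2 / 2 <= h * ?C0 * (wt m i * (?z i)^2)"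
  proof (cases "i <= N")
   case False
   then show ?thesis using w0 C0 h_pos by (simp add: v_def)
  next
   case True
   then have bi: "0 < b i" using N(2) i by auto
   \<comment> \<open>m >= 2 N keeps the damping of the controlled modes above 1/2, and the resulting
     factor 2 is compensated by the 1/2 of the entropy.\<close>
   have f: "1 / 2 <= fw m i" "0 < freq i"
    using True N(1) i freq_ge_1[of i] by (auto simp: fw_def field_simps)
   have "(v i)^2 / 2 = h * ?K^2 * (?z i)^2 / (2 * (fw m i)^2 * b i)"
    using True bi h_pos by (simp add: v_def power_divide power_mult_distrib)
   also have "\<dots> = h * ?K^2 * (freq i / b i) * (wt m i * (?z i)^2) * (1 / (2 * fw m i))"
    using f bi by (simp add: wt_def field_simps power2_eq_square)
   also have "\<dots> <= h * ?K^2 * (freq i / b i) * (wt m i * (?z i)^2) * 1"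
   proof (rule mult_left_mono)
    show "1 / (2 * fw m i) <= 1" using f by (simp add: field_simps)
    have "0 <= h * ?K^2 * (freq i / b i)" using f bi h_pos by simp
    then show "0 <= h * ?K^2 * (freq i / b i) * (wt m i * (?z i)^2)" by (rule mult_nonneg_nonneg[OF _ w0])
   qed
   also have "\<dots> <= h * ?K^2 * (\<Sum>i=1..N. freq i / b i) * (wt m i * (?z i)^2) * 1"
   proof (intro mult_right_mono mult_left_mono w0)
    show "freq i / b i <= (\<Sum>i=1..N. freq i / b i)"
     using True i N(2) by (intro member_le_sum) (auto simp: freq_def less_imp_le intro!: divide_nonneg_nonneg)
   qed (use h_pos in auto)
   finally show ?thesis by (simp add: ctrl_cost_def mult_ac)
  qed
 qed
 also have "\<dots> = h * ?C0 * nrm2 m ?z" by (simp add: nrm2_def sum_distrib_left)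
 finally have 3: "(\<Sum>i\<in>{1..m}. (v i)^2 / 2) <= h * ?C0 * nrm2 m ?z" .
 \<comment> \<open>The induction closes: what remains after contraction plus the cost of this step
   stays within the budget, as 2/(1 + h) + h <= 2 for h <= 1.\<close>
 have "2 * (nrm2 m ?z / (1 + h)) + h * nrm2 m ?z <= 2 * nrm2 m ?z"
 proof -
  have "2 / (1 + h) + h <= 2"
  proof -
   have "h * h <= h * 1" using h_pos h_le by (intro mult_left_mono) auto
   then show ?thesis using h_pos by (simp add: field_simps)
  qed
  from mult_right_mono[OF this nrm2_nonneg[of m ?z]] show ?thesis by (simp add: algebra_simps)
 qed
 from mult_left_mono[OF this C0]
 have "2 * ?C0 * (nrm2 m ?z / (1 + h)) + h * ?C0 * nrm2 m ?z <= 2 * ?C0 * nrm2 m ?z"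
  by (simp add: algebra_simps)
 then show ?case using 1 2 3 unfolding E_def by linarith
qed

end

section \<open>The law of the scheme and its energy balance\<close>

lemma std_normal_second_moment:
 "(\<integral>\<^sup>+s. ennreal (w * (a + r * s)^2) \<partial>std_normal) = ennreal (w * (a^2 + r^2))" if "0 <= w"
proof -
 let ?\<phi> = std_normal_density
 have m0: "has_bochner_integral lborel (%s. ?\<phi> s * s ^ (2 * 0)) (fact (2 * 0) / (2 ^ 0 * fact 0))"
  by (rule std_normal_moment_even)
 have m1: "has_bochner_integral lborel (%s. ?\<phi> s * s ^ (2 * 0 + 1)) 0"
  by (rule std_normal_moment_odd)
 have m2: "has_bochner_integral lborel (%s. ?\<phi> s * s ^ (2 * 1)) (fact (2 * 1) / (2 ^ 1 * fact 1))"
  by (rule std_normal_moment_even)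
 have "has_bochner_integral lborel (%s. a^2 * (?\<phi> s * s ^ (2 * 0)) + (2 * a * r) * (?\<phi> s * s ^ (2 * 0 + 1)) + r^2 * (?\<phi> s * s ^ (2 * 1)))
   (a^2 * (fact (2 * 0) / (2 ^ 0 * fact 0)) + (2 * a * r) * 0 + r^2 * (fact (2 * 1) / (2 ^ 1 * fact 1)))"
  by (intro has_bochner_integral_add has_bochner_integral_mult_right m0 m1 m2)
 then have "has_bochner_integral lborel (%s. w * (a^2 * (?\<phi> s * s ^ (2 * 0)) + (2 * a * r) * (?\<phi> s * s ^ (2 * 0 + 1)) + r^2 * (?\<phi> s * s ^ (2 * 1))))
   (w * (a^2 * (fact (2 * 0) / (2 ^ 0 * fact 0)) + (2 * a * r) * 0 + r^2 * (fact (2 * 1) / (2 ^ 1 * fact 1))))"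
  by (rule has_bochner_integral_mult_right)
 then have "has_bochner_integral lborel (%s. ?\<phi> s * (w * (a + r * s)^2)) (w * (a^2 + r^2))"
  by (rule has_bochner_integral_cong[THEN iffD1, rotated 3]) (auto simp: power2_eq_square algebra_simps)
 then have "(\<integral>\<^sup>+s. ennreal (?\<phi> s * (w * (a + r * s)^2)) \<partial>lborel) = ennreal (w * (a^2 + r^2))"
  using that by (subst nn_integral_eq_integral)
   (auto simp: has_bochner_integral_iff intro!: AE_I2 mult_nonneg_nonneg)
 moreover have "(\<integral>\<^sup>+s. ennreal (w * (a + r * s)^2) \<partial>std_normal) = (\<integral>\<^sup>+s. ennreal (?\<phi> s * (w * (a + r * s)^2)) \<partial>lborel)"
  using that by (subst nn_integral_density) (auto simp: ennreal_mult intro!: nn_integral_cong)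
 ultimately show ?thesis by simp
qed

context scheme
begin

text \<open>The measure counterpart of the iterates of \<open>T\<close>; the energy is unbounded and
  has to be integrated against a measure with values in \<open>ennreal\<close>.\<close>

primrec law :: "nat => (nat => real) => (nat => real) measure" where
 "law 0 x = return borel x"
| "law (Suc k) x = distr (law k x \<Otimes>\<^sub>M gauss {1..m}) borel (%(a, \<eta>). flow a \<eta>)"

lemma sets_law [simp, measurable_cong]: "sets (law k x) = sets borel"
 by (cases k) auto

lemma space_law [simp]: "space (law k x) = UNIV"
 using sets_eq_imp_space_eq[OF sets_law] by simp

lemma measurable_flow_law: "(%(a, \<eta>). flow a \<eta>) \<in> law k x \<Otimes>\<^sub>M gauss {1..m} \<rightarrow>\<^sub>M borel"
 using measurable_flow
 by (subst measurable_cong_sets[OF sets_pair_measure_cong[OF sets_law refl] refl])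

lemma prob_space_law: "prob_space (law k x)"
proof (induction k)
 case 0
 show ?case by (simp add: prob_space_return)
next
 case (Suc k)
 interpret l: prob_space "law k x" by fact
 interpret g: prob_space "gauss {1..m}" by (rule prob_space_gauss)
 interpret pair_prob_space "law k x" "gauss {1..m}" by unfold_locales
 show ?case unfolding law.simps by (rule prob_space_distr[OF measurable_flow_law])
qed

lemma nn_integral_law_Suc:
 assumes [measurable]: "f \<in> borel_measurable borel"
 shows "(\<integral>\<^sup>+a. f a \<partial>law (Suc k) x) = (\<integral>\<^sup>+a. \<integral>\<^sup>+\<eta>. f (flow a \<eta>) \<partial>gauss {1..m} \<partial>law k x)"
proof -
 interpret g: prob_space "gauss {1..m}" by (rule prob_space_gauss)
 have "(\<integral>\<^sup>+a. f a \<partial>law (Suc k) x) = (\<integral>\<^sup>+p. f (case p of (a, \<eta>) => flow a \<eta>) \<partial>(law k x \<Otimes>\<^sub>M gauss {1..m}))"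
  unfolding law.simps by (rule nn_integral_distr[OF measurable_flow_law]) simp
 also have "\<dots> = (\<integral>\<^sup>+a. \<integral>\<^sup>+\<eta>. f (flow a \<eta>) \<partial>gauss {1..m} \<partial>law k x)"
  by (subst g.nn_integral_fst[symmetric])
   (use measurable_compose[OF measurable_flow_law assms] in \<open>simp_all add: case_prod_beta\<close>)
 finally show ?thesis .
qed

lemma integral_law:
 assumes "\<phi> \<in> borel_measurable borel" "!!a. \<bar>\<phi> a\<bar> <= B"
 shows "(\<integral>a. \<phi> a \<partial>law k x) = (T ^^ k) \<phi> x"
 using assms
proof (induction k arbitrary: \<phi>)
 case 0
 then show ?case by (simp add: integral_return)
next
 case (Suc k)
 interpret l: prob_space "law k x" by (rule prob_space_law)
 interpret g: prob_space "gauss {1..m}" by (rule prob_space_gauss)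
 interpret pair_prob_space "law k x" "gauss {1..m}" by unfold_locales
 have mc: "(%p. \<phi> (case p of (a, \<eta>) => flow a \<eta>)) \<in> borel_measurable (law k x \<Otimes>\<^sub>M gauss {1..m})"
  by (rule measurable_compose[OF measurable_flow_law Suc.prems(1)])
 have B: "- B <= \<phi> a \<and> \<phi> a <= B" for a using Suc.prems(2)[of a] by linarith
 have "(\<integral>a. \<phi> a \<partial>law (Suc k) x) = (\<integral>p. \<phi> (case p of (a, \<eta>) => flow a \<eta>) \<partial>(law k x \<Otimes>\<^sub>M gauss {1..m}))"
  unfolding law.simps by (rule integral_distr[OF measurable_flow_law Suc.prems(1)])
 also have "\<dots> = (\<integral>a. \<integral>\<eta>. \<phi> (case (a, \<eta>) of (a, \<eta>) => flow a \<eta>) \<partial>gauss {1..m} \<partial>law k x)"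
  by (rule integral_fst'[symmetric], rule integrable_bounded_prob[OF prob_space_axioms mc Suc.prems(2)])
 also have "\<dots> = (\<integral>a. T \<phi> a \<partial>law k x)" by (simp add: T_def)
 also have "\<dots> = (T ^^ k) (T \<phi>) x"
 proof (rule Suc.IH[OF measurable_T[OF Suc.prems(1)]])
  show "\<bar>T \<phi> a\<bar> <= B" for a using T_bounds[OF Suc.prems(1) B, of a] by linarith
 qed
 finally show ?case by (simp add: funpow_swap1)
qed

lemma measurable_coord [measurable]: "(%a :: nat => real. a i) \<in> borel_measurable borel"
 by (rule measurable_product_coordinates)

text \<open>The increments are centred, so mode i adds only its variance wt * noise_amp^2 = fw h b /
  freq, at most h times the i-th term of the trace Tr_{-1}.\<close>

lemma nn_integral_kick:
 assumes Tr: "(\<Sum>i=1..m. b i / freq i) <= tr"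
 shows "(\<integral>\<^sup>+\<eta>. ennreal (nrm2 m (kick b h m a \<eta>)) \<partial>gauss {1..m}) <= ennreal (nrm2 m a + h * tr)"
proof -
 have comp: "(\<integral>\<^sup>+\<eta>. f (\<eta> i) \<partial>gauss {1..m}) = (\<integral>\<^sup>+s. f s \<partial>std_normal)"
  if "i \<in> {1..m}" "f \<in> borel_measurable borel" for i and f :: "real => ennreal"
 proof -
  have "distr (gauss {1..m}) std_normal (%\<eta>. \<eta> i) = std_normal"
   by (rule distr_PiM_component) (use that in \<open>auto intro: std_normal.prob_space_axioms\<close>)
  then have "(\<integral>\<^sup>+s. f s \<partial>std_normal) = (\<integral>\<^sup>+s. f s \<partial>distr (gauss {1..m}) std_normal (%\<eta>. \<eta> i))" by simp
  also have "\<dots> = (\<integral>\<^sup>+\<eta>. f (\<eta> i) \<partial>gauss {1..m})"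
   using that by (intro nn_integral_distr measurable_component_singleton) auto
  finally show ?thesis ..
 qed
 have eq: "ennreal (nrm2 m (kick b h m a \<eta>)) = (\<Sum>i=1..m. ennreal (wt m i * (a i + noise_amp b h m i * \<eta> i)^2))" for \<eta>
  unfolding nrm2_def kick_def
  by (intro sum_ennreal[symmetric] mult_nonneg_nonneg less_imp_le[OF wt_pos]) auto
 have ms: "(%\<eta>. ennreal (wt m i * (a i + noise_amp b h m i * \<eta> i)^2)) \<in> borel_measurable (gauss {1..m})"
  if "i \<in> {1..m}" for i
  by (rule measurable_compose[OF measurable_component_singleton[OF that]]) simp
 have "(\<integral>\<^sup>+\<eta>. ennreal (nrm2 m (kick b h m a \<eta>)) \<partial>gauss {1..m})
   = (\<Sum>i=1..m. \<integral>\<^sup>+\<eta>. ennreal (wt m i * (a i + noise_amp b h m i * \<eta> i)^2) \<partial>gauss {1..m})"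
  unfolding eq by (rule nn_integral_sum[OF ms])
 also have "\<dots> = (\<Sum>i=1..m. ennreal (wt m i * ((a i)^2 + (noise_amp b h m i)^2)))"
 proof (intro sum.cong refl)
  fix i assume i: "i \<in> {1..m}"
  show "(\<integral>\<^sup>+\<eta>. ennreal (wt m i * (a i + noise_amp b h m i * \<eta> i)^2) \<partial>gauss {1..m})
   = ennreal (wt m i * ((a i)^2 + (noise_amp b h m i)^2))"
   using comp[OF i, of "%s. ennreal (wt m i * (a i + noise_amp b h m i * s)^2)"]
    std_normal_second_moment[of "wt m i"] wt_pos[OF i] by simp
 qed
 also have "\<dots> = ennreal (\<Sum>i=1..m. wt m i * ((a i)^2 + (noise_amp b h m i)^2))"
  by (intro sum_ennreal mult_nonneg_nonneg less_imp_le[OF wt_pos]) auto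
 also have "\<dots> <= ennreal (nrm2 m a + h * tr)"
 proof (rule ennreal_leI)
  have "(\<Sum>i=1..m. wt m i * (noise_amp b h m i)^2) <= (\<Sum>i=1..m. h * (b i / freq i))"
  proof (intro sum_mono)
   fix i assume i: "i \<in> {1..m}"
   have p: "1 <= freq i" "0 < fw m i" "fw m i <= 1"
    using i freq_ge_1[of i] fw_bounds[of i m] fw_bounds(2)[of m i] by auto
   have "wt m i * (noise_amp b h m i)^2 = fw m i * (h * (b i / freq i))"
    using i p h_pos b_nonneg[of i]
    by (simp add: noise_amp_def wt_def power_mult_distrib power2_eq_square field_simps)
   also have "\<dots> <= 1 * (h * (b i / freq i))"
    using p h_pos b_nonneg[of i] by (intro mult_right_mono) auto
   finally show "wt m i * (noise_amp b h m i)^2 <= h * (b i / freq i)" by simp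
  qed
  also have "\<dots> = h * (\<Sum>i=1..m. b i / freq i)" by (rule sum_distrib_left[symmetric])
  also have "\<dots> <= h * tr" using Tr h_pos by (intro mult_left_mono) auto
  finally show "(\<Sum>i=1..m. wt m i * ((a i)^2 + (noise_amp b h m i)^2)) <= nrm2 m a + h * tr"
   by (simp add: nrm2_def sum.distrib distrib_left)
 qed
 finally show ?thesis .
qed

lemma measurable_nrm2 [measurable]: "nrm2 m \<in> borel_measurable borel"
 unfolding nrm2_def[abs_def] by measurable

text \<open>\<open>step_dissipation\<close> summed over the steps and averaged: the discrete energy
  equality in inequality form, where the trace plays the part of the Ito correction. Nonnegative
  integrals spare any prior integrability.\<close>

lemma law_energy:
 assumes C: "!!u. fpoly lam n u * (u - c) <= C" "0 <= C" and Tr: "(\<Sum>i=1..m. b i / freq i) <= tr" "0 <= tr"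
 shows "(\<integral>\<^sup>+a. ennreal (nrm2 m a) \<partial>law k x)
  + (\<Sum>j=1..k. \<integral>\<^sup>+a. ennreal (h * (\<Sum>i=1..m. freq i * (a i)^2)) \<partial>law j x) <= ennreal (nrm2 m x + real k * h * (C + tr))"
proof (induction k)
 case 0
 show ?case by (simp add: nn_integral_return)
next
 case (Suc k)
 interpret l: prob_space "law k x" by (rule prob_space_law)
 let ?D = "%a. h * (\<Sum>i=1..m. freq i * (a i)^2)"
 have D0: "0 <= ?D a" for a using h_pos by (intro mult_nonneg_nonneg sum_nonneg) (auto simp: freq_def)
 have [measurable]: "(%a. ennreal (?D a)) \<in> borel_measurable borel" by measurable
 have "(\<integral>\<^sup>+a. ennreal (nrm2 m a) \<partial>law (Suc k) x) + (\<integral>\<^sup>+a. ennreal (?D a) \<partial>law (Suc k) x)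
   = (\<integral>\<^sup>+a. ennreal (nrm2 m a) + ennreal (?D a) \<partial>law (Suc k) x)"
  by (intro nn_integral_add[symmetric]) (simp_all cong: measurable_cong_sets)
 also have "\<dots> = (\<integral>\<^sup>+a. \<integral>\<^sup>+\<eta>. ennreal (nrm2 m (flow a \<eta>)) + ennreal (?D (flow a \<eta>)) \<partial>gauss {1..m} \<partial>law k x)"
  by (rule nn_integral_law_Suc) measurable
 also have "\<dots> <= (\<integral>\<^sup>+a. ennreal (nrm2 m a) + ennreal (h * (C + tr)) \<partial>law k x)"
 proof (rule nn_integral_mono)
  fix a
  interpret g: prob_space "gauss {1..m}" by (rule prob_space_gauss)
  have "(\<integral>\<^sup>+\<eta>. ennreal (nrm2 m (flow a \<eta>)) + ennreal (?D (flow a \<eta>)) \<partial>gauss {1..m})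
   <= (\<integral>\<^sup>+\<eta>. ennreal (nrm2 m (kick b h m a \<eta>)) + ennreal (h * C) \<partial>gauss {1..m})"
  proof (rule nn_integral_mono)
   fix \<eta>
   have "nrm2 m (flow a \<eta>) + ?D (flow a \<eta>) <= nrm2 m (kick b h m a \<eta>) + h * C"
    by (rule step_dissipation[OF less_imp_le[OF h_pos] step_solution_J C(1)])
   then show "ennreal (nrm2 m (flow a \<eta>)) + ennreal (?D (flow a \<eta>)) <= ennreal (nrm2 m (kick b h m a \<eta>)) + ennreal (h * C)"
    using D0 nrm2_nonneg h_pos C(2) by (simp add: ennreal_leI flip: ennreal_plus)
  qed
  also have "\<dots> = (\<integral>\<^sup>+\<eta>. ennreal (nrm2 m (kick b h m a \<eta>)) \<partial>gauss {1..m}) + ennreal (h * C)"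
  proof (subst nn_integral_add)
   have "kick b h m a \<in> gauss {1..m} \<rightarrow>\<^sub>M borel"
    using measurable_compose[OF measurable_Pair1'[of a borel "gauss {1..m}"] measurable_kick] by simp
   then show "(%\<eta>. ennreal (nrm2 m (kick b h m a \<eta>))) \<in> borel_measurable (gauss {1..m})"
    by (rule measurable_compose) measurable
  qed (use g.emeasure_space_1 in simp_all)
  also have "\<dots> <= ennreal (nrm2 m a + h * tr) + ennreal (h * C)"
   by (intro add_right_mono nn_integral_kick Tr(1))
  also have "\<dots> = ennreal (nrm2 m a) + ennreal (h * (C + tr))"
   using nrm2_nonneg h_pos C(2) Tr(2) by (simp add: algebra_simps flip: ennreal_plus)
  finally show "(\<integral>\<^sup>+\<eta>. ennreal (nrm2 m (flow a \<eta>)) + ennreal (?D (flow a \<eta>)) \<partial>gauss {1..m})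
   <= ennreal (nrm2 m a) + ennreal (h * (C + tr))" .
 qed
 also have "\<dots> = (\<integral>\<^sup>+a. ennreal (nrm2 m a) \<partial>law k x) + ennreal (h * (C + tr))"
  using l.emeasure_space_1 by (subst nn_integral_add) (simp_all cong: measurable_cong_sets)
 finally have 1: "(\<integral>\<^sup>+a. ennreal (nrm2 m a) \<partial>law (Suc k) x) + (\<integral>\<^sup>+a. ennreal (?D a) \<partial>law (Suc k) x)
   <= (\<integral>\<^sup>+a. ennreal (nrm2 m a) \<partial>law k x) + ennreal (h * (C + tr))" .
 have "(\<integral>\<^sup>+a. ennreal (nrm2 m a) \<partial>law (Suc k) x) + (\<Sum>j=1..Suc k. \<integral>\<^sup>+a. ennreal (?D a) \<partial>law j x)
   = ((\<integral>\<^sup>+a. ennreal (nrm2 m a) \<partial>law (Suc k) x) + (\<integral>\<^sup>+a. ennreal (?D a) \<partial>law (Suc k) x))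
    + (\<Sum>j=1..k. \<integral>\<^sup>+a. ennreal (?D a) \<partial>law j x)"
  by (simp add: add_ac)
 also have "\<dots> <= ((\<integral>\<^sup>+a. ennreal (nrm2 m a) \<partial>law k x) + ennreal (h * (C + tr))) + (\<Sum>j=1..k. \<integral>\<^sup>+a. ennreal (?D a) \<partial>law j x)"
  by (intro add_right_mono 1)
 also have "\<dots> = ((\<integral>\<^sup>+a. ennreal (nrm2 m a) \<partial>law k x) + (\<Sum>j=1..k. \<integral>\<^sup>+a. ennreal (?D a) \<partial>law j x)) + ennreal (h * (C + tr))"
  by (simp add: add_ac)
 also have "\<dots> <= ennreal (nrm2 m x + real k * h * (C + tr)) + ennreal (h * (C + tr))"
  by (intro add_right_mono Suc.IH)
 also have "\<dots> = ennreal (nrm2 m x + real (Suc k) * h * (C + tr))"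
  using nrm2_nonneg[of m x] h_pos C(2) Tr(2) by (simp add: algebra_simps flip: ennreal_plus)
 finally show ?case .
qed

section \<open>Realisation of the scheme by Wiener increments\<close>

primrec path :: "(nat => real) => nat => (nat \<times> nat => real) => nat => real" where
 "path x 0 r = x"
| "path x (Suc k) r = flow (path x k r) (\<lambda>i\<in>{1..m}. r (k, i))"

lemma path_cong: "(!!j i. j < k ==> i \<in> {1..m} ==> r (j, i) = r' (j, i)) ==> path x k r = path x k r'"
proof (induction k)
 case (Suc k)
 then have "path x k r = path x k r'" by simp
 moreover have "(\<lambda>i\<in>{1..m}. r (k, i)) = (\<lambda>i\<in>{1..m}. r' (k, i))"
  using Suc.prems[of k] by (auto simp: fun_eq_iff)
 ultimately show ?case by (simp only: path.simps)
qed simp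

lemma measurable_path: "path x k \<in> PiM UNIV (%_. borel) \<rightarrow>\<^sub>M borel"
proof (induction k)
 case (Suc k)
 have "(%r. \<lambda>i\<in>{1..m}. r (k, i)) \<in> PiM UNIV (%_. borel :: real measure) \<rightarrow>\<^sub>M gauss {1..m}"
  by (subst measurable_cong_sets[OF refl sets_PiM_cong[OF refl sets_std_normal]])
   (intro measurable_restrict measurable_component_singleton, simp)
 from measurable_compose[OF measurable_Pair[OF Suc this] measurable_flow]
 show ?case by simp
qed simp

text \<open>The state after k steps depends on the noise rows before k only and is therefore
  independent of row k, so the pair has the product law from which \<open>law\<close> is
  built.\<close>

lemma path_law:
 assumes M: "prob_space M" and m: "1 <= m"
  and ind: "prob_space.indep_vars M (%_. borel) \<zeta> ({..<K} \<times> {1..m})"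
  and std: "!!p. p \<in> {..<K} \<times> {1..m} ==> distr M borel (\<zeta> p) = std_normal"
  and k: "k <= K"
 shows "(%om. path x k (%p. \<zeta> p om)) \<in> borel_measurable M \<and> distr M borel (%om. path x k (%p. \<zeta> p om)) = law k x"
proof -
 interpret prob_space M by fact
 let ?X = "%k om. path x k (%p. \<zeta> p om)"
 have rv: "\<zeta> p \<in> borel_measurable M" if "p \<in> {..<K} \<times> {1..m}" for p
  using ind that unfolding indep_vars_def by blast
 show ?thesis using k
 proof (induction k)
  case 0
  show ?case by (auto intro!: measure_eqI simp: emeasure_distr emeasure_space_1 indicator_def vimage_def)
 next
  case (Suc k)
  then have IH: "?X k \<in> borel_measurable M" "distr M borel (?X k) = law k x" and k: "k < K" by auto
  let ?A = "{..<k} \<times> {1..m}" and ?B = "{k} \<times> {1..m}"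
  \<comment> \<open>The state as a function of the earlier rows alone; the filling value 0 sits at
    entries that the first k steps never read.\<close>
  let ?\<Lambda> = "%r. path x k (%p. if p \<in> ?A then r p else 0)"
  let ?R = "%r :: nat \<times> nat => real. \<lambda>i\<in>{1..m}. r (k, i)"
  have iv: "indep_var (PiM ?A (%_. borel)) (%om. \<lambda>p\<in>?A. \<zeta> p om) (PiM ?B (%_. borel)) (%om. \<lambda>p\<in>?B. \<zeta> p om)"
   using k by (intro indep_var_restrict[OF ind]) auto
  have mA: "?\<Lambda> \<in> PiM ?A (%_. borel) \<rightarrow>\<^sub>M borel"
  proof (rule measurable_compose[OF _ measurable_path])
   show "(%r p. if p \<in> ?A then r p else 0) \<in> PiM ?A (%_. borel :: real measure) \<rightarrow>\<^sub>M PiM UNIV (%_. borel)"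
   proof (rule measurable_PiM_single')
    fix p :: "nat \<times> nat"
    show "(%r. if p \<in> ?A then r p else 0) \<in> borel_measurable (PiM ?A (%_. borel :: real measure))"
     by (cases "p \<in> ?A") (auto intro: measurable_component_singleton)
   qed auto
  qed
  have mB: "?R \<in> PiM ?B (%_. borel) \<rightarrow>\<^sub>M gauss {1..m}"
   by (subst measurable_cong_sets[OF refl sets_PiM_cong[OF refl sets_std_normal]])
    (intro measurable_restrict measurable_component_singleton, simp)
  have XA: "?\<Lambda> (\<lambda>p\<in>?A. \<zeta> p om) = ?X k om" for om by (rule path_cong) auto
  have XB: "?R (\<lambda>p\<in>?B. \<zeta> p om) = (\<lambda>i\<in>{1..m}. \<zeta> (k, i) om)" for om by auto
  have iv2: "indep_var borel (?X k) (gauss {1..m}) (%om. \<lambda>i\<in>{1..m}. \<zeta> (k, i) om)"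
   using indep_var_compose[OF iv mA mB] unfolding comp_def XA XB .
  \<comment> \<open>Row k is a marginal of the joint law of all rows, which independence identifies
    as a product of standard normal laws.\<close>
  have dB: "distr M (gauss {1..m}) (%om. \<lambda>i\<in>{1..m}. \<zeta> (k, i) om) = gauss {1..m}"
  proof -
   let ?I = "{..<K} \<times> {1..m}"
   have "(k, 1) \<in> ?I" using k m by simp
   then have ne: "?I \<noteq> {}" by blast
   have mz: "(%om. \<lambda>p\<in>?I. \<zeta> p om) \<in> M \<rightarrow>\<^sub>M PiM ?I (%_. borel)"
    by (rule measurable_restrict) (rule rv)
   have "distr M (PiM ?I (%_. borel)) (%om. \<lambda>p\<in>?I. \<zeta> p om) = PiM ?I (%p. distr M borel (\<zeta> p))"
    by (rule iffD1[OF indep_vars_iff_distr_eq_PiM'[OF ne rv] ind])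
   also have "\<dots> = PiM ?I (%_. std_normal)" by (intro PiM_cong refl std)
   finally have d: "distr M (PiM ?I (%_. borel)) (%om. \<lambda>p\<in>?I. \<zeta> p om) = PiM ?I (%_. std_normal)" .
   have "gauss {1..m} = distr (PiM ?I (%_. std_normal)) (gauss {1..m}) ?R"
    using k by (intro distr_PiM_reindex[symmetric] std_normal.prob_space_axioms) (auto simp: inj_on_def)
   also have "\<dots> = distr M (gauss {1..m}) (?R \<circ> (%om. \<lambda>p\<in>?I. \<zeta> p om))"
   proof (subst d[symmetric], rule distr_distr[OF _ mz])
    show "?R \<in> PiM ?I (%_. borel) \<rightarrow>\<^sub>M gauss {1..m}"
     using k by (subst measurable_cong_sets[OF refl sets_PiM_cong[OF refl sets_std_normal]])
      (intro measurable_restrict measurable_component_singleton, simp)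
   qed
   also have "?R \<circ> (%om. \<lambda>p\<in>?I. \<zeta> p om) = (%om. \<lambda>i\<in>{1..m}. \<zeta> (k, i) om)"
    using k by (auto simp: fun_eq_iff)
   finally show ?thesis ..
  qed
  have m2: "(%om. (?X k om, \<lambda>i\<in>{1..m}. \<zeta> (k, i) om)) \<in> M \<rightarrow>\<^sub>M borel \<Otimes>\<^sub>M gauss {1..m}"
   using iv2 by (intro measurable_Pair) (auto dest: indep_var_rv1 indep_var_rv2)
  have pd: "law k x \<Otimes>\<^sub>M gauss {1..m} = distr M (borel \<Otimes>\<^sub>M gauss {1..m}) (%om. (?X k om, \<lambda>i\<in>{1..m}. \<zeta> (k, i) om))"
   using iv2 unfolding indep_var_distribution_eq IH(2) dB by simp
  have "?X (Suc k) \<in> borel_measurable M"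
   using measurable_compose[OF m2 measurable_flow] by simp
  moreover have "distr M borel (?X (Suc k)) = law (Suc k) x"
   unfolding law.simps pd by (subst distr_distr[OF measurable_flow m2]) (simp add: comp_def)
  ultimately show ?case ..
 qed
qed

end

text \<open>Two layers of independence: the coordinate processes are independent as paths, and
  within one coordinate the increments over the grid are independent. The probability of a rectangle
  factorises first over modes, then over time steps.\<close>

lemma increments_indep:
 assumes W: "cylindrical_wiener M W" and h: "0 < h" and m: "1 <= m" and K: "1 <= K"
 defines "\<zeta> \<equiv> %p om. (W (snd p) (real (Suc (fst p)) * h) om - W (snd p) (real (fst p) * h) om) / sqrt h"
 shows "prob_space.indep_vars M (%_. borel) \<zeta> ({..<K} \<times> {1..m})"
  "!!p. distr M borel (\<zeta> p) = std_normal"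
proof -
 interpret prob_space M using W by (simp add: cylindrical_wiener_def)
 have bm: "brownian_motion M (W i)" for i using W by (simp add: cylindrical_wiener_def)
 have mW: "W i t \<in> borel_measurable M" if "0 <= t" for i t using bm[of i] that by (simp add: brownian_motion_def)
 have m\<zeta>: "\<zeta> p \<in> borel_measurable M" for p
  using h unfolding \<zeta>_def by (intro borel_measurable_divide borel_measurable_diff mW) auto
 show "distr M borel (\<zeta> p) = std_normal" for p
 proof -
  let ?s = "real (fst p) * h" and ?t = "real (Suc (fst p)) * h"
  have st: "0 <= ?s" "?s < ?t" "?t - ?s = h" using h by (auto simp: algebra_simps)
  then have "distributed M lborel (%om. W (snd p) ?t om - W (snd p) ?s om) (normal_density 0 (sqrt (?t - ?s)))"
   using bm[of "snd p"] unfolding brownian_motion_def by blast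
  then have "distributed M lborel (%om. W (snd p) ?t om - W (snd p) ?s om) (normal_density 0 (sqrt h))"
   unfolding st(3) .
  then have "distributed M lborel (%om. 0 + (1 / sqrt h) * (W (snd p) ?t om - W (snd p) ?s om))
    (normal_density (0 + (1 / sqrt h) * 0) (\<bar>1 / sqrt h\<bar> * sqrt h))"
   using h by (intro normal_density_affine) auto
  then have "distributed M lborel (\<zeta> p) std_normal_density"
   using h by (simp add: \<zeta>_def)
  then have "distr M lborel (\<zeta> p) = density lborel std_normal_density"
   by (rule distributed_distr_eq_density)
  moreover have "distr M lborel (\<zeta> p) = distr M borel (\<zeta> p)" by (rule distr_cong) auto
  ultimately show ?thesis by simp
 qed
 let ?I = "{..<K} \<times> {1..m}"
 show "indep_vars (%_. borel) \<zeta> ?I"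
 proof -
  have "(0, 1) \<in> ?I" using K m by simp
  then have ne: "?I \<noteq> {}" and Kne: "{..<K} \<noteq> {}" by blast+
  have "indep_vars (%_. borel) \<zeta> ?I \<longleftrightarrow> (\<forall>A\<in>?I \<rightarrow> sets borel.
    prob (\<Inter>j\<in>?I. \<zeta> j -` A j \<inter> space M) = (\<Prod>j\<in>?I. prob (\<zeta> j -` A j \<inter> space M)))"
   by (rule indep_vars_finite[OF ne])
    (use K m m\<zeta> sets.sigma_sets_eq[of "borel :: real measure"] sets.Int_stable[of "borel :: real measure"] in auto)
  moreover have "\<forall>A\<in>?I \<rightarrow> sets borel. prob (\<Inter>j\<in>?I. \<zeta> j -` A j \<inter> space M) = (\<Prod>j\<in>?I. prob (\<zeta> j -` A j \<inter> space M))"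
  proof
   fix A assume A: "A \<in> ?I \<rightarrow> sets (borel :: real measure)"
   let ?V = "%i om. \<lambda>k\<in>{..<K}. \<zeta> (k, i) om"
   \<comment> \<open>The grid increments of coordinate i are a measurable function of its path, so
     independence of the paths is inherited.\<close>
   have iV: "indep_vars (%_. PiM {..<K} (%_. borel)) ?V UNIV"
   proof -
    let ?Y = "%i (r :: real => real). \<lambda>k\<in>{..<K}. (r (real (Suc k) * h) - r (real k * h)) / sqrt h"
    have "indep_vars (%_. PiM {..<K} (%_. borel)) (%i om. ?Y i (\<lambda>t\<in>{0..}. W i t om)) UNIV"
    proof (rule indep_vars_compose2[where Y="?Y" and X="%i om. \<lambda>t\<in>{0..}. W i t om"
       and M'="%_. Pi\<^sub>M {0..} (%_. borel)"])
     show "indep_vars (%_. Pi\<^sub>M {0..} (%_. borel)) (%i om. \<lambda>t\<in>{0..}. W i t om) UNIV"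
      using W by (simp add: cylindrical_wiener_def)
     show "?Y i \<in> PiM {0..} (%_. borel) \<rightarrow>\<^sub>M PiM {..<K} (%_. borel)" for i
      using h by (intro measurable_restrict borel_measurable_divide borel_measurable_diff
        measurable_component_singleton borel_measurable_const) auto
    qed
    moreover have "?Y i (\<lambda>t\<in>{0..}. W i t om) = ?V i om" for i om
     using h by (auto simp: fun_eq_iff \<zeta>_def)
    ultimately show ?thesis by simp
   qed
   let ?E = "%i. PiE {..<K} (%k. A (k, i))"
   have pre: "?V i -` ?E i \<inter> space M = (\<Inter>k\<in>{..<K}. \<zeta> (k, i) -` A (k, i) \<inter> space M)" for i
    using Kne by (auto simp: PiE_iff)
   have "(\<Inter>j\<in>?I. \<zeta> j -` A j \<inter> space M) = (\<Inter>i\<in>{1..m}. ?V i -` ?E i \<inter> space M)"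
    unfolding pre using m Kne by (auto simp: Ball_def)
   also have "prob \<dots> = (\<Prod>i\<in>{1..m}. prob (?V i -` ?E i \<inter> space M))"
   proof (rule indep_varsD_finite[OF indep_vars_subset[OF iV]])
    show "?E i \<in> sets (PiM {..<K} (%_. borel))" if "i \<in> {1..m}" for i
     using A that by (intro sets_PiM_I_finite) auto
   qed (use m in auto)
   also have "\<dots> = (\<Prod>i\<in>{1..m}. \<Prod>k\<in>{..<K}. prob (\<zeta> (k, i) -` A (k, i) \<inter> space M))"
   proof (intro prod.cong refl)
    fix i assume i: "i \<in> {1..m}"
    have "mono (%j. real j * h)" using h by (auto simp: mono_def)
    then have "indep_vars (%_. borel) (%j om. W i (real (Suc j) * h) om - W i (real j * h) om) {..<K}"
    proof -
     have "\<forall>(m :: nat) (\<tau> :: nat => real). 0 <= \<tau> 0 \<and> mono \<tau> -->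
      indep_vars (%_. borel) (%j om. W i (\<tau> (Suc j)) om - W i (\<tau> j) om) {..<m}"
      using bm[of i] unfolding brownian_motion_def by (elim conjE)
     from this[rule_format, of "%j. real j * h" K] show "mono (%j. real j * h) ==> ?thesis" by simp
    qed
    then have "indep_vars (%_. borel) (%j om. (W i (real (Suc j) * h) om - W i (real j * h) om) / sqrt h) {..<K}"
     by (rule indep_vars_compose2[where Y="%_ x. x / sqrt h"]) simp
    then have "indep_vars (%_. borel) (%k. \<zeta> (k, i)) {..<K}"
     by (simp add: \<zeta>_def)
    then show "prob (?V i -` ?E i \<inter> space M) = (\<Prod>k\<in>{..<K}. prob (\<zeta> (k, i) -` A (k, i) \<inter> space M))"
     unfolding pre by (rule indep_varsD_finite[OF _ Kne]) (use A i in auto)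
   qed
   also have "\<dots> = (\<Prod>j\<in>?I. prob (\<zeta> j -` A j \<inter> space M))"
    by (subst prod.swap, subst prod.cartesian_product) (intro prod.cong refl, simp add: case_prod_beta)
   finally show "prob (\<Inter>j\<in>?I. \<zeta> j -` A j \<inter> space M) = (\<Prod>j\<in>?I. prob (\<zeta> j -` A j \<inter> space M))" .
  qed
  ultimately show ?thesis by blast
 qed
qed

section \<open>Fejer means\<close>

text \<open>Multiplied by m + 1 this is the squared modulus of the sum of exp(i j \<phi>) over j <=
  m, written through its real and imaginary parts.\<close>

lemma fejer_nonneg: "0 <= 1 + 2 * (\<Sum>i=1..m. fw m i * cos (real i * \<phi>))"
proof -
 let ?C = "%m. \<Sum>j\<le>m. cos (real j * \<phi>)" and ?S = "%m. \<Sum>j\<le>m. sin (real j * \<phi>)"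
 have "(?C m)^2 + (?S m)^2 = (real m + 1) + 2 * (\<Sum>i=1..m. (real m + 1 - real i) * cos (real i * \<phi>))"
 proof (induction m)
  case (Suc m)
  have "(?C (Suc m))^2 + (?S (Suc m))^2 = ((?C m)^2 + (?S m)^2)
    + ((cos (real (Suc m) * \<phi>))^2 + (sin (real (Suc m) * \<phi>))^2)
    + 2 * (?C m * cos (real (Suc m) * \<phi>) + ?S m * sin (real (Suc m) * \<phi>))"
   by (simp add: power2_sum algebra_simps)
  also have "(cos (real (Suc m) * \<phi>))^2 + (sin (real (Suc m) * \<phi>))^2 = 1" by simp
  also have "?C m * cos (real (Suc m) * \<phi>) + ?S m * sin (real (Suc m) * \<phi>)
    = (\<Sum>j\<le>m. cos (real (Suc m - j) * \<phi>))"
   unfolding sum_distrib_right sum.distrib[symmetric]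
  proof (intro sum.cong refl)
   fix j assume "j \<in> {..m}"
   then have "real (Suc m - j) * \<phi> = real (Suc m) * \<phi> - real j * \<phi>" by (simp add: of_nat_diff algebra_simps)
   then show "cos (real j * \<phi>) * cos (real (Suc m) * \<phi>) + sin (real j * \<phi>) * sin (real (Suc m) * \<phi>)
     = cos (real (Suc m - j) * \<phi>)"
    by (simp add: cos_diff mult.commute)
  qed
  also have "\<dots> = (\<Sum>i=1..Suc m. cos (real i * \<phi>))"
   by (rule sum.reindex_bij_witness[of _ "%i. Suc m - i" "%j. Suc m - j"]) auto
  finally have "(?C (Suc m))^2 + (?S (Suc m))^2
   = (real m + 1) + 2 * (\<Sum>i=1..m. (real m + 1 - real i) * cos (real i * \<phi>)) + 1 + 2 * (\<Sum>i=1..Suc m. cos (real i * \<phi>))"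
   unfolding Suc.IH .
  also have "(\<Sum>i=1..m. (real m + 1 - real i) * cos (real i * \<phi>)) = (\<Sum>i=1..Suc m. (real m + 1 - real i) * cos (real i * \<phi>))"
   by simp
  finally have "(?C (Suc m))^2 + (?S (Suc m))^2 = (real m + 1)
   + 2 * (\<Sum>i=1..Suc m. (real m + 1 - real i) * cos (real i * \<phi>)) + 1 + 2 * (\<Sum>i=1..Suc m. cos (real i * \<phi>))" .
  moreover have "(\<Sum>i=1..Suc m. (real (Suc m) + 1 - real i) * cos (real i * \<phi>))
    = (\<Sum>i=1..Suc m. (real m + 1 - real i) * cos (real i * \<phi>)) + (\<Sum>i=1..Suc m. cos (real i * \<phi>))"
   unfolding sum.distrib[symmetric] by (intro sum.cong refl) (simp add: algebra_simps)
  moreover have "real (Suc m) = real m + 1" by simp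
  ultimately show ?case by linarith
 qed simp
 then have "0 <= (real m + 1) + 2 * (\<Sum>i=1..m. (real m + 1 - real i) * cos (real i * \<phi>))"
  by (metis zero_le_power2 add_nonneg_nonneg)
 also have "\<dots> = (real m + 1) * (1 + 2 * (\<Sum>i=1..m. fw m i * cos (real i * \<phi>)))"
 proof -
  have "(\<Sum>i=1..m. (real m + 1 - real i) * cos (real i * \<phi>)) = (real m + 1) * (\<Sum>i=1..m. fw m i * cos (real i * \<phi>))"
   unfolding sum_distrib_left by (intro sum.cong) (auto simp: fw_def field_simps)
  then show ?thesis by (simp add: algebra_simps)
 qed
 finally show ?thesis by (simp add: zero_le_mult_iff)
qed

definition fejer_kernel :: "nat => real => real => real" where
 "fejer_kernel m th = cospoly m (%i. fw m i * eigfun i th)"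

text \<open>The cosine basis amounts to even reflection: the kernel is the average of the classical
  Fejer kernels at th - th' and th + th'.\<close>

lemma fejer_kernel_nonneg: "0 <= fejer_kernel m th th'"
proof -
 have e: "eigfun i th * eigfun i th' = cos (real i * (pi * (th - th'))) + cos (real i * (pi * (th + th')))" if "i \<in> {1..m}" for i
 proof -
  have "eigfun i th * eigfun i th' = 2 * (cos (real i * pi * th) * cos (real i * pi * th'))"
   using that by (simp add: eigfun_def)
  also have "\<dots> = cos (real i * pi * th - real i * pi * th') + cos (real i * pi * th + real i * pi * th')"
   by (simp add: cos_times_cos)
  finally show ?thesis by (simp add: algebra_simps)
 qed
 have "fejer_kernel m th th' = 1 + (\<Sum>i=1..m. fw m i * (eigfun i th * eigfun i th'))"
  by (simp add: fejer_kernel_def cospoly_def sum_atMost_head eigfun_def mult.assoc)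
 also have "(\<Sum>i=1..m. fw m i * (eigfun i th * eigfun i th'))
   = (\<Sum>i=1..m. fw m i * cos (real i * (pi * (th - th')))) + (\<Sum>i=1..m. fw m i * cos (real i * (pi * (th + th'))))"
  unfolding sum.distrib[symmetric] by (intro sum.cong refl) (simp only: e distrib_left)
 finally show ?thesis
  using fejer_nonneg[of m "pi * (th - th')"] fejer_nonneg[of m "pi * (th + th')"] by linarith
qed

definition fejer_mean :: "nat => (real => real) => real => real" where
 "fejer_mean m u = cospoly m (%i. fw m i * L2_coef u i)"

lemma fejer_mean_kernel:
 assumes "integrable ulb u"
 shows "fejer_mean m u th = (\<integral>th'. u th' * fejer_kernel m th th' \<partial>ulb)"
 unfolding fejer_kernel_def integral_mult_cospoly(2)[OF assms]
 by (simp add: fejer_mean_def cospoly_def mult_ac)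

lemma integrable_mult_fejer_kernel:
 "integrable ulb u ==> integrable ulb (%th'. u th' * fejer_kernel m th th')"
 unfolding fejer_kernel_def by (rule integral_mult_cospoly)

lemma L2_coef_0: "L2_coef u 0 = (\<integral>th. u th \<partial>ulb)"
 by (simp add: L2_coef_ulb eigfun_def)

lemma integral_fejer_kernel: "(\<integral>th'. fejer_kernel m th th' \<partial>ulb) = 1"
proof -
 have "(\<integral>th'. fejer_kernel m th th' \<partial>ulb) = L2_coef (cospoly m (%i. fw m i * eigfun i th)) 0"
  by (simp add: L2_coef_0 fejer_kernel_def)
 then show ?thesis by (simp add: L2_coef_cospoly eigfun_def)
qed

lemma power_le_even_power: "k <= p ==> even p ==> \<bar>x\<bar> ^ k <= 1 + x ^ p" for x :: real
proof -
 assume *: "k <= p" "even p"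
 have "x ^ p = \<bar>x\<bar> ^ p" using * by (simp add: power_even_abs)
 moreover have "\<bar>x\<bar> ^ k <= 1 + \<bar>x\<bar> ^ p"
 proof (cases "\<bar>x\<bar> <= 1")
  case True
  then have "\<bar>x\<bar> ^ k <= 1" by (intro power_le_one) auto
  then show ?thesis using zero_le_power[of "\<bar>x\<bar>" p] by linarith
 next
  case False
  then have "\<bar>x\<bar> ^ k <= \<bar>x\<bar> ^ p" using * by (intro power_increasing) auto
  then show ?thesis by simp
 qed
 ultimately show ?thesis by simp
qed

lemma integrable_lower_power:
 fixes u :: "'a => real"
 assumes "finite_measure M" "u \<in> borel_measurable M" "integrable M (%x. u x ^ p)" "even p" "k <= p"
 shows "integrable M (%x. u x ^ k)"
proof -
 interpret finite_measure M by fact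
 show ?thesis
 proof (rule Bochner_Integration.integrable_bound)
  show "integrable M (%x. 1 + u x ^ p)" using assms by simp
  show "(%x. u x ^ k) \<in> borel_measurable M" using assms by simp
  show "AE x in M. norm (u x ^ k) <= norm (1 + u x ^ p)"
  proof (rule AE_I2)
   fix x
   have "\<bar>u x\<bar> ^ k <= 1 + u x ^ p" by (rule power_le_even_power[OF assms(5,4)])
   then show "norm (u x ^ k) <= norm (1 + u x ^ p)" by (simp add: power_abs)
  qed
 qed
qed

lemma power_add_le: "(x + y) ^ p <= 2 ^ p * (x ^ p + y ^ p)" if "even p" for x y :: real
proof -
 have "(x + y) ^ p = \<bar>x + y\<bar> ^ p" using that by (simp add: power_even_abs)
 also have "\<dots> <= (2 * max \<bar>x\<bar> \<bar>y\<bar>) ^ p" by (intro power_mono) auto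
 also have "\<dots> <= 2 ^ p * (\<bar>x\<bar> ^ p + \<bar>y\<bar> ^ p)"
  unfolding power_mult_distrib by (intro mult_left_mono) (auto simp: max_def)
 finally show ?thesis using that by (simp add: power_even_abs)
qed

text \<open>For fixed th the kernel is a probability density, so Jensen applies to the even power;
  integration in th then costs nothing because \<open>fw m 0\<close> is 1.\<close>

lemma fejer_mean_Lp:
 assumes u: "u \<in> borel_measurable ulb" "integrable ulb (%th. u th ^ p)" and p: "even p" "1 <= p"
 shows "(\<integral>th. fejer_mean m u th ^ p \<partial>ulb) <= (\<integral>th. u th ^ p \<partial>ulb)"
proof -
 have iu: "integrable ulb u"
  using integrable_lower_power[OF ulb.finite_measure_axioms u p] by simp
 have "fejer_mean m u th ^ p <= fejer_mean m (%th. u th ^ p) th" for th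
 proof -
  let ?k = "fejer_kernel m th" and ?D = "density ulb (%th'. ennreal (fejer_kernel m th th'))"
  have ik: "integrable ulb ?k"
   unfolding fejer_kernel_def by (intro integrable_ulb_continuous continuous_cospoly)
  then have mk: "?k \<in> borel_measurable ulb" by simp
  interpret D: prob_space ?D
  proof (rule prob_spaceI)
   have "emeasure ?D (space ulb) = (\<integral>\<^sup>+th'. ennreal (?k th') * indicator (space ulb) th' \<partial>ulb)"
    by (rule emeasure_density[OF _ sets.top]) (use mk in simp)
   also have "\<dots> = (\<integral>\<^sup>+th'. ennreal (?k th') \<partial>ulb)"
    by (intro nn_integral_cong) simp
   also have "\<dots> = ennreal 1"
    using ik by (subst nn_integral_eq_integral) (auto simp: fejer_kernel_nonneg integral_fejer_kernel)
   finally show "emeasure ?D (space ?D) = 1" by (simp only: space_density ennreal_1)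
  qed
  have dens: "(\<integral>th'. f th' \<partial>?D) = fejer_mean m f th" "integrable ?D f" if "integrable ulb f" for f
  proof -
   have mf: "f \<in> borel_measurable ulb" using that by simp
   show "(\<integral>th'. f th' \<partial>?D) = fejer_mean m f th"
    using mf mk fejer_kernel_nonneg by (subst integral_density) (auto simp: fejer_mean_kernel[OF that] mult.commute)
   show "integrable ?D f"
    using mf mk fejer_kernel_nonneg integrable_mult_fejer_kernel[OF that, of m th]
    by (subst integrable_density) (auto simp: mult.commute)
  qed
  have "(D.expectation u) ^ p <= D.expectation (%th'. u th' ^ p)"
   by (rule D.jensens_inequality[where I=UNIV]) (auto simp: dens(2) iu u p convex_power_even)
  then show ?thesis using dens(1)[OF iu] dens(1)[OF u(2)] by simp
 qed
 then have "(\<integral>th. fejer_mean m u th ^ p \<partial>ulb) <= (\<integral>th. fejer_mean m (%th. u th ^ p) th \<partial>ulb)"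
  unfolding fejer_mean_def
  by (intro integral_mono integrable_ulb_continuous continuous_intros continuous_cospoly)
 also have "\<dots> = L2_coef (fejer_mean m (%th. u th ^ p)) 0" by (simp add: L2_coef_0)
 also have "\<dots> = (\<integral>th. u th ^ p \<partial>ulb)"
  by (simp only: fejer_mean_def L2_coef_cospoly) (simp add: L2_coef_0)
 finally show ?thesis .
qed

section \<open>Density of cosine polynomials and convergence of Fejer means\<close>

lemma cospoly_add: "cospoly q a th + cospoly r a' th
  = cospoly (max q r) (%i. (if i <= q then a i else 0) + (if i <= r then a' i else 0)) th"
proof -
 have ext: "cospoly q a th = (\<Sum>i\<le>max q r. (if i <= q then a i else 0) * eigfun i th)" for q r a
  unfolding cospoly_def by (intro sum.mono_neutral_cong_left) auto
 show ?thesis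
  unfolding ext[of q a r] ext[of r a' q] by (simp add: cospoly_def max.commute sum.distrib distrib_right)
qed

definition cospolys :: "(real => real) set" where
 "cospolys = {f. \<exists>q a. f = cospoly q a}"

lemma cospolys_add: "f \<in> cospolys ==> g \<in> cospolys ==> (%x. f x + g x) \<in> cospolys"
 unfolding cospolys_def
proof clarify
 fix q r a a'
 show "\<exists>s a''. (%x. cospoly q a x + cospoly r a' x) = cospoly s a''"
  unfolding cospoly_add by (rule exI)+ (rule refl)
qed

lemma cospolys_scale: "f \<in> cospolys ==> (%x. k * f x) \<in> cospolys"
proof -
 have "(%x. k * cospoly q a x) = cospoly q (%i. k * a i)" for q a
  by (auto simp: cospoly_def sum_distrib_left mult_ac)
 then show "f \<in> cospolys ==> (%x. k * f x) \<in> cospolys" unfolding cospolys_def by auto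
qed

lemma cospolys_eigfun: "eigfun i \<in> cospolys"
proof -
 have "eigfun i = cospoly i (%j. if j = i then 1 else 0)"
  unfolding cospoly_def by (simp add: if_distrib[of "%x. x * _"] cong: if_cong)
 then show ?thesis unfolding cospolys_def by blast
qed

lemma cospolys_cos: "(%x. cos (real i * pi * x)) \<in> cospolys"
proof (cases "i = 0")
 case True
 then show ?thesis using cospolys_eigfun[of 0] by (simp add: eigfun_def[abs_def])
next
 case False
 then have "(%x. cos (real i * pi * x)) = (%x. (1 / sqrt 2) * eigfun i x)"
  by (simp add: eigfun_def[abs_def])
 then show ?thesis using cospolys_scale[OF cospolys_eigfun[of i], of "1 / sqrt 2"] by (simp only:)
qed

lemma cospolys_sum: "finite I ==> (!!i. i \<in> I ==> f i \<in> cospolys) ==> (%x. \<Sum>i\<in>I. f i x) \<in> cospolys"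
proof (induction I rule: finite_induct)
 case empty
 then show ?case using cospolys_scale[OF cospolys_eigfun[of 0], of 0] by simp
qed (simp add: cospolys_add)

lemma cospolys_mult_eigfun: "(%x. eigfun i x * eigfun j x) \<in> cospolys"
proof -
 have "(%x. cos (real i * pi * x) * cos (real j * pi * x)) \<in> cospolys"
 proof -
  define d where "d = (if i <= j then j - i else i - j)"
  have "cos (real i * pi * x - real j * pi * x) = cos (real d * pi * x)" for x
  proof (cases "i <= j")
   case True
   then have "real i * pi * x - real j * pi * x = - (real d * pi * x)" by (simp add: d_def of_nat_diff algebra_simps)
   then show ?thesis by (simp only: cos_minus)
  next
   case False
   then have "real i * pi * x - real j * pi * x = real d * pi * x" by (simp add: d_def of_nat_diff algebra_simps)
   then show ?thesis by simp
  qed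
  moreover have "real i * pi * x + real j * pi * x = real (i + j) * pi * x" for x by (simp add: algebra_simps)
  ultimately have "(%x. cos (real i * pi * x) * cos (real j * pi * x))
    = (%x. (1 / 2) * (cos (real d * pi * x) + cos (real (i + j) * pi * x)))"
   unfolding cos_times_cos by simp
  then show ?thesis by (simp only: cospolys_scale cospolys_add cospolys_cos)
 qed
 moreover have "eigfun i x * eigfun j x = ((if i = 0 then 1 else sqrt 2) * (if j = 0 then 1 else sqrt 2))
   * (cos (real i * pi * x) * cos (real j * pi * x))" for x
  by (simp add: eigfun_def)
 ultimately show ?thesis by (simp only: cospolys_scale)
qed

lemma cospolys_mult: 
 assumes "f \<in> cospolys" "g \<in> cospolys"
 shows "(%x. f x * g x) \<in> cospolys"
proof -
 obtain q a r a' where f: "f = cospoly q a" and g: "g = cospoly r a'" using assms unfolding cospolys_def by auto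
 have "(%x. f x * g x) = (%x. \<Sum>i\<le>q. \<Sum>j\<le>r. (a i * a' j) * (eigfun i x * eigfun j x))"
  unfolding f g cospoly_def sum_product by (simp add: mult_ac)
 then show ?thesis by (simp only: cospolys_sum cospolys_scale cospolys_mult_eigfun finite_atMost)
qed

text \<open>Stone-Weierstrass: product formulas make the cosine polynomials an algebra, and cos(pi
  x) alone separates the points of [0,1].\<close>

lemma cospolys_uniform_dense:
 assumes "continuous_on {0..1} f" "0 < e"
 shows "\<exists>g\<in>cospolys. \<forall>x\<in>{0..1}. \<bar>f x - g x\<bar> < e"
proof -
 interpret function_ring_on cospolys "{0..1}"
 proof
  show "continuous_on {0..1} f" if "f \<in> cospolys" for f
   using that continuous_cospoly unfolding cospolys_def by auto
  show "(%_. c) \<in> cospolys" for c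
   using cospolys_scale[OF cospolys_eigfun[of 0], of c] by (simp add: eigfun_def)
  fix x y :: real assume xy: "x \<in> {0..1}" "y \<in> {0..1}" "x \<noteq> y"
  have "cos (pi * x) \<noteq> cos (pi * y)"
  proof
   assume "cos (pi * x) = cos (pi * y)"
   moreover have "pi * x \<in> {0..pi}" "pi * y \<in> {0..pi}" using xy by (auto simp: mult_left_le)
   ultimately have "pi * x = pi * y" using cos_inj_pi[of "pi * x" "pi * y"] by auto
   then show False using xy by simp
  qed
  then show "\<exists>f\<in>cospolys. f x \<noteq> f y"
   using cospolys_cos[of 1] by (intro bexI[of _ "%x. cos (real 1 * pi * x)"]) auto
 qed (auto intro: cospolys_add cospolys_mult)
 show ?thesis by (rule Stone_Weierstrass_basic[OF assms])
qed

lemma tendsto_integral_clamp: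
 assumes u: "u \<in> borel_measurable ulb" "integrable ulb (%th. u th ^ p)" and p: "even p" "1 <= p"
 shows "(%k. \<integral>th. (u th - max (- real k) (min (real k) (u th))) ^ p \<partial>ulb) \<longlonglongrightarrow> 0"
proof -
 have "(%k. \<integral>th. (u th - max (- real k) (min (real k) (u th))) ^ p \<partial>ulb) \<longlonglongrightarrow> (\<integral>th. 0 \<partial>ulb)"
 proof (rule integral_dominated_convergence[where w="%th. u th ^ p"])
  show "AE th in ulb. (%k. (u th - max (- real k) (min (real k) (u th))) ^ p) \<longlonglongrightarrow> 0"
  proof (rule AE_I2, rule tendsto_eventually)
   fix th
   obtain K where "\<bar>u th\<bar> <= real K" using real_arch_simple by blast
   then show "\<forall>\<^sub>F k in sequentially. (u th - max (- real k) (min (real k) (u th))) ^ p = 0"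
    using p unfolding eventually_sequentially by (intro exI[of _ K]) (auto simp: max_def min_def)
  qed
  show "AE th in ulb. norm ((u th - max (- real k) (min (real k) (u th))) ^ p) <= u th ^ p" for k
  proof (rule AE_I2)
   fix th
   have "\<bar>u th - max (- real k) (min (real k) (u th))\<bar> <= \<bar>u th\<bar>" by (auto simp: max_def min_def)
   then have "\<bar>u th - max (- real k) (min (real k) (u th))\<bar> ^ p <= \<bar>u th\<bar> ^ p" by (intro power_mono) auto
   then show "norm ((u th - max (- real k) (min (real k) (u th))) ^ p) <= u th ^ p"
    using p by (simp add: power_abs power_even_abs)
  qed
 qed (use u in auto)
 then show ?thesis by simp
qed

text \<open>Lebesgue measurability supplies continuous functions converging almost everywhere;
  clamping them to [-B, B] keeps the limit and yields domination. A continuous function is then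
  approximated uniformly.\<close>

lemma cospolys_Lp_dense_bounded:
 assumes u: "u \<in> borel_measurable ulb" "!!th. \<bar>u th\<bar> <= B" and p: "even p" "1 <= p" and e: "0 < e"
 shows "\<exists>g\<in>cospolys. (\<integral>th. (u th - g th) ^ p \<partial>ulb) < e"
proof -
 have B: "0 <= B" using u(2)[of 0] by linarith
 let ?u = "%th. indicator {0<..<1} th * u th"
 have "?u \<in> borel_measurable borel"
  using u(1) by (subst (asm) borel_measurable_restrict_space_iff) auto
 then have "?u \<in> borel_measurable lebesgue" by (simp add: measurable_completion)
 then have "?u measurable_on UNIV"
  by (rule lebesgue_measurable_imp_measurable_on_real) auto
 then obtain N g where N: "negligible N" and g: "!!k. continuous_on UNIV (g k)"
  and lim: "!!x. x \<notin> N ==> (%k. g k x) \<longlonglongrightarrow> (if x \<in> UNIV then ?u x else 0)"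
  unfolding measurable_on_def by blast
 let ?g = "%k x. max (- B) (min B (g k x))"
 have cg: "continuous_on UNIV (?g k)" for k by (intro continuous_intros g)
 have cl: "\<bar>?g k x\<bar> <= B" for k x using B by (auto simp: max_def min_def)
 have aeN: "AE x in ulb. x \<notin> N"
 proof -
  have "N \<in> null_sets lebesgue" using N by (simp add: negligible_iff_null_sets)
  then have "AE x in lebesgue. x \<notin> N" by (rule AE_not_in)
  then have "AE x in lborel. x \<notin> N" by (simp add: AE_completion_iff)
  then show ?thesis by (subst AE_restrict_space_iff) auto
 qed
 have "(%k. \<integral>th. (u th - ?g k th) ^ p \<partial>ulb) \<longlonglongrightarrow> (\<integral>th. 0 \<partial>ulb)"
 proof (rule integral_dominated_convergence[where w="%th. (2 * B) ^ p"])
  show "(%th. (u th - ?g k th) ^ p) \<in> borel_measurable ulb" for k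
   using u(1) borel_measurable_ulb[OF borel_measurable_continuous_onI[OF cg[of k]]]
   by (intro borel_measurable_power borel_measurable_diff)
  show "AE th in ulb. (%k. (u th - ?g k th) ^ p) \<longlonglongrightarrow> 0"
   using aeN AE_space
  proof eventually_elim
   fix th assume "th \<notin> N" "th \<in> space ulb"
   then have "(%k. g k th) \<longlonglongrightarrow> u th" using lim[of th] by (simp add: indicator_def)
   then have "(%k. (u th - ?g k th) ^ p) \<longlonglongrightarrow> (u th - max (- B) (min B (u th))) ^ p"
    by (intro tendsto_intros)
   moreover have "max (- B) (min B (u th)) = u th" using u(2)[of th] by auto
   ultimately show "(%k. (u th - ?g k th) ^ p) \<longlonglongrightarrow> 0" using p by (simp add: power_0_left)
  qed
  show "AE th in ulb. norm ((u th - ?g k th) ^ p) <= (2 * B) ^ p" for k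
  proof (rule AE_I2)
   fix th
   have "\<bar>u th - ?g k th\<bar> <= 2 * B" using u(2)[of th] cl[of k th] by linarith
   then have "\<bar>u th - ?g k th\<bar> ^ p <= (2 * B) ^ p" by (intro power_mono) auto
   then show "norm ((u th - ?g k th) ^ p) <= (2 * B) ^ p" by (simp add: power_abs)
  qed
 qed auto
 then have L: "(%k. \<integral>th. (u th - ?g k th) ^ p \<partial>ulb) \<longlonglongrightarrow> 0" by simp
 have "0 < e / (2 * 2 ^ p)" using e by simp
 from order_tendstoD(2)[OF L this] obtain k where k: "(\<integral>th. (u th - ?g k th) ^ p \<partial>ulb) < e / (2 * 2 ^ p)"
  unfolding eventually_sequentially by blast
 \<comment> \<open>\<delta> <= 1 turns the uniform error \<delta>^p into at most \<delta>.\<close>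
 define \<delta> where "\<delta> = min 1 (e / (2 * 2 ^ p) / 2)"
 have \<delta>: "0 < \<delta>" "\<delta> <= 1" "\<delta> <= e / (2 * 2 ^ p) / 2" unfolding \<delta>_def using e by auto
 obtain f where f: "f \<in> cospolys" "!!x. x \<in> {0..1} ==> \<bar>?g k x - f x\<bar> < \<delta>"
  using cospolys_uniform_dense[OF continuous_on_subset[OF cg[of k]] \<delta>(1)] by auto
 have cf: "continuous_on UNIV f" using f(1) continuous_cospoly unfolding cospolys_def by auto
 have mu: "(%th. u th - ?g k th) \<in> borel_measurable ulb"
  using u(1) borel_measurable_ulb[OF borel_measurable_continuous_onI[OF cg[of k]]]
  by (intro borel_measurable_diff)
 have i1: "integrable ulb (%th. (u th - ?g k th) ^ p)"
 proof (rule integrable_bounded_prob[OF ulb.prob_space_axioms, where B="(2 * B) ^ p"])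
  show "(%th. (u th - ?g k th) ^ p) \<in> borel_measurable ulb" using mu by (rule borel_measurable_power)
  fix th
  have "\<bar>u th - ?g k th\<bar> <= 2 * B" using u(2)[of th] cl[of k th] by linarith
  then have "\<bar>u th - ?g k th\<bar> ^ p <= (2 * B) ^ p" by (intro power_mono) auto
  then show "\<bar>(u th - ?g k th) ^ p\<bar> <= (2 * B) ^ p" by (simp add: power_abs)
 qed
 have i2: "integrable ulb (%th. (?g k th - f th) ^ p)"
  by (intro integrable_ulb_continuous continuous_on_power continuous_on_diff cg cf)
 have ptw: "(u th - f th) ^ p <= 2 ^ p * ((u th - ?g k th) ^ p + (?g k th - f th) ^ p)" for th
  using power_add_le[OF p(1), of "u th - ?g k th" "?g k th - f th"] by simp
 have i3: "integrable ulb (%th. 2 ^ p * ((u th - ?g k th) ^ p + (?g k th - f th) ^ p))"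
  by (intro integrable_mult_right Bochner_Integration.integrable_add i1 i2)
 have i4: "integrable ulb (%th. (u th - f th) ^ p)"
 proof (rule Bochner_Integration.integrable_bound[OF i3])
  show "(%th. (u th - f th) ^ p) \<in> borel_measurable ulb"
   using u(1) borel_measurable_ulb[OF borel_measurable_continuous_onI[OF cf]]
   by (intro borel_measurable_power borel_measurable_diff)
  show "AE th in ulb. norm ((u th - f th) ^ p) <= norm (2 ^ p * ((u th - ?g k th) ^ p + (?g k th - f th) ^ p))"
  proof (rule AE_I2)
   fix th
   have "0 <= (u th - f th) ^ p" using p by (intro zero_le_even_power)
   then show "norm ((u th - f th) ^ p) <= norm (2 ^ p * ((u th - ?g k th) ^ p + (?g k th - f th) ^ p))"
    using ptw[of th] by simp
  qed
 qed
 have "(\<integral>th. (u th - f th) ^ p \<partial>ulb) <= (\<integral>th. 2 ^ p * ((u th - ?g k th) ^ p + (?g k th - f th) ^ p) \<partial>ulb)"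
  by (intro integral_mono i3 i4 ptw)
 also have "\<dots> = 2 ^ p * ((\<integral>th. (u th - ?g k th) ^ p \<partial>ulb) + (\<integral>th. (?g k th - f th) ^ p \<partial>ulb))"
  using i1 i2 by simp
 also have "\<dots> < 2 ^ p * (e / (2 * 2 ^ p) + e / (2 * 2 ^ p))"
 proof (intro mult_strict_left_mono add_less_le_mono k)
  have "(\<integral>th. (?g k th - f th) ^ p \<partial>ulb) <= (\<integral>th. \<delta> \<partial>ulb)"
  proof (rule integral_mono[OF i2])
   fix th assume "th \<in> space ulb"
   then have "\<bar>?g k th - f th\<bar> <= \<delta>" using f(2)[of th] by auto
   then have "\<bar>?g k th - f th\<bar> ^ p <= \<delta> ^ p" by (intro power_mono) auto
   also have "\<dots> <= \<delta> ^ 1" using \<delta> p by (intro power_decreasing) auto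
   finally show "(?g k th - f th) ^ p <= \<delta>" using p by (simp add: power_even_abs)
  qed simp
  also have "\<dots> = \<delta>" using ulb.prob_space by simp
  also have "\<delta> <= e / (2 * 2 ^ p) / 2" by (rule \<delta>)
  also have "\<dots> <= e / (2 * 2 ^ p) / 1" by (rule divide_left_mono) (use e in auto)
  also have "\<dots> = e / (2 * 2 ^ p)" by (rule div_by_1)
  finally show "(\<integral>th. (?g k th - f th) ^ p \<partial>ulb) <= e / (2 * 2 ^ p)" .
 qed simp
 also have "\<dots> = e" by simp
 finally show ?thesis using f(1) by blast
qed

lemma integrable_diff_power:
 fixes x y :: "'a => real"
 assumes "x \<in> borel_measurable M" "y \<in> borel_measurable M" 
   "integrable M (%th. x th ^ p)" "integrable M (%th. y th ^ p)" and p: "even p"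
 shows "integrable M (%th. (x th - y th) ^ p)"
proof (rule Bochner_Integration.integrable_bound)
 show "integrable M (%th. 2 ^ p * (x th ^ p + y th ^ p))" using assms by simp
 show "(%th. (x th - y th) ^ p) \<in> borel_measurable M" using assms by measurable
 show "AE th in M. norm ((x th - y th) ^ p) <= norm (2 ^ p * (x th ^ p + y th ^ p))"
 proof (rule AE_I2)
  fix th
  have "(x th - y th) ^ p <= 2 ^ p * (x th ^ p + y th ^ p)" "0 <= (x th - y th) ^ p"
   using power_add_le[OF p(1), of "x th" "- y th"] p(1) by (auto simp: power_minus_even zero_le_even_power)
  then show "norm ((x th - y th) ^ p) <= norm (2 ^ p * (x th ^ p + y th ^ p))" by simp
 qed
qed

lemma cospolys_Lp_dense:
 assumes u: "u \<in> borel_measurable ulb" "integrable ulb (%th. u th ^ p)" and p: "even p" "1 <= p"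
  and e: "0 < e"
 shows "\<exists>g\<in>cospolys. (\<integral>th. (u th - g th) ^ p \<partial>ulb) < e"
proof -
 have e': "0 < e / (2 * 2 ^ p)" using e by simp
 from order_tendstoD(2)[OF tendsto_integral_clamp[OF u p] this]
 obtain k where k: "(\<integral>th. (u th - max (- real k) (min (real k) (u th))) ^ p \<partial>ulb) < e / (2 * 2 ^ p)"
  unfolding eventually_sequentially by blast
 let ?v = "%th. max (- real k) (min (real k) (u th))"
 have mv: "?v \<in> borel_measurable ulb" using u(1) by measurable
 have vb: "\<bar>?v th\<bar> <= real k" for th by auto
 obtain g where g: "g \<in> cospolys" "(\<integral>th. (?v th - g th) ^ p \<partial>ulb) < e / (2 * 2 ^ p)"
  using cospolys_Lp_dense_bounded[OF mv vb p e'] by blast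
 have cg: "continuous_on UNIV g" using g(1) continuous_cospoly unfolding cospolys_def by auto
 have mg: "g \<in> borel_measurable ulb" by (intro borel_measurable_ulb borel_measurable_continuous_onI cg)
 have iv: "integrable ulb (%th. (?v th) ^ p)"
 proof (rule integrable_bounded_prob[OF ulb.prob_space_axioms, where B="real k ^ p"])
  show "(%th. (?v th) ^ p) \<in> borel_measurable ulb" using mv by (rule borel_measurable_power)
  show "\<bar>(?v th) ^ p\<bar> <= real k ^ p" for th
   unfolding power_abs by (intro power_mono vb abs_ge_zero)
 qed
 have ig: "integrable ulb (%th. (g th) ^ p)"
  by (intro integrable_ulb_continuous continuous_on_power cg)
 note id = integrable_diff_power[OF _ _ _ _ p(1)]
 have "(\<integral>th. (u th - g th) ^ p \<partial>ulb) <= (\<integral>th. 2 ^ p * ((u th - ?v th) ^ p + (?v th - g th) ^ p) \<partial>ulb)"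
 proof (rule integral_mono)
  show "(u th - g th) ^ p <= 2 ^ p * ((u th - ?v th) ^ p + (?v th - g th) ^ p)" for th
   using power_add_le[OF p(1), of "u th - ?v th" "?v th - g th"] by simp
 qed (intro integrable_mult_right Bochner_Integration.integrable_add id u mv mg iv ig)+
 also have "\<dots> = 2 ^ p * ((\<integral>th. (u th - ?v th) ^ p \<partial>ulb) + (\<integral>th. (?v th - g th) ^ p \<partial>ulb))"
  using id[OF u(1) mv u(2) iv] id[OF mv mg iv ig] by simp
 also have "\<dots> < 2 ^ p * (e / (2 * 2 ^ p) + e / (2 * 2 ^ p))"
  by (intro mult_strict_left_mono add_strict_mono k g(2)) simp
 also have "\<dots> = e" by simp
 finally show ?thesis using g(1) by blast
qed

text \<open>The means are uniformly bounded operators by \<open>fejer_mean_Lp\<close>, and on a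
  fixed cosine polynomial they converge uniformly since finitely many weights tend to 1; density
  does the rest.\<close>

lemma fejer_mean_tendsto_Lp:
 assumes u: "u \<in> borel_measurable ulb" "integrable ulb (%th. u th ^ p)" and p: "even p" "1 <= p"
 shows "(%m. \<integral>th. (fejer_mean m u th - u th) ^ p \<partial>ulb) \<longlonglongrightarrow> 0"
proof (rule LIMSEQ_I)
 fix r :: real assume r: "0 < r"
 \<comment> \<open>Splitting the p-th power twice costs 2^p * 2^p = 4^p; three terms below e then
   stay below r.\<close>
 define e where "e = r / (4 * 4 ^ p)"
 have e: "0 < e" using r by (simp add: e_def)
 obtain g where g: "g \<in> cospolys" "(\<integral>th. (u th - g th) ^ p \<partial>ulb) < e"
  using cospolys_Lp_dense[OF u p e] by blast
 then obtain q a where ga: "g = cospoly q a" unfolding cospolys_def by blast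
 have cg: "continuous_on UNIV g" unfolding ga by (rule continuous_cospoly)
 have mg: "g \<in> borel_measurable ulb" by (intro borel_measurable_ulb borel_measurable_continuous_onI cg)
 have ig: "integrable ulb (%th. (g th) ^ p)"
  by (intro integrable_ulb_continuous continuous_on_power cg)
 have ig1: "integrable ulb g" by (rule integrable_ulb_continuous[OF cg])
 have iu: "integrable ulb u"
  using integrable_lower_power[OF ulb.finite_measure_axioms u p] by simp
 have cfm: "continuous_on UNIV (fejer_mean m v)" for m v unfolding fejer_mean_def by (rule continuous_cospoly)
 have mfm: "fejer_mean m v \<in> borel_measurable ulb" for m v
  by (intro borel_measurable_ulb borel_measurable_continuous_onI cfm)
 have ifm: "integrable ulb (%th. (fejer_mean m v th) ^ p)" for m v
  by (intro integrable_ulb_continuous continuous_on_power cfm)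
 have iug: "integrable ulb (%th. (u th - g th) ^ p)" by (rule integrable_diff_power[OF u(1) mg u(2) ig p(1)])
 have muo: "(%th. u th - g th) \<in> borel_measurable ulb" using u(1) mg by measurable
 have fd: "fejer_mean m u th - fejer_mean m g th = fejer_mean m (%th. u th - g th) th" for m th
  unfolding fejer_mean_def cospoly_diff L2_coef_diff[OF iu ig1] by (simp add: right_diff_distrib)
 define om where "om m = 2 * (\<Sum>i\<le>q. \<bar>(fw m i - 1) * a i\<bar>)" for m
 have "(%m. om m ^ p) \<longlonglongrightarrow> (2 * (\<Sum>i\<le>q. \<bar>(1 - 1) * a i\<bar>)) ^ p"
  unfolding om_def by (intro tendsto_intros fw_lim)
 then have "(%m. om m ^ p) \<longlonglongrightarrow> 0" using p by (simp add: power_0_left)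
 from order_tendstoD(2)[OF this e] obtain M where M: "!!m. M <= m ==> om m ^ p < e"
  unfolding eventually_sequentially by blast
 have gd: "\<bar>fejer_mean m g th - g th\<bar> <= om m" if "q <= m" for m th
 proof -
  have "fejer_mean m g th = cospoly q (%i. fw m i * a i) th"
   unfolding fejer_mean_def ga L2_coef_cospoly cospoly_def using that
   by (intro sum.mono_neutral_cong_right) auto
  then have "fejer_mean m g th - g th = cospoly q (%i. (fw m i - 1) * a i) th"
   unfolding ga by (simp add: cospoly_diff left_diff_distrib)
  then show ?thesis using abs_cospoly_le[of q "%i. (fw m i - 1) * a i" th] by (simp add: om_def)
 qed
 have "norm ((\<integral>th. (fejer_mean m u th - u th) ^ p \<partial>ulb) - 0) < r" if m: "max M q <= m" for m
 proof -
  let ?A = "%th. (fejer_mean m u th - fejer_mean m g th) ^ p" and ?B = "%th. (fejer_mean m g th - g th) ^ p"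
  let ?C = "%th. (u th - g th) ^ p"
  have iA: "integrable ulb ?A" by (rule integrable_diff_power[OF mfm mfm ifm ifm p(1)])
  have iB: "integrable ulb ?B" by (rule integrable_diff_power[OF mfm mg ifm ig p(1)])
  have "(\<integral>th. (fejer_mean m u th - u th) ^ p \<partial>ulb) <= (\<integral>th. 4 ^ p * (?A th + ?B th + ?C th) \<partial>ulb)"
  proof (rule integral_mono)
   show "integrable ulb (%th. (fejer_mean m u th - u th) ^ p)"
    by (rule integrable_diff_power[OF mfm u(1) ifm u(2) p(1)])
   show "integrable ulb (%th. 4 ^ p * (?A th + ?B th + ?C th))"
    by (intro integrable_mult_right Bochner_Integration.integrable_add iA iB iug)
   fix th
   have "(fejer_mean m u th - u th) ^ p <= 2 ^ p * (?A th + (fejer_mean m g th - u th) ^ p)"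
    using power_add_le[OF p(1), of "fejer_mean m u th - fejer_mean m g th" "fejer_mean m g th - u th"] by simp
   also have "(fejer_mean m g th - u th) ^ p <= 2 ^ p * (?B th + ?C th)"
    using power_add_le[OF p(1), of "fejer_mean m g th - g th" "- (u th - g th)"] p(1)
    by (simp add: power_minus_even del: minus_diff_eq)
   also have "?A th <= 2 ^ p * ?A th"
    using p(1) mult_right_mono[of 1 "2 ^ p" "?A th"] by (simp add: zero_le_even_power)
   finally have "(fejer_mean m u th - u th) ^ p <= 2 ^ p * (2 ^ p * ?A th + 2 ^ p * (?B th + ?C th))" by simp
   also have "\<dots> = 4 ^ p * (?A th + ?B th + ?C th)"
   proof -
    have "(4 :: real) ^ p = 2 ^ p * 2 ^ p" by (simp flip: power_mult_distrib)
    then show ?thesis by (simp add: algebra_simps)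
   qed
   finally show "(fejer_mean m u th - u th) ^ p <= 4 ^ p * (?A th + ?B th + ?C th)" .
  qed
  also have "\<dots> = 4 ^ p * ((\<integral>th. ?A th \<partial>ulb) + (\<integral>th. ?B th \<partial>ulb) + (\<integral>th. ?C th \<partial>ulb))"
   using iA iB iug by simp
  also have "\<dots> < 4 ^ p * (e + e + e)"
  proof (intro mult_strict_left_mono add_strict_mono g(2))
   have "(\<integral>th. ?A th \<partial>ulb) <= (\<integral>th. ?C th \<partial>ulb)"
    unfolding fd by (rule fejer_mean_Lp[OF muo iug p])
   then show "(\<integral>th. ?A th \<partial>ulb) < e" using g(2) by simp
   have "(\<integral>th. ?B th \<partial>ulb) <= (\<integral>th. om m ^ p \<partial>ulb)"
   proof (intro integral_mono iB)
    fix th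
    have "\<bar>fejer_mean m g th - g th\<bar> ^ p <= om m ^ p" using gd[of m th] m by (intro power_mono) auto
    then show "?B th <= om m ^ p" using p by (simp add: power_even_abs)
   qed simp
   also have "\<dots> < e" using M[of m] m ulb.prob_space by simp
   finally show "(\<integral>th. ?B th \<partial>ulb) < e" .
  qed simp
  also have "\<dots> < r" using r by (simp add: e_def)
  finally have "(\<integral>th. (fejer_mean m u th - u th) ^ p \<partial>ulb) < r" .
  moreover have "0 <= (\<integral>th. (fejer_mean m u th - u th) ^ p \<partial>ulb)"
   using p(1) by (intro integral_nonneg_AE AE_I2) (simp add: zero_le_even_power)
  ultimately show ?thesis by simp
 qed
 then show "\<exists>no. \<forall>m\<ge>no. norm ((\<integral>th. (fejer_mean m u th - u th) ^ p \<partial>ulb) - 0) < r" by blast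
qed

section \<open>Consistency of the scheme along a solution\<close>

lemma abs_coef_le: "\<bar>coef h i\<bar> <= (real i * pi + 1) * norm h"
proof -
 let ?w = "%i. (- eig (Suc i)) powr (- 1)"
 have S: "summable (%i. ?w i * (coef h (Suc i))^2)" using coef[of h] by (simp add: V_def)
 have nn: "0 <= (\<Sum>i. ?w i * (coef h (Suc i))^2)" by (intro suminf_nonneg S) simp
 have n2: "(norm h)^2 = (coef h 0)^2 + (\<Sum>i. ?w i * (coef h (Suc i))^2)"
  using nn by (simp add: norm_H_def V_norm_def V_seminorm_def)
 show ?thesis
 proof (cases i)
  case 0
  have "(coef h 0)^2 <= (norm h)^2" unfolding n2 using nn by simp
  then show ?thesis using 0 by (simp add: abs_le_square_iff[symmetric])
 next
  case (Suc j)
  have "?w j * (coef h (Suc j))^2 <= (\<Sum>i. ?w i * (coef h (Suc i))^2)"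
   using sum_le_suminf[OF S, of "{j}"] by simp
  also have "\<dots> <= (norm h)^2" unfolding n2 by simp
  finally have "(coef h i)^2 / freq i <= (norm h)^2"
   unfolding Suc by (simp add: eig_eq_freq powr_minus_divide freq_def)
  then have "(coef h i)^2 <= (norm h)^2 * freq i" using Suc freq_ge_1[of i] by (simp add: pos_divide_le_eq)
  also have "\<dots> = ((real i * pi) * norm h)^2" by (simp add: freq_def power_mult_distrib mult.commute)
  finally have "\<bar>coef h i\<bar> <= \<bar>(real i * pi) * norm h\<bar>" by (simp only: abs_le_square_iff)
  also have "\<dots> <= (real i * pi + 1) * norm h" by (simp add: abs_mult algebra_simps)
  finally show ?thesis .
 qed
qed

lemma continuous_coef: "continuous_on A (%h. coef h i)"
proof (rule continuous_on_subset[OF _ subset_UNIV])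
 have "(real i * pi + 1)-lipschitz_on UNIV (%h. coef h i)"
 proof (rule lipschitz_onI)
  show "0 <= real i * pi + 1" by simp
  show "dist (coef h i) (coef k i) <= (real i * pi + 1) * dist h k" for h k
   using abs_coef_le[of "h - k" i] by (simp add: dist_norm minus_H.rep_eq)
 qed
 then show "continuous_on UNIV (%h. coef h i)" by (rule lipschitz_on_continuous_on)
qed

text \<open>Density of the consistency error. In use, u is the exact solution and v its Fejer mean;
  the numerical value does not occur.\<close>

definition err :: "real => nat => real => real => real" where
 "err lam n v u = \<bar>gpoly n v - gpoly n u\<bar> * \<bar>v - u\<bar> + \<bar>lam\<bar> * (v - u)^2"

lemma err_nonneg: "0 <= err lam n v u"
 by (simp add: err_def)

text \<open>Monotonicity lets the consistency error be measured without any bound on \<open>a\<close>: if \<open>a\<close> lies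
 between \<open>u\<close> and \<open>v\<close> the product is controlled by the increment, otherwise it has the good sign.\<close>

lemma fpoly_consistency:
 "(fpoly lam n a - fpoly lam n u) * (a - v) <= err lam n v u + 2 * \<bar>lam\<bar> * (a - v)^2"
proof -
 have "(gpoly n a - gpoly n u) * (a - v) <= \<bar>gpoly n v - gpoly n u\<bar> * \<bar>v - u\<bar>"
 proof (cases "(gpoly n a - gpoly n u) * (a - v) <= 0")
  case True
  also have "0 <= \<bar>gpoly n v - gpoly n u\<bar> * \<bar>v - u\<bar>" by simp
  finally show ?thesis .
 next
  case False
  have "\<bar>gpoly n a - gpoly n u\<bar> <= \<bar>gpoly n v - gpoly n u\<bar> \<and> \<bar>a - v\<bar> <= \<bar>v - u\<bar>"
  proof (cases "a <= u")
   case True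
   then have "gpoly n u <= gpoly n a" by (rule gpoly_antimono)
   with False have "v <= a" by (smt (verit) mult_nonneg_nonpos)
   then show ?thesis using True gpoly_antimono[of v a n] gpoly_antimono[of a u n] by auto
  next
   case 2: False
   then have "gpoly n a <= gpoly n u" by (intro gpoly_antimono) simp
   with False have "a <= v" by (smt (verit) mult_nonpos_nonneg)
   then show ?thesis using 2 gpoly_antimono[of a v n] gpoly_antimono[of u a n] by auto
  qed
  then have "\<bar>gpoly n a - gpoly n u\<bar> * \<bar>a - v\<bar> <= \<bar>gpoly n v - gpoly n u\<bar> * \<bar>v - u\<bar>"
   by (intro mult_mono) auto
  then show ?thesis by (metis abs_ge_self abs_mult order_trans)
 qed
 moreover have "lam * ((a - u) * (a - v)) <= \<bar>lam\<bar> * ((v - u)^2 + 2 * (a - v)^2)"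
 proof -
  have "\<bar>(a - u) * (a - v)\<bar> <= (v - u)^2 + 2 * (a - v)^2"
  proof -
   have "\<bar>(r + s) * r\<bar> <= s^2 + 2 * r^2" for r s :: real
   proof -
    have "0 <= s * s + s * r + r * r / 4" "0 <= s * s - s * r + r * r / 4" "0 <= r * r"
     using zero_le_power2[of "s + r / 2"] zero_le_power2[of "s - r / 2"]
     by (simp_all add: power2_eq_square algebra_simps)
    then show ?thesis
     unfolding abs_le_iff power2_eq_square distrib_right by (intro conjI; linarith)
   qed
   from this[of "a - v" "v - u"] show ?thesis by simp
  qed
  then have "\<bar>lam\<bar> * \<bar>(a - u) * (a - v)\<bar> <= \<bar>lam\<bar> * ((v - u)^2 + 2 * (a - v)^2)"
   by (intro mult_left_mono) auto
  then show ?thesis by (metis abs_ge_self abs_mult order_trans)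
 qed
 ultimately show ?thesis by (simp add: err_def fpoly_gpoly algebra_simps)
qed

lemma gpoly_diff_le:
 assumes "\<bar>v\<bar> <= B"
 shows "\<bar>gpoly n v - gpoly n u\<bar> <= 2 * (real n + 1) * (3 + 2 * B ^ (2 * n)) * (B + 2) * (1 + u ^ (2 * n + 2))"
  "\<bar>v - u\<bar> <= (B + 2) * (1 + u ^ (2 * n + 2))"
proof -
 have B: "0 <= B" using assms by linarith
 have u0: "0 <= u ^ (2 * n + 2)" by (intro zero_le_even_power) simp
 have p1: "\<bar>u\<bar> <= 1 + u ^ (2 * n + 2)" using power_le_even_power[of 1 "2 * n + 2" u] by simp
 have p2: "u ^ (2 * n) <= 1 + u ^ (2 * n + 2)"
  using power_le_even_power[of "2 * n" "2 * n + 2" u] by (simp add: power_even_abs)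
 have p3: "\<bar>u\<bar> * u ^ (2 * n) <= 1 + u ^ (2 * n + 2)"
  using power_le_even_power[of "2 * n + 1" "2 * n + 2" u] by (simp add: power_even_abs)
 have vn: "v ^ (2 * n) <= B ^ (2 * n)" using power_mono[OF assms, of "2 * n"] by (simp add: power_even_abs)
 have Bn: "0 <= B ^ (2 * n)" by (intro zero_le_even_power) simp
 have un: "0 <= u ^ (2 * n)" by (intro zero_le_even_power) simp
 have "B * 1 <= B * (1 + u ^ (2 * n + 2))" using B u0 by (intro mult_left_mono) auto
 then show "\<bar>v - u\<bar> <= (B + 2) * (1 + u ^ (2 * n + 2))"
  using assms p1 u0 by (simp add: distrib_right)
 let ?Q = "1 + u ^ (2 * n + 2)"
 have "\<bar>v - u\<bar> * (1 + v ^ (2 * n) + u ^ (2 * n)) <= (B + \<bar>u\<bar>) * (1 + B ^ (2 * n) + u ^ (2 * n))"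
  using assms vn un Bn by (intro mult_mono) auto
 also have "\<dots> = (1 + B ^ (2 * n)) * B + B * u ^ (2 * n) + (1 + B ^ (2 * n)) * \<bar>u\<bar> + \<bar>u\<bar> * u ^ (2 * n)"
  by (simp add: algebra_simps)
 also have "\<dots> <= (1 + B ^ (2 * n)) * B * ?Q + B * ?Q + (1 + B ^ (2 * n)) * ?Q + ?Q"
 proof -
  have "(1 + B ^ (2 * n)) * B * 1 <= (1 + B ^ (2 * n)) * B * ?Q"
   using B Bn u0 by (intro mult_left_mono mult_nonneg_nonneg) auto
  moreover have "B * u ^ (2 * n) <= B * ?Q" using p2 B by (rule mult_left_mono)
  moreover have "(1 + B ^ (2 * n)) * \<bar>u\<bar> <= (1 + B ^ (2 * n)) * ?Q" using p1 Bn by (intro mult_left_mono) auto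
  ultimately show ?thesis using p3 by linarith
 qed
 also have "\<dots> <= (3 + 2 * B ^ (2 * n)) * (B + 2) * ?Q"
 proof -
  have "(1 + B ^ (2 * n)) * B + B + (1 + B ^ (2 * n)) + 1 <= (3 + 2 * B ^ (2 * n)) * (B + 2)"
   using B Bn mult_nonneg_nonneg[OF Bn B] by (simp add: algebra_simps)
  from mult_right_mono[OF this, of ?Q] u0 show ?thesis by (simp add: distrib_right)
 qed
 finally have "2 * (real n + 1) * (\<bar>v - u\<bar> * (1 + v ^ (2 * n) + u ^ (2 * n))) <= 2 * (real n + 1) * ((3 + 2 * B ^ (2 * n)) * (B + 2) * ?Q)"
  by (intro mult_left_mono) auto
 moreover have "\<bar>gpoly n v - gpoly n u\<bar> <= 2 * (real n + 1) * (\<bar>v - u\<bar> * (1 + v ^ (2 * n) + u ^ (2 * n)))"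
  using gpoly_lipschitz[of n v u] by (simp only: mult.assoc)
 ultimately show "\<bar>gpoly n v - gpoly n u\<bar> <= 2 * (real n + 1) * (3 + 2 * B ^ (2 * n)) * (B + 2) * ?Q"
  by (simp only: mult.assoc)
qed

text \<open>Moving the Fejer mean from an intermediate time to the end of the step costs its
  increment times the integrable weight 1 + u^(2n+2). The constant depends on B, hence on m in the
  application; this is harmless because the time step vanishes for fixed m.\<close>

lemma err_shift:
 "\<exists>C\<ge>0. \<forall>v v' u. \<bar>v\<bar> <= B --> \<bar>v'\<bar> <= B --> err lam n v' u <= err lam n v u + \<bar>v' - v\<bar> * C * (1 + u ^ (2 * n + 2))"
proof (cases "0 <= B")
 case False
 then show ?thesis by (intro exI[of _ 0]) auto
next
 case True
 have Bn: "0 <= B ^ (2 * n)" by (intro zero_le_even_power) simp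
 define G where "G = 2 * (real n + 1) * (3 + 2 * B ^ (2 * n)) * (B + 2)"
 define L where "L = 2 * (real n + 1) * (1 + B ^ (2 * n) + B ^ (2 * n))"
 define C where "C = L * (B + 2) + G + 2 * \<bar>lam\<bar> * (B + 2)"
 have G: "0 <= G" unfolding G_def using True Bn by simp
 have L: "0 <= L" unfolding L_def using True Bn by simp
 have C: "0 <= C" unfolding C_def using G L True by simp
 have "err lam n v' u <= err lam n v u + \<bar>v' - v\<bar> * C * (1 + u ^ (2 * n + 2))" if v: "\<bar>v\<bar> <= B" "\<bar>v'\<bar> <= B" for v v' u
 proof -
  let ?Q = "1 + u ^ (2 * n + 2)"
  have Q: "0 <= ?Q" using zero_le_even_power[of "2 * n + 2" u] by simp
  have pw: "a ^ (2 * n) <= B ^ (2 * n)" if "\<bar>a\<bar> <= B" for a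
   using power_mono[OF that, of "2 * n"] by (simp add: power_even_abs)
  have gl: "\<bar>gpoly n v' - gpoly n v\<bar> <= L * \<bar>v' - v\<bar>"
  proof -
   have "2 * (real n + 1) * \<bar>v' - v\<bar> * (1 + v' ^ (2 * n) + v ^ (2 * n)) <= 2 * (real n + 1) * \<bar>v' - v\<bar> * (1 + B ^ (2 * n) + B ^ (2 * n))"
    using pw v by (intro mult_left_mono add_mono) auto
   then show ?thesis using gpoly_lipschitz[of n v' v] by (simp add: L_def mult_ac)
  qed
  have "\<bar>gpoly n v' - gpoly n u\<bar> * \<bar>v' - u\<bar>
    <= (\<bar>gpoly n v' - gpoly n v\<bar> + \<bar>gpoly n v - gpoly n u\<bar>) * \<bar>v' - u\<bar>"
   by (intro mult_right_mono) auto
  also have "\<dots> <= \<bar>gpoly n v' - gpoly n v\<bar> * \<bar>v' - u\<bar> + \<bar>gpoly n v - gpoly n u\<bar> * (\<bar>v - u\<bar> + \<bar>v' - v\<bar>)"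
   unfolding distrib_right by (intro add_mono mult_left_mono) auto
  also have "\<dots> <= (L * \<bar>v' - v\<bar>) * ((B + 2) * ?Q) + (\<bar>gpoly n v - gpoly n u\<bar> * \<bar>v - u\<bar> + (G * ?Q) * \<bar>v' - v\<bar>)"
   unfolding distrib_left[of "\<bar>gpoly n v - gpoly n u\<bar>"]
  proof (intro add_mono order_refl)
   show "\<bar>gpoly n v' - gpoly n v\<bar> * \<bar>v' - u\<bar> <= (L * \<bar>v' - v\<bar>) * ((B + 2) * ?Q)"
    by (rule mult_mono[OF gl gpoly_diff_le(2)[OF v(2)]]) (use L in auto)
   show "\<bar>gpoly n v - gpoly n u\<bar> * \<bar>v' - v\<bar> <= (G * ?Q) * \<bar>v' - v\<bar>"
    unfolding G_def by (rule mult_right_mono[OF gpoly_diff_le(1)[OF v(1)]]) simp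
  qed
  finally have 1: "\<bar>gpoly n v' - gpoly n u\<bar> * \<bar>v' - u\<bar>
    <= \<bar>gpoly n v - gpoly n u\<bar> * \<bar>v - u\<bar> + \<bar>v' - v\<bar> * (L * (B + 2) + G) * ?Q"
   by (simp add: algebra_simps)
  have "(v' - u)^2 - (v - u)^2 = (v' - v) * ((v' - u) + (v - u))" by (simp add: power2_eq_square algebra_simps)
  also have "\<dots> <= \<bar>v' - v\<bar> * \<bar>(v' - u) + (v - u)\<bar>" by (metis abs_ge_self abs_mult)
  also have "\<dots> <= \<bar>v' - v\<bar> * (2 * ((B + 2) * ?Q))"
   using gpoly_diff_le(2)[OF v(1), where n=n and u=u] gpoly_diff_le(2)[OF v(2), where n=n and u=u] by (intro mult_left_mono) auto
  finally have "\<bar>lam\<bar> * ((v' - u)^2 - (v - u)^2) <= \<bar>lam\<bar> * (\<bar>v' - v\<bar> * (2 * ((B + 2) * ?Q)))"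
   by (intro mult_left_mono) auto
  then show ?thesis using 1 unfolding err_def C_def by (simp add: algebra_simps)
 qed
 then show ?thesis using C by blast
qed

lemma err_le_bounded:
 "\<exists>C\<ge>0. \<forall>v u. \<bar>v\<bar> <= B --> err lam n v u <= C * (1 + u ^ (2 * n + 2))"
proof (cases "0 <= B")
 case False
 then show ?thesis by (intro exI[of _ 0]) auto
next
 case True
 have Bn: "0 <= B ^ (2 * n)" by (intro zero_le_even_power) simp
 obtain C1 where C1: "0 <= C1" "!!v v' u. \<bar>v\<bar> <= B ==> \<bar>v'\<bar> <= B ==> err lam n v' u <= err lam n v u + \<bar>v' - v\<bar> * C1 * (1 + u ^ (2 * n + 2))"
  using err_shift[of B lam n] by blast
 have e0: "err lam n 0 u <= (2 * (real n + 1) + \<bar>lam\<bar>) * 4 * (1 + u ^ (2 * n + 2))" for u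
 proof -
  have u0: "0 <= u ^ (2 * n + 2)" by (intro zero_le_even_power) simp
  have p2: "u^2 <= 1 + u ^ (2 * n + 2)"
   using power_le_even_power[of 2 "2 * n + 2" u] by simp
  have "\<bar>gpoly n 0 - gpoly n u\<bar> * \<bar>u\<bar> <= (2 * (real n + 1) * \<bar>0 - u\<bar> * (1 + 0 ^ (2 * n) + u ^ (2 * n))) * \<bar>u\<bar>"
   by (intro mult_right_mono gpoly_lipschitz) auto
  also have "\<dots> = 2 * (real n + 1) * ((\<bar>u\<bar> * \<bar>u\<bar>) * (1 + 0 ^ (2 * n) + u ^ (2 * n)))"
   by simp
  also have "(\<bar>u\<bar> * \<bar>u\<bar>) * (1 + 0 ^ (2 * n) + u ^ (2 * n)) = u^2 * (1 + 0 ^ (2 * n)) + u ^ (2 * n + 2)"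
   by (simp only: abs_mult_self_eq power2_eq_square power_add distrib_left mult.commute)
  also have "2 * (real n + 1) * (u^2 * (1 + 0 ^ (2 * n)) + u ^ (2 * n + 2)) <= 2 * (real n + 1) * (4 * (1 + u ^ (2 * n + 2)))"
  proof (rule mult_left_mono)
   show "u^2 * (1 + 0 ^ (2 * n)) + u ^ (2 * n + 2) <= 4 * (1 + u ^ (2 * n + 2))"
    using p2 u0 by (cases "n = 0") (auto simp: power_0_left power2_eq_square)
  qed simp
  finally have 1: "\<bar>gpoly n 0 - gpoly n u\<bar> * \<bar>u\<bar> <= 2 * (real n + 1) * (4 * (1 + u ^ (2 * n + 2)))" .
  have "\<bar>lam\<bar> * u^2 <= \<bar>lam\<bar> * (4 * (1 + u ^ (2 * n + 2)))"
   using p2 u0 by (intro mult_left_mono) auto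
  moreover have "err lam n 0 u = \<bar>gpoly n 0 - gpoly n u\<bar> * \<bar>u\<bar> + \<bar>lam\<bar> * u^2" by (simp add: err_def)
  moreover have "(2 * (real n + 1) + \<bar>lam\<bar>) * 4 * Q = 2 * (real n + 1) * (4 * Q) + \<bar>lam\<bar> * (4 * Q)" for Q
   by (simp only: distrib_right mult.assoc)
  ultimately show ?thesis using 1 by (metis add_mono)
 qed
 show ?thesis
 proof (intro exI[of _ "(2 * (real n + 1) + \<bar>lam\<bar>) * 4 + B * C1"] conjI allI impI)
  show "0 <= (2 * (real n + 1) + \<bar>lam\<bar>) * 4 + B * C1" using True C1 by simp
  fix v u :: real assume v: "\<bar>v\<bar> <= B"
  have Q: "0 <= 1 + u ^ (2 * n + 2)" using zero_le_even_power[of "2 * n + 2" u] by simp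
  have "err lam n v u <= err lam n 0 u + \<bar>v - 0\<bar> * C1 * (1 + u ^ (2 * n + 2))"
   using True v by (intro C1) auto
  also have "\<dots> <= (2 * (real n + 1) + \<bar>lam\<bar>) * 4 * (1 + u ^ (2 * n + 2)) + B * C1 * (1 + u ^ (2 * n + 2))"
   using v C1 Q by (intro add_mono e0 mult_right_mono) auto
  finally show "err lam n v u <= ((2 * (real n + 1) + \<bar>lam\<bar>) * 4 + B * C1) * (1 + u ^ (2 * n + 2))"
   by (simp add: distrib_right)
 qed
qed

text \<open>For each q in {1, u, v} either (v - u)^2 <= \<delta> q^2, or q is controlled by (v -
  u)^2 / \<delta>. Consequently \<open>err\<close> is small as soon as v is close to u in L^(2n+2),
  the growth being carried by the factor \<delta>.\<close>

lemma err_young: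
 assumes \<delta>: "0 < \<delta>" "\<delta> <= 1"
 shows "err lam n v u <= (2 * (real n + 1) + \<bar>lam\<bar>) * (\<delta> * (1 + u ^ (2 * n + 2) + v ^ (2 * n + 2)) + 3 / \<delta> ^ n * (v - u) ^ (2 * n + 2))"
proof -
 have y: "(v - u)^2 * q ^ (2 * n) <= \<delta> * q ^ (2 * n + 2) + 1 / \<delta> ^ n * (v - u) ^ (2 * n + 2)" for q
 proof (cases "(v - u)^2 <= \<delta> * q^2")
  case True
  then have "(v - u)^2 * q ^ (2 * n) <= (\<delta> * q^2) * q ^ (2 * n)"
   by (intro mult_right_mono zero_le_even_power) auto
  also have "\<dots> = \<delta> * q ^ (2 * n + 2)" by (simp add: power2_eq_square)
  also have "\<dots> <= \<delta> * q ^ (2 * n + 2) + 1 / \<delta> ^ n * (v - u) ^ (2 * n + 2)"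
   using \<delta> zero_le_even_power[of "2 * n + 2" "v - u"] by simp
  finally show ?thesis .
 next
  case False
  then have "q^2 <= (v - u)^2 / \<delta>" using \<delta> by (simp add: pos_le_divide_eq mult.commute)
  then have "(q^2) ^ n <= ((v - u)^2 / \<delta>) ^ n" by (intro power_mono) auto
  then have "(v - u)^2 * (q^2) ^ n <= (v - u)^2 * ((v - u)^2 / \<delta>) ^ n" by (intro mult_left_mono) auto
  also have "\<dots> = 1 / \<delta> ^ n * (v - u) ^ (2 * n + 2)"
   unfolding power_add power_mult power_divide by simp
  also have "\<dots> <= \<delta> * q ^ (2 * n + 2) + 1 / \<delta> ^ n * (v - u) ^ (2 * n + 2)"
   using \<delta> zero_le_even_power[of "2 * n + 2" q] by simp
  finally show ?thesis by (simp add: power_mult)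
 qed
 have "(v - u)^2 * (1 + v ^ (2 * n) + u ^ (2 * n))
   <= \<delta> * (1 + u ^ (2 * n + 2) + v ^ (2 * n + 2)) + 3 / \<delta> ^ n * (v - u) ^ (2 * n + 2)"
 proof -
  have "(v - u)^2 * (1 + v ^ (2 * n) + u ^ (2 * n))
    = (v - u)^2 * 1 ^ (2 * n) + (v - u)^2 * v ^ (2 * n) + (v - u)^2 * u ^ (2 * n)"
   by (simp add: distrib_left)
  also have "\<dots> <= (\<delta> * 1 ^ (2 * n + 2) + 1 / \<delta> ^ n * (v - u) ^ (2 * n + 2))
    + (\<delta> * v ^ (2 * n + 2) + 1 / \<delta> ^ n * (v - u) ^ (2 * n + 2))
    + (\<delta> * u ^ (2 * n + 2) + 1 / \<delta> ^ n * (v - u) ^ (2 * n + 2))"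
   by (intro add_mono y)
  also have "\<dots> = \<delta> * (1 + u ^ (2 * n + 2) + v ^ (2 * n + 2)) + 3 / \<delta> ^ n * (v - u) ^ (2 * n + 2)"
  proof -
   have "(\<delta> * 1 + 1 / D * w) + (\<delta> * Q + 1 / D * w) + (\<delta> * P + 1 / D * w) = \<delta> * (1 + P + Q) + 3 / D * w"
    for P Q D w :: real by (simp add: algebra_simps)
   then show ?thesis unfolding power_one .
  qed
  finally show ?thesis .
 qed
 moreover have "err lam n v u <= (2 * (real n + 1) + \<bar>lam\<bar>) * ((v - u)^2 * (1 + v ^ (2 * n) + u ^ (2 * n)))"
 proof -
  have "\<bar>gpoly n v - gpoly n u\<bar> * \<bar>v - u\<bar> <= (2 * (real n + 1) * \<bar>v - u\<bar> * (1 + v ^ (2 * n) + u ^ (2 * n))) * \<bar>v - u\<bar>"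
   by (intro mult_right_mono gpoly_lipschitz) auto
  also have "\<dots> = 2 * (real n + 1) * ((\<bar>v - u\<bar> * \<bar>v - u\<bar>) * (1 + v ^ (2 * n) + u ^ (2 * n)))"
   by (simp only: mult_ac)
  also have "\<bar>v - u\<bar> * \<bar>v - u\<bar> = (v - u)^2" by (simp add: power2_eq_square)
  finally have 1: "\<bar>gpoly n v - gpoly n u\<bar> * \<bar>v - u\<bar> <= 2 * (real n + 1) * ((v - u)^2 * (1 + v ^ (2 * n) + u ^ (2 * n)))" .
  have "\<bar>lam\<bar> * ((v - u)^2 * 1) <= \<bar>lam\<bar> * ((v - u)^2 * (1 + v ^ (2 * n) + u ^ (2 * n)))"
   using zero_le_even_power[of "2 * n" u] zero_le_even_power[of "2 * n" v] by (intro mult_left_mono) auto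
  then show ?thesis using 1 by (simp add: err_def distrib_right)
 qed
 ultimately show ?thesis
  by (meson order_trans mult_left_mono add_nonneg_nonneg abs_ge_zero of_nat_0_le_iff mult_nonneg_nonneg zero_le_numeral zero_le_one)
qed

section \<open>Error analysis along one fixed trajectory\<close>

locale weak_path =
 fixes b :: "nat => real" and lam :: real and n :: nat and x :: H
  and w :: "nat => real => real" and \<xi> :: "real => H" and u :: "real => real => real"
 assumes b0: "b 0 = 0" and cont: "continuous_on {0..} \<xi>" and init: "\<xi> 0 = x"
  and meas_u: "case_prod u \<in> borel_measurable (lborel \<Otimes>\<^sub>M lborel)"
  and int_u: "!!T. 0 < T ==> set_integrable (lborel \<Otimes>\<^sub>M lborel) ({0<..<T} \<times> {0<..<1})
        (%(t, th). \<bar>u t th\<bar> ^ (2 * n + 2))"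
  and repr: "AE t in lborel. 0 < t --> coef (\<xi> t) = L2_coef (u t)"
  and evol: "!!i t. 0 <= t ==> coef (\<xi> t) i
     + 1/2 * set_lebesgue_integral lborel {0..t}
       (%s. (eig i)^2 * coef (\<xi> s) i + eig i * L2_coef (%th. fpoly lam n (u s th)) i)
     = coef x i + sqrt (b i) * w i t"
begin

text \<open>Constant on negative times, so that continuity and measurability hold on the whole
  line.\<close>

definition y :: "real => nat => real" where
 "y t i = coef (\<xi> (max 0 t)) i"

text \<open>The Fejer mean of the solution, written with the coefficients of \<xi> because these
  exist and are continuous at every time, whereas u represents the solution only at almost every
  time.\<close>

definition V :: "nat => real => real => real" where
 "V m t = cospoly m (%i. fw m i * y t i)"

definition U :: "real => real" where
 "U t = (\<integral>th. u t th ^ (2 * n + 2) \<partial>ulb)"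

lemma continuous_y: "continuous_on A (%t. y t i)"
proof -
 have "continuous_on UNIV (%t. \<xi> (max 0 t))"
  by (intro continuous_on_compose2[OF cont] continuous_intros) auto
 then have "continuous_on UNIV (%t. y t i)"
  unfolding y_def by (intro continuous_on_compose2[OF continuous_coef[of UNIV]]) auto
 then show ?thesis by (rule continuous_on_subset) simp
qed

lemma y_nonneg: "0 <= t ==> y t i = coef (\<xi> t) i"
 by (simp add: y_def max_absorb2)

lemma measurable_y [measurable]: "(%t. y t i) \<in> borel_measurable borel"
 by (intro borel_measurable_continuous_onI continuous_y)

lemma measurable_u_pair [measurable]: "(%p. u (fst p) (snd p)) \<in> borel_measurable (lborel \<Otimes>\<^sub>M lborel)"
 using meas_u by (simp add: case_prod_beta')

lemma measurable_u: "u t \<in> borel_measurable ulb"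
proof -
 have "(%th. u t th) \<in> borel_measurable lborel"
  using measurable_compose[OF measurable_Pair1'[of t lborel lborel] measurable_u_pair] by simp
 then show ?thesis by (simp add: borel_measurable_ulb)
qed

text \<open>Fubini on (0,T) x (0,1), packaged for integrands dominated by 1 + u^(2n+2), the only
  integrability that a solution offers.\<close>

lemma strip:
 fixes F :: "real => real => real"
 assumes F: "(%p. F (fst p) (snd p)) \<in> borel_measurable (lborel \<Otimes>\<^sub>M lborel)"
  and bd: "!!t th. 0 < t ==> t <= T ==> \<bar>F t th\<bar> <= C * (1 + u t th ^ (2 * n + 2))"
 shows "AE t in lborel. t \<in> {0<..T} --> integrable ulb (F t)"
  "set_integrable lborel {0<..T} (%t. \<integral>th. F t th \<partial>ulb)"
proof -
 let ?S = "{0<..T} \<times> {0<..<1 :: real}"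
 let ?f = "%p. indicator ?S p *\<^sub>R F (fst p) (snd p)"
 have Smeas: "?S \<in> sets (lborel \<Otimes>\<^sub>M lborel)" by simp
 have i0: "integrable (lborel \<Otimes>\<^sub>M lborel) (%p. indicator ?S p *\<^sub>R (1 :: real))"
 proof -
  have "emeasure (lborel \<Otimes>\<^sub>M lborel) ?S = emeasure lborel {0<..T} * emeasure lborel {0<..<1 :: real}"
   by (rule lborel.emeasure_pair_measure_Times) auto
  also have "\<dots> < \<infinity>" by (cases "0 <= T") (auto simp: ennreal_mult_less_top)
  finally show ?thesis using Smeas by (simp add: integrable_indicator_iff)
 qed
 have i1: "integrable (lborel \<Otimes>\<^sub>M lborel) (%p. indicator ?S p *\<^sub>R (u (fst p) (snd p) ^ (2 * n + 2)))"
 proof -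
  have "set_integrable (lborel \<Otimes>\<^sub>M lborel) ?S (%(t, th). \<bar>u t th\<bar> ^ (2 * n + 2))"
   by (rule set_integrable_subset[OF int_u[of "max 1 (T + 1)"]]) auto
  moreover have "\<bar>v\<bar> ^ (2 * n + 2) = v ^ (2 * n + 2)" for v :: real by (rule power_even_abs) simp
  ultimately show ?thesis unfolding set_integrable_def case_prod_beta' by (simp only:)
 qed
 have i2: "integrable (lborel \<Otimes>\<^sub>M lborel) (%p. C * (indicator ?S p *\<^sub>R (1 :: real) + indicator ?S p *\<^sub>R (u (fst p) (snd p) ^ (2 * n + 2))))"
  by (intro integrable_mult_right Bochner_Integration.integrable_add i0 i1)
 have if': "integrable (lborel \<Otimes>\<^sub>M lborel) ?f"
 proof (rule Bochner_Integration.integrable_bound[OF i2])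
  show "?f \<in> borel_measurable (lborel \<Otimes>\<^sub>M lborel)" using F Smeas by (intro borel_measurable_scaleR borel_measurable_indicator)
  show "AE p in lborel \<Otimes>\<^sub>M lborel. norm (?f p) <= norm (C * (indicator ?S p *\<^sub>R (1 :: real) + indicator ?S p *\<^sub>R (u (fst p) (snd p) ^ (2 * n + 2))))"
  proof (rule AE_I2)
   fix p :: "real \<times> real"
   show "norm (?f p) <= norm (C * (indicator ?S p *\<^sub>R (1 :: real) + indicator ?S p *\<^sub>R (u (fst p) (snd p) ^ (2 * n + 2))))"
   proof (cases "p \<in> ?S")
    case True
    then have "0 < fst p" "fst p <= T" by auto
    from order_trans[OF bd[OF this, of "snd p"] abs_ge_self] True show ?thesis by simp
   qed simp
  qed
 qed
 have ind: "?f (t, th) = indicator {0<..T} t * (indicator {0<..<1} th *\<^sub>R F t th)" for t th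
  by (auto simp: indicator_def)
 have "AE t in lborel. integrable lborel (%th. ?f (t, th))"
  by (rule lborel_pair.AE_integrable_fst'[OF if'])
 then show "AE t in lborel. t \<in> {0<..T} --> integrable ulb (F t)"
 proof eventually_elim
  fix t assume "integrable lborel (%th. ?f (t, th))"
  then show "t \<in> {0<..T} --> integrable ulb (F t)"
   unfolding ind by (cases "t \<in> {0<..T}") (auto simp: integrable_restrict_space)
 qed
 have "integrable lborel (%t. \<integral>th. ?f (t, th) \<partial>lborel)"
  by (rule lborel_pair.integrable_fst'[OF if'])
 then show "set_integrable lborel {0<..T} (%t. \<integral>th. F t th \<partial>ulb)"
  unfolding ind set_integrable_def by (simp add: integral_restrict_space)
qed

lemma abs_power_le: "\<bar>v ^ (2 * n + 2)\<bar> <= 1 * (1 + v ^ (2 * n + 2))" for v :: real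
proof -
 have "0 <= v ^ (2 * n + 2)" by (rule zero_le_even_power) simp
 then show ?thesis by (simp only: abs_of_nonneg) simp
qed

lemma U_integrable: "set_integrable lborel {0<..T} U"
 unfolding U_def[abs_def]
 by (rule strip(2)[where C=1]) (measurable, rule abs_power_le)

lemma AE_u_power: "AE t in lborel. 0 < t --> integrable ulb (%th. u t th ^ (2 * n + 2))"
proof -
 have "AE t in lborel. t \<in> {0<..real k} --> integrable ulb (%th. u t th ^ (2 * n + 2))" for k
  by (rule strip(1)[where C=1]) (measurable, rule abs_power_le)
 then have "AE t in lborel. \<forall>k. t \<in> {0<..real k} --> integrable ulb (%th. u t th ^ (2 * n + 2))"
  by (intro AE_all_countable[THEN iffD2] allI)
 then show ?thesis
 proof eventually_elim
  case (elim t)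
  then show ?case using real_arch_simple[of t] by auto
 qed
qed

lemma fpoly_le: "\<exists>C\<ge>0. \<forall>v. \<bar>fpoly lam n v\<bar> <= C * (1 + v ^ (2 * n + 2))"
proof -
 let ?G = "2 * (real n + 1) * (3 + 2 * 0 ^ (2 * n)) * (0 + 2)"
 have "\<bar>fpoly lam n v\<bar> <= (?G + \<bar>lam\<bar> * 2) * (1 + v ^ (2 * n + 2))" for v
 proof -
  have g0: "gpoly n 0 = 0" by (simp add: gpoly_def)
  have "\<bar>fpoly lam n v\<bar> <= \<bar>gpoly n v\<bar> + \<bar>lam\<bar> * \<bar>v\<bar>"
   unfolding fpoly_gpoly abs_mult[symmetric] by (rule abs_triangle_ineq)
  also have "\<dots> <= ?G * (1 + v ^ (2 * n + 2)) + \<bar>lam\<bar> * ((0 + 2) * (1 + v ^ (2 * n + 2)))"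
   using gpoly_diff_le(1)[where n=n and u=v and v=0 and B=0] gpoly_diff_le(2)[where n=n and u=v and v=0 and B=0]
   unfolding g0 by (intro add_mono mult_left_mono) simp_all
  also have "\<dots> = (?G + \<bar>lam\<bar> * 2) * (1 + v ^ (2 * n + 2))"
   by (simp only: distrib_right mult.assoc add_0)
  finally show ?thesis .
 qed
 moreover have "0 <= ?G + \<bar>lam\<bar> * 2" by (intro add_nonneg_nonneg mult_nonneg_nonneg) auto
 ultimately show ?thesis by blast
qed

lemma AE_f_integrable: "AE t in lborel. 0 < t --> integrable ulb (%th. fpoly lam n (u t th))"
 using AE_u_power
proof eventually_elim
 case (elim t)
 obtain C where C: "0 <= C" "!!v. \<bar>fpoly lam n v\<bar> <= C * (1 + v ^ (2 * n + 2))" using fpoly_le by blast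
 show ?case
 proof
  assume "0 < t"
  then have i: "integrable ulb (%th. C * (1 + u t th ^ (2 * n + 2)))" using elim by simp
  show "integrable ulb (%th. fpoly lam n (u t th))"
  proof (rule Bochner_Integration.integrable_bound[OF i])
   show "(%th. fpoly lam n (u t th)) \<in> borel_measurable ulb"
    by (rule measurable_compose[OF measurable_u])
     (intro borel_measurable_continuous_onI continuous_fpoly)
   show "AE th in ulb. norm (fpoly lam n (u t th)) <= norm (C * (1 + u t th ^ (2 * n + 2)))"
    using order_trans[OF C(2) abs_ge_self] by simp
  qed
 qed
qed

definition force :: "nat => real => real" where
 "force i t = (freq i)^2 * y t i - freq i * L2_coef (%th. fpoly lam n (u t th)) i"

lemma measurable_fpoly [measurable]: "fpoly lam n \<in> borel_measurable borel"
 by (intro borel_measurable_continuous_onI continuous_fpoly)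

lemma force_integrable: "set_integrable lborel {0<..T} (force i)"
proof -
 obtain C where C: "0 <= C" "!!v. \<bar>fpoly lam n v\<bar> <= C * (1 + v ^ (2 * n + 2))" using fpoly_le by blast
 have "set_integrable lborel {0<..T} (%t. \<integral>th. fpoly lam n (u t th) * eigfun i th \<partial>ulb)"
 proof (rule strip(2)[where C="C * 2"])
  show "(%p. fpoly lam n (u (fst p) (snd p)) * eigfun i (snd p)) \<in> borel_measurable (lborel \<Otimes>\<^sub>M lborel)"
   by measurable
  show "\<bar>fpoly lam n (u t th) * eigfun i th\<bar> <= C * 2 * (1 + u t th ^ (2 * n + 2))" for t th
  proof -
   have "0 <= C * (1 + u t th ^ (2 * n + 2))" using C(2) by (meson abs_ge_zero order_trans)
   then have "\<bar>fpoly lam n (u t th)\<bar> * \<bar>eigfun i th\<bar> <= C * (1 + u t th ^ (2 * n + 2)) * 2"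
    by (intro mult_mono C abs_eigfun_le) auto
   then show ?thesis by (simp add: abs_mult mult_ac)
  qed
 qed
 then have 1: "set_integrable lborel {0<..T} (%t. L2_coef (%th. fpoly lam n (u t th)) i)"
  by (simp add: L2_coef_ulb)
 have "set_integrable lborel {0..T} (%t. y t i)"
  unfolding set_integrable_def by (rule borel_integrable_compact) (auto intro: continuous_y)
 then have 2: "set_integrable lborel {0<..T} (%t. y t i)"
  by (rule set_integrable_subset) auto
 show ?thesis unfolding force_def using 1 2 by simp
qed

lemma evol_increment:
 assumes "0 <= s" "s <= t"
 shows "y t i - y s i = - (1/2) * (LBINT r:{s<..t}. force i r) + sqrt (b i) * (w i t - w i s)"
proof -
 have *: "y t i = coef x i + sqrt (b i) * w i t - 1/2 * (LBINT r:{0<..t}. force i r)" if "0 <= t" for t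
 proof -
  have "(LBINT s:{0..t}. (eig i)^2 * coef (\<xi> s) i + eig i * L2_coef (%th. fpoly lam n (u s th)) i)
   = (LBINT r:{0<..t}. force i r)"
  proof -
   \<comment> \<open>The closed and the half-open interval differ by the null set {0}.\<close>
   have eq: "indicator {0..t} s *\<^sub>R ((eig i)^2 * coef (\<xi> s) i + eig i * L2_coef (%th. fpoly lam n (u s th)) i)
     = indicator {0<..t} s *\<^sub>R force i s + indicator {0} s *\<^sub>R force i 0" for s
    using that by (auto simp: indicator_def force_def eig_eq_freq y_nonneg)
   show ?thesis
    using force_integrable[of t i] unfolding set_lebesgue_integral_def set_integrable_def eq
    by (subst Bochner_Integration.integral_add) auto
  qed
  then show ?thesis using evol[OF that, of i] that by (simp add: y_nonneg)
 qed
 have "{0<..t} = {0<..s} \<union> {s<..t}" using assms by auto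
 then have "(LBINT r:{0<..t}. force i r) = (LBINT r:{0<..s}. force i r) + (LBINT r:{s<..t}. force i r)"
  using assms by (simp only:) (rule set_integral_Un; auto intro!: set_integrable_subset[OF force_integrable[of t]])
 then show ?thesis using *[of s] *[of t] assms by (simp add: algebra_simps)
qed

lemma y_0: "0 <= t ==> y t 0 = coef x 0"
 using evol_increment[of 0 t 0] y_nonneg[of 0 0] init by (simp add: force_def b0 set_lebesgue_integral_def)

end

text \<open>Each implicit step multiplies by 1/(1 - z), which is at most exp(2 z) for z <= 1/2; I
  accumulates the local errors.\<close>

lemma implicit_gronwall:
 fixes a I e :: "nat => real"
 assumes z: "0 <= z" "z <= 1 / 2" and a0: "a 0 = 0" "I 0 = 0"
  and e: "!!k. k < K ==> 0 <= e k" and I: "!!k. k < K ==> I (Suc k) = I k + e k" 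
  and step: "!!k. k < K ==> a (Suc k) <= a k + z * a (Suc k) + e k"
  and k: "k <= K"
 shows "a k <= exp (2 * z * real k) * I k"
 using k
proof (induction k)
 case 0
 show ?case using a0 by simp
next
 case (Suc k)
 then have k: "k < K" by simp
 have "1 <= (1 - z) * exp (2 * z)"
 proof -
  have "0 <= z * (1 - 2 * z)" using z by (intro mult_nonneg_nonneg) auto
  then have "1 <= (1 - z) * (1 + 2 * z)" by (simp add: algebra_simps)
  also have "\<dots> <= (1 - z) * exp (2 * z)" using z exp_ge_add_one_self[of "2 * z"] by (intro mult_left_mono) auto
  finally show ?thesis .
 qed
 moreover have "(1 - z) * a (Suc k) <= a k + e k" using step[OF k] by (simp add: algebra_simps)
 moreover have IH: "a k <= exp (2 * z * real k) * I k" using Suc by simp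
 ultimately have "(1 - z) * a (Suc k) <= exp (2 * z * real k) * I k + 1 * e k" by simp
 also have "\<dots> <= exp (2 * z * real k) * I k + exp (2 * z * real k) * e k"
  using e[OF k] z by (intro add_left_mono mult_right_mono) auto
 also have "\<dots> = exp (2 * z * real k) * I (Suc k)" using I[OF k] by (simp add: algebra_simps)
 finally have 1: "(1 - z) * a (Suc k) <= exp (2 * z * real k) * I (Suc k)" .
 have I0: "0 <= I j" if "j <= K" for j
  using that by (induction j) (use a0 I e in auto)
 have "a (Suc k) <= exp (2 * z * real k) * I (Suc k) / (1 - z)"
  using 1 z by (simp add: pos_le_divide_eq mult.commute)
 also have "\<dots> = exp (2 * z * real k) * I (Suc k) * (1 / (1 - z))" by simp
 also have "\<dots> <= exp (2 * z * real k) * I (Suc k) * exp (2 * z)"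
 proof (rule mult_left_mono)
  show "1 / (1 - z) <= exp (2 * z)" using \<open>1 <= (1 - z) * exp (2 * z)\<close> z by (simp add: pos_divide_le_eq mult.commute)
  show "0 <= exp (2 * z * real k) * I (Suc k)" using I0[of "Suc k"] Suc.prems by simp
 qed
 also have "\<dots> = exp (2 * z * real (Suc k)) * I (Suc k)" by (simp add: exp_add algebra_simps)
 finally show ?case .
qed

lemma measurable_gpoly [measurable]: "gpoly n \<in> borel_measurable borel"
 unfolding gpoly_def[abs_def] by measurable

lemma measurable_err [measurable]:
 assumes [measurable]: "f \<in> borel_measurable M" "g \<in> borel_measurable M"
 shows "(%x. err lam n (f x) (g x)) \<in> borel_measurable M"
 unfolding err_def by measurable

context weak_path
begin

definition errI :: "nat => real => real" where
 "errI m r = (\<integral>th. err lam n (V m r th) (u r th) \<partial>ulb)"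

lemma y_bounded: "\<exists>R\<ge>0. \<forall>t\<in>{0..T}. \<forall>i\<le>m. \<bar>y t i\<bar> <= R"
proof -
 have "\<exists>R. \<forall>t\<in>{0..T}. \<bar>y t i\<bar> <= R" for i
 proof -
  have "compact ((%t. y t i) ` {0..T})" by (intro compact_continuous_image continuous_y) auto
  then show ?thesis by (metis compact_imp_bounded bounded_iff imageI real_norm_def)
 qed
 then obtain R where R: "!!i t. t \<in> {0..T} ==> \<bar>y t i\<bar> <= R i" by metis
 have "\<bar>y t i\<bar> <= (\<Sum>j\<le>m. \<bar>R j\<bar>)" if "t \<in> {0..T}" "i <= m" for t i
 proof -
  have "\<bar>y t i\<bar> <= \<bar>R i\<bar>" using R[OF that(1), of i] by linarith
  also have "\<dots> <= (\<Sum>j\<le>m. \<bar>R j\<bar>)" using that by (intro member_le_sum) auto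
  finally show ?thesis .
 qed
 then show ?thesis by (intro exI[of _ "\<Sum>j\<le>m. \<bar>R j\<bar>"]) (auto intro: sum_nonneg)
qed

lemma V_bounded: "\<exists>B\<ge>0. \<forall>t\<in>{0..T}. \<forall>th. \<bar>V m t th\<bar> <= B"
proof -
 obtain R where R: "0 <= R" "!!t i. t \<in> {0..T} ==> i <= m ==> \<bar>y t i\<bar> <= R" using y_bounded[of T m] by blast
 have "\<bar>V m t th\<bar> <= 2 * (\<Sum>i\<le>m. R)" if "t \<in> {0..T}" for t th
 proof -
  have "\<bar>V m t th\<bar> <= 2 * (\<Sum>i\<le>m. \<bar>fw m i * y t i\<bar>)" unfolding V_def by (rule abs_cospoly_le)
  also have "\<dots> <= 2 * (\<Sum>i\<le>m. R)"
  proof (intro mult_left_mono sum_mono)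
   fix i assume "i \<in> {..m}"
   then have "\<bar>fw m i\<bar> * \<bar>y t i\<bar> <= 1 * R" using fw_bounds[of i m] fw_bounds(2)[of m i] R(2)[OF that, of i]
    by (intro mult_mono) auto
   then show "\<bar>fw m i * y t i\<bar> <= R" by (simp add: abs_mult)
  qed simp
  finally show ?thesis .
 qed
 then show ?thesis using R(1) by (intro exI[of _ "2 * (\<Sum>i\<le>m. R)"]) auto
qed

lemma measurable_V: "(%p. V m (fst p) (snd p)) \<in> borel_measurable (lborel \<Otimes>\<^sub>M lborel)"
 unfolding V_def cospoly_def by measurable

lemma measurable_V1: "V m t \<in> borel_measurable ulb"
 unfolding V_def by (intro borel_measurable_ulb borel_measurable_continuous_onI continuous_cospoly)

lemma V_diff_le:
 assumes "!!i. i <= m ==> \<bar>y t i - y r i\<bar> <= om"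
 shows "\<bar>V m t th - V m r th\<bar> <= 2 * (real m + 1) * om"
proof -
 have "\<bar>V m t th - V m r th\<bar> <= 2 * (\<Sum>i\<le>m. \<bar>fw m i * y t i - fw m i * y r i\<bar>)"
  unfolding V_def cospoly_diff by (rule abs_cospoly_le)
 also have "\<dots> <= 2 * (\<Sum>i\<le>m. om)"
 proof (intro mult_left_mono sum_mono)
  fix i assume "i \<in> {..m}"
  then have "\<bar>fw m i\<bar> * \<bar>y t i - y r i\<bar> <= 1 * om" using fw_bounds[of i m] fw_bounds(2)[of m i] assms[of i]
   by (intro mult_mono) auto
  then show "\<bar>fw m i * y t i - fw m i * y r i\<bar> <= om" by (simp add: abs_mult flip: right_diff_distrib)
 qed simp
 finally show ?thesis by (simp add: algebra_simps)
qed

lemma err_integrable: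
 "AE t in lborel. t \<in> {0<..T} --> integrable ulb (%th. err lam n (V m t th) (u t th))"
 "set_integrable lborel {0<..T} (errI m)"
proof -
 obtain B where B: "!!t th. t \<in> {0..T} ==> \<bar>V m t th\<bar> <= B" using V_bounded[of T m] by blast
 obtain C where C: "!!v u. \<bar>v\<bar> <= B ==> err lam n v u <= C * (1 + u ^ (2 * n + 2))"
  using err_le_bounded[of B lam n] by blast
 have m: "(%p. err lam n (V m (fst p) (snd p)) (u (fst p) (snd p))) \<in> borel_measurable (lborel \<Otimes>\<^sub>M lborel)"
  by (intro measurable_err measurable_V measurable_u_pair)
 have bd: "\<bar>err lam n (V m t th) (u t th)\<bar> <= C * (1 + u t th ^ (2 * n + 2))" if "0 < t" "t <= T" for t th
  using C[OF B[of t th], of "u t th"] that err_nonneg[of lam n "V m t th" "u t th"] by simp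
 show "AE t in lborel. t \<in> {0<..T} --> integrable ulb (%th. err lam n (V m t th) (u t th))"
  by (rule strip(1)[where C=C, OF m bd])
 show "set_integrable lborel {0<..T} (errI m)"
  unfolding errI_def[abs_def] by (rule strip(2)[where C=C, OF m bd])
qed

definition Q :: "nat => real" where
 "Q m = (\<Sum>i=1..m. (freq i)^2 / wt m i)"

lemma Q_nonneg: "0 <= Q m"
 unfolding Q_def
proof (rule sum_nonneg)
 fix i assume "i \<in> {1..m}"
 then show "0 <= (freq i)^2 / wt m i" using wt_pos[of i m] by simp
qed

text \<open>Rate of the local error at time r, where om bounds the oscillation of the coefficients
  over one step: the consistency error, the price of \<open>err_shift\<close>, and the price of
  freezing the linear part.\<close>

definition G :: "nat => real => real => real => real" where
 "G m om C r = errI m r + (2 * (real m + 1) * om * C * (1 + U r) + om^2 * Q m)"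

lemma set_integrable_const: "set_integrable lborel {s<..t :: real} (%_. k :: real)"
 unfolding set_integrable_def
proof (rule integrable_scaleR_left, rule integrable_real_indicator)
 show "{s<..t} \<in> sets lborel" by simp
 show "emeasure lborel {s<..t} < \<infinity>" by (cases "s <= t") auto
qed

lemma G_integrable: "set_integrable lborel {0<..T} (G m om C)"
proof -
 have "set_integrable lborel {0<..T} (%r. 2 * (real m + 1) * om * C * (1 + U r))"
  by (rule set_integrable_mult_right[OF set_integral_add(1)[OF set_integrable_const U_integrable]])
 then show ?thesis unfolding G_def[abs_def]
  by (rule set_integral_add(1)[OF err_integrable(2) set_integral_add(1)[OF _ set_integrable_const]])
qed

lemma U_nonneg: "0 <= U r"
 unfolding U_def by (intro integral_nonneg_AE AE_I2 zero_le_even_power) simp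

lemma G_nonneg: "0 <= om ==> 0 <= C ==> 0 <= G m om C r"
 unfolding G_def errI_def using U_nonneg[of r] Q_nonneg[of m]
 by (intro add_nonneg_nonneg integral_nonneg_AE AE_I2 err_nonneg mult_nonneg_nonneg) auto

text \<open>The scheme is evaluated at its new value a, the equation at every intermediate time r.
  For the nonlinear part, \<open>fpoly_consistency\<close> with v = V m t is moved to time r by
  \<open>err_shift\<close>; in the linear part the dissipation of a - fw y absorbs the term 2 |lam|
  (a - v)^2.\<close>

lemma step_error_pointwise:
 assumes a0: "a 0 = y t 0"
  and osc: "!!i. i <= m ==> \<bar>y t i - y r i\<bar> <= om" and B: "!!th. \<bar>V m t th\<bar> <= B" "!!th. \<bar>V m r th\<bar> <= B"
  and C: "0 <= C" "!!v v' u. \<bar>v\<bar> <= B ==> \<bar>v'\<bar> <= B ==> err lam n v' u <= err lam n v u + \<bar>v' - v\<bar> * C * (1 + u ^ (2 * n + 2))"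
  and r: "integrable ulb (%th. u r th ^ (2 * n + 2))" "integrable ulb (%th. fpoly lam n (u r th))"
   "integrable ulb (%th. err lam n (V m r th) (u r th))"
 shows "- (\<Sum>i=1..m. (a i - fw m i * y t i) * ((freq i / fw m i * a i - L2_coef (%th. fpoly lam n (cospoly m a th)) i)
   - (freq i * y r i - L2_coef (%th. fpoly lam n (u r th)) i)))
  <= G m om C r + (lam^2 + 1) * nrm2 m (%i. a i - fw m i * y t i)"
proof -
 let ?d = "%i. a i - fw m i * y t i"
 let ?fa = "%th. fpoly lam n (cospoly m a th)" and ?fu = "%th. fpoly lam n (u r th)"
 have d0: "?d 0 = 0" using a0 by simp
 have cd: "cospoly m a th - V m t th = cospoly m ?d th" for th unfolding V_def cospoly_diff ..
 have ifd: "integrable ulb (%th. ?fa th - ?fu th)" using r(2) integrable_fpoly_cospoly by (intro Bochner_Integration.integrable_diff)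
 have bnd: "err lam n (V m t th) (u r th) <= err lam n (V m r th) (u r th) + 2 * (real m + 1) * om * C * (1 + u r th ^ (2 * n + 2))" for th
 proof -
  have "0 <= 1 + u r th ^ (2 * n + 2)" using zero_le_even_power[of "2 * n + 2" "u r th"] by simp
  then have "\<bar>V m t th - V m r th\<bar> * C * (1 + u r th ^ (2 * n + 2)) <= 2 * (real m + 1) * om * C * (1 + u r th ^ (2 * n + 2))"
   using V_diff_le[of m t r om th] osc C(1) by (intro mult_right_mono) auto
  then show ?thesis using C(2)[OF B(2)[of th] B(1)[of th], of "u r th"] by linarith
 qed
 let ?bd = "%th. err lam n (V m r th) (u r th) + 2 * (real m + 1) * om * C * (1 + u r th ^ (2 * n + 2)) + 2 * \<bar>lam\<bar> * (cospoly m ?d th)^2"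
 have isq: "integrable ulb (%th. (cospoly m ?d th)^2)"
  by (intro integrable_ulb_continuous continuous_intros continuous_cospoly)
 have ibd: "integrable ulb ?bd"
  by (intro Bochner_Integration.integrable_add integrable_mult_right r isq) auto
 have "(\<Sum>i=1..m. ?d i * (L2_coef ?fa i - L2_coef ?fu i)) = (\<Sum>i\<le>m. ?d i * L2_coef (%th. ?fa th - ?fu th) i)"
  using d0 by (simp add: sum_atMost_head L2_coef_diff integrable_fpoly_cospoly r(2))
 also have "\<dots> = (\<integral>th. (?fa th - ?fu th) * cospoly m ?d th \<partial>ulb)"
  by (intro integral_mult_cospoly(2)[symmetric] ifd)
 also have "\<dots> <= (\<integral>th. ?bd th \<partial>ulb)"
 proof (intro integral_mono integral_mult_cospoly ifd ibd)
  fix th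
  have "(?fa th - ?fu th) * (cospoly m a th - V m t th) <= err lam n (V m t th) (u r th) + 2 * \<bar>lam\<bar> * (cospoly m a th - V m t th)^2"
   by (rule fpoly_consistency)
  then show "(?fa th - ?fu th) * cospoly m ?d th <= ?bd th" unfolding cd using bnd[of th] by linarith
 qed
 also have "\<dots> = errI m r + 2 * (real m + 1) * om * C * (1 + U r) + 2 * \<bar>lam\<bar> * (\<Sum>i\<le>m. (?d i)^2)"
 proof -
  have i1: "integrable ulb (%th. 1 + u r th ^ (2 * n + 2))" using r(1) by (intro Bochner_Integration.integrable_add) auto
  have "(\<integral>th. 1 + u r th ^ (2 * n + 2) \<partial>ulb) = 1 + U r"
   unfolding U_def using r(1) ulb.prob_space by (subst Bochner_Integration.integral_add) auto
  then show ?thesis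
   by (subst Bochner_Integration.integral_add Bochner_Integration.integral_add;
     (intro Bochner_Integration.integrable_add integrable_mult_right i1 isq r)?)
    (simp only: Bochner_Integration.integral_add[OF r(3) integrable_mult_right[OF i1]]
     integral_mult_right_zero integral_cospoly_square errI_def)
 qed
 finally have 1: "(\<Sum>i=1..m. ?d i * (L2_coef ?fa i - L2_coef ?fu i))
   <= errI m r + 2 * (real m + 1) * om * C * (1 + U r) + 2 * \<bar>lam\<bar> * (\<Sum>i=1..m. (?d i)^2)"
  using d0 by (simp add: sum_atMost_head)
 have "(\<Sum>i=1..m. 2 * \<bar>lam\<bar> * (?d i)^2 - ?d i * (freq i / fw m i * a i - freq i * y r i))
   <= (\<Sum>i=1..m. (lam^2 + 1) * (wt m i * (?d i)^2) + om^2 * ((freq i)^2 / wt m i))"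
 proof (intro sum_mono)
  fix i assume i: "i \<in> {1..m}"
  have p: "1 <= freq i" "0 < fw m i" "0 < wt m i" using i freq_ge_1[of i] fw_bounds[of i m] wt_pos by auto
  let ?e = "y t i - y r i"
  \<comment> \<open>Interpolation with 2 lam in place of lam, to match the factor left by
    \<open>fpoly_consistency\<close>; it spends exactly the whole dissipation and leaves
    lam^2.\<close>
  have "\<bar>2 * lam\<bar> <= freq i / fw m i + (2 * lam)^2 / 4 * wt m i" by (rule lam_interpolate[OF i])
  then have "\<bar>2 * lam\<bar> * (?d i)^2 <= (freq i / fw m i + (2 * lam)^2 / 4 * wt m i) * (?d i)^2"
   by (intro mult_right_mono) auto
  then have A: "2 * \<bar>lam\<bar> * (?d i)^2 <= freq i / fw m i * (?d i)^2 + lam^2 * (wt m i * (?d i)^2)"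
   by (simp add: abs_mult power_mult_distrib distrib_right mult.assoc)
  have e: "freq i / fw m i * a i - freq i * y r i = freq i / fw m i * ?d i + freq i * ?e"
   using p by (simp add: field_simps)
  have "0 <= (?d i * sqrt (wt m i) + freq i * ?e / sqrt (wt m i))^2" by simp
  also have "\<dots> = wt m i * (?d i)^2 + 2 * (?d i * (freq i * ?e)) + (freq i)^2 / wt m i * ?e^2"
   using p by (simp add: power2_sum power_mult_distrib power_divide)
  finally have f1: "- (?d i * (freq i * ?e)) <= wt m i * (?d i)^2 / 2 + (freq i)^2 / wt m i * ?e^2 / 2" by simp
  have f2: "(freq i)^2 / wt m i * ?e^2 <= (freq i)^2 / wt m i * om^2"
  proof (rule mult_left_mono)
   have "\<bar>?e\<bar> <= \<bar>om\<bar>" using osc[of i] i by auto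
   then show "?e^2 <= om^2" by (simp only: abs_le_square_iff)
  qed (use p in auto)
  have f3: "0 <= wt m i * (?d i)^2" and f4: "0 <= (freq i)^2 / wt m i * om^2" using p by auto
  have "A <= P + R" if "A <= P / 2 + S / 2" "S <= R" "0 <= P" "0 <= R" for A P R S :: real
   using that by linarith
  from this[OF f1 f2 f3 f4]
  have Bq: "- (?d i * (freq i * ?e)) <= wt m i * (?d i)^2 + (freq i)^2 / wt m i * om^2" .
  have "?d i * (freq i / fw m i * ?d i + freq i * ?e) = freq i / fw m i * (?d i)^2 + ?d i * (freq i * ?e)"
   by (simp only: distrib_left power2_eq_square mult_ac)
  then show "2 * \<bar>lam\<bar> * (?d i)^2 - ?d i * (freq i / fw m i * a i - freq i * y r i)
    <= (lam^2 + 1) * (wt m i * (?d i)^2) + om^2 * ((freq i)^2 / wt m i)"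
   unfolding e using A Bq by (simp only: distrib_right mult_1 mult.commute[of "om^2"])
 qed
 also have "\<dots> = (lam^2 + 1) * nrm2 m ?d + om^2 * Q m"
  by (simp only: sum.distrib nrm2_def Q_def sum_distrib_left)
 finally have 2: "2 * \<bar>lam\<bar> * (\<Sum>i=1..m. (?d i)^2) - (\<Sum>i=1..m. ?d i * (freq i / fw m i * a i - freq i * y r i))
   <= (lam^2 + 1) * nrm2 m ?d + om^2 * Q m"
  by (simp only: sum_subtractf sum_distrib_left)
 have eq: "(\<Sum>i=1..m. ?d i * ((freq i / fw m i * a i - L2_coef ?fa i) - (freq i * y r i - L2_coef ?fu i)))
  = (\<Sum>i=1..m. ?d i * (freq i / fw m i * a i - freq i * y r i)) - (\<Sum>i=1..m. ?d i * (L2_coef ?fa i - L2_coef ?fu i))"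
  unfolding sum_subtractf[symmetric] right_diff_distrib[symmetric] by (intro sum.cong refl) (simp add: algebra_simps)
 have "- S <= E + (P + R) + W" if "S = S1 - S2" "S2 <= E + P + L" "L - S1 <= W + R" for S S1 S2 E P R W L :: real
  using that by linarith
 from this[OF eq 1 2] show ?thesis unfolding G_def .
qed

text \<open>Subtract the equation integrated over the step from the scheme and test with the new
  error d'; the left side is handled by d'^2 - d^2 <= 2 (d' - d) d'.\<close>

lemma step_error:
 assumes h: "0 < h" and s: "0 <= s" and t: "t = s + h"
  and step: "step_solution lam n (coef x 0) m h (%i. X i + fw m i * sqrt (b i) * (w i t - w i s)) a"
  and osc: "!!r i. r \<in> {s..t} ==> i <= m ==> \<bar>y t i - y r i\<bar> <= om"
  and B: "!!r th. r \<in> {0..t} ==> \<bar>V m r th\<bar> <= B"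
  and C: "0 <= C" "!!v v' u. \<bar>v\<bar> <= B ==> \<bar>v'\<bar> <= B ==> err lam n v' u <= err lam n v u + \<bar>v' - v\<bar> * C * (1 + u ^ (2 * n + 2))"
 shows "nrm2 m (%i. a i - fw m i * y t i) <= nrm2 m (%i. X i - fw m i * y s i)
  + h * (lam^2 + 1) * nrm2 m (%i. a i - fw m i * y t i) + (LBINT r:{s<..t}. G m om C r)"
proof -
 let ?d' = "%i. a i - fw m i * y t i" and ?d = "%i. X i - fw m i * y s i"
 let ?I = "{s<..t}"
 let ?fa = "%th. fpoly lam n (cospoly m a th)"
 define \<kappa> where "\<kappa> i = freq i / fw m i * a i - L2_coef ?fa i" for i
 define q where "q i r = \<kappa> i - (freq i * y r i - L2_coef (%th. fpoly lam n (u r th)) i)" for i r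
 have st: "0 <= t" "s <= t" using s t h by auto
 have sub: "set_integrable lborel ?I F" if "set_integrable lborel {0<..t} F" for F :: "real => real"
  using that s by (rule_tac set_integrable_subset) auto
 have fq: "freq i * y r i - L2_coef (%th. fpoly lam n (u r th)) i = force i r / freq i" if "1 <= i" for i r
  using freq_ge_1[OF that] by (simp add: force_def field_simps power2_eq_square)
 have ifr: "set_integrable lborel ?I (%r. force i r / freq i)" for i
  by (intro set_integrable_divide sub force_integrable) 
 have iq: "set_integrable lborel ?I (q i)" if "1 <= i" for i
  unfolding q_def[abs_def] fq[OF that] by (intro set_integral_diff set_integrable_const ifr)
 have lc: "(LBINT r:?I. k) = h * k" for k :: real
  using h t by (simp add: set_lebesgue_integral_def)
 \<comment> \<open>Scheme and damped solution receive identical Wiener increments, so no noise term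
   is left.\<close>
 have key: "wt m i * (?d' i - ?d i) = - (1/2) * (LBINT r:?I. q i r)" if i: "i \<in> {1..m}" for i
 proof -
  have p: "1 <= freq i" "0 < fw m i" using i freq_ge_1[of i] fw_bounds[of i m] by auto
  have i1: "1 <= i" using i by simp
  have w1: "wt m i * fw m i = 1 / freq i" "wt m i * (freq i)^2 = freq i / fw m i"
   using p by (simp_all add: wt_def field_simps power2_eq_square)
  have A: "(LBINT r:?I. q i r) = h * \<kappa> i - (LBINT r:?I. force i r) / freq i"
   unfolding q_def fq[OF i1] using ifr[of i]
   by (subst set_integral_diff(2)[OF set_integrable_const ifr]) (simp add: lc)
  have "(1 / k) * (- (1/2) * F + N) = - (1/2) * (F / k) + (1 / k) * N" for k F N :: real
   by (simp add: algebra_simps)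
  then have Bq: "(1 / freq i) * (y t i - y s i)
    = - (1/2) * ((LBINT r:?I. force i r) / freq i) + (1 / freq i) * (sqrt (b i) * (w i t - w i s))"
   unfolding evol_increment[OF s st(2)] .
  have Cq: "wt m i * a i + h / 2 * \<kappa> i = wt m i * (X i + fw m i * sqrt (b i) * (w i t - w i s))"
   using step_solution_weighted[OF step i] by (simp add: \<kappa>_def w1)
  have Dq: "wt m i * (?d' i - ?d i) = wt m i * a i - wt m i * X i - (1 / freq i) * (y t i - y s i)"
   unfolding w1(1)[symmetric] by (simp add: algebra_simps)
  have Eq: "wt m i * (X i + fw m i * sqrt (b i) * (w i t - w i s)) = wt m i * X i + (1 / freq i) * (sqrt (b i) * (w i t - w i s))"
   unfolding w1(1)[symmetric] by (simp add: algebra_simps)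
  have "a1 - x1 - (- (1/2) * F + R) = - (1/2) * (h * k - F)" if "a1 + h / 2 * k = z" "z = x1 + R" for a1 x1 F R k z :: real
  proof -
   have "a1 = x1 + R - h / 2 * k" using that by simp
   then show ?thesis by (simp add: field_simps)
  qed
  from this[OF Cq Eq] show ?thesis unfolding Dq Bq A .
 qed
 have a0: "a 0 = y t 0" using step y_0[OF st(1)] by (simp add: step_solution_def)
 have iS: "set_integrable lborel ?I (%r. - (\<Sum>i=1..m. ?d' i * q i r))"
 proof -
  have eq: "indicat_real ?I r *\<^sub>R - (\<Sum>i=1..m. ?d' i * q i r) = (\<Sum>i=1..m. (- ?d' i) * (indicat_real ?I r *\<^sub>R q i r))" for r
   by (simp only: real_scaleR_def sum_distrib_left sum_negf[symmetric] mult_minus_right mult_minus_left mult.left_commute)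
  show ?thesis
   unfolding set_integrable_def eq
   by (intro Bochner_Integration.integrable_sum integrable_mult_right iq[unfolded set_integrable_def]) simp
 qed
 have iG: "set_integrable lborel ?I (%r. G m om C r + (lam^2 + 1) * nrm2 m ?d')"
  by (intro set_integral_add set_integrable_const sub G_integrable)
 have "(\<Sum>i=1..m. wt m i * (?d' i - ?d i) * ?d' i) = (\<Sum>i=1..m. - (1/2) * (LBINT r:?I. q i r) * ?d' i)"
  by (intro sum.cong refl) (simp only: key)
 also have "\<dots> = (1/2) * (LBINT r:?I. - (\<Sum>i=1..m. ?d' i * q i r))"
 proof -
  have eq: "indicat_real ?I r *\<^sub>R (\<Sum>i=1..m. ?d' i * q i r) = (\<Sum>i=1..m. ?d' i * (indicat_real ?I r *\<^sub>R q i r))" for r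
   by (simp only: real_scaleR_def sum_distrib_left mult.left_commute)
  have "(LBINT r:?I. (\<Sum>i=1..m. ?d' i * q i r)) = (\<Sum>i=1..m. \<integral>r. ?d' i * (indicat_real ?I r *\<^sub>R q i r) \<partial>lborel)"
   unfolding set_lebesgue_integral_def eq
   by (rule Bochner_Integration.integral_sum) (intro integrable_mult_right iq[unfolded set_integrable_def], simp)
  also have "\<dots> = (\<Sum>i=1..m. ?d' i * (LBINT r:?I. q i r))"
   by (intro sum.cong refl) (simp only: integral_mult_right_zero set_lebesgue_integral_def)
  finally have e1: "(LBINT r:?I. (\<Sum>i=1..m. ?d' i * q i r)) = (\<Sum>i=1..m. ?d' i * (LBINT r:?I. q i r))" .
  have "(LBINT r:?I. - (\<Sum>i=1..m. ?d' i * q i r)) = - (LBINT r:?I. (\<Sum>i=1..m. ?d' i * q i r))"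
   unfolding set_lebesgue_integral_def by simp
  then show ?thesis unfolding e1 by (simp add: sum_distrib_left sum_negf mult_ac)
 qed
 also have "\<dots> <= (1/2) * (LBINT r:?I. G m om C r + (lam^2 + 1) * nrm2 m ?d')"
 proof (intro mult_left_mono)
  show "(LBINT r:?I. - (\<Sum>i=1..m. ?d' i * q i r)) <= (LBINT r:?I. G m om C r + (lam^2 + 1) * nrm2 m ?d')"
   unfolding set_lebesgue_integral_def
  proof (rule integral_mono_AE)
   show "integrable lborel (%r. indicat_real ?I r *\<^sub>R - (\<Sum>i=1..m. ?d' i * q i r))"
    using iS unfolding set_integrable_def .
   show "integrable lborel (%r. indicat_real ?I r *\<^sub>R (G m om C r + (lam^2 + 1) * nrm2 m ?d'))"
    using iG unfolding set_integrable_def .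
   show "AE r in lborel. indicat_real ?I r *\<^sub>R - (\<Sum>i=1..m. ?d' i * q i r)
     <= indicat_real ?I r *\<^sub>R (G m om C r + (lam^2 + 1) * nrm2 m ?d')"
    using AE_u_power AE_f_integrable err_integrable(1)[of t m]
   proof eventually_elim
    case (elim r)
    show ?case
    proof (cases "r \<in> ?I")
     case True
     then have r: "0 < r" "r <= t" "r \<in> {s..t}" using s by auto
     have "- (\<Sum>i=1..m. ?d' i * q i r) <= G m om C r + (lam^2 + 1) * nrm2 m ?d'"
      unfolding q_def \<kappa>_def
     proof (rule step_error_pointwise[where B=B and C=C])
      show "\<bar>V m t th\<bar> <= B" "\<bar>V m r th\<bar> <= B" for th using B r st by auto
     qed (use a0 osc[OF r(3)] C r elim in auto)
     then show ?thesis using True by simp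
    qed simp
   qed
  qed
 qed simp
 also have "(LBINT r:?I. G m om C r + (lam^2 + 1) * nrm2 m ?d') = (LBINT r:?I. G m om C r) + h * ((lam^2 + 1) * nrm2 m ?d')"
  by (subst set_integral_add(2)[OF sub[OF G_integrable] set_integrable_const]) (simp only: lc)
 finally have 1: "(\<Sum>i=1..m. wt m i * (?d' i - ?d i) * ?d' i) <= (1/2) * ((LBINT r:?I. G m om C r) + h * ((lam^2 + 1) * nrm2 m ?d'))" .
 have "(1/2) * (nrm2 m ?d' - nrm2 m ?d) <= (\<Sum>i=1..m. wt m i * (?d' i - ?d i) * ?d' i)"
  unfolding nrm2_def sum_subtractf[symmetric] sum_distrib_left
 proof (intro sum_mono)
  fix i assume i: "i \<in> {1..m}"
  have sq: "(p' :: real)^2 - p^2 <= 2 * ((p' - p) * p')" for p' p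
   using zero_le_power2[of "p' - p"] by (simp add: power2_eq_square algebra_simps)
  have "wt m i * ((?d' i)^2 - (?d i)^2) <= wt m i * (2 * ((?d' i - ?d i) * ?d' i))"
   using wt_pos[OF i] by (intro mult_left_mono[OF sq]) simp
  then show "1 / 2 * (wt m i * (?d' i)^2 - wt m i * (?d i)^2) <= wt m i * (?d' i - ?d i) * ?d' i"
   by (simp only: right_diff_distrib[symmetric] mult.left_commute[of "wt m i" 2] mult.assoc)
 qed
 then show ?thesis using 1 by (simp add: algebra_simps)
qed

end

text \<open>A predicate on arbitrary sequences: the pathwise estimate needs only the step equations
  along the grid and no knowledge of how the sequence was produced from the noise.\<close>

definition grid_path ::
 "(nat => real) => real => nat => H => (nat => real => real) => nat => real => nat => (nat => nat => real) => bool" where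
 "grid_path b lam n x w m h K X \<longleftrightarrow>
  (\<forall>i\<in>{1..m}. X 0 i = fw m i * coef x i) \<and>
  (\<forall>k<K. step_solution lam n (coef x 0) m h
    (%i. X k i + fw m i * sqrt (b i) * (w i (real (Suc k) * h) - w i (real k * h))) (X (Suc k)))"

lemma mult_half_le: "d * (2 * c * x) <= e ==> c * (d * x) <= e / 2" for c d x e :: real
 by (simp add: mult_ac)

context weak_path
begin

lemma grid_error:
 assumes h: "0 < h" "h * (lam^2 + 1) <= 1 / 2" and om: "0 <= om"
  and osc: "!!s t i. s \<in> {0..real K * h} ==> t \<in> {0..real K * h} ==> \<bar>t - s\<bar> <= h ==> i <= m ==> \<bar>y t i - y s i\<bar> <= om"
  and B: "!!r th. r \<in> {0..real K * h} ==> \<bar>V m r th\<bar> <= B"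
  and C: "0 <= C" "!!v v' u. \<bar>v\<bar> <= B ==> \<bar>v'\<bar> <= B ==> err lam n v' u <= err lam n v u + \<bar>v' - v\<bar> * C * (1 + u ^ (2 * n + 2))"
  and X: "grid_path b lam n x w m h K X" and k: "k <= K"
 shows "nrm2 m (%i. X k i - fw m i * y (real k * h) i)
  <= exp (2 * (h * (lam^2 + 1)) * real k) * (LBINT r:{0<..real k * h}. G m om C r)"
proof (rule implicit_gronwall[where K=K and e="%k. LBINT r:{real k * h<..real (Suc k) * h}. G m om C r"
   and a="%k. nrm2 m (%i. X k i - fw m i * y (real k * h) i)"
   and I="%k. LBINT r:{0<..real k * h}. G m om C r"])
 show "0 <= h * (lam^2 + 1)" using h by simp
 show "nrm2 m (%i. X 0 i - fw m i * y (real 0 * h) i) = 0"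
  unfolding nrm2_def using X init by (intro sum.neutral) (auto simp: grid_path_def y_nonneg)
 show "(LBINT r:{0<..real 0 * h}. G m om C r) = 0" by (simp add: set_lebesgue_integral_def)
 fix k assume k: "k < K"
 have le: "real k * h <= real (Suc k) * h" using h by (intro mult_right_mono) auto
 have kK: "real (Suc k) * h <= real K * h" using k h by (intro mult_right_mono) auto
 have k0: "0 <= real k * h" using h by simp
 show "0 <= (LBINT r:{real k * h<..real (Suc k) * h}. G m om C r)"
  unfolding set_lebesgue_integral_def
  by (intro integral_nonneg_AE AE_I2) (auto intro!: G_nonneg om C(1) simp: indicator_def)
 have sub: "set_integrable lborel {real k * h<..real (Suc k) * h} (G m om C)"
  by (rule set_integrable_subset[OF G_integrable[of "real (Suc k) * h"]]) (use k0 in auto)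
 have "{0<..real (Suc k) * h} = {0<..real k * h} \<union> {real k * h<..real (Suc k) * h}" using le k0 by auto
 then show "(LBINT r:{0<..real (Suc k) * h}. G m om C r)
   = (LBINT r:{0<..real k * h}. G m om C r) + (LBINT r:{real k * h<..real (Suc k) * h}. G m om C r)"
  by (simp only:) (rule set_integral_Un[OF _ G_integrable sub], auto)
 show "nrm2 m (%i. X (Suc k) i - fw m i * y (real (Suc k) * h) i)
  <= nrm2 m (%i. X k i - fw m i * y (real k * h) i)
   + h * (lam^2 + 1) * nrm2 m (%i. X (Suc k) i - fw m i * y (real (Suc k) * h) i)
   + (LBINT r:{real k * h<..real (Suc k) * h}. G m om C r)"
 proof (rule step_error[OF h(1) k0])
  show eq: "real (Suc k) * h = real k * h + h" by (simp add: algebra_simps)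
  show "step_solution lam n (coef x 0) m h
    (%i. X k i + fw m i * sqrt (b i) * (w i (real (Suc k) * h) - w i (real k * h))) (X (Suc k))"
   using X k by (simp add: grid_path_def)
  show "\<bar>y (real (Suc k) * h) i - y r i\<bar> <= om" if "r \<in> {real k * h..real (Suc k) * h}" "i <= m" for r i
  proof (rule osc[OF _ _ _ that(2)])
   show "r \<in> {0..real K * h}" using that(1) k0 kK unfolding atLeastAtMost_iff by linarith
   show "real (Suc k) * h \<in> {0..real K * h}" using k0 kK le unfolding atLeastAtMost_iff by linarith
   show "\<bar>real (Suc k) * h - r\<bar> <= h" using that(1) eq unfolding atLeastAtMost_iff by linarith
  qed
  show "\<bar>V m r th\<bar> <= B" if "r \<in> {0..real (Suc k) * h}" for r th
   using B[of r th] that kK by auto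
 qed (rule C)+
qed (use h k in auto)

lemma V_fejer: "AE t in lborel. 0 < t --> (\<forall>m. V m t = fejer_mean m (u t))"
 using repr
proof eventually_elim
 case (elim t)
 show ?case
 proof (intro impI allI)
  fix m assume t: "0 < t"
  then have "y t i = L2_coef (u t) i" for i using elim by (simp add: y_nonneg)
  then show "V m t = fejer_mean m (u t)" unfolding V_def fejer_mean_def by simp
 qed
qed

lemma errI_young:
 assumes \<delta>: "0 < \<delta>" "\<delta> <= 1" and t: "V m t = fejer_mean m (u t)" "integrable ulb (%th. u t th ^ (2 * n + 2))"
 shows "errI m t <= (2 * (real n + 1) + \<bar>lam\<bar>)
  * (\<delta> * (1 + 2 * U t) + 3 / \<delta> ^ n * (\<integral>th. (fejer_mean m (u t) th - u t th) ^ (2 * n + 2) \<partial>ulb))"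
proof -
 let ?p = "2 * n + 2" and ?v = "fejer_mean m (u t)" and ?c = "2 * (real n + 1) + \<bar>lam\<bar>"
 have p: "even ?p" "1 <= ?p" by auto
 have mv: "?v \<in> borel_measurable ulb" using measurable_V1[of m t] t(1) by simp
 have iv: "integrable ulb (%th. ?v th ^ ?p)"
  unfolding fejer_mean_def by (intro integrable_ulb_continuous continuous_on_power continuous_cospoly)
 have idf: "integrable ulb (%th. (?v th - u t th) ^ ?p)"
  by (rule integrable_diff_power[OF mv measurable_u iv t(2) p(1)])
 have i1: "integrable ulb (%th. 1 + u t th ^ ?p + ?v th ^ ?p)"
  by (intro Bochner_Integration.integrable_add iv t(2)) auto
 let ?bd = "%th. ?c * (\<delta> * (1 + u t th ^ ?p + ?v th ^ ?p) + 3 / \<delta> ^ n * (?v th - u t th) ^ ?p)"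
 have ib: "integrable ulb ?bd"
  by (intro integrable_mult_right Bochner_Integration.integrable_add i1 idf)
 have le: "err lam n (?v th) (u t th) <= ?bd th" for th by (rule err_young[OF \<delta>])
 have ie: "integrable ulb (%th. err lam n (?v th) (u t th))"
 proof (rule Bochner_Integration.integrable_bound[OF ib])
  show "(%th. err lam n (?v th) (u t th)) \<in> borel_measurable ulb"
   by (rule measurable_err[OF mv measurable_u])
  show "AE th in ulb. norm (err lam n (?v th) (u t th)) <= norm (?bd th)"
  proof (rule AE_I2)
   fix th
   have "0 <= err lam n (?v th) (u t th)" by (rule err_nonneg)
   then show "norm (err lam n (?v th) (u t th)) <= norm (?bd th)"
    unfolding real_norm_def using le[of th] by (rule_tac order_trans[OF _ abs_ge_self]) simp
  qed
 qed
 have "errI m t <= (\<integral>th. ?bd th \<partial>ulb)"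
  unfolding errI_def t(1) by (intro integral_mono ie ib le)
 also have "\<dots> = ?c * (\<delta> * (\<integral>th. 1 + u t th ^ ?p + ?v th ^ ?p \<partial>ulb) + 3 / \<delta> ^ n * (\<integral>th. (?v th - u t th) ^ ?p \<partial>ulb))"
  using i1 idf by (subst integral_mult_right_zero, subst Bochner_Integration.integral_add)
   (intro integrable_mult_right i1 idf | simp only: integral_mult_right_zero)+
 also have "(\<integral>th. 1 + u t th ^ ?p + ?v th ^ ?p \<partial>ulb) = 1 + U t + (\<integral>th. ?v th ^ ?p \<partial>ulb)"
 proof -
  have one: "(\<integral>th. 1 \<partial>ulb) = (1 :: real)" using ulb.prob_space by simp
  have i2: "integrable ulb (%th. 1 + u t th ^ ?p)" by (rule Bochner_Integration.integrable_add[OF ulb.integrable_const t(2)])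
  show ?thesis
   unfolding U_def Bochner_Integration.integral_add[OF i2 iv]
    Bochner_Integration.integral_add[OF ulb.integrable_const t(2)] one ..
 qed
 also have "?c * (\<delta> * (1 + U t + (\<integral>th. ?v th ^ ?p \<partial>ulb)) + 3 / \<delta> ^ n * (\<integral>th. (?v th - u t th) ^ ?p \<partial>ulb))
   <= ?c * (\<delta> * (1 + 2 * U t) + 3 / \<delta> ^ n * (\<integral>th. (?v th - u t th) ^ ?p \<partial>ulb))"
 proof (intro mult_left_mono add_right_mono)
  have "(\<integral>th. ?v th ^ ?p \<partial>ulb) <= U t"
   unfolding U_def by (rule fejer_mean_Lp[OF measurable_u t(2) p])
  then show "1 + U t + (\<integral>th. ?v th ^ ?p \<partial>ulb) <= 1 + 2 * U t" by simp
 qed (use \<delta> in auto)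
 finally show ?thesis .
qed

text \<open>At almost every time the Fejer means converge in L^(2n+2), and \<open>err_young\<close>
  with small \<delta> transfers this to \<open>errI\<close>; dominated convergence in time
  concludes.\<close>

lemma errI_tendsto: "(%m. LBINT r:{0<..T}. errI m r) \<longlonglongrightarrow> 0"
proof -
 let ?p = "2 * n + 2" and ?c = "2 * (real n + 1) + \<bar>lam\<bar>"
 have p: "even ?p" "1 <= ?p" by auto
 have c0: "0 < ?c" by (intro add_pos_nonneg) auto
 let ?e = "%m t. \<integral>th. (fejer_mean m (u t) th - u t th) ^ ?p \<partial>ulb"
 have "(%m. \<integral>r. indicator {0<..T} r *\<^sub>R errI m r \<partial>lborel) \<longlonglongrightarrow> (\<integral>r. 0 \<partial>(lborel :: real measure))"
 \<comment> \<open>The dominating function is \<open>err_young\<close> with \<delta> = 1, where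
   Jensen bounds the Fejer mean by U.\<close>
 proof (rule integral_dominated_convergence[where w="%r. indicator {0<..T} r *\<^sub>R (?c * ((1 + 2 * U r) + 3 * (2 ^ ?p * (2 * U r))))"])
  show "(%r. indicator {0<..T} r *\<^sub>R errI m r) \<in> borel_measurable lborel" for m
   using err_integrable(2)[of T m] unfolding set_integrable_def by (rule borel_measurable_integrable)
  have U1: "set_integrable lborel {0<..T} (%r. k * U r)" for k
   by (rule set_integrable_mult_right[OF U_integrable])
  have "set_integrable lborel {0<..T} (%r. ?c * ((1 + 2 * U r) + 3 * (2 ^ ?p * (2 * U r))))"
   by (rule set_integrable_mult_right, rule set_integral_add(1), rule set_integral_add(1),
     rule set_integrable_const, rule U1, rule set_integrable_mult_right, rule set_integrable_mult_right, rule U1)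
  then show "integrable lborel (%r. indicator {0<..T} r *\<^sub>R (?c * ((1 + 2 * U r) + 3 * (2 ^ ?p * (2 * U r)))))"
   unfolding set_integrable_def .
  show "AE r in lborel. (%m. indicator {0<..T} r *\<^sub>R errI m r) \<longlonglongrightarrow> 0"
   using V_fejer AE_u_power
  proof eventually_elim
   case (elim t)
   show ?case
   proof (cases "t \<in> {0<..T}")
    case True
    then have t: "!!m. V m t = fejer_mean m (u t)" "integrable ulb (%th. u t th ^ ?p)" using elim by auto
    have lim: "(%m. ?e m t) \<longlonglongrightarrow> 0" by (rule fejer_mean_tendsto_Lp[OF measurable_u t(2) p])
    have "(%m. errI m t) \<longlonglongrightarrow> 0"
    proof (rule LIMSEQ_I)
     fix ep :: real assume ep: "0 < ep"
     define \<delta> where "\<delta> = min 1 (ep / (2 * ?c * (1 + 2 * U t)))"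
     have "0 < 1 + 2 * U t" using U_nonneg[of t] by linarith
     from mult_pos_pos[OF mult_pos_pos[OF _ c0, of 2] this] have den: "0 < 2 * ?c * (1 + 2 * U t)" by simp
     have \<delta>: "0 < \<delta>" "\<delta> <= 1" unfolding \<delta>_def using ep den by auto
     have "\<delta> <= ep / (2 * ?c * (1 + 2 * U t))" unfolding \<delta>_def by simp
     then have d1: "?c * (\<delta> * (1 + 2 * U t)) <= ep / 2"
      unfolding pos_le_divide_eq[OF den] by (rule mult_half_le)
     have "(%m. ?c * (3 / \<delta> ^ n * ?e m t)) \<longlonglongrightarrow> ?c * (3 / \<delta> ^ n * 0)"
      by (intro tendsto_intros lim)
     then have "(%m. ?c * (3 / \<delta> ^ n * ?e m t)) \<longlonglongrightarrow> 0" by simp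
     from order_tendstoD(2)[OF this half_gt_zero[OF ep]]
     obtain M where M: "!!m. M <= m ==> ?c * (3 / \<delta> ^ n * ?e m t) < ep / 2"
      unfolding eventually_sequentially by blast
     have "norm (errI m t - 0) < ep" if "M <= m" for m
     proof -
      have "errI m t <= ?c * (\<delta> * (1 + 2 * U t)) + ?c * (3 / \<delta> ^ n * ?e m t)"
       using errI_young[OF \<delta> t(1) t(2), of m] by (simp only: distrib_left)
      then have "errI m t < ep" using d1 M[OF that] by linarith
      moreover have "0 <= errI m t" unfolding errI_def by (intro integral_nonneg_AE AE_I2 err_nonneg)
      ultimately show ?thesis by simp
     qed
     then show "\<exists>M. \<forall>m\<ge>M. norm (errI m t - 0) < ep" by blast
    qed
    then show ?thesis using True by simp
   qed simp
  qed
  show "AE r in lborel. norm (indicator {0<..T} r *\<^sub>R errI m r)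
    <= indicator {0<..T} r *\<^sub>R (?c * ((1 + 2 * U r) + 3 * (2 ^ ?p * (2 * U r))))" for m
   using V_fejer AE_u_power
  proof eventually_elim
   case (elim t)
   show ?case
   proof (cases "t \<in> {0<..T}")
    case True
    then have t: "V m t = fejer_mean m (u t)" "integrable ulb (%th. u t th ^ ?p)" using elim by auto
    let ?v = "fejer_mean m (u t)"
    have mv: "?v \<in> borel_measurable ulb" using measurable_V1[of m t] t(1) by simp
    have iv: "integrable ulb (%th. ?v th ^ ?p)"
     unfolding fejer_mean_def by (intro integrable_ulb_continuous continuous_on_power continuous_cospoly)
    have "?e m t <= (\<integral>th. 2 ^ ?p * (?v th ^ ?p + u t th ^ ?p) \<partial>ulb)"
    proof (rule integral_mono)
     show "integrable ulb (%th. (?v th - u t th) ^ ?p)"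
      by (rule integrable_diff_power[OF mv measurable_u iv t(2) p(1)])
     show "integrable ulb (%th. 2 ^ ?p * (?v th ^ ?p + u t th ^ ?p))"
      by (intro integrable_mult_right Bochner_Integration.integrable_add iv t(2))
     show "(?v th - u t th) ^ ?p <= 2 ^ ?p * (?v th ^ ?p + u t th ^ ?p)" for th
      using power_add_le[OF p(1), of "?v th" "- u t th"] by (simp only: power_minus_even[OF p(1)] add_uminus_conv_diff)
    qed
    also have "\<dots> = 2 ^ ?p * ((\<integral>th. ?v th ^ ?p \<partial>ulb) + U t)"
     unfolding U_def integral_mult_right_zero Bochner_Integration.integral_add[OF iv t(2)] ..
    also have "\<dots> <= 2 ^ ?p * (2 * U t)"
     using fejer_mean_Lp[OF measurable_u t(2) p, of m] unfolding U_def[symmetric] by (intro mult_left_mono) auto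
    finally have e: "?e m t <= 2 ^ ?p * (2 * U t)" .
    have "errI m t <= ?c * (1 * (1 + 2 * U t) + 3 / 1 ^ n * ?e m t)"
     by (rule errI_young[OF _ _ t]) auto
    also have "\<dots> <= ?c * ((1 + 2 * U t) + 3 * (2 ^ ?p * (2 * U t)))"
    proof (rule mult_left_mono[OF _ less_imp_le[OF c0]])
     show "1 * (1 + 2 * U t) + 3 / 1 ^ n * ?e m t <= (1 + 2 * U t) + 3 * (2 ^ ?p * (2 * U t))"
      unfolding mult_1 power_one div_by_1 by (intro add_left_mono mult_left_mono[OF e]) simp
    qed
    finally have "errI m t <= ?c * ((1 + 2 * U t) + 3 * (2 ^ ?p * (2 * U t)))" .
    moreover have "0 <= errI m t" unfolding errI_def by (intro integral_nonneg_AE AE_I2 err_nonneg)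
    ultimately show ?thesis using True by simp
   qed simp
  qed
 qed auto
 then show ?thesis by (simp add: set_lebesgue_integral_def)
qed

text \<open>m comes first and makes the consistency error small. The constants B, C, Q and R depend
  on m; the oscillation om and then the time step are chosen after them, hence the nested
  \<open>eventually\<close>.\<close>

lemma grid_converges:
 assumes T: "0 < T" and ep: "0 < ep"
 shows "\<forall>\<^sub>F m in sequentially. \<forall>\<^sub>F K in sequentially. \<forall>X. grid_path b lam n x w m (T / real K) K X -->
  (\<forall>k\<le>K. nrm2 m (%i. X k i - fw m i * y (real k * (T / real K)) i) < ep)"
proof -
 let ?\<Lambda> = "lam^2 + 1"
 let ?E = "exp (2 * ?\<Lambda> * T)"
 have "0 < ep / (2 * ?E)" using ep by simp
 from order_tendstoD(2)[OF errI_tendsto[of T] this]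
 show ?thesis
 proof eventually_elim
  case (elim m)
  obtain B where B: "0 <= B" "!!t th. t \<in> {0..T} ==> \<bar>V m t th\<bar> <= B" using V_bounded[of T m] by blast
  obtain C where C: "0 <= C" "!!v v' u. \<bar>v\<bar> <= B ==> \<bar>v'\<bar> <= B ==> err lam n v' u <= err lam n v u + \<bar>v' - v\<bar> * C * (1 + u ^ (2 * n + 2))"
   using err_shift[of B lam n] by blast
  let ?IU = "LBINT r:{0<..T}. U r"
  have IU: "0 <= ?IU" unfolding set_lebesgue_integral_def
   by (intro integral_nonneg_AE AE_I2) (auto simp: indicator_def U_nonneg)
  define R where "R = 2 * (real m + 1) * C * (T + ?IU) + Q m * T"
  have R: "0 <= R" unfolding R_def using C(1) T IU Q_nonneg[of m] by (intro add_nonneg_nonneg mult_nonneg_nonneg) auto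
  define om where "om = min 1 (ep / (2 * ?E * (R + 1)))"
  have om: "0 < om" "om <= 1" unfolding om_def using ep R by auto
  have "om <= ep / (2 * ?E * (R + 1))" unfolding om_def by simp
  moreover have "0 < 2 * ?E * (R + 1)" using R by simp
  ultimately have omR: "?E * (om * (R + 1)) <= ep / 2"
   by (intro mult_half_le) (simp only: pos_le_divide_eq)
  have intG: "(LBINT r:{0<..T}. G m om C r) <= (LBINT r:{0<..T}. errI m r) + om * R"
  proof -
   have lc: "(LBINT r:{0<..T}. k) = T * k" for k :: real using T by (simp add: set_lebesgue_integral_def)
   have i1: "set_integrable lborel {0<..T} (%r. 1 + U r)"
    by (rule set_integral_add(1)[OF set_integrable_const U_integrable])
   let ?k = "2 * (real m + 1) * om * C"
   have i2: "set_integrable lborel {0<..T} (%r. ?k * (1 + U r))" by (rule set_integrable_mult_right[OF i1])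
   have "(LBINT r:{0<..T}. G m om C r) = (LBINT r:{0<..T}. errI m r) + ((LBINT r:{0<..T}. ?k * (1 + U r)) + (LBINT r:{0<..T}. om^2 * Q m))"
    unfolding G_def set_integral_add(2)[OF err_integrable(2) set_integral_add(1)[OF i2 set_integrable_const]]
     set_integral_add(2)[OF i2 set_integrable_const] ..
   also have "(LBINT r:{0<..T}. ?k * (1 + U r)) = ?k * (LBINT r:{0<..T}. 1 + U r)"
    by (rule set_integral_mult_right)
   also have "(LBINT r:{0<..T}. 1 + U r) = T + ?IU"
    unfolding set_integral_add(2)[OF set_integrable_const U_integrable] lc by simp
   also have "(LBINT r:{0<..T}. om^2 * Q m) = T * (om^2 * Q m)" by (rule lc)
   also have "om^2 * Q m <= om * Q m"
    using om Q_nonneg[of m] by (intro mult_right_mono) (auto simp: power2_eq_square mult_left_le)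
   finally have "(LBINT r:{0<..T}. G m om C r) <= (LBINT r:{0<..T}. errI m r) + (?k * (T + ?IU) + T * (om * Q m))"
    using T by simp
   also have "?k * (T + ?IU) + T * (om * Q m) = om * R" unfolding R_def by (simp add: algebra_simps)
   finally show ?thesis .
  qed
  have "\<exists>d>0. \<forall>i\<le>m. \<forall>s\<in>{0..T}. \<forall>t\<in>{0..T}. \<bar>t - s\<bar> < d --> \<bar>y t i - y s i\<bar> < om"
  proof -
   have "\<exists>d>0. \<forall>s\<in>{0..T}. \<forall>t\<in>{0..T}. \<bar>t - s\<bar> < d --> \<bar>y t i - y s i\<bar> < om" for i
   proof -
    have "uniformly_continuous_on {0..T} (%t. y t i)"
     by (rule compact_uniformly_continuous[OF continuous_y]) simp
    then show ?thesis unfolding uniformly_continuous_on_def dist_real_def using om(1) by blast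
   qed
   then obtain d where d: "!!i. 0 < d i" "!!i s t. s \<in> {0..T} ==> t \<in> {0..T} ==> \<bar>t - s\<bar> < d i ==> \<bar>y t i - y s i\<bar> < om"
    by metis
   have fin: "finite (d ` {..m})" "d ` {..m} \<noteq> {}" by auto
   have "0 < Min (d ` {..m})" using d(1) fin by (subst Min_gr_iff) auto
   moreover have "Min (d ` {..m}) <= d i" if "i <= m" for i using that fin by (intro Min_le) auto
   ultimately show ?thesis using d(2) by (intro exI[of _ "Min (d ` {..m})"]) (meson less_le_trans)
  qed
  then obtain d where d: "0 < d" "!!i s t. i <= m ==> s \<in> {0..T} ==> t \<in> {0..T} ==> \<bar>t - s\<bar> < d ==> \<bar>y t i - y s i\<bar> < om"
   by blast
  have lim: "(%K. T / real K) \<longlonglongrightarrow> 0" by (rule lim_const_over_n)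
  have "0 < min d (1 / (2 * ?\<Lambda>))" using d(1) by (simp add: add_nonneg_pos)
  from order_tendstoD(2)[OF lim this] eventually_gt_at_top[of 0]
  show "\<forall>\<^sub>F K in sequentially. \<forall>X. grid_path b lam n x w m (T / real K) K X -->
   (\<forall>k\<le>K. nrm2 m (%i. X k i - fw m i * y (real k * (T / real K)) i) < ep)"
  proof eventually_elim
   case (elim K)
   note eK = elim
   show ?case
   proof (intro allI impI)
    fix X k assume X: "grid_path b lam n x w m (T / real K) K X" and k: "k <= K"
    let ?h = "T / real K"
    have \<Lambda>: "0 < ?\<Lambda>" by (simp add: add_nonneg_pos)
    have h: "0 < ?h" "?h < d" "?h * ?\<Lambda> <= 1 / 2" and Kh: "real K * ?h = T"
     using eK T \<Lambda> by (auto simp: pos_less_divide_eq mult_ac)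
    have kT: "real k * ?h <= T" using k h(1) mult_right_mono[of "real k" "real K" ?h] Kh by simp
    have "nrm2 m (%i. X k i - fw m i * y (real k * ?h) i)
     <= exp (2 * (?h * ?\<Lambda>) * real k) * (LBINT r:{0<..real k * ?h}. G m om C r)"
    proof (rule grid_error[OF h(1,3) _ _ _ C X k])
     show "\<bar>y t i - y s i\<bar> <= om"
      if "s \<in> {0..real K * ?h}" "t \<in> {0..real K * ?h}" "\<bar>t - s\<bar> <= ?h" "i <= m" for s t i
      using d(2)[OF that(4), of s t] that h(2) unfolding Kh by auto
    qed (use om B Kh in auto)
    also have "\<dots> <= ?E * (LBINT r:{0<..T}. G m om C r)"
    proof (rule mult_mono)
     have "2 * (?h * ?\<Lambda>) * real k = 2 * ?\<Lambda> * (real k * ?h)" by (simp only: mult_ac)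
     also have "\<dots> <= 2 * ?\<Lambda> * T" using kT \<Lambda> by (intro mult_left_mono) auto
     finally show "exp (2 * (?h * ?\<Lambda>) * real k) <= ?E" by simp
     show "(LBINT r:{0<..real k * ?h}. G m om C r) <= (LBINT r:{0<..T}. G m om C r)"
      unfolding set_lebesgue_integral_def
     proof (rule integral_mono)
      show "integrable lborel (%r. indicat_real {0<..real k * ?h} r *\<^sub>R G m om C r)"
       "integrable lborel (%r. indicat_real {0<..T} r *\<^sub>R G m om C r)"
       using G_integrable unfolding set_integrable_def by blast+
      fix r
      have "0 <= G m om C r" by (rule G_nonneg) (use om C in auto)
      then show "indicat_real {0<..real k * ?h} r *\<^sub>R G m om C r <= indicat_real {0<..T} r *\<^sub>R G m om C r"
       using kT by (auto simp: indicator_def)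
     qed
     show "0 <= (LBINT r:{0<..real k * ?h}. G m om C r)"
      unfolding set_lebesgue_integral_def using om C(1)
      by (intro integral_nonneg_AE AE_I2) (auto intro!: G_nonneg simp: indicator_def)
    qed simp
    also have "\<dots> <= ?E * ((LBINT r:{0<..T}. errI m r) + om * R)"
     by (intro mult_left_mono intG) simp
    also have "\<dots> < ep"
    proof -
     have "?E * (LBINT r:{0<..T}. errI m r) < ep / 2"
      using \<open>(LBINT r:{0<..T}. errI m r) < ep / (2 * ?E)\<close> by (simp add: pos_less_divide_eq mult_ac)
     moreover have "?E * (om * R) <= ?E * (om * (R + 1))" using om by (intro mult_left_mono) auto
     ultimately show ?thesis using omR unfolding distrib_left[of ?E "LBINT r:{0<..T}. errI m r" "om * R"] by linarith
    qed
    finally show "nrm2 m (%i. X k i - fw m i * y (real k * ?h) i) < ep" .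
   qed
  qed
 qed
qed

end

section \<open>Convergence of expectations\<close>

lemma summable_coef: "summable (%i. (coef h (Suc i))^2 / freq (Suc i))"
proof -
 have "summable (%i. (- eig (Suc i)) powr (- 1) * (coef h (Suc i))^2)" using coef[of h] by (simp add: V_def)
 then show ?thesis by (simp add: eig_eq_freq powr_minus_divide freq_def)
qed

lemma norm_H_sq: "(norm h)^2 = (coef h 0)^2 + (\<Sum>i. (coef h (Suc i))^2 / freq (Suc i))"
proof -
 let ?w = "%i. (- eig (Suc i)) powr (- 1)"
 have S: "summable (%i. ?w i * (coef h (Suc i))^2)" using coef[of h] by (simp add: V_def)
 have "0 <= (\<Sum>i. ?w i * (coef h (Suc i))^2)" by (intro suminf_nonneg S) simp
 then have "(norm h)^2 = (coef h 0)^2 + (\<Sum>i. ?w i * (coef h (Suc i))^2)"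
  by (simp add: norm_H_def V_norm_def V_seminorm_def)
 then show ?thesis by (simp add: eig_eq_freq powr_minus_divide freq_def)
qed

lift_definition emb :: "nat => (nat => real) => H" is "%m a i. if i <= m then a i else 0"
proof -
 fix m and a :: "nat => real"
 show "(%i. if i <= m then a i else 0) \<in> V (- 1)"
  unfolding V_def mem_Collect_eq by (rule summable_finite[of "{..<m}"]) auto
qed

lemma H_eqI: "(!!i. coef h i = coef k i) ==> h = k"
 by (simp add: coef_inject[symmetric] fun_eq_iff)

lemma emb_diff: "emb m a - emb m a' = emb m (%i. a i - a' i)"
 by (rule H_eqI) (simp add: minus_H.rep_eq emb.rep_eq)

lemma coef_sum: "coef (\<Sum>j\<in>A. f j) i = (\<Sum>j\<in>A. coef (f j) i)"
 by (induction A rule: infinite_finite_induct) (auto simp: zero_H.rep_eq plus_H.rep_eq)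

lemma continuous_emb: "continuous_on UNIV (emb m)"
proof -
 have "emb m a = (\<Sum>j\<le>m. a j *\<^sub>R emb j (%i. if i = j then 1 else 0))" for a
 proof (rule H_eqI)
  fix i
  have "coef (a j *\<^sub>R emb j (%i. if i = j then 1 else 0)) i = (if j = i then a j else 0)" for j
   by (simp add: emb.rep_eq scaleR_H.rep_eq)
  then show "coef (emb m a) i = coef (\<Sum>j\<le>m. a j *\<^sub>R emb j (%i. if i = j then 1 else 0)) i"
   by (simp add: coef_sum emb.rep_eq)
 qed
 then have "emb m = (%a. \<Sum>j\<le>m. a j *\<^sub>R emb j (%i. if i = j then 1 else 0))" by auto
 moreover have "continuous_on UNIV \<dots>"
  by (intro continuous_on_sum continuous_on_scaleR continuous_on_const continuous_on_product_coordinates)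
 ultimately show ?thesis by simp
qed

lemma measurable_emb [measurable]: "emb m \<in> borel_measurable borel"
 by (intro borel_measurable_continuous_onI continuous_emb)

lemma norm_emb_sq: "(norm (emb m z))^2 = (z 0)^2 + (\<Sum>i=1..m. (z i)^2 / freq i)"
proof -
 have "(\<Sum>i. (coef (emb m z) (Suc i))^2 / freq (Suc i)) = (\<Sum>i<m. (coef (emb m z) (Suc i))^2 / freq (Suc i))"
  by (rule suminf_finite) (auto simp: emb.rep_eq)
 also have "\<dots> = (\<Sum>i<m. (z (Suc i))^2 / freq (Suc i))"
  by (intro sum.cong) (auto simp: emb.rep_eq)
 also have "\<dots> = (\<Sum>i=1..m. (z i)^2 / freq i)"
  using sum.atLeast1_atMost_eq[of "%i. (z i)^2 / freq i" m] by simp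
 finally show ?thesis by (simp add: norm_H_sq emb.rep_eq)
qed

text \<open>fw <= 1 gives 1/freq <= wt, so estimates in the weighted norm pass to Lipschitz
  functions on H.\<close>

lemma norm_emb_le: "z 0 = 0 ==> norm (emb m z) <= sqrt (nrm2 m z)"
proof -
 assume z: "z 0 = 0"
 have "(norm (emb m z))^2 <= nrm2 m z"
  unfolding norm_emb_sq nrm2_def z
 proof (simp only: power_zero_numeral add_0, rule sum_mono)
  fix i assume i: "i \<in> {1..m}"
  then have "freq i * fw m i <= freq i * 1" "0 < fw m i" "0 < freq i"
   using fw_bounds[of i m] fw_bounds(2)[of m i] freq_ge_1[of i] by (auto intro!: mult_left_mono)
  then have "1 / freq i <= wt m i" unfolding wt_def by (intro divide_left_mono) (auto simp: mult.commute)
  from mult_right_mono[OF this, of "(z i)^2"] show "(z i)^2 / freq i <= wt m i * (z i)^2" by simp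
 qed
 then show ?thesis by (rule real_le_rsqrt)
qed

text \<open>The Fejer mean of x. The squared weight fw^2 against 1/fw in \<open>wt\<close> keeps the
  weighted norm of the initial value below the norm of x, uniformly in m.\<close>

definition start :: "nat => H => nat => real" where
 "start m x i = (if i <= m then fw m i * coef x i else 0)"

lemma emb_start_diff: "emb m (start m x) - emb m (start m y) = emb m (start m (x - y))"
 unfolding emb_diff by (rule H_eqI) (simp add: emb.rep_eq start_def minus_H.rep_eq algebra_simps)

lemma norm_emb_start: "norm (emb m (start m x)) <= norm x"
proof -
 have "(norm (emb m (start m x)))^2 <= (norm x)^2"
  unfolding norm_H_sq
 proof (rule add_mono)
  show "(coef (emb m (start m x)) 0)^2 <= (coef x 0)^2" by (simp add: emb.rep_eq start_def)
  show "(\<Sum>i. (coef (emb m (start m x)) (Suc i))^2 / freq (Suc i)) <= (\<Sum>i. (coef x (Suc i))^2 / freq (Suc i))"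
  proof (rule suminf_le[OF _ summable_coef summable_coef])
   fix i
   have "\<bar>coef (emb m (start m x)) (Suc i)\<bar> <= \<bar>coef x (Suc i)\<bar>"
   proof (cases "Suc i <= m")
    case True
    then have "\<bar>fw m (Suc i)\<bar> <= 1" using fw_bounds(3)[of "Suc i" m] fw_bounds(2)[of m "Suc i"] by simp
    then show ?thesis using True mult_right_mono[of "\<bar>fw m (Suc i)\<bar>" 1 "\<bar>coef x (Suc i)\<bar>"]
     by (simp add: emb.rep_eq start_def abs_mult)
   qed (simp add: emb.rep_eq start_def)
   then show "(coef (emb m (start m x)) (Suc i))^2 / freq (Suc i) <= (coef x (Suc i))^2 / freq (Suc i)"
    by (intro divide_right_mono) (simp_all add: abs_le_square_iff freq_def)
  qed
 qed
 then show ?thesis by (rule power2_le_imp_le) simp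
qed

lemma emb_start_tendsto: "(%m. emb m (start m x)) \<longlonglongrightarrow> x"
proof -
 let ?d = "%m i. coef (emb m (start m x) - x) i"
 have lim: "(%m. ?d m i) \<longlonglongrightarrow> 0" for i
 proof -
  have "(%m. fw m i * coef x i - coef x i) \<longlonglongrightarrow> 1 * coef x i - coef x i"
   by (intro tendsto_intros fw_lim)
  moreover have "\<forall>\<^sub>F m in sequentially. fw m i * coef x i - coef x i = ?d m i"
   using eventually_ge_at_top[of i] by eventually_elim (simp add: minus_H.rep_eq emb.rep_eq start_def)
  ultimately show ?thesis by (simp add: tendsto_cong)
 qed
 have bd: "\<bar>?d m i\<bar> <= \<bar>coef x i\<bar>" for m i
 proof (cases "i <= m")
  case True
  have "\<bar>1 - fw m i\<bar> <= 1" using fw_bounds(3)[OF True] fw_bounds(2)[of m i] by simp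
  from mult_right_mono[OF this, of "\<bar>coef x i\<bar>"] show ?thesis
   using True by (simp add: minus_H.rep_eq emb.rep_eq start_def abs_mult[symmetric] algebra_simps abs_minus_commute)
 qed (simp add: minus_H.rep_eq emb.rep_eq start_def)
 have "(%m. \<Sum>i. (?d m (Suc i))^2 / freq (Suc i)) \<longlonglongrightarrow> (\<Sum>i. 0)"
 proof (rule tannerys_theorem[OF _ _ summable_coef[of x], THEN conjunct2, THEN conjunct2])
  show "(%m. (?d m (Suc i))^2 / freq (Suc i)) \<longlonglongrightarrow> 0" for i
   using tendsto_divide[OF tendsto_power[OF lim[of "Suc i"], of 2] tendsto_const, of "freq (Suc i)"] freq_ge_1[of "Suc i"] by simp
  show "\<forall>\<^sub>F (i, m) in at_top \<times>\<^sub>F sequentially. norm ((?d m (Suc i))^2 / freq (Suc i)) <= (coef x (Suc i))^2 / freq (Suc i)"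
  proof (rule always_eventually, safe)
   fix i m
   have "(?d m (Suc i))^2 <= (coef x (Suc i))^2" using bd[of m "Suc i"] by (simp add: abs_le_square_iff)
   then show "norm ((?d m (Suc i))^2 / freq (Suc i)) <= (coef x (Suc i))^2 / freq (Suc i)"
    using freq_ge_1[of "Suc i"] by (simp add: divide_right_mono)
  qed
 qed auto
 moreover have "?d m 0 = 0" for m by (simp add: minus_H.rep_eq emb.rep_eq start_def)
 ultimately have "(%m. (norm (emb m (start m x) - x))^2) \<longlonglongrightarrow> 0"
  unfolding norm_H_sq by simp
 from tendsto_real_sqrt[OF this] have "(%m. norm (emb m (start m x) - x)) \<longlonglongrightarrow> 0" by simp
 then show ?thesis by (rule Lim_null[THEN iffD2, OF tendsto_norm_zero_cancel])
qed

text \<open>Contractions converging pointwise converge uniformly on compact sets. The compact set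
  will be the range of a trajectory over [0,T].\<close>

lemma emb_start_uniform:
 assumes S: "compact S" and ep: "0 < ep"
 shows "\<forall>\<^sub>F m in sequentially. \<forall>x\<in>S. dist (emb m (start m x)) x < ep"
proof -
 obtain k where k: "finite k" "S \<subseteq> (\<Union>x\<in>k. ball x (ep / 3))"
  using S ep unfolding compact_eq_totally_bounded by (metis zero_less_divide_iff zero_less_numeral)
 have "\<forall>\<^sub>F m in sequentially. \<forall>z\<in>k. dist (emb m (start m z)) z < ep / 3"
  using k(1) ep by (intro eventually_ball_finite ballI tendstoD[OF emb_start_tendsto]) auto
 then show ?thesis
 proof eventually_elim
  case (elim m)
  show ?case
  proof
   fix x assume "x \<in> S"
   then obtain z where z: "z \<in> k" "dist z x < ep / 3" using k(2) by auto
   have "dist (emb m (start m x)) (emb m (start m z)) <= dist x z"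
    unfolding dist_norm emb_start_diff by (rule norm_emb_start)
   moreover have "dist (emb m (start m x)) x <= dist (emb m (start m x)) (emb m (start m z)) + dist (emb m (start m z)) z + dist z x"
    using dist_triangle[of "emb m (start m x)" x "emb m (start m z)"] dist_triangle[of "emb m (start m z)" x z] by linarith
   moreover have "dist (emb m (start m z)) z < ep / 3" using elim z by blast
   ultimately show "dist (emb m (start m x)) x < ep" using z(2) by (simp add: dist_commute)
  qed
 qed
qed

lemma nrm2_start: "nrm2 m (start m x) <= (norm x)^2"
proof -
 have "nrm2 m (start m x) <= (\<Sum>i=1..m. (coef x i)^2 / freq i)"
  unfolding nrm2_def
 proof (rule sum_mono)
  fix i assume i: "i \<in> {1..m}"
  then have f: "0 < fw m i" "fw m i <= 1" "0 < freq i" using fw_bounds(1)[of i m] fw_bounds(2)[of m i] freq_ge_1[of i] by auto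
  have "wt m i * (start m x i)^2 = fw m i * ((coef x i)^2 / freq i)"
   using f i by (simp add: wt_def power2_eq_square start_def)
  also have "\<dots> <= 1 * ((coef x i)^2 / freq i)" using f by (intro mult_right_mono) auto
  finally show "wt m i * (start m x i)^2 <= (coef x i)^2 / freq i" by simp
 qed
 also have "\<dots> = (\<Sum>i<m. (coef x (Suc i))^2 / freq (Suc i))"
  using sum.atLeast1_atMost_eq[of "%i. (coef x i)^2 / freq i" m] by simp
 also have "\<dots> <= (\<Sum>i. (coef x (Suc i))^2 / freq (Suc i))"
  by (rule sum_le_suminf[OF summable_coef]) (auto simp: freq_def)
 also have "\<dots> <= (norm x)^2" by (simp add: norm_H_sq)
 finally show ?thesis .
qed

lemma nrm2_start_diff: "nrm2 m (%i. start m x i - start m y i) <= (dist x y)^2"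
proof -
 have "(%i. start m x i - start m y i) = start m (x - y)"
  by (auto simp: start_def minus_H.rep_eq algebra_simps)
 then show ?thesis using nrm2_start[of m "x - y"] by (simp add: dist_norm)
qed

text \<open>Dominated convergence for an iterated limit in which the threshold for K may depend on m
  and on the sample point; it is carried out once in m and once in K.\<close>

lemma nested_dct:
 fixes D :: "nat => nat => 'w => real"
 assumes M: "prob_space M" and D [measurable]: "!!m K. D m K \<in> borel_measurable M"
  and bd: "!!m K om. 0 <= D m K om \<and> D m K om <= B"
  and ae: "AE om in M. \<forall>ep>0. \<forall>\<^sub>F m in sequentially. \<forall>\<^sub>F K in sequentially. D m K om < ep"
  and ep: "0 < ep"
 shows "\<forall>\<^sub>F m in sequentially. \<forall>\<^sub>F K in sequentially. (\<integral>om. D m K om \<partial>M) < ep"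
proof -
 interpret prob_space M by fact
 have B0: "0 <= B" using bd[of 0 0 undefined] by linarith
 \<comment> \<open>Samples for which the inner limit is already below ep/3. Their complements vanish
   as m grows, and on A m the excess over ep/3 vanishes as K grows.\<close>
 define A where "A m = {om \<in> space M. \<forall>\<^sub>F K in sequentially. D m K om < ep / 3}" for m
 have A [measurable]: "A m \<in> sets M" for m
  unfolding A_def eventually_sequentially by measurable
 have "(%m. \<integral>om. B * indicator (space M - A m) om \<partial>M) \<longlonglongrightarrow> (\<integral>om. 0 \<partial>M)"
 proof (rule integral_dominated_convergence[where w="%_. B"])
  show "AE om in M. (%m. B * indicator (space M - A m) om) \<longlonglongrightarrow> 0"
   using ae AE_space
  proof eventually_elim
   case (elim om)
   have "\<forall>\<^sub>F m in sequentially. \<forall>\<^sub>F K in sequentially. D m K om < ep / 3" using elim(1) ep by (metis divide_pos_pos zero_less_numeral)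
   then have "\<forall>\<^sub>F m in sequentially. B * indicator (space M - A m) om = 0"
    by eventually_elim (use elim in \<open>simp add: A_def\<close>)
   then show ?case by (rule tendsto_eventually)
  qed
 qed (use B0 in \<open>auto simp: indicator_def\<close>)
 then have "\<forall>\<^sub>F m in sequentially. (\<integral>om. B * indicator (space M - A m) om \<partial>M) < ep / 3"
  by (rule order_tendstoD) (use ep in simp)
 then show ?thesis
 proof eventually_elim
  case (elim m)
  let ?r = "%K om. indicator (A m) om * max (D m K om - ep / 3) 0"
  have rb: "0 <= ?r K om \<and> ?r K om <= B" for K om
   using bd[of m K om] ep B0 by (auto simp: indicator_def)
  have "(%K. \<integral>om. ?r K om \<partial>M) \<longlonglongrightarrow> (\<integral>om. 0 \<partial>M)"
  proof (rule integral_dominated_convergence[where w="%_. B"])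
   show "AE om in M. (%K. ?r K om) \<longlonglongrightarrow> 0"
   proof (rule AE_I2)
    fix om assume "om \<in> space M"
    show "(%K. ?r K om) \<longlonglongrightarrow> 0"
    proof (cases "om \<in> A m")
     case True
     then have "\<forall>\<^sub>F K in sequentially. D m K om < ep / 3" by (simp add: A_def)
     then have "\<forall>\<^sub>F K in sequentially. ?r K om = 0" by eventually_elim simp
     then show ?thesis by (rule tendsto_eventually)
    qed simp
   qed
   show "AE om in M. norm (?r K om) <= B" for K using rb by auto
  qed auto
  then have "\<forall>\<^sub>F K in sequentially. (\<integral>om. ?r K om \<partial>M) < ep / 3"
   by (rule order_tendstoD) (use ep in simp)
  then show ?case
  proof eventually_elim
   case K: (elim K)
   have ir: "integrable M (?r K)"
    by (rule integrable_const_bound[where B=B]) (use rb in auto)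
   have ia: "integrable M (%om. B * indicator (space M - A m) om)"
    by (rule integrable_const_bound[where B=B]) (use B0 in \<open>auto simp: indicator_def\<close>)
   have "(\<integral>om. D m K om \<partial>M) <= (\<integral>om. (ep / 3 + ?r K om) + B * indicator (space M - A m) om \<partial>M)"
   proof (rule integral_mono)
    show "integrable M (D m K)" by (rule integrable_const_bound[where B=B]) (use bd in auto)
    fix om assume "om \<in> space M"
    then show "D m K om <= (ep / 3 + ?r K om) + B * indicator (space M - A m) om"
     using bd[of m K om] ep by (auto simp: indicator_def)
   qed (intro Bochner_Integration.integrable_add ir ia, simp)
   also have "\<dots> = ep / 3 + (\<integral>om. ?r K om \<partial>M) + (\<integral>om. B * indicator (space M - A m) om \<partial>M)"
    using ir ia by (simp add: prob_space)
   also have "\<dots> < ep" using K elim by linarith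
   finally show ?case .
  qed
 qed
qed

lemma step_solution_cong:
 "step_solution lam n c m h x a ==> (!!i. i \<in> {1..m} ==> x i = x' i) ==> step_solution lam n c m h x' a"
 by (simp add: step_solution_def)

lemma (in scheme) adm_start: "x \<in> Hc c ==> adm (start m x)"
 by (simp add: adm_def start_def Hc_def)

lemma (in scheme) grid_path_path:
 assumes x: "x \<in> Hc c"
 shows "grid_path b lam n x w m h K
  (%k. path (start m x) k (%p. (w (snd p) (real (Suc (fst p)) * h) - w (snd p) (real (fst p) * h)) / sqrt h))"
  (is "grid_path b lam n x w m h K (%k. path ?x k ?r)")
 unfolding grid_path_def
proof (intro conjI ballI allI impI)
 show "path ?x 0 ?r i = fw m i * coef x i" if "i \<in> {1..m}" for i using that by (simp add: start_def)
 fix k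
 have "step_solution lam n c m h (kick b h m (path ?x k ?r) (\<lambda>i\<in>{1..m}. ?r (k, i))) (path ?x (Suc k) ?r)"
  unfolding path.simps by (rule step_solution_J)
 then show "step_solution lam n (coef x 0) m h
   (%i. path ?x k ?r i + fw m i * sqrt (b i) * (w i (real (Suc k) * h) - w i (real k * h))) (path ?x (Suc k) ?r)"
  using x h_pos unfolding Hc_def mem_Collect_eq
  by (elim ssubst) (erule step_solution_cong, simp add: kick_def noise_amp_def real_sqrt_mult)
qed

lemma eventually_small_step:
 assumes "0 < T"
 shows "\<forall>\<^sub>F K in sequentially. 1 <= K \<and> 0 < T / real K \<and> T / real K * A <= 1 / 2"
proof -
 have "(%K. T * A * inverse (real K)) \<longlonglongrightarrow> T * A * 0" by (intro tendsto_intros lim_inverse_n)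
 then have "\<forall>\<^sub>F K in sequentially. T * A * inverse (real K) < 1 / 2" by (rule order_tendstoD) simp
 with eventually_ge_at_top[of 1] show ?thesis
 proof eventually_elim
  case (elim K)
  have "T / real K * A = T * A * inverse (real K)" by (simp only: divide_inverse mult_ac)
  with elim assms show ?case by simp
 qed
qed

text \<open>Driving the scheme by the increments of the given Wiener process leaves its law
  unchanged and couples it with the solution, so pathwise convergence applies. All grid times are
  covered at once because the energy estimate compares a Riemann sum.\<close>

lemma expect_converges:
 fixes \<phi> :: "H => real"
 assumes W: "cylindrical_wiener M W" and b: "b 0 = 0" "!!i. 0 <= b i"
  and sol: "solution M W b lam n x \<Xi>" and x: "x \<in> Hc c" and T: "0 < T" and ep: "0 < ep"
  and \<phi>: "!!h. \<bar>\<phi> h\<bar> <= B" and L: "0 <= L" "!!h k. \<bar>\<phi> h - \<phi> k\<bar> <= L * dist h k"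
 shows "\<forall>\<^sub>F m in sequentially. \<forall>\<^sub>F K in sequentially. \<forall>k\<le>K.
  \<bar>(scheme.T lam c n m b (T / real K) ^^ k) (%a. \<phi> (emb m a)) (start m x) - (\<integral>om. \<phi> (\<Xi> (real k * (T / real K)) om) \<partial>M)\<bar> < ep"
proof -
 interpret prob_space M using W by (simp add: cylindrical_wiener_def)
 have B0: "0 <= B" using \<phi>[of 0] by linarith
 have "L-lipschitz_on UNIV \<phi>" using L by (auto intro: lipschitz_onI simp: dist_real_def)
 then have c\<phi>: "continuous_on UNIV \<phi>" by (rule lipschitz_on_continuous_on)
 then have m\<phi>: "\<phi> \<in> borel_measurable borel" by (rule borel_measurable_continuous_onI)
 \<comment> \<open>The parameters for which the scheme is available. D is 0 elsewhere, so that the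
   uniform bounds hold for every m and K.\<close>
 define ok where "ok m K \<longleftrightarrow> 1 <= m \<and> 1 <= K \<and> 0 < T / real K \<and> T / real K * (lam^2 + 1) <= 1 / 2" for m K :: nat
 define \<zeta> where "\<zeta> K p om = (W (snd p) (real (Suc (fst p)) * (T / real K)) om - W (snd p) (real (fst p) * (T / real K)) om) / sqrt (T / real K)" for K :: nat and p om
 define Y where "Y m K k om = scheme.path lam c n m b (T / real K) (start m x) k (%p. \<zeta> K p om)" for m K k :: nat and om
 define d where "d m K k om = \<bar>\<phi> (emb m (Y m K k om)) - \<phi> (\<Xi> (real k * (T / real K)) om)\<bar>" for m K k :: nat and om
 define D where "D m K om = (if ok m K then MAX k\<in>{..K}. d m K k om else 0)" for m K :: nat and om
 have sch: "scheme lam b (T / real K)" if "ok m K" for m K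
  using that b(2) unfolding ok_def scheme_def by blast
 have Y: "Y m K k \<in> borel_measurable M" "distr M borel (Y m K k) = scheme.law lam c n m b (T / real K) k (start m x)"
  if ok: "ok m K" and k: "k <= K" for m K k
 proof -
  interpret scheme lam c n m b "T / real K" by (rule sch[OF ok])
  have "1 <= m" "1 <= K" using ok by (auto simp: ok_def)
  note inc = increments_indep[OF W h_pos this, folded \<zeta>_def]
  have eta: "(%p. \<zeta> K p) = \<zeta> K" by auto
  from path_law[OF prob_space_axioms \<open>1 <= m\<close> inc(1)[folded \<zeta>_def] inc(2) k, of "start m x"]
  show "Y m K k \<in> borel_measurable M" "distr M borel (Y m K k) = law k (start m x)"
   unfolding Y_def[abs_def] by auto
 qed
 have mX: "(%om. \<phi> (\<Xi> (real k * (T / real K)) om)) \<in> borel_measurable M" for k K :: nat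
 proof (rule measurable_compose[OF _ m\<phi>])
  have "0 <= real k * (T / real K)" using T by simp
  then show "\<Xi> (real k * (T / real K)) \<in> borel_measurable M" using sol by (simp add: solution_def)
 qed
 have mY: "(%om. \<phi> (emb m (Y m K k om))) \<in> borel_measurable M" if "ok m K" "k <= K" for m K k
  by (rule measurable_compose[OF measurable_compose[OF Y(1)[OF that] measurable_emb] m\<phi>])
 have md: "d m K k \<in> borel_measurable M" if "ok m K" "k <= K" for m K k
  unfolding d_def[abs_def] by (intro borel_measurable_abs borel_measurable_diff mX mY that)
 have dB: "0 <= d m K k om \<and> d m K k om <= 2 * B" for m K k om
  unfolding d_def using \<phi>[of "emb m (Y m K k om)"] \<phi>[of "\<Xi> (real k * (T / real K)) om"] by linarith
 have D_ex: "\<exists>k. D m K om = d m K k om" if "ok m K" for m K om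
 proof -
  have "Max ((%k. d m K k om) ` {..K}) \<in> (%k. d m K k om) ` {..K}" by (rule Max_in) auto
  then obtain k where "Max ((%k. d m K k om) ` {..K}) = d m K k om" by (rule imageE)
  then show ?thesis using that unfolding D_def by auto
 qed
 have ev_ok: "\<forall>\<^sub>F m in sequentially. \<forall>\<^sub>F K in sequentially. ok m K"
  using eventually_ge_at_top[of 1]
 proof eventually_elim
  case (elim m)
  show ?case using eventually_small_step[OF T, of "lam^2 + 1"]
   by eventually_elim (use elim in \<open>auto simp: ok_def\<close>)
 qed
 have "\<forall>\<^sub>F m in sequentially. \<forall>\<^sub>F K in sequentially. (\<integral>om. D m K om \<partial>M) < ep"
 proof (rule nested_dct[OF prob_space_axioms _ _ _ ep, where B="2 * B"])
  show "D m K \<in> borel_measurable M" for m K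
   unfolding D_def[abs_def] using md by (cases "ok m K") (auto intro!: borel_measurable_Max)
  show "0 <= D m K om \<and> D m K om <= 2 * B" for m K om
  proof (cases "ok m K")
   case True
   then obtain k where "D m K om = d m K k om" using D_ex by blast
   then show ?thesis using dB by simp
  qed (use B0 in \<open>simp add: D_def\<close>)
  have "AE om in M. solution_path b lam n x (%k t. W k t om) (%t. \<Xi> t om)"
   using sol by (simp add: solution_def)
  then show "AE om in M. \<forall>ep>0. \<forall>\<^sub>F m in sequentially. \<forall>\<^sub>F K in sequentially. D m K om < ep"
  proof eventually_elim
   case (elim om)
   from elim obtain u where wp: "weak_path b lam n x (%k t. W k t om) (%t. \<Xi> t om) u"
    using b(1) unfolding solution_path_def weak_path_def by blast
   interpret weak_path b lam n x "%k t. W k t om" "%t. \<Xi> t om" u by (rule wp)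
   show ?case
   proof (intro allI impI)
    fix ep :: real assume ep: "0 < ep"
    \<comment> \<open>One \<delta> for the error of the scheme and one for replacing the solution by
      its Fejer mean; L + 1 keeps the quotient meaningful for L = 0.\<close>
    define \<delta> where "\<delta> = ep / (2 * (L + 1))"
    have \<delta>: "0 < \<delta>" using ep L by (simp add: \<delta>_def)
    have L\<delta>: "L * (2 * \<delta>) < ep"
    proof -
     have "L * (2 * \<delta>) < (L + 1) * (2 * \<delta>)" using \<delta> by (intro mult_strict_right_mono) auto
     also have "\<dots> = ep" using L(1) unfolding \<delta>_def by (simp add: divide_simps)
     finally show ?thesis .
    qed
    have "compact ((%t. \<Xi> t om) ` {0..T})"
     by (intro compact_continuous_image continuous_on_subset[OF cont]) auto
    from emb_start_uniform[OF this \<delta>] grid_converges[OF T zero_less_power[OF \<delta>, of 2]] ev_ok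
    show "\<forall>\<^sub>F m in sequentially. \<forall>\<^sub>F K in sequentially. D m K om < ep"
    proof eventually_elim
     case m: (elim m)
     have "\<forall>\<^sub>F K in sequentially. \<forall>X. grid_path b lam n x (%k t. W k t om) m (T / real K) K X -->
      (\<forall>k\<le>K. nrm2 m (%i. X k i - fw m i * y (real k * (T / real K)) i) < \<delta>^2)"
      by (rule m(2))
     with m(3) show ?case
     proof eventually_elim
      case K: (elim K)
      interpret scheme lam c n m b "T / real K" by (rule sch[OF K(1)])
      have gp: "grid_path b lam n x (%k t. W k t om) m (T / real K) K (%k. Y m K k om)"
       unfolding Y_def \<zeta>_def by (rule grid_path_path[OF x])
      have "d m K k om < ep" if k: "k <= K" for k
      proof -
       let ?s = "real k * (T / real K)"
       let ?\<xi> = "\<Xi> ?s om"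
       have "real k * (T / real K) <= real K * (T / real K)" using k T by (intro mult_right_mono) auto
       also have "\<dots> = T" using K(1) by (simp add: ok_def)
       finally have s: "?s \<in> {0..T}" using T by simp
       have Y0: "Y m K k om 0 = c"
       proof (cases k)
        case 0
        then show ?thesis using x by (simp add: Y_def start_def Hc_def)
       next
        case (Suc j)
        then show ?thesis using adm_J by (simp add: Y_def adm_def)
       qed
       have s0: "0 <= ?s" using s by simp
       have \<xi>0: "coef ?\<xi> 0 = c" using y_0[OF s0] y_nonneg[OF s0, of 0] x by (simp add: Hc_def)
       have ys: "y ?s = coef ?\<xi>" using y_nonneg[OF s0] by auto
       have "dist (emb m (Y m K k om)) (emb m (start m ?\<xi>)) <= sqrt (nrm2 m (%i. Y m K k om i - start m ?\<xi> i))"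
        unfolding dist_norm emb_diff by (rule norm_emb_le) (simp only: Y0 start_def \<xi>0 fw_0 le0 if_True mult_1 diff_self)
       also have "nrm2 m (%i. Y m K k om i - start m ?\<xi> i) = nrm2 m (%i. Y m K k om i - fw m i * y ?s i)"
        unfolding nrm2_def ys by (intro sum.cong refl) (simp add: start_def)
       also have "sqrt \<dots> <= sqrt (\<delta>^2)"
        using K(2) gp k by (intro real_sqrt_le_mono less_imp_le) blast
       also have "\<dots> = \<delta>" using \<delta> by simp
       finally have 1: "dist (emb m (Y m K k om)) (emb m (start m ?\<xi>)) <= \<delta>" .
       have 2: "dist (emb m (start m ?\<xi>)) ?\<xi> < \<delta>" using m(1) s by blast
       have "dist (emb m (Y m K k om)) ?\<xi> <= 2 * \<delta>"
        using 1 2 dist_triangle[of "emb m (Y m K k om)" ?\<xi> "emb m (start m ?\<xi>)"] by linarith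
       then have "L * dist (emb m (Y m K k om)) ?\<xi> <= L * (2 * \<delta>)" using L(1) by (rule mult_left_mono)
       then show ?thesis using L(2)[of "emb m (Y m K k om)" ?\<xi>] L\<delta> unfolding d_def by linarith
      qed
      then show ?case using K(1) by (simp add: D_def)
     qed
    qed
   qed
  qed
 qed
 with ev_ok show ?thesis
 proof eventually_elim
  case (elim m)
  from elim show ?case
  proof eventually_elim
   case K: (elim K)
   interpret S: scheme lam c n m b "T / real K" by (rule sch[OF K(1)])
   show ?case
   proof (intro allI impI)
    fix k assume k: "k <= K"
    note my = mY[OF K(1) k] and mx = mX[of k K]
    have iy: "integrable M (%om. \<phi> (emb m (Y m K k om)))" and ix: "integrable M (%om. \<phi> (\<Xi> (real k * (T / real K)) om))"
     using my mx \<phi> by (auto intro!: integrable_const_bound[where B=B])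
    have me: "(%a. \<phi> (emb m a)) \<in> borel_measurable borel"
     by (rule measurable_compose[OF measurable_emb m\<phi>])
    have "(S.T ^^ k) (%a. \<phi> (emb m a)) (start m x) = (\<integral>a. \<phi> (emb m a) \<partial>S.law k (start m x))"
     by (rule S.integral_law[symmetric, OF me \<phi>])
    also have "\<dots> = (\<integral>om. \<phi> (emb m (Y m K k om)) \<partial>M)"
     unfolding Y(2)[OF K(1) k, symmetric] by (rule integral_distr[OF Y(1)[OF K(1) k] me])
    finally have eq: "(S.T ^^ k) (%a. \<phi> (emb m a)) (start m x) = (\<integral>om. \<phi> (emb m (Y m K k om)) \<partial>M)" .
    have "\<bar>(\<integral>om. \<phi> (emb m (Y m K k om)) \<partial>M) - (\<integral>om. \<phi> (\<Xi> (real k * (T / real K)) om) \<partial>M)\<bar> <= (\<integral>om. d m K k om \<partial>M)"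
     unfolding Bochner_Integration.integral_diff[OF iy ix, symmetric] d_def by (rule integral_abs_bound)
    also have "\<dots> <= (\<integral>om. D m K om \<partial>M)"
    proof (rule integral_mono)
     show "integrable M (d m K k)" using md[OF K(1) k] dB by (auto intro!: integrable_const_bound[where B="2 * B"])
     have "D m K \<in> borel_measurable M"
      unfolding D_def[abs_def] using md K(1) by (auto intro!: borel_measurable_Max)
     moreover have "\<bar>D m K om\<bar> <= 2 * B" for om
     proof -
      obtain k where "D m K om = d m K k om" using D_ex[OF K(1)] by blast
      then show ?thesis using dB[of m K k om] by simp
     qed
     ultimately show "integrable M (D m K)" by (auto intro!: integrable_const_bound[where B="2 * B"])
     show "d m K k om <= D m K om" for om using K(1) k by (auto simp: D_def intro!: Max_ge)
    qed
    also have "\<dots> < ep" by (rule K(2))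
    finally show "\<bar>(S.T ^^ k) (%a. \<phi> (emb m a)) (start m x) - (\<integral>om. \<phi> (\<Xi> (real k * (T / real K)) om) \<partial>M)\<bar> < ep"
     unfolding eq .
   qed
  qed
 qed
qed

section \<open>Harnack inequality and energy bound for the approximations\<close>

text \<open>The limit of \<open>chain_log_harnack\<close> at the last grid point. Bernoulli's (1 +
  h)^K >= 1 + t turns the contraction into 1/sqrt(1 + t), and ln z <= z - 1 leaves a statement
  affine in expectations, ready for the limit in n.\<close>

lemma approx_harnack:
 fixes g :: "H => real"
 assumes W: "cylindrical_wiener M W" and b: "b 0 = 0" "!!i. 0 <= b i"
  and N: "!!i. i \<in> {1..N} ==> 0 < b i" "lam < 1 / 2 * (real N + 1)^2"
  and sol: "solution M W b lam n x \<Xi>" "solution M W b lam n y \<Upsilon>" and xy: "x \<in> Hc c" "y \<in> Hc c" and t: "0 < t"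
  and g: "!!h. \<bar>g h\<bar> <= B" and L: "0 <= L" "!!h k. \<bar>g h - g k\<bar> <= L * dist h k"
 shows "(\<integral>om. g (\<Upsilon> t om) \<partial>M) <= (\<integral>om. exp (g (\<Xi> t om)) \<partial>M) - 1
  + L * dist x y / sqrt (1 + t) + 2 * ctrl_cost lam b N * (dist x y)^2"
  (is "?Eg <= ?Ee - 1 + ?R1 + ?R2")
proof (rule field_le_epsilon)
 fix ep :: real assume "0 < ep"
 then have ep: "0 < ep / 2" by simp
 let ?K = "ctrl_gain lam N"
 have "L-lipschitz_on UNIV g" using L by (auto intro: lipschitz_onI simp: dist_real_def)
 then have mg: "g \<in> borel_measurable borel" by (intro borel_measurable_continuous_onI lipschitz_on_continuous_on)
 have C0: "0 <= ctrl_cost lam b N"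
  unfolding ctrl_cost_def using N(1)
  by (intro mult_nonneg_nonneg sum_nonneg divide_nonneg_nonneg) (auto simp: freq_def less_imp_le)
 have exp_lip: "\<bar>exp u - exp v\<bar> <= exp B * \<bar>u - v\<bar>" if "u <= B" "v <= B" for u v :: real
 proof -
  have le: "exp u - exp v <= exp B * \<bar>u - v\<bar>" if "u <= B" for u v :: real
  proof -
   have "exp u * (1 + (v - u)) <= exp u * exp (v - u)" by (intro mult_left_mono exp_ge_add_one_self) simp
   then have "exp u - exp v <= exp u * (u - v)" by (simp add: exp_diff algebra_simps)
   also have "\<dots> <= exp u * \<bar>u - v\<bar>" by (intro mult_left_mono) auto
   also have "\<dots> <= exp B * \<bar>u - v\<bar>" using that by (intro mult_right_mono) auto
   finally show ?thesis .
  qed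
  from le[OF that(1), of v] le[OF that(2), of u] show ?thesis by (simp add: abs_minus_commute)
 qed
 have gB: "g h <= B" for h using g[of h] by linarith
 note ev1 = expect_converges[OF W b sol(2) xy(2) t ep g L]
 have ev2: "\<forall>\<^sub>F m in sequentially. \<forall>\<^sub>F K in sequentially. \<forall>k\<le>K.
  \<bar>(scheme.T lam c n m b (t / real K) ^^ k) (%a. exp (g (emb m a))) (start m x) - (\<integral>om. exp (g (\<Xi> (real k * (t / real K)) om)) \<partial>M)\<bar> < ep / 2"
 proof (rule expect_converges[OF W b sol(1) xy(1) t ep, where B="exp B" and L="exp B * L"])
  show "\<bar>exp (g h)\<bar> <= exp B" for h using gB[of h] by simp
  show "0 <= exp B * L" using L by simp
  show "\<bar>exp (g h) - exp (g k)\<bar> <= exp B * L * dist h k" for h k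
  proof -
   have "\<bar>exp (g h) - exp (g k)\<bar> <= exp B * \<bar>g h - g k\<bar>" by (rule exp_lip[OF gB gB])
   also have "\<dots> <= exp B * (L * dist h k)" by (intro mult_left_mono L) auto
   finally show ?thesis by (simp only: mult.assoc)
  qed
 qed
 from ev1 ev2 eventually_ge_at_top[of "2 * N"]
 have "\<forall>\<^sub>F m in sequentially. \<forall>\<^sub>F K in sequentially. ?Eg <= ?Ee - 1 + ?R1 + ?R2 + ep"
 proof eventually_elim
  case m: (elim m)
  from m(1) m(2) eventually_small_step[OF t, of "lam^2 + 1"] eventually_small_step[OF t, of ?K]
  show ?case
  proof eventually_elim
   case K: (elim K)
   let ?h = "t / real K"
   interpret scheme lam c n m b ?h by unfold_locales (use K b in auto)
   have tK: "real K * ?h = t" using K(3) by simp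
   let ?z = "nrm2 m (%i. start m x i - start m y i)"
   have "(T ^^ K) (%a. g (emb m a)) (start m y) <= ln ((T ^^ K) (%a. exp (g (emb m a))) (start m x))
    + L * sqrt (?z / (1 + ?h) ^ K) + 2 * ctrl_cost lam b N * ?z"
   proof (rule chain_log_harnack[OF _ _ L(1) _ m(3) N])
    show "(%a. g (emb m a)) \<in> borel_measurable borel" by (rule measurable_compose[OF measurable_emb mg])
    show "\<bar>g (emb m a)\<bar> <= B" for a by (rule g)
    show "?h * ?K <= 1" using K(4) by linarith
    show "\<bar>g (emb m a) - g (emb m a')\<bar> <= L * sqrt (nrm2 m (%i. a i - a' i))" if "adm a" "adm a'" for a a'
    proof -
     have "dist (emb m a) (emb m a') <= sqrt (nrm2 m (%i. a i - a' i))"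
      unfolding dist_norm emb_diff by (rule norm_emb_le) (use that in \<open>simp add: adm_def\<close>)
     from mult_left_mono[OF this L(1)] L(2)[of "emb m a" "emb m a'"] show ?thesis by linarith
    qed
   qed (assumption | intro adm_start xy)+
   moreover have "ln ((T ^^ K) (%a. exp (g (emb m a))) (start m x)) <= (T ^^ K) (%a. exp (g (emb m a))) (start m x) - 1"
   proof (rule ln_le_minus_one)
    have me: "(%a. exp (g (emb m a))) \<in> borel_measurable borel"
     using measurable_compose[OF measurable_emb mg] by measurable
    have "exp (- B) <= exp (g (emb m a)) \<and> exp (g (emb m a)) <= exp B" for a
     using g[of "emb m a"] by auto
    from T_funpow(2)[OF me this, of K "start m x"] show "0 < (T ^^ K) (%a. exp (g (emb m a))) (start m x)"
     using exp_gt_zero[of "- B"] by linarith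
   qed
   moreover have "L * sqrt (?z / (1 + ?h) ^ K) <= ?R1"
   proof -
    have "1 + real K * ?h <= (1 + ?h) ^ K" by (rule Bernoulli_inequality) (use K(3) in linarith)
    then have h1: "1 + t <= (1 + ?h) ^ K" unfolding tK .
    have "?z / (1 + ?h) ^ K <= (dist x y)^2 / (1 + t)"
     by (rule frac_le) (use h1 nrm2_start_diff t in auto)
    then have "sqrt (?z / (1 + ?h) ^ K) <= sqrt ((dist x y)^2 / (1 + t))" by (rule real_sqrt_le_mono)
    also have "\<dots> = dist x y / sqrt (1 + t)" by (simp add: real_sqrt_divide)
    finally show ?thesis using mult_left_mono[OF _ L(1)] by fastforce
   qed
   moreover have "2 * ctrl_cost lam b N * ?z <= ?R2"
    using C0 by (intro mult_left_mono nrm2_start_diff) auto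
   moreover have "\<bar>(T ^^ K) (%a. g (emb m a)) (start m y) - ?Eg\<bar> < ep / 2"
    using K(1)[rule_format, of K] unfolding tK by simp
   moreover have "\<bar>(T ^^ K) (%a. exp (g (emb m a))) (start m x) - ?Ee\<bar> < ep / 2"
    using K(2)[rule_format, of K] unfolding tK by simp
   ultimately show ?case by linarith
  qed
 qed
 then show "?Eg <= ?Ee - 1 + ?R1 + ?R2 + ep" by (simp add: eventually_const)
qed

text \<open>Bounded Lipschitz functions increasing to the squared H^1 seminorm; one index limits
  both the number of modes and the value.\<close>

definition \<psi> :: "nat => H => real" where
 "\<psi> J h = min (real J) (\<Sum>i=1..J. freq i * (coef h i)^2)"

lemma \<psi>_bounds: "0 <= \<psi> J h" "\<psi> J h <= real J"
 unfolding \<psi>_def by (auto intro!: sum_nonneg simp: freq_def)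

lemma \<psi>_mono: "J <= J' ==> \<psi> J h <= \<psi> J' h"
 unfolding \<psi>_def by (rule min.mono) (auto intro!: sum_mono2 simp: freq_def)

text \<open>The truncated quadratic form is the square of min(sqrt J, l), with l a Lipschitz
  seminorm, and squaring is Lipschitz on bounded sets.\<close>

lemma \<psi>_lipschitz: "\<exists>L\<ge>0. \<forall>h k. \<bar>\<psi> J h - \<psi> J k\<bar> <= L * dist h k"
proof (intro exI conjI allI)
 let ?s = "%h. L2_set (%i. sqrt (freq i) * coef h i) {1..J}"
 let ?A = "\<Sum>i=1..J. sqrt (freq i) * (real i * pi + 1)"
 show "0 <= 2 * sqrt (real J) * ?A" by (auto intro!: mult_nonneg_nonneg sum_nonneg simp: freq_def)
 fix h k
 have q: "\<psi> J h = (min (sqrt (real J)) (?s h))^2" for h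
 proof -
  have "(?s h)^2 = (\<Sum>i=1..J. freq i * (coef h i)^2)"
   unfolding L2_set_def by (simp add: sum_nonneg power_mult_distrib freq_def)
  then have "\<psi> J h = min ((sqrt (real J))^2) ((?s h)^2)" by (simp add: \<psi>_def)
  also have "\<dots> = (min (sqrt (real J)) (?s h))^2"
  proof -
   have "min (a^2) (b^2) = (min a b)^2" if "0 <= a" "0 <= b" for a b :: real
    using that power_mono[of a b 2] power_mono[of b a 2] by (cases "a <= b") (auto simp: min_def)
   from this[OF real_sqrt_ge_zero[of "real J"] L2_set_nonneg] show ?thesis by simp
  qed
  finally show ?thesis .
 qed
 have tri: "?s h <= ?s k + ?A * dist h k" for h k
 proof -
  have "?s h = L2_set (%i. sqrt (freq i) * coef k i + sqrt (freq i) * coef (h - k) i) {1..J}"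
   by (simp add: minus_H.rep_eq algebra_simps)
  also have "\<dots> <= ?s k + L2_set (%i. sqrt (freq i) * coef (h - k) i) {1..J}" by (rule L2_set_triangle_ineq)
  also have "L2_set (%i. sqrt (freq i) * coef (h - k) i) {1..J} <= (\<Sum>i=1..J. \<bar>sqrt (freq i) * coef (h - k) i\<bar>)"
   by (rule L2_set_le_sum_abs)
  also have "\<dots> <= (\<Sum>i=1..J. sqrt (freq i) * ((real i * pi + 1) * dist h k))"
   unfolding abs_mult dist_norm by (intro sum_mono mult_mono abs_coef_le) (auto simp: freq_def)
  also have "\<dots> = ?A * dist h k" by (simp add: sum_distrib_right mult.assoc)
  finally show ?thesis by simp
 qed
 have "\<bar>?s h - ?s k\<bar> <= ?A * dist h k" using tri[of h k] tri[of k h] by (simp add: dist_commute abs_le_iff)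
 then have d: "\<bar>min (sqrt (real J)) (?s h) - min (sqrt (real J)) (?s k)\<bar> <= ?A * dist h k" by linarith
 have s0: "0 <= ?s h" for h by (rule L2_set_nonneg)
 have sq: "\<bar>a^2 - b^2\<bar> <= 2 * r * D" if "0 <= a" "0 <= b" "a <= r" "b <= r" "\<bar>a - b\<bar> <= D" for a b r D :: real
 proof -
  have "\<bar>a^2 - b^2\<bar> = (a + b) * \<bar>a - b\<bar>"
   using that by (simp add: power2_eq_square square_diff_square_factored abs_mult)
  also have "\<dots> <= (2 * r) * D" using that by (intro mult_mono) auto
  finally show ?thesis .
 qed
 have "\<bar>\<psi> J h - \<psi> J k\<bar> <= 2 * sqrt (real J) * (?A * dist h k)"
  unfolding q by (rule sq[OF _ _ _ _ d]) (use s0 in auto)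
 then show "\<bar>\<psi> J h - \<psi> J k\<bar> <= 2 * sqrt (real J) * ?A * dist h k" by (simp only: mult.assoc)
qed

lemma measurable_\<psi> [measurable]: "\<psi> J \<in> borel_measurable borel"
proof -
 obtain L where "0 <= L" "\<forall>h k. \<bar>\<psi> J h - \<psi> J k\<bar> <= L * dist h k" using \<psi>_lipschitz by blast
 then have "L-lipschitz_on UNIV (\<psi> J)" by (auto intro: lipschitz_onI simp: dist_real_def)
 then show ?thesis by (intro borel_measurable_continuous_onI lipschitz_on_continuous_on)
qed

lemma (in scheme) energy_\<psi>:
 assumes C: "!!u. fpoly lam n u * (u - c) <= C" "0 <= C" and Tr: "(\<Sum>i=1..m. b i / freq i) <= tr" "0 <= tr"
 shows "(\<Sum>k=1..K. h * (T ^^ k) (%a. \<psi> q (emb m a)) (start m x)) <= (norm x)^2 + real K * h * (C + tr)"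
proof -
 have me: "(%a. \<psi> q (emb m a)) \<in> borel_measurable borel" by measurable
 have ab: "\<bar>\<psi> q (emb m a)\<bar> <= real q" for a using \<psi>_bounds[of q "emb m a"] by simp
 have le: "\<psi> q (emb m a) <= (\<Sum>i=1..m. freq i * (a i)^2)" for a
 proof -
  have "\<psi> q (emb m a) <= (\<Sum>i=1..q. freq i * (coef (emb m a) i)^2)" by (simp add: \<psi>_def)
  also have "\<dots> = (\<Sum>i\<in>{1..q} \<inter> {1..m}. freq i * (a i)^2)"
   by (rule sum.mono_neutral_cong_right) (auto simp: emb.rep_eq)
  also have "\<dots> <= (\<Sum>i=1..m. freq i * (a i)^2)" by (rule sum_mono2) (auto simp: freq_def)
  finally show ?thesis .
 qed
 have term_le: "ennreal (h * (T ^^ k) (%a. \<psi> q (emb m a)) (start m x))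
   <= (\<integral>\<^sup>+a. ennreal (h * (\<Sum>i=1..m. freq i * (a i)^2)) \<partial>law k (start m x))" for k
 proof -
  interpret l: prob_space "law k (start m x)" by (rule prob_space_law)
  have "h * (T ^^ k) (%a. \<psi> q (emb m a)) (start m x) = (\<integral>a. h * \<psi> q (emb m a) \<partial>law k (start m x))"
   unfolding integral_law[symmetric, OF me ab] by simp
  also have "ennreal \<dots> = (\<integral>\<^sup>+a. ennreal (h * \<psi> q (emb m a)) \<partial>law k (start m x))"
  proof (rule nn_integral_eq_integral[symmetric])
   show "integrable (law k (start m x)) (%a. h * \<psi> q (emb m a))"
    by (intro integrable_mult_right l.integrable_const_bound[where B="real q"]) (use ab in auto)
  qed (use h_pos \<psi>_bounds in auto)
  also have "\<dots> <= (\<integral>\<^sup>+a. ennreal (h * (\<Sum>i=1..m. freq i * (a i)^2)) \<partial>law k (start m x))"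
   using le h_pos by (intro nn_integral_mono ennreal_leI mult_left_mono) auto
  finally show ?thesis .
 qed
 have pos: "0 <= (T ^^ k) (%a. \<psi> q (emb m a)) (start m x)" for k
  unfolding integral_law[symmetric, OF me ab] by (rule integral_nonneg_AE) (simp add: \<psi>_bounds)
 have "ennreal (\<Sum>k=1..K. h * (T ^^ k) (%a. \<psi> q (emb m a)) (start m x))
   = (\<Sum>k=1..K. ennreal (h * (T ^^ k) (%a. \<psi> q (emb m a)) (start m x)))"
  by (rule sum_ennreal[symmetric]) (use pos h_pos in auto)
 also have "\<dots> <= (\<Sum>k=1..K. \<integral>\<^sup>+a. ennreal (h * (\<Sum>i=1..m. freq i * (a i)^2)) \<partial>law k (start m x))"
  by (intro sum_mono term_le)
 also have "\<dots> <= (\<integral>\<^sup>+a. ennreal (nrm2 m a) \<partial>law K (start m x)) + \<dots>" by simp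
 also have "\<dots> <= ennreal (nrm2 m (start m x) + real K * h * (C + tr))" by (rule law_energy[OF C Tr])
 also have "\<dots> <= ennreal ((norm x)^2 + real K * h * (C + tr))" by (intro ennreal_leI add_right_mono nrm2_start)
 finally show ?thesis using h_pos C(2) Tr(2) by (subst (asm) ennreal_le_iff) auto
qed

lemma continuous_expect:
 fixes \<phi> :: "H => real"
 assumes M: "prob_space M" and sol: "solution M W b lam n x \<Xi>"
  and c\<phi>: "continuous_on UNIV \<phi>" and B: "!!h. \<bar>\<phi> h\<bar> <= B"
 shows "continuous_on UNIV (%s. \<integral>om. \<phi> (\<Xi> (max 0 s) om) \<partial>M)"
 unfolding continuous_on_sequentially comp_def
proof (intro ballI allI impI, elim conjE)
 interpret prob_space M by fact
 fix s and r :: "nat => real" assume r: "r \<longlonglongrightarrow> s"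
 have m\<phi>: "\<phi> \<in> borel_measurable borel" by (rule borel_measurable_continuous_onI[OF c\<phi>])
 have mX: "\<Xi> (max 0 t) \<in> borel_measurable M" for t using sol by (simp add: solution_def)
 show "(%i. \<integral>om. \<phi> (\<Xi> (max 0 (r i)) om) \<partial>M) \<longlonglongrightarrow> (\<integral>om. \<phi> (\<Xi> (max 0 s) om) \<partial>M)"
 proof (rule integral_dominated_convergence[where w="%_. B"])
  have "AE om in M. solution_path b lam n x (%k t. W k t om) (%t. \<Xi> t om)"
   using sol by (simp add: solution_def)
  then show "AE om in M. (%i. \<phi> (\<Xi> (max 0 (r i)) om)) \<longlonglongrightarrow> \<phi> (\<Xi> (max 0 s) om)"
  proof eventually_elim
   case (elim om)
   then have "continuous_on {0..} (%t. \<Xi> t om)" by (simp add: solution_path_def)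
   then have "continuous_on UNIV (%t. \<Xi> (max 0 t) om)"
    by (rule continuous_on_compose2[where g="%t. \<Xi> t om"]) (auto intro!: continuous_intros)
   then have "continuous_on UNIV (%t. \<phi> (\<Xi> (max 0 t) om))"
    by (rule continuous_on_compose2[OF c\<phi>]) auto
   from continuous_on_tendsto_compose[OF this r] show ?case by simp
  qed
 qed (use measurable_compose[OF mX m\<phi>] B in auto)
qed

text \<open>Right end points are used because the energy balance of the scheme evaluates the
  dissipation after each step.\<close>

lemma nn_integral_le_riemann:
 fixes F :: "real => real"
 assumes F: "F \<in> borel_measurable borel" and h: "0 <= h"
  and osc: "!!s t. 0 <= s ==> t <= real K * h ==> s <= t ==> t - s <= h ==> F s <= F t + om"
  and nn: "!!s. 0 <= F s" "0 <= om"
 shows "(\<integral>\<^sup>+s. ennreal (F s) * indicator {0<..real K * h} s \<partial>lborel) <= ennreal (\<Sum>k=1..K. h * (F (real k * h) + om))"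
proof -
 have "(\<integral>\<^sup>+s. ennreal (F s) * indicator {0<..real k * h} s \<partial>lborel) <= ennreal (\<Sum>j=1..k. h * (F (real j * h) + om))"
  if "k <= K" for k
  using that
 proof (induction k)
  case (Suc k)
  let ?s = "real k * h" and ?t = "real (Suc k) * h"
  have s0: "0 <= ?s" "?s <= ?t" "?t = ?s + h" using h by (auto simp: algebra_simps)
  have tK: "?t <= real K * h" using Suc.prems h by (intro mult_right_mono) auto
  have "ennreal (F r) * indicator {0<..?t} r = ennreal (F r) * indicator {0<..?s} r + ennreal (F r) * indicator {?s<..?t} r" for r
   using s0(1,2) unfolding indicator_def greaterThanAtMost_iff
   by (cases "r <= ?s"; cases "0 < r"; cases "r <= ?t") (simp_all only: if_True if_False simp_thms not_le, auto)
  then have "(\<integral>\<^sup>+r. ennreal (F r) * indicator {0<..?t} r \<partial>lborel)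
    = (\<integral>\<^sup>+r. ennreal (F r) * indicator {0<..?s} r \<partial>lborel) + (\<integral>\<^sup>+r. ennreal (F r) * indicator {?s<..?t} r \<partial>lborel)"
   using F by (simp add: nn_integral_add)
  also have "(\<integral>\<^sup>+r. ennreal (F r) * indicator {?s<..?t} r \<partial>lborel)
    <= (\<integral>\<^sup>+r. ennreal (F ?t + om) * indicator {?s<..?t} r \<partial>lborel)"
  proof (rule nn_integral_mono)
   fix r
   show "ennreal (F r) * indicator {?s<..?t} r <= ennreal (F ?t + om) * indicator {?s<..?t} r"
   proof (cases "r \<in> {?s<..?t}")
    case True
    then have "F r <= F ?t + om" using s0 tK by (intro osc) (auto simp only: greaterThanAtMost_iff; linarith)+
    then show ?thesis using True by (simp add: ennreal_leI)
   qed simp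
  qed
  also have "\<dots> = ennreal (F ?t + om) * emeasure lborel {?s<..?t}" by (rule nn_integral_cmult_indicator) simp
  also have "emeasure lborel {?s<..?t} = ennreal h" using s0 by simp
  also have "ennreal (F ?t + om) * ennreal h = ennreal (h * (F ?t + om))"
   using nn(1)[of ?t] nn(2) h by (subst mult.commute, intro ennreal_mult[symmetric]) auto
  also have "(\<integral>\<^sup>+r. ennreal (F r) * indicator {0<..?s} r \<partial>lborel) <= ennreal (\<Sum>j=1..k. h * (F (real j * h) + om))"
   using Suc by simp
  finally have "(\<integral>\<^sup>+r. ennreal (F r) * indicator {0<..?t} r \<partial>lborel)
   <= ennreal (\<Sum>j=1..k. h * (F (real j * h) + om)) + ennreal (h * (F ?t + om))"
   by (simp add: add_mono)
  also have "\<dots> = ennreal (\<Sum>j=1..Suc k. h * (F (real j * h) + om))"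
   using nn h by (subst ennreal_plus[symmetric]) (auto intro!: sum_nonneg)
  finally show ?case .
 qed simp
 then show ?thesis by simp
qed

text \<open>The discrete energy balance read as a Riemann sum. The bound depends neither on n nor on
  q, as the limits in both require.\<close>

lemma approx_energy:
 assumes W: "cylindrical_wiener M W" and b: "b 0 = 0" "!!i. 0 <= b i"
  and sol: "solution M W b lam n x \<Xi>" and x: "x \<in> Hc c" and T: "0 < T"
  and C: "!!u. fpoly lam n u * (u - c) <= C" "0 <= C" and Tr: "!!m. (\<Sum>i=1..m. b i / freq i) <= tr" "0 <= tr"
 shows "(\<integral>\<^sup>+s. ennreal (\<integral>om. \<psi> q (\<Xi> (max 0 s) om) \<partial>M) * indicator {0<..T} s \<partial>lborel) <= ennreal ((norm x)^2 + T * (C + tr))"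
  (is "?I <= ennreal ?E")
proof (rule ennreal_le_epsilon)
 interpret prob_space M using W by (simp add: cylindrical_wiener_def)
 fix e :: real assume e: "0 < e"
 \<comment> \<open>One ep for the oscillation within a step, one for the approximation of
   expectations, each integrated over a time of length T.\<close>
 define ep where "ep = e / (2 * T)"
 have ep: "0 < ep" "2 * (T * ep) = e" using e T by (auto simp: ep_def)
 let ?F = "%s. \<integral>om. \<psi> q (\<Xi> (max 0 s) om) \<partial>M"
 obtain L where L: "0 <= L" "!!h k. \<bar>\<psi> q h - \<psi> q k\<bar> <= L * dist h k" using \<psi>_lipschitz by blast
 have ab: "\<bar>\<psi> q h\<bar> <= real q" for h using \<psi>_bounds[of q h] by simp
 have "L-lipschitz_on UNIV (\<psi> q)" using L by (auto intro: lipschitz_onI simp: dist_real_def)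
 then have cont: "continuous_on UNIV ?F"
  by (intro continuous_expect[OF prob_space_axioms sol _ ab] lipschitz_on_continuous_on)
 have F0: "0 <= ?F s" for s by (rule integral_nonneg_AE) (simp add: \<psi>_bounds)
 have mF: "?F \<in> borel_measurable borel" by (rule borel_measurable_continuous_onI[OF cont])
 have "uniformly_continuous_on {0..T} ?F"
  by (intro compact_uniformly_continuous continuous_on_subset[OF cont]) auto
 then obtain d where d: "0 < d" "!!s t. s \<in> {0..T} ==> t \<in> {0..T} ==> dist t s < d ==> dist (?F t) (?F s) < ep"
  unfolding uniformly_continuous_on_def using ep(1) by metis
 have "\<forall>\<^sub>F m in sequentially. \<forall>\<^sub>F K in sequentially. ?I <= ennreal ?E + ennreal e"
  using expect_converges[OF W b sol x T ep(1) ab L]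
 proof eventually_elim
  case m: (elim m)
  from m eventually_small_step[OF T, of "lam^2 + 1"] eventually_small_step[OF T, of "1 / d"]
  show ?case
  proof eventually_elim
   case K: (elim K)
   let ?h = "T / real K"
   interpret S: scheme lam c n m b ?h by unfold_locales (use K b in auto)
   have tK: "real K * ?h = T" using K(2) by simp
   have h0: "0 < ?h" using K(2) by simp
   have hd: "?h < d" using K(3) d(1) by (simp only: times_divide_eq_right mult_1_right pos_divide_le_eq) linarith
   have "?I <= ennreal (\<Sum>k=1..K. ?h * (?F (real k * ?h) + ep))"
   proof (rule nn_integral_le_riemann[OF mF _ _ F0, where h="?h" and K=K and om=ep, unfolded tK])
    show "?F s <= ?F t + ep" if "0 <= s" "t <= T" "s <= t" "t - s <= ?h" for s t
     using d(2)[of s t] that hd by (auto simp: dist_real_def abs_less_iff)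
   qed (use h0 ep in auto)
   also have "(\<Sum>k=1..K. ?h * (?F (real k * ?h) + ep))
     <= (\<Sum>k=1..K. ?h * (S.T ^^ k) (%a. \<psi> q (emb m a)) (start m x) + ?h * (2 * ep))"
   proof (rule sum_mono)
    fix k assume "k \<in> {1..K}"
    then have "\<bar>(S.T ^^ k) (%a. \<psi> q (emb m a)) (start m x) - (\<integral>om. \<psi> q (\<Xi> (real k * ?h) om) \<partial>M)\<bar> < ep"
     using K(1) by simp
    moreover have "max 0 (real k * ?h) = real k * ?h" using h0 by (intro max_absorb2 mult_nonneg_nonneg) auto
    ultimately have "?F (real k * ?h) + ep <= (S.T ^^ k) (%a. \<psi> q (emb m a)) (start m x) + 2 * ep" by linarith
    then have "?h * (?F (real k * ?h) + ep) <= ?h * ((S.T ^^ k) (%a. \<psi> q (emb m a)) (start m x) + 2 * ep)"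
     using h0 by (intro mult_left_mono) auto
    then show "?h * (?F (real k * ?h) + ep) <= ?h * (S.T ^^ k) (%a. \<psi> q (emb m a)) (start m x) + ?h * (2 * ep)"
     by (simp only: distrib_left)
   qed
   also have "\<dots> = (\<Sum>k=1..K. ?h * (S.T ^^ k) (%a. \<psi> q (emb m a)) (start m x)) + real K * ?h * (2 * ep)"
    by (simp only: sum.distrib sum_constant card_atLeastAtMost mult.assoc) simp
   also have "\<dots> <= ((norm x)^2 + real K * ?h * (C + tr)) + real K * ?h * (2 * ep)"
    by (intro add_right_mono S.energy_\<psi> C Tr)
   also have "\<dots> = ?E + e" unfolding tK using ep(2) by simp
   also have "ennreal (?E + e) = ennreal ?E + ennreal e"
    using C(2) Tr(2) T e by (intro ennreal_plus) auto
   finally show ?case by (simp add: ennreal_leI)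
  qed
 qed
 then show "?I <= ennreal ?E + ennreal e" by (simp add: eventually_const)
qed

section \<open>Lipschitz test functions\<close>

definition lip :: "('a::metric_space => real) => bool" where
 "lip g \<longleftrightarrow> (\<exists>L\<ge>0. \<forall>x y. \<bar>g x - g y\<bar> <= L * dist x y)"

lemma lipI: "0 <= L ==> (!!x y. \<bar>g x - g y\<bar> <= L * dist x y) ==> lip g"
 by (auto simp: lip_def)

lemma lipE: "lip g ==> (!!L. 0 <= L ==> (!!x y. \<bar>g x - g y\<bar> <= L * dist x y) ==> P) ==> P"
 by (auto simp: lip_def)

lemma lip_continuous: "lip g ==> continuous_on A g"
proof (elim lipE)
 fix L assume "0 <= L" "!!x y. \<bar>g x - g y\<bar> <= L * dist x y"
 then have "L-lipschitz_on A g" by (auto intro: lipschitz_onI simp: dist_real_def)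
 then show ?thesis by (rule lipschitz_on_continuous_on)
qed

lemma lip_measurable: "lip g ==> g \<in> borel_measurable borel"
 by (intro borel_measurable_continuous_onI lip_continuous)

lemma lip_add: "lip f ==> lip g ==> lip (%x. f x + g x)"
proof (elim lipE)
 fix K L assume *: "0 <= K" "!!x y. \<bar>f x - f y\<bar> <= K * dist x y" "0 <= L" "!!x y. \<bar>g x - g y\<bar> <= L * dist x y"
 show ?thesis
 proof (rule lipI[of "K + L"])
  show "\<bar>f x + g x - (f y + g y)\<bar> <= (K + L) * dist x y" for x y
   using *(2)[of x y] *(4)[of x y] by (simp add: distrib_right)
 qed (use * in simp)
qed

lemma lip_mult_const: "lip f ==> lip (%x. a * f x)"
proof (elim lipE)
 fix K assume *: "0 <= K" "!!x y. \<bar>f x - f y\<bar> <= K * dist x y"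
 show ?thesis
 proof (rule lipI[of "\<bar>a\<bar> * K"])
  fix x y
  have "\<bar>a * f x - a * f y\<bar> = \<bar>a\<bar> * \<bar>f x - f y\<bar>" by (simp add: right_diff_distrib[symmetric] abs_mult)
  also have "\<dots> <= \<bar>a\<bar> * (K * dist x y)" by (intro mult_left_mono *) simp
  finally show "\<bar>a * f x - a * f y\<bar> <= \<bar>a\<bar> * K * dist x y" by (simp only: mult.assoc)
 qed (use * in simp)
qed

lemma lip_const: "lip (%_. a)"
 by (rule lipI[of 0]) auto

lemma lip_sum: "(!!i. i \<in> I ==> lip (f i)) ==> lip (%x. \<Sum>i\<in>I. f i x)"
 by (induction I rule: infinite_finite_induct) (auto intro!: lip_const lip_add)

lemma lip_min_1: "lip f ==> lip (%x. min 1 (f x))"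
proof (elim lipE)
 fix K assume *: "0 <= K" "!!x y. \<bar>f x - f y\<bar> <= K * dist x y"
 show ?thesis
 proof (rule lipI[OF *(1)])
  show "\<bar>min 1 (f x) - min 1 (f y)\<bar> <= K * dist x y" for x y using *(2)[of x y] by linarith
 qed
qed

lemma lip_bump: "A \<noteq> {} ==> lip (%x. max 0 (1 - real n * infdist x A))"
proof (rule lipI[of "real n"])
 fix x y
 have "real n * \<bar>infdist x A - infdist y A\<bar> <= real n * dist x y"
  by (intro mult_left_mono infdist_triangle_abs) simp
 moreover have "real n * \<bar>infdist x A - infdist y A\<bar> = \<bar>real n * infdist x A - real n * infdist y A\<bar>"
  by (simp add: abs_mult right_diff_distrib[symmetric])
 ultimately show "\<bar>max 0 (1 - real n * infdist x A) - max 0 (1 - real n * infdist y A)\<bar> <= real n * dist x y"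
  by linarith
qed simp

text \<open>The index in \<open>bool\<close> makes one function serve two measures. Closed sets are
  approximated by bumps; complements and disjoint unions by the induction for the generated
  sigma-algebra.\<close>

lemma lipschitz_approx_indicator:
 fixes \<mu> :: "bool => 'a::metric_space measure"
 assumes \<mu>: "!!b. prob_space (\<mu> b)" and s [simp, measurable_cong]: "!!b. sets (\<mu> b) = sets borel"
  and A: "A \<in> sets borel" and ep: "0 < ep"
 shows "\<exists>g. lip g \<and> (\<forall>x. 0 <= g x \<and> g x <= 1) \<and> (\<forall>b. (\<integral>x. \<bar>g x - indicator A x\<bar> \<partial>\<mu> b) < ep)"
proof -
 have sp [simp]: "space (\<mu> b) = UNIV" for b using sets_eq_imp_space_eq[OF s[of b]] by simp
 interpret prob_space "\<mu> b" for b by (rule \<mu>)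
 have iI: "integrable (\<mu> b) (%x. \<bar>g x - indicator A x\<bar>)" if "lip g" "!!x. 0 <= g x \<and> g x <= 1" "A \<in> sets borel" for b g A
 proof (rule integrable_const_bound[where B=1])
  show "AE x in \<mu> b. norm \<bar>g x - indicator A x\<bar> <= 1" using that(2) by (auto simp: indicator_def)
  have "g \<in> borel_measurable (\<mu> b)" using lip_measurable[OF that(1)] by simp
  then show "(%x. \<bar>g x - indicator A x\<bar>) \<in> borel_measurable (\<mu> b)" using that(3) by simp
 qed
 have "Int_stable (Collect closed :: 'a set set)" "Collect closed \<subseteq> Pow (UNIV :: 'a set)"
  "A \<in> sigma_sets UNIV (Collect closed)"
  using A by (auto simp: Int_stable_def borel_eq_closed)
 then have "\<forall>ep>0. \<exists>g. lip g \<and> (\<forall>x. 0 <= g x \<and> g x <= 1) \<and> (\<forall>b. (\<integral>x. \<bar>g x - indicator A x\<bar> \<partial>\<mu> b) < ep)"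
 proof (induction rule: sigma_sets_induct_disjoint)
  case (basic A)
  then have A: "closed A" by simp
  show ?case
  proof (cases "A = {}")
   case True
   then show ?thesis by (auto intro!: exI[of _ "%_. 0"] lip_const)
  next
   case False
   let ?g = "%n x. max 0 (1 - real n * infdist x A)"
   have g01: "0 <= ?g n x \<and> ?g n x <= 1" for n x using infdist_nonneg[of x A] by simp
   have "(%n. \<integral>x. \<bar>?g n x - indicator A x\<bar> \<partial>\<mu> b) \<longlonglongrightarrow> (\<integral>x. 0 \<partial>\<mu> b)" for b
   proof (rule integral_dominated_convergence[where w="%_. 1"])
    show "(%x. \<bar>?g n x - indicator A x\<bar>) \<in> borel_measurable (\<mu> b)" for n
     using iI[OF lip_bump[OF False] g01, of A b n] A by auto
    show "AE x in \<mu> b. (%n. \<bar>?g n x - indicator A x\<bar>) \<longlonglongrightarrow> 0"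
    proof (rule AE_I2)
     fix x
     show "(%n. \<bar>?g n x - indicator A x\<bar>) \<longlonglongrightarrow> 0"
     proof (cases "x \<in> A")
      case True
      then show ?thesis by simp
     next
      case x: False
      then have "0 < infdist x A" using A False by (simp add: infdist_pos_not_in_closed)
      then obtain N where N: "1 < real N * infdist x A" using reals_Archimedean3 by blast
      have "\<forall>\<^sub>F n in sequentially. \<bar>?g n x - indicator A x\<bar> = 0"
       using eventually_ge_at_top[of N]
      proof eventually_elim
       case (elim n)
       then have "real N * infdist x A <= real n * infdist x A"
        by (intro mult_right_mono infdist_nonneg) simp
       then show ?case using x N by simp
      qed
      then show ?thesis by (rule tendsto_eventually)
     qed
    qed
    show "AE x in \<mu> b. norm \<bar>?g n x - indicator A x\<bar> <= 1" for n
     using g01[of n] by (auto simp: indicator_def)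
   qed auto
   then have lim: "(%n. \<integral>x. \<bar>?g n x - indicator A x\<bar> \<partial>\<mu> b) \<longlonglongrightarrow> 0" for b by simp
   show ?thesis
   proof (intro allI impI)
    fix ep :: real assume ep: "0 < ep"
    have "\<forall>\<^sub>F n in sequentially. (\<integral>x. \<bar>?g n x - indicator A x\<bar> \<partial>\<mu> True) < ep \<and> (\<integral>x. \<bar>?g n x - indicator A x\<bar> \<partial>\<mu> False) < ep"
     by (intro eventually_conj order_tendstoD(2)[OF lim ep])
    then obtain n where n: "(\<integral>x. \<bar>?g n x - indicator A x\<bar> \<partial>\<mu> True) < ep" "(\<integral>x. \<bar>?g n x - indicator A x\<bar> \<partial>\<mu> False) < ep"
     unfolding eventually_sequentially by blast
    have "\<forall>b. (\<integral>x. \<bar>?g n x - indicator A x\<bar> \<partial>\<mu> b) < ep" using n by (metis (full_types))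
    then show "\<exists>g. lip g \<and> (\<forall>x. 0 <= g x \<and> g x <= 1) \<and> (\<forall>b. (\<integral>x. \<bar>g x - indicator A x\<bar> \<partial>\<mu> b) < ep)"
     using lip_bump[OF False, of n] g01[of n] by blast
   qed
  qed
 next
  case empty
  show ?case by (auto intro!: exI[of _ "%_. 0"] lip_const)
 next
  case (compl A)
  show ?case
  proof (intro allI impI)
   fix ep :: real assume "0 < ep"
   then obtain g where g: "lip g" "!!x. 0 <= g x \<and> g x <= 1" "!!b. (\<integral>x. \<bar>g x - indicator A x\<bar> \<partial>\<mu> b) < ep"
    using compl by blast
   have "\<bar>1 + (- 1) * g x - indicator (UNIV - A) x\<bar> = \<bar>g x - indicator A x\<bar>" for x
    by (auto simp: indicator_def)
   then show "\<exists>g. lip g \<and> (\<forall>x. 0 <= g x \<and> g x <= 1) \<and> (\<forall>b. (\<integral>x. \<bar>g x - indicator (UNIV - A) x\<bar> \<partial>\<mu> b) < ep)"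
    using g by (intro exI[of _ "%x. 1 + (- 1) * g x"] conjI lip_add lip_mult_const lip_const) auto
  qed
 next
  case (union A)
  have mA: "A i \<in> sets borel" for i using union(2) by (auto simp: borel_eq_closed)
  show ?case
  proof (intro allI impI)
   fix ep :: real assume ep: "0 < ep"
   have "(%n. \<Sum>i<n. measure (\<mu> b) (A i)) \<longlonglongrightarrow> measure (\<mu> b) (\<Union>i. A i)" for b
    using finite_measure_UNION[of A b] union(1) mA by (auto simp: sums_def)
   then have "(%n. measure (\<mu> b) (\<Union>i. A i) - (\<Sum>i<n. measure (\<mu> b) (A i))) \<longlonglongrightarrow> measure (\<mu> b) (\<Union>i. A i) - measure (\<mu> b) (\<Union>i. A i)" for b
    by (intro tendsto_diff tendsto_const)
   then have lim: "(%n. measure (\<mu> b) (\<Union>i. A i) - (\<Sum>i<n. measure (\<mu> b) (A i))) \<longlonglongrightarrow> 0" for b by simp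
   have "\<forall>\<^sub>F n in sequentially. measure (\<mu> True) (\<Union>i. A i) - (\<Sum>i<n. measure (\<mu> True) (A i)) < ep / 2
     \<and> measure (\<mu> False) (\<Union>i. A i) - (\<Sum>i<n. measure (\<mu> False) (A i)) < ep / 2"
    using ep by (intro eventually_conj order_tendstoD(2)[OF lim]) auto
   then obtain n where "measure (\<mu> True) (\<Union>i. A i) - (\<Sum>i<n. measure (\<mu> True) (A i)) < ep / 2"
     "measure (\<mu> False) (\<Union>i. A i) - (\<Sum>i<n. measure (\<mu> False) (A i)) < ep / 2"
    unfolding eventually_sequentially by blast
   then have n: "measure (\<mu> b) (\<Union>i. A i) - (\<Sum>i<n. measure (\<mu> b) (A i)) < ep / 2" for b by (cases b) auto
   \<comment> \<open>The first n sets carry all but ep/2 of the union for both measures; the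
     remaining ep/2 is shared among their approximations.\<close>
   define \<delta> where "\<delta> = ep / (2 * (real n + 1))"
   have \<delta>: "0 < \<delta>" using ep by (simp add: \<delta>_def)
   have n\<delta>: "real n * \<delta> <= ep / 2"
   proof -
    have "real n * \<delta> <= (real n + 1) * \<delta>" using \<delta> by (intro mult_right_mono) auto
    also have "\<dots> = ep / 2" unfolding \<delta>_def by (simp add: divide_simps)
    finally show ?thesis .
   qed
   have "\<forall>i. \<exists>g. lip g \<and> (\<forall>x. 0 <= g x \<and> g x <= 1) \<and> (\<forall>b. (\<integral>x. \<bar>g x - indicator (A i) x\<bar> \<partial>\<mu> b) < \<delta>)"
    using union(3) \<delta> by blast
   from choice[OF this] obtain g where g: "!!i. lip (g i)" "!!i x. 0 <= g i x \<and> g i x <= 1"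
    "!!i b. (\<integral>x. \<bar>g i x - indicator (A i) x\<bar> \<partial>\<mu> b) < \<delta>" by blast
   let ?G = "%x. min 1 (\<Sum>i<n. g i x)"
   have lG: "lip ?G" by (intro lip_min_1 lip_sum g)
   have G01: "0 <= ?G x \<and> ?G x <= 1" for x using g(2) by (auto intro!: sum_nonneg)
   let ?U = "\<Union>i. A i"
   have mU: "?U \<in> sets borel" using mA by blast
   have pw: "\<bar>?G x - indicator ?U x\<bar> <= (\<Sum>i<n. \<bar>g i x - indicator (A i) x\<bar>) + (indicator ?U x - (\<Sum>i<n. indicator (A i) x))" for x
   proof -
    have "(\<Sum>i<n. indicator (A i) x) = (indicator (\<Union>i<n. A i) x :: real)"
     using union(1) by (subst indicator_UN_disjoint) (auto simp: disjoint_family_on_def)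
    also have "\<dots> <= indicator ?U x" by (auto simp: indicator_def)
    finally have le: "(\<Sum>i<n. indicator (A i) x) <= (indicator ?U x :: real)" .
    have "indicator ?U x <= (1 :: real)" by (simp add: indicator_def)
    moreover have "\<bar>(\<Sum>i<n. g i x) - (\<Sum>i<n. indicator (A i) x)\<bar> <= (\<Sum>i<n. \<bar>g i x - indicator (A i) x\<bar>)"
     unfolding sum_subtractf[symmetric] by (rule sum_abs)
    ultimately show ?thesis using le by linarith
   qed
   have "(\<integral>x. \<bar>?G x - indicator ?U x\<bar> \<partial>\<mu> b) < ep" for b
   proof -
    have ii: "integrable (\<mu> b) (%x. \<bar>g i x - indicator (A i) x\<bar>)" for i by (rule iI[OF g(1,2) mA])
    have is1: "integrable (\<mu> b) (%x. \<Sum>i<n. \<bar>g i x - indicator (A i) x\<bar>)" by (rule Bochner_Integration.integrable_sum[OF ii])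
    have iu: "integrable (\<mu> b) (indicator ?U :: _ => real)" using mU by (simp add: integrable_indicator_iff less_top[symmetric])
    have ia: "integrable (\<mu> b) (indicator (A i) :: _ => real)" for i using mA by (simp add: integrable_indicator_iff less_top[symmetric])
    have is2: "integrable (\<mu> b) (%x. \<Sum>i<n. indicator (A i) x :: real)" by (rule Bochner_Integration.integrable_sum[OF ia])
    have "(\<integral>x. \<bar>?G x - indicator ?U x\<bar> \<partial>\<mu> b)
     <= (\<integral>x. (\<Sum>i<n. \<bar>g i x - indicator (A i) x\<bar>) + (indicator ?U x - (\<Sum>i<n. indicator (A i) x)) \<partial>\<mu> b)"
     by (intro integral_mono iI lG G01 mU pw Bochner_Integration.integrable_add is1 Bochner_Integration.integrable_diff iu is2)
    also have "\<dots> = (\<Sum>i<n. \<integral>x. \<bar>g i x - indicator (A i) x\<bar> \<partial>\<mu> b) + (measure (\<mu> b) ?U - (\<Sum>i<n. measure (\<mu> b) (A i)))"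
     by (simp only: Bochner_Integration.integral_add[OF is1 Bochner_Integration.integrable_diff[OF iu is2]]
       Bochner_Integration.integral_diff[OF iu is2] Bochner_Integration.integral_sum[OF ii] Bochner_Integration.integral_sum[OF ia])
      (simp add: mA mU)
    also have "(\<Sum>i<n. \<integral>x. \<bar>g i x - indicator (A i) x\<bar> \<partial>\<mu> b) <= (\<Sum>i<n. \<delta>)"
     using g(3) by (intro sum_mono less_imp_le)
    also have "\<dots> = real n * \<delta>" by simp
    finally show ?thesis using n[of b] n\<delta> by linarith
   qed
   then show "\<exists>g. lip g \<and> (\<forall>x. 0 <= g x \<and> g x <= 1) \<and> (\<forall>b. (\<integral>x. \<bar>g x - indicator ?U x\<bar> \<partial>\<mu> b) < ep)"
    using lG G01 by blast
  qed
 qed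
 then show ?thesis using ep by blast
qed

text \<open>The form in which a Hahn decomposition is exploited: domination of measures is known
  only on subsets of Y.\<close>

lemma integral_mono_on_dominated:
 fixes f :: "'a => real"
 assumes "prob_space M" "prob_space N" and s: "sets N = sets M" and Y: "Y \<in> sets M"
  and dom: "!!X. X \<in> sets M ==> X \<subseteq> Y ==> emeasure N X <= emeasure M X"
  and f: "f \<in> borel_measurable M" "!!x. 0 <= f x \<and> f x <= B"
 shows "(\<integral>x. indicator Y x * f x \<partial>N) <= (\<integral>x. indicator Y x * f x \<partial>M)"
proof -
 interpret M: prob_space M by fact
 interpret N: prob_space N by fact
 note [measurable_cong] = s and [measurable] = Y f(1)
 have B0: "0 <= B" using f(2)[of undefined] by linarith
 have fN: "f \<in> borel_measurable N" using f(1) by measurable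
 have YN: "Y \<in> sets N" using Y s by simp
 have i: "integrable M (%x. indicator Y x * f x)" "integrable N (%x. indicator Y x * f x)"
  using f(2) B0 fN YN
  by (auto intro!: M.integrable_const_bound[where B=B] N.integrable_const_bound[where B=B] simp: indicator_def)
 have "density N (indicator Y) <= density M (indicator Y)"
 proof (subst le_measure)
  show "\<forall>A\<in>sets (density N (indicator Y)). emeasure (density N (indicator Y)) A <= emeasure (density M (indicator Y)) A"
  proof
   fix A assume "A \<in> sets (density N (indicator Y))"
   then have A: "A \<in> sets N" "A \<in> sets M" using s by auto
   then have "emeasure (density N (indicator Y)) A = emeasure N (Y \<inter> A)"
    "emeasure (density M (indicator Y)) A = emeasure M (Y \<inter> A)"
    using Y YN by (auto simp: emeasure_density indicator_inter_arith[symmetric])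
   then show "emeasure (density N (indicator Y)) A <= emeasure (density M (indicator Y)) A"
    using dom[of "Y \<inter> A"] A Y by auto
  qed
 qed (use s in simp)
 then have "(\<integral>\<^sup>+x. ennreal (f x) \<partial>density N (indicator Y)) <= (\<integral>\<^sup>+x. ennreal (f x) \<partial>density M (indicator Y))"
  by (intro nn_integral_mono_measure) (use s in auto)
 then have "(\<integral>\<^sup>+x. indicator Y x * ennreal (f x) \<partial>N) <= (\<integral>\<^sup>+x. indicator Y x * ennreal (f x) \<partial>M)"
  using fN f(1) Y YN by (simp add: nn_integral_density)
 moreover have "indicator Y x * ennreal (f x) = ennreal (indicator Y x * f x)" for x by (simp add: indicator_def)
 ultimately have "ennreal (\<integral>x. indicator Y x * f x \<partial>N) <= ennreal (\<integral>x. indicator Y x * f x \<partial>M)"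
  using f(2) by (simp add: nn_integral_eq_integral[OF i(1)] nn_integral_eq_integral[OF i(2)])
 then show ?thesis using f(2) by (subst (asm) ennreal_le_iff) (auto intro!: integral_nonneg_AE)
qed

section \<open>Uniqueness of invariant measures\<close>

lemma kernel_props:
 assumes "K \<in> S \<rightarrow>\<^sub>M prob_algebra S" "x \<in> space S"
 shows "prob_space (K x)" "sets (K x) = sets S" "space (K x) = space S"
proof -
 have "K x \<in> space (prob_algebra S)" using assms by (rule measurable_space)
 then show "prob_space (K x)" "sets (K x) = sets S" by (auto simp: space_prob_algebra)
 then show "space (K x) = space S" by (intro sets_eq_imp_space_eq)
qed

lemma integral_bind_kernel:
 fixes f :: "'a => real"
 assumes \<nu>: "prob_space \<nu>" "sets \<nu> = sets S" and K: "K \<in> S \<rightarrow>\<^sub>M prob_algebra S"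
  and f: "f \<in> borel_measurable S" "!!x. x \<in> space S ==> \<bar>f x\<bar> <= B"
 shows "(\<integral>x. f x \<partial>(\<nu> \<bind> K)) = (\<integral>x. \<integral>y. f y \<partial>K x \<partial>\<nu>)"
proof -
 interpret prob_space \<nu> by fact
 have sp: "space \<nu> = space S" by (rule sets_eq_imp_space_eq[OF \<nu>(2)])
 have K': "K \<in> \<nu> \<rightarrow>\<^sub>M subprob_algebra S"
  using measurable_prob_algebraD[OF K] by (subst measurable_cong_sets[OF \<nu>(2) refl])
 show ?thesis
 proof (rule integral_bind[OF f K', where B'=1])
  show "finite_measure \<nu>" by unfold_locales
  show "AE x in \<nu>. emeasure (K x) (space (K x)) <= ennreal 1"
   using prob_space.emeasure_space_1[OF kernel_props(1)[OF K]] by (intro AE_I2) (simp add: sp)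
 qed
qed

lemma measurable_kernel_integral:
 fixes f :: "'a => real"
 assumes "K \<in> S \<rightarrow>\<^sub>M prob_algebra S" "f \<in> borel_measurable S"
 shows "(%x. \<integral>y. f y \<partial>K x) \<in> borel_measurable S"
 by (rule measurable_compose[OF measurable_prob_algebraD[OF assms(1)] integral_measurable_subprob_algebra[OF assms(2)]])

lemma integral_bounds_prob:
 fixes f :: "'a => real"
 assumes "prob_space M" "f \<in> borel_measurable M" "!!x. x \<in> space M ==> A <= f x \<and> f x <= B"
 shows "integrable M f" "A <= (\<integral>x. f x \<partial>M)" "(\<integral>x. f x \<partial>M) <= B"
proof -
 interpret prob_space M by fact
 show i: "integrable M f"
 proof (rule integrable_const_bound[where B="\<bar>A\<bar> + \<bar>B\<bar>"])
  show "AE x in M. norm (f x) <= \<bar>A\<bar> + \<bar>B\<bar>"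
  proof (rule AE_I2)
   fix x assume "x \<in> space M"
   from assms(3)[OF this] show "norm (f x) <= \<bar>A\<bar> + \<bar>B\<bar>" by (auto simp: abs_le_iff)
  qed
 qed fact
 show "A <= (\<integral>x. f x \<partial>M)" using assms(3) by (intro integral_ge_const i AE_I2) auto
 show "(\<integral>x. f x \<partial>M) <= B" using assms(3) by (intro integral_le_const i AE_I2) auto
qed

text \<open>Here \<open>Y\<close> is a positive set of the signed measure \<open>\<nu>\<^sub>1 - \<nu>\<^sub>2\<close>. Invariance forces the kernel to
 keep almost all of the excess mass inside \<open>Y\<close>.\<close>

lemma positive_set_point:
 assumes \<nu>: "prob_space \<nu>1" "prob_space \<nu>2" "sets \<nu>1 = sets S" "sets \<nu>2 = sets S"
  and K: "K \<in> S \<rightarrow>\<^sub>M prob_algebra S" and inv: "\<nu>1 \<bind> K = \<nu>1" "\<nu>2 \<bind> K = \<nu>2"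
  and Y: "Y \<in> sets S"
  and pos: "!!X. X \<in> sets S ==> X \<subseteq> Y ==> emeasure \<nu>2 X <= emeasure \<nu>1 X"
  and neg: "!!X. X \<in> sets S ==> X \<inter> Y = {} ==> emeasure \<nu>1 X <= emeasure \<nu>2 X"
  and G: "G \<in> sets S" "G \<subseteq> Y" and \<delta>: "0 < \<delta>" "\<delta> <= measure \<nu>1 G - measure \<nu>2 G" and \<eta>: "0 < \<eta>"
  and w: "w \<in> borel_measurable S" "!!x. 0 <= w x \<and> w x <= B" "(\<integral>x. w x \<partial>\<nu>1) <= ep" "0 < ep"
 shows "\<exists>x\<in>G. measure (K x) (space S - Y) < \<eta> \<and> (\<integral>y. w y \<partial>K x) <= 2 * ep / \<delta>"
proof -
 interpret n1: prob_space \<nu>1 by fact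
 interpret n2: prob_space \<nu>2 by fact
 have sp: "space \<nu>1 = space S" "space \<nu>2 = space S"
  using sets_eq_imp_space_eq[OF \<nu>(3)] sets_eq_imp_space_eq[OF \<nu>(4)] by auto
 let ?N = "space S - Y"
 \<comment> \<open>The mass that the kernel sends from x out of Y. Invariance says that its integral
   is the mass of the complement of Y.\<close>
 define u where "u x = (if x \<in> space S then measure (K x) ?N else 0)" for x
 have N: "?N \<in> sets S" using Y by auto
 have "u \<in> borel_measurable S"
 proof -
  have "(%x. measure (K x) ?N) \<in> borel_measurable S"
   by (rule measurable_compose[OF K measurable_measure_prob_algebra[OF N]])
  then show ?thesis by (rule measurable_cong[THEN iffD1, rotated]) (simp add: u_def)
 qed
 note mu = this
 have u01: "0 <= u x \<and> u x <= 1" for x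
  using kernel_props(1)[OF K, of x] prob_space.prob_le_1 by (auto simp: u_def)
 have uint: "(\<integral>x. u x \<partial>\<nu>) = measure \<nu> ?N" if "prob_space \<nu>" "sets \<nu> = sets S" "\<nu> \<bind> K = \<nu>" for \<nu>
 proof -
  have sp: "space \<nu> = space S" by (rule sets_eq_imp_space_eq[OF that(2)])
  have "measure \<nu> ?N = (\<integral>x. indicator ?N x \<partial>(\<nu> \<bind> K))"
   using N that by simp
  also have "\<dots> = (\<integral>x. \<integral>y. indicator ?N y \<partial>K x \<partial>\<nu>)"
   by (rule integral_bind_kernel[OF that(1,2) K borel_measurable_indicator[OF N], where B=1]) (simp add: indicator_def)
  also have "\<dots> = (\<integral>x. u x \<partial>\<nu>)"
   using N kernel_props(2)[OF K] by (intro Bochner_Integration.integral_cong refl) (simp add: u_def sp)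
  finally show ?thesis ..
 qed
 have i1: "integrable \<nu>1 f" and i2: "integrable \<nu>2 f"
  if "f \<in> borel_measurable S" "!!x. \<bar>f x\<bar> <= 1" for f :: "'a => real"
  using that by (auto intro!: n1.integrable_const_bound[where B=1] n2.integrable_const_bound[where B=1]
    simp: measurable_cong_sets[OF \<nu>(3) refl] measurable_cong_sets[OF \<nu>(4) refl])
 define E where "E = {x \<in> G. \<eta> <= u x}"
 have E: "E \<in> sets S" "E \<subseteq> G"
 proof -
  have "E = G \<inter> (u -` {\<eta>..} \<inter> space S)" using sets.sets_into_space[OF G(1)] by (auto simp: E_def)
  also have "\<dots> \<in> sets S" by (intro sets.Int G measurable_sets[OF mu]) simp
  finally show "E \<in> sets S" .
 qed (auto simp: E_def)
 let ?i = "%A f x. indicator A x * f x :: real"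
 have mi: "?i A f \<in> borel_measurable S" if "A \<in> sets S" "f \<in> borel_measurable S" for A f using that by measurable
 have bi: "\<bar>?i A f x\<bar> <= 1" if "0 <= f x \<and> f x <= 1" for A f x using that by (auto simp: indicator_def)
 \<comment> \<open>Off Y the second measure dominates. Subtracting this comparison from the two
   invariance identities bounds the leak from Y under \<nu>1 by the leak under \<nu>2.\<close>
 have "(\<integral>x. ?i ?N (%x. 1 - u x) x \<partial>\<nu>1) <= (\<integral>x. ?i ?N (%x. 1 - u x) x \<partial>\<nu>2)"
 proof (rule integral_mono_on_dominated[where B=1])
  show "emeasure \<nu>1 X <= emeasure \<nu>2 X" if "X \<in> sets \<nu>2" "X \<subseteq> ?N" for X
   using that \<nu>(4) by (intro neg) auto
  show "(%x. 1 - u x) \<in> borel_measurable \<nu>2" using mu by (simp add: measurable_cong_sets[OF \<nu>(4) refl])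
  show "0 <= 1 - u x \<and> 1 - u x <= 1" for x using u01[of x] by auto
 qed (use \<nu> N in auto)
 then have 1: "measure \<nu>1 ?N - (\<integral>x. ?i ?N u x \<partial>\<nu>1) <= measure \<nu>2 ?N - (\<integral>x. ?i ?N u x \<partial>\<nu>2)"
 proof -
  have eq: "?i ?N (%x. 1 - u x) = (%x. indicator ?N x - ?i ?N u x)" by (auto simp: indicator_def)
  have ii: "integrable \<nu>1 (indicator ?N :: _ => real)" "integrable \<nu>2 (indicator ?N :: _ => real)"
   by (rule i1 i2, rule borel_measurable_indicator[OF N], simp add: indicator_def)+
  have iu: "integrable \<nu>1 (?i ?N u)" "integrable \<nu>2 (?i ?N u)" using mu N u01 by (auto intro!: i1 i2 mi bi)
  assume "(\<integral>x. ?i ?N (%x. 1 - u x) x \<partial>\<nu>1) <= (\<integral>x. ?i ?N (%x. 1 - u x) x \<partial>\<nu>2)"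
  then show ?thesis
   unfolding eq Bochner_Integration.integral_diff[OF ii(1) iu(1)] Bochner_Integration.integral_diff[OF ii(2) iu(2)]
   using N \<nu> by simp
 qed
 have split: "(\<integral>x. u x \<partial>\<nu>) = (\<integral>x. ?i Y u x \<partial>\<nu>) + (\<integral>x. ?i ?N u x \<partial>\<nu>)"
  if "integrable \<nu> (?i Y u)" "integrable \<nu> (?i ?N u)" "space \<nu> = space S" for \<nu>
  unfolding Bochner_Integration.integral_add[OF that(1,2), symmetric]
  by (rule Bochner_Integration.integral_cong) (auto simp: that(3) indicator_def)
 have iY: "integrable \<nu>1 (?i Y u)" "integrable \<nu>2 (?i Y u)" and iN: "integrable \<nu>1 (?i ?N u)" "integrable \<nu>2 (?i ?N u)"
  using mu N Y u01 by (auto intro!: i1 i2 mi bi)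
 from 1 split[OF iY(1) iN(1) sp(1)] split[OF iY(2) iN(2) sp(2)] uint[OF \<nu>(1,3) inv(1)] uint[OF \<nu>(2,4) inv(2)]
 have 2: "(\<integral>x. ?i Y u x \<partial>\<nu>1) <= (\<integral>x. ?i Y u x \<partial>\<nu>2)" by linarith
 \<comment> \<open>On Y the first measure dominates, so the reverse comparison holds even after
   subtracting \<eta> on E. Together they show that E, where the leak is at least \<eta>, carries no
   excess mass.\<close>
 let ?v = "%x. max 0 (u x - \<eta> * indicator E x)"
 have "(\<integral>x. ?i Y ?v x \<partial>\<nu>2) <= (\<integral>x. ?i Y ?v x \<partial>\<nu>1)"
 proof (rule integral_mono_on_dominated[where B=1])
  show "emeasure \<nu>2 X <= emeasure \<nu>1 X" if "X \<in> sets \<nu>1" "X \<subseteq> Y" for X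
   using that \<nu>(3) by (intro pos) auto
  have "?v \<in> borel_measurable S" using mu E(1) by measurable
  then show "?v \<in> borel_measurable \<nu>1" by (simp add: measurable_cong_sets[OF \<nu>(3) refl])
  show "0 <= ?v x \<and> ?v x <= 1" for x using u01[of x] \<eta> by (auto simp: indicator_def)
 qed (use \<nu> Y in auto)
 moreover have "?i Y ?v = (%x. ?i Y u x - \<eta> * indicator E x)"
  using E(2) G(2) u01 by (auto simp: indicator_def E_def fun_eq_iff)
 ultimately have "(\<integral>x. ?i Y u x - \<eta> * indicator E x \<partial>\<nu>2) <= (\<integral>x. ?i Y u x - \<eta> * indicator E x \<partial>\<nu>1)" by simp
 moreover have "integrable \<nu>1 (indicator E :: _ => real)" "integrable \<nu>2 (indicator E :: _ => real)"
  by (rule i1 i2, rule borel_measurable_indicator[OF E(1)], simp add: indicator_def)+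
 ultimately have "(\<integral>x. ?i Y u x \<partial>\<nu>2) - \<eta> * measure \<nu>2 E <= (\<integral>x. ?i Y u x \<partial>\<nu>1) - \<eta> * measure \<nu>1 E"
  using iY E(1) \<nu> by simp
 with 2 have "\<eta> * measure \<nu>1 E <= \<eta> * measure \<nu>2 E" by linarith
 then have 3: "measure \<nu>1 E <= measure \<nu>2 E" using \<eta> by simp
 define v where "v x = (\<integral>y. w y \<partial>K x)" for x
 have mv: "v \<in> borel_measurable S" unfolding v_def[abs_def] by (rule measurable_kernel_integral[OF K w(1)])
 have vb: "0 <= v x \<and> v x <= B" if "x \<in> space S" for x
 proof -
  have "w \<in> borel_measurable (K x)" using w(1) by (simp add: measurable_cong_sets[OF kernel_props(2)[OF K that] refl])
  from integral_bounds_prob[OF kernel_props(1)[OF K that] this w(2)] show ?thesis by (simp add: v_def)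
 qed
 have iv: "integrable \<nu>1 v"
  using mv vb sp by (intro integral_bounds_prob(1)[OF \<nu>(1)]) (auto simp: measurable_cong_sets[OF \<nu>(3) refl])
 have vint: "(\<integral>x. v x \<partial>\<nu>1) <= ep"
 proof -
  have "(\<integral>x. v x \<partial>\<nu>1) = (\<integral>x. w x \<partial>(\<nu>1 \<bind> K))"
   unfolding v_def by (rule integral_bind_kernel[OF \<nu>(1,3) K w(1), symmetric, where B=B]) (use w(2) in \<open>auto simp: abs_le_iff intro: order_trans[of _ 0]\<close>)
  then show ?thesis using w(3) inv(1) by simp
 qed
 \<comment> \<open>With E free of excess mass and this set of mass at most \<delta>/2, the excess
   \<delta> of G cannot be exhausted, so a suitable point exists.\<close>
 have markov: "measure \<nu>1 {x \<in> space \<nu>1. 2 * ep / \<delta> <= v x} <= \<delta> / 2"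
 proof -
  have c: "0 < 2 * ep / \<delta>" using w(4) \<delta>(1) by simp
  have "measure \<nu>1 {x \<in> space \<nu>1. 2 * ep / \<delta> <= v x} <= (\<integral>x. v x \<partial>\<nu>1) / (2 * ep / \<delta>)"
   by (rule integral_Markov_inequality_measure[where A="{}"]) (use iv vb sp c in auto)
  also have "\<dots> <= ep / (2 * ep / \<delta>)" using vint c by (intro divide_right_mono) auto
  also have "\<dots> = \<delta> / 2" using w(4) \<delta>(1) by simp
  finally show ?thesis .
 qed
 show ?thesis
 proof (rule ccontr)
  assume neg: "\<not> ?thesis"
  let ?M = "{x \<in> space \<nu>1. 2 * ep / \<delta> <= v x}"
  have "G \<subseteq> E \<union> ?M"
  proof
   fix x assume x: "x \<in> G"
   then have xs: "x \<in> space S" using sets.sets_into_space[OF G(1)] by auto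
   show "x \<in> E \<union> ?M"
   proof (cases "u x < \<eta>")
    case True
    then have "\<not> v x <= 2 * ep / \<delta>" using neg x xs by (auto simp: u_def v_def)
    then show ?thesis using xs sp by auto
   qed (use x in \<open>auto simp: E_def\<close>)
  qed
  moreover have "?M \<in> sets \<nu>1"
   using borel_measurable_integrable[OF iv] by measurable
  ultimately have "measure \<nu>1 G <= measure \<nu>1 (E \<union> ?M)"
   using E(1) \<nu>(3) by (intro n1.finite_measure_mono) auto
  also have "\<dots> <= measure \<nu>1 E + measure \<nu>1 ?M"
   using E(1) \<nu>(3) \<open>?M \<in> sets \<nu>1\<close> by (intro measure_Un_le) auto
  also have "\<dots> <= measure \<nu>2 G + \<delta> / 2"
   using 3 markov n2.finite_measure_mono[of E G] E(2) G(1) \<nu>(4) by auto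
  finally show False using \<delta> by linarith
 qed
qed

abbreviation bor :: "'a::topological_space set => 'a measure" where
 "bor S \<equiv> restrict_space borel S"

lemma lip_approx_bor:
 fixes \<mu> \<nu> :: "'a::metric_space measure"
 assumes S: "closed S" and p: "prob_space \<mu>" "prob_space \<nu>" "sets \<mu> = sets (bor S)" "sets \<nu> = sets (bor S)"
  and A: "A \<in> sets (bor S)" and ep: "0 < ep"
 shows "\<exists>g. lip g \<and> (\<forall>x. 0 <= g x \<and> g x <= 1) \<and> (\<integral>x. \<bar>g x - indicator A x\<bar> \<partial>\<mu>) < ep \<and> (\<integral>x. \<bar>g x - indicator A x\<bar> \<partial>\<nu>) < ep"
proof -
 have AB: "A \<in> sets borel" using A S by (auto simp: sets_restrict_space)
 have id: "(%x. x) \<in> bor S \<rightarrow>\<^sub>M borel" by (rule measurable_restrict_space1) simp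
 have m: "(%x. x) \<in> \<mu> \<rightarrow>\<^sub>M borel" "(%x. x) \<in> \<nu> \<rightarrow>\<^sub>M borel"
  using id p by (simp_all add: measurable_cong_sets[OF p(3) refl] measurable_cong_sets[OF p(4) refl])
 let ?D = "%b. distr (if b then \<mu> else \<nu>) borel (%x. x)"
 have "\<exists>g. lip g \<and> (\<forall>x. 0 <= g x \<and> g x <= 1) \<and> (\<forall>b. (\<integral>x. \<bar>g x - indicator A x\<bar> \<partial>?D b) < ep)"
  by (rule lipschitz_approx_indicator[OF _ _ AB ep]) (use p m in \<open>auto intro!: prob_space.prob_space_distr\<close>)
 then obtain g where g: "lip g" "!!x. 0 <= g x \<and> g x <= 1" "!!b. (\<integral>x. \<bar>g x - indicator A x\<bar> \<partial>?D b) < ep" by blast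
 have mg: "(%x. \<bar>g x - indicator A x\<bar>) \<in> borel_measurable borel"
  using lip_measurable[OF g(1)] AB by simp
 have "(\<integral>x. \<bar>g x - indicator A x\<bar> \<partial>\<mu>) < ep" using g(3)[of True] by (simp add: integral_distr[OF m(1) mg])
 moreover have "(\<integral>x. \<bar>g x - indicator A x\<bar> \<partial>\<nu>) < ep" using g(3)[of False] by (simp add: integral_distr[OF m(2) mg])
 ultimately show ?thesis using g by blast
qed

lemma lip_measurable_bor: "lip g ==> g \<in> borel_measurable (bor S)"
 by (intro measurable_restrict_space1 lip_measurable)

lemma lip_determines:
 fixes \<mu> \<nu> :: "'a::metric_space measure"
 assumes S: "closed S" and p: "prob_space \<mu>" "prob_space \<nu>" "sets \<mu> = sets (bor S)" "sets \<nu> = sets (bor S)"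
  and eq: "!!g. lip g ==> (!!x. 0 <= g x \<and> g x <= 1) ==> (\<integral>x. g x \<partial>\<mu>) = (\<integral>x. g x \<partial>\<nu>)"
 shows "\<mu> = \<nu>"
proof (rule measure_eqI)
 show "sets \<mu> = sets \<nu>" using p by simp
 interpret m: prob_space \<mu> by fact
 interpret n: prob_space \<nu> by fact
 fix A assume "A \<in> sets \<mu>"
 then have A: "A \<in> sets (bor S)" "A \<in> sets \<mu>" "A \<in> sets \<nu>" using p by auto
 have close: "\<bar>measure M A - (\<integral>x. g x \<partial>M)\<bar> <= (\<integral>x. \<bar>g x - indicator A x\<bar> \<partial>M)"
  if M: "prob_space M" "sets M = sets (bor S)" and g: "lip g" "!!x. 0 <= g x \<and> g x <= 1" for M g
 proof -
  interpret prob_space M by fact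
  have AM: "A \<in> sets M" using A M by simp
  have "g \<in> borel_measurable M" using lip_measurable_bor[OF g(1), of S] by (simp add: measurable_cong_sets[OF M(2) refl])
  then have ig: "integrable M g" by (rule integral_bounds_prob(1)[OF M(1)]) (use g in auto)
  have iA: "integrable M (indicator A :: _ => real)" using AM by (simp add: integrable_indicator_iff less_top[symmetric])
  have "\<bar>measure M A - (\<integral>x. g x \<partial>M)\<bar> = \<bar>\<integral>x. g x - indicator A x \<partial>M\<bar>"
   unfolding Bochner_Integration.integral_diff[OF ig iA] using AM by simp
  also have "\<dots> <= (\<integral>x. \<bar>g x - indicator A x\<bar> \<partial>M)" by (rule integral_abs_bound)
  finally show ?thesis .
 qed
 have "\<bar>measure \<mu> A - measure \<nu> A\<bar> <= 0 + ep" if ep: "0 < ep" for ep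
 proof -
  obtain g where g: "lip g" "!!x. 0 <= g x \<and> g x <= 1"
   "(\<integral>x. \<bar>g x - indicator A x\<bar> \<partial>\<mu>) < ep / 2" "(\<integral>x. \<bar>g x - indicator A x\<bar> \<partial>\<nu>) < ep / 2"
   using lip_approx_bor[OF S p A(1), of "ep / 2"] ep by auto
  show ?thesis using close[OF p(1,3) g(1,2)] close[OF p(2,4) g(1,2)] eq[OF g(1,2)] g(3,4) by linarith
 qed
 then have "\<bar>measure \<mu> A - measure \<nu> A\<bar> <= 0" by (rule field_le_epsilon)
 then show "emeasure \<mu> A = emeasure \<nu> A" by (simp add: m.emeasure_eq_measure n.emeasure_eq_measure)
qed

text \<open>All that uniqueness and the Feller property use. C is independent of t while the
  Lipschitz term decays; there is no continuity or measurability in t.\<close>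

locale harnack_semigroup =
 fixes S :: "'a::metric_space set" and \<kappa> :: "real => 'a => 'a measure" and C :: real
 assumes closed_S: "closed S"
  and kernel: "!!t. 0 <= t ==> \<kappa> t \<in> bor S \<rightarrow>\<^sub>M prob_algebra (bor S)"
  and chapman: "!!s t x. 0 <= s ==> 0 <= t ==> x \<in> S ==> \<kappa> (s + t) x = \<kappa> s x \<bind> \<kappa> t"
  and C_nonneg: "0 <= C"
  and harnack: "!!t x y L B g. 0 < t ==> x \<in> S ==> y \<in> S ==> 0 <= L ==> (!!z. \<bar>g z\<bar> <= B) ==>
   (!!z z'. \<bar>g z - g z'\<bar> <= L * dist z z') ==>
   (\<integral>z. g z \<partial>\<kappa> t y) <= (\<integral>z. exp (g z) \<partial>\<kappa> t x) - 1 + L * dist x y / sqrt (1 + t) + C * (dist x y)^2"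
begin

lemma space_bor: "space (bor S) = S"
 by (simp add: space_restrict_space)

lemmas kernel_at = kernel_props[OF kernel, unfolded space_bor]

definition invariant :: "'a measure => real => bool" where
 "invariant \<nu> t \<longleftrightarrow> prob_space \<nu> \<and> sets \<nu> = sets (bor S) \<and> \<nu> \<bind> \<kappa> t = \<nu>"

lemma bind_kernel:
 assumes \<nu>: "prob_space \<nu>" "sets \<nu> = sets (bor S)" and t: "0 <= t"
 shows "prob_space (\<nu> \<bind> \<kappa> t)" "sets (\<nu> \<bind> \<kappa> t) = sets (bor S)"
proof -
 have "\<nu> \<in> space (prob_algebra (bor S))" using \<nu> by (simp add: space_prob_algebra)
 from prob_space_bind'[OF this kernel[OF t]] sets_bind'[OF this kernel[OF t]]
 show "prob_space (\<nu> \<bind> \<kappa> t)" "sets (\<nu> \<bind> \<kappa> t) = sets (bor S)" .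
qed

lemma bind_chapman:
 assumes \<nu>: "prob_space \<nu>" "sets \<nu> = sets (bor S)" and st: "0 <= s" "0 <= t"
 shows "\<nu> \<bind> \<kappa> (s + t) = \<nu> \<bind> \<kappa> s \<bind> \<kappa> t"
proof -
 have sp: "space \<nu> = S" using sets_eq_imp_space_eq[OF \<nu>(2)] by (simp add: space_bor)
 have "\<nu> \<bind> \<kappa> (s + t) = \<nu> \<bind> (%x. \<kappa> s x \<bind> \<kappa> t)"
  by (intro bind_cong refl chapman st) (simp add: sp)
 also have "\<dots> = \<nu> \<bind> \<kappa> s \<bind> \<kappa> t"
 proof (rule bind_assoc[symmetric])
  show "\<kappa> s \<in> \<nu> \<rightarrow>\<^sub>M subprob_algebra (bor S)"
   using measurable_prob_algebraD[OF kernel[OF st(1)]] by (subst measurable_cong_sets[OF \<nu>(2) refl])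
  show "\<kappa> t \<in> bor S \<rightarrow>\<^sub>M subprob_algebra (bor S)"
   by (rule measurable_prob_algebraD[OF kernel[OF st(2)]])
 qed
 finally show ?thesis .
qed

lemma invariant_nat: "invariant \<nu> 1 ==> invariant \<nu> (real (Suc k))"
proof (induction k)
 case (Suc k)
 then have \<nu>: "prob_space \<nu>" "sets \<nu> = sets (bor S)" "\<nu> \<bind> \<kappa> 1 = \<nu>" "\<nu> \<bind> \<kappa> (real (Suc k)) = \<nu>"
  by (auto simp: invariant_def)
 have "\<nu> \<bind> \<kappa> (real (Suc k) + 1) = \<nu>"
  by (subst bind_chapman[OF \<nu>(1,2)]) (auto simp: \<nu>(3,4) simp del: of_nat_Suc)
 then show ?case using \<nu> by (simp add: invariant_def add.commute)
qed simp

text \<open>Two distinct invariant measures give x and y in a fixed ball whose kernels at time t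
  live essentially on opposite sides of a Hahn decomposition. The order of choices matters: R from
  the decomposition, a from R, q from a, the Lipschitz g and hence L from q, and t last.\<close>

lemma invariant_unique:
 assumes inv1: "invariant \<nu>1 1" and inv2: "invariant \<nu>2 1"
 shows "\<nu>1 = \<nu>2"
proof (rule ccontr)
 assume ne: "\<nu>1 \<noteq> \<nu>2"
 have \<nu>: "prob_space \<nu>1" "prob_space \<nu>2" "sets \<nu>1 = sets (bor S)" "sets \<nu>2 = sets (bor S)"
  using inv1 inv2 by (auto simp: invariant_def)
 interpret n1: prob_space \<nu>1 by fact
 interpret n2: prob_space \<nu>2 by fact
 have sp: "space \<nu>1 = S" "space \<nu>2 = S"
  using sets_eq_imp_space_eq[OF \<nu>(3)] sets_eq_imp_space_eq[OF \<nu>(4)] by (auto simp: space_bor)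
 obtain Y where Y: "Y \<in> sets (bor S)"
  and pos: "!!X. X \<in> sets (bor S) ==> X \<subseteq> Y ==> emeasure \<nu>2 X <= emeasure \<nu>1 X"
  and neg: "!!X. X \<in> sets (bor S) ==> X \<inter> Y = {} ==> emeasure \<nu>1 X <= emeasure \<nu>2 X"
  using finite_unsigned_Hahn_decomposition[OF n1.finite_measure_axioms n2.finite_measure_axioms] \<nu>(3,4) by auto
 have pos': "measure \<nu>2 X <= measure \<nu>1 X" if "X \<in> sets (bor S)" "X \<subseteq> Y" for X
  using pos[OF that] by (simp add: n1.emeasure_eq_measure n2.emeasure_eq_measure)
 have neg': "measure \<nu>1 X <= measure \<nu>2 X" if "X \<in> sets (bor S)" "X \<inter> Y = {}" for X
  using neg[OF that] by (simp add: n1.emeasure_eq_measure n2.emeasure_eq_measure)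
 let ?N = "S - Y"
 have YS: "Y \<subseteq> S" using sets.sets_into_space[OF Y] by (simp add: space_bor)
 have N: "?N \<in> sets (bor S)" using sets.compl_sets[OF Y] by (simp add: space_bor)
 define \<delta>0 where "\<delta>0 = measure \<nu>1 Y - measure \<nu>2 Y"
 have \<delta>N: "measure \<nu>2 ?N - measure \<nu>1 ?N = \<delta>0"
  using n1.prob_compl[of Y] n2.prob_compl[of Y] Y \<nu> by (simp add: sp \<delta>0_def)
 \<comment> \<open>Otherwise each inequality between the parts of Y and of its complement is an
   equality, and the measures agree.\<close>
 have \<delta>0: "0 < \<delta>0"
 proof (rule ccontr)
  assume "\<not> 0 < \<delta>0"
  then have le: "measure \<nu>1 Y <= measure \<nu>2 Y" "measure \<nu>2 ?N <= measure \<nu>1 ?N" using \<delta>N by (auto simp: \<delta>0_def)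
  have "measure \<nu>1 A = measure \<nu>2 A" if A: "A \<in> sets (bor S)" for A
  proof -
   have AS: "A \<subseteq> S" using sets.sets_into_space[OF A] by (simp add: space_bor)
   have s: "A \<inter> Y \<in> sets (bor S)" "Y - A \<in> sets (bor S)" "A - Y \<in> sets (bor S)" "?N - A \<in> sets (bor S)"
    using A Y N by auto
   have d: "measure \<nu> X = measure \<nu> (X \<inter> Z) + measure \<nu> (X - Z)"
    if "prob_space \<nu>" "sets \<nu> = sets (bor S)" "X \<in> sets (bor S)" "Z \<in> sets (bor S)" for \<nu> X Z
   proof -
    interpret prob_space \<nu> by fact
    have "measure \<nu> (X \<inter> Z \<union> (X - Z)) = measure \<nu> (X \<inter> Z) + measure \<nu> (X - Z)"
     by (rule finite_measure_Union) (use that in auto)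
    then show ?thesis by (simp only: Int_Diff_Un)
   qed
   have u: "measure \<nu> Y = measure \<nu> (A \<inter> Y) + measure \<nu> (Y - A)" "measure \<nu> ?N = measure \<nu> (A - Y) + measure \<nu> (?N - A)"
    "measure \<nu> A = measure \<nu> (A \<inter> Y) + measure \<nu> (A - Y)"
    if "prob_space \<nu>" "sets \<nu> = sets (bor S)" for \<nu>
   proof -
    have "Y \<inter> A = A \<inter> Y" "?N \<inter> A = A - Y" using AS by auto
    with d[OF that Y A] d[OF that N A] d[OF that A Y]
    show "measure \<nu> Y = measure \<nu> (A \<inter> Y) + measure \<nu> (Y - A)" "measure \<nu> ?N = measure \<nu> (A - Y) + measure \<nu> (?N - A)"
     "measure \<nu> A = measure \<nu> (A \<inter> Y) + measure \<nu> (A - Y)" by simp_all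
   qed
   have "(A - Y) \<inter> Y = {}" "(?N - A) \<inter> Y = {}" by auto
   note ng = neg'[OF s(3) this(1)] neg'[OF s(4) this(2)]
   show ?thesis
    using u[OF \<nu>(1,3)] u[OF \<nu>(2,4)] le pos'[OF s(1)] pos'[OF s(2)] ng by auto
  qed
  then have "\<nu>1 = \<nu>2" using \<nu> by (intro measure_eqI) (auto simp: n1.emeasure_eq_measure n2.emeasure_eq_measure)
  then show False using ne by simp
 qed
 \<comment> \<open>Any point can serve as the centre of the exhausting balls.\<close>
 define p :: 'a where "p = undefined"
 have lim: "(%R. measure \<nu> (X \<inter> cball p (real R))) \<longlonglongrightarrow> measure \<nu> X"
  if "prob_space \<nu>" "sets \<nu> = sets (bor S)" "X \<in> sets (bor S)" for \<nu> X
 proof -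
  interpret prob_space \<nu> by fact
  have XS: "X \<subseteq> S" using sets.sets_into_space[OF that(3)] by (simp add: space_bor)
  have "X \<inter> cball p (real R) = X \<inter> (S \<inter> cball p (real R))" for R using XS by auto
  moreover have "S \<inter> cball p (real R) \<in> sets (bor S)" for R by (auto simp: sets_restrict_space)
  ultimately have m: "X \<inter> cball p (real R) \<in> sets (bor S)" for R using that(3) by (metis sets.Int)
  have "(%R. measure \<nu> (X \<inter> cball p (real R))) \<longlonglongrightarrow> measure \<nu> (\<Union>R. X \<inter> cball p (real R))"
  proof (rule finite_Lim_measure_incseq)
   show "incseq (%R. X \<inter> cball p (real R))"
    by (auto simp: incseq_def intro: order_trans)
  qed (use m that in auto)
  moreover have "(\<Union>R. X \<inter> cball p (real R)) = X"
   using real_arch_simple by (auto simp: mem_cball)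
  ultimately show ?thesis by simp
 qed
 have mc: "X \<inter> cball p r \<in> sets (bor S)" if "X \<in> sets (bor S)" for X r
 proof -
  have "X \<inter> cball p r = X \<inter> (S \<inter> cball p r)" using sets.sets_into_space[OF that] by (auto simp: space_bor)
  moreover have "S \<inter> cball p r \<in> sets (bor S)" by (auto simp: sets_restrict_space)
  ultimately show ?thesis using that by (metis sets.Int)
 qed
 define \<delta> where "\<delta> = \<delta>0 / 2"
 have \<delta>: "0 < \<delta>" "\<delta> < \<delta>0" using \<delta>0 by (auto simp: \<delta>_def)
 have "(%R. measure \<nu>1 (Y \<inter> cball p (real R)) - measure \<nu>2 (Y \<inter> cball p (real R))) \<longlonglongrightarrow> \<delta>0"
  unfolding \<delta>0_def by (intro tendsto_diff lim \<nu> Y)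
 moreover have "(%R. measure \<nu>2 (?N \<inter> cball p (real R)) - measure \<nu>1 (?N \<inter> cball p (real R))) \<longlonglongrightarrow> \<delta>0"
  unfolding \<delta>N[symmetric] by (intro tendsto_diff lim \<nu> N)
 ultimately have "\<forall>\<^sub>F R in sequentially. \<delta> < measure \<nu>1 (Y \<inter> cball p (real R)) - measure \<nu>2 (Y \<inter> cball p (real R))
   \<and> \<delta> < measure \<nu>2 (?N \<inter> cball p (real R)) - measure \<nu>1 (?N \<inter> cball p (real R))"
  by (intro eventually_conj order_tendstoD(1)[OF _ \<delta>(2)])
 then obtain R0 where R0: "\<delta> < measure \<nu>1 (Y \<inter> cball p (real R0)) - measure \<nu>2 (Y \<inter> cball p (real R0))"
   "\<delta> < measure \<nu>2 (?N \<inter> cball p (real R0)) - measure \<nu>1 (?N \<inter> cball p (real R0))"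
  unfolding eventually_sequentially by blast
 define R where "R = real R0"
 \<comment> \<open>Of the 3, one unit covers the Lipschitz term, one covers q (a + exp a) = 1, and
   one is left for the contradiction.\<close>
 define a where "a = C * (2 * R)^2 + 3"
 define q where "q = 1 / (a + exp a)"
 have a0: "0 < a" using C_nonneg by (simp add: a_def add_nonneg_pos)
 then have ae: "0 < a + exp a" by (simp add: add_pos_pos)
 then have q: "0 < q" "q * (a + exp a) = 1" by (auto simp: q_def)
 \<comment> \<open>Half of q is reserved for the leaking mass and half for the distance of g from
   the indicator.\<close>
 define ep where "ep = q * \<delta> / 4"
 have ep: "0 < ep" "2 * ep / \<delta> = q / 2" using q \<delta> by (auto simp: ep_def)
 obtain g where g: "lip g" "!!x. 0 <= g x \<and> g x <= 1"
  "(\<integral>x. \<bar>g x - indicator ?N x\<bar> \<partial>\<nu>1) < ep" "(\<integral>x. \<bar>g x - indicator ?N x\<bar> \<partial>\<nu>2) < ep"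
  using lip_approx_bor[OF closed_S \<nu> N ep(1)] by blast
 from lip_mult_const[OF g(1), of a] obtain L where L: "0 <= L" "!!x y. \<bar>a * g x - a * g y\<bar> <= L * dist x y"
  by (auto elim: lipE)
 \<comment> \<open>t is taken to be a natural number, since invariance is given for the time-1
   kernel and its iterates only.\<close>
 obtain k where k: "(L * (2 * R))^2 <= real k" using real_arch_simple by blast
 define t where "t = real (Suc k)"
 have t0: "0 <= t" "0 < t" by (auto simp: t_def)
 let ?w = "%x. \<bar>g x - indicator ?N x\<bar>"
 have K: "\<kappa> t \<in> bor S \<rightarrow>\<^sub>M prob_algebra (bor S)" by (rule kernel[OF t0(1)])
 have inv: "\<nu>1 \<bind> \<kappa> t = \<nu>1" "\<nu>2 \<bind> \<kappa> t = \<nu>2"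
  using invariant_nat[OF inv1, of k] invariant_nat[OF inv2, of k] by (auto simp: invariant_def t_def simp del: of_nat_Suc)
 have mg: "g \<in> borel_measurable (bor S)" by (rule lip_measurable_bor[OF g(1)])
 have mw: "?w \<in> borel_measurable (bor S)" using mg borel_measurable_indicator[OF N] by (intro borel_measurable_abs borel_measurable_diff)
 have w01: "0 <= ?w x \<and> ?w x <= 1" for x using g(2)[of x] by (auto simp: indicator_def)
 have "\<exists>x\<in>Y \<inter> cball p R. measure (\<kappa> t x) (space (bor S) - Y) < q / 2 \<and> (\<integral>y. ?w y \<partial>\<kappa> t x) <= 2 * ep / \<delta>"
 proof (rule positive_set_point[OF \<nu>(1,2,3,4) K inv Y pos neg])
  show "Y \<inter> cball p R \<in> sets (bor S)" by (rule mc[OF Y])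
  show "\<delta> <= measure \<nu>1 (Y \<inter> cball p R) - measure \<nu>2 (Y \<inter> cball p R)" using R0 by (simp add: R_def)
 qed (use mw w01 \<delta> ep q g in auto)
 then obtain x where x: "x \<in> Y" "dist p x <= R" "measure (\<kappa> t x) ?N < q / 2" "(\<integral>y. ?w y \<partial>\<kappa> t x) <= q / 2"
  unfolding space_bor ep(2) by auto
 have "\<exists>x\<in>?N \<inter> cball p R. measure (\<kappa> t x) (space (bor S) - ?N) < q / 2 \<and> (\<integral>y. ?w y \<partial>\<kappa> t x) <= 2 * ep / \<delta>"
 proof (rule positive_set_point[OF \<nu>(2,1,4,3) K inv(2,1) N])
  show "?N \<inter> cball p R \<in> sets (bor S)" by (rule mc[OF N])
  show "\<delta> <= measure \<nu>2 (?N \<inter> cball p R) - measure \<nu>1 (?N \<inter> cball p R)" using R0 by (simp add: R_def)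
  show "emeasure \<nu>1 X <= emeasure \<nu>2 X" if "X \<in> sets (bor S)" "X \<subseteq> ?N" for X using that by (intro neg) auto
  show "emeasure \<nu>2 X <= emeasure \<nu>1 X" if "X \<in> sets (bor S)" "X \<inter> ?N = {}" for X
   using that sets.sets_into_space[OF that(1)] by (intro pos) (auto simp: space_bor)
 qed (use mw w01 \<delta> ep q g in auto)
 moreover have "S - ?N = Y" using YS by auto
 ultimately have "\<exists>x\<in>?N \<inter> cball p R. measure (\<kappa> t x) Y < q / 2 \<and> (\<integral>y. ?w y \<partial>\<kappa> t x) <= q / 2"
  by (simp only: space_bor ep(2))
 then obtain y where y: "y \<in> ?N" "dist p y <= R" "measure (\<kappa> t y) Y < q / 2" "(\<integral>z. ?w z \<partial>\<kappa> t y) <= q / 2"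
  unfolding Bex_def Int_iff mem_cball by (elim exE conjE)
 have xyS: "x \<in> S" "y \<in> S" using x y YS by auto
 have G: "measure (\<kappa> t z) ?N - (\<integral>z. ?w z \<partial>\<kappa> t z) <= (\<integral>z. g z \<partial>\<kappa> t z)"
  "(\<integral>z. g z \<partial>\<kappa> t z) <= measure (\<kappa> t z) ?N + (\<integral>z. ?w z \<partial>\<kappa> t z)"
  "(\<integral>z. exp (a * g z) \<partial>\<kappa> t z) <= 1 + (exp a - 1) * (\<integral>z. g z \<partial>\<kappa> t z)"
  "measure (\<kappa> t z) ?N = 1 - measure (\<kappa> t z) Y" if z: "z \<in> S" for z
 proof -
  note kz = kernel_at[OF t0(1) z]
  interpret prob_space "\<kappa> t z" by (rule kz)
  have mz: "f \<in> borel_measurable (\<kappa> t z)" if "f \<in> borel_measurable (bor S)" for f :: "'a => real"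
   using that by (simp add: measurable_cong_sets[OF kz(2) refl])
  have ig: "integrable (\<kappa> t z) g" by (rule integral_bounds_prob(1)[OF kz(1) mz[OF mg] g(2)])
  have iw: "integrable (\<kappa> t z) ?w" by (rule integral_bounds_prob(1)[OF kz(1) mz[OF mw] w01])
  have Nz: "?N \<in> sets (\<kappa> t z)" using N kz by simp
  have iN: "integrable (\<kappa> t z) (indicator ?N :: _ => real)" using Nz by (simp add: integrable_indicator_iff less_top[symmetric])
  have "(\<integral>z. indicator ?N z - ?w z \<partial>\<kappa> t z) <= (\<integral>z. g z \<partial>\<kappa> t z)"
   by (intro integral_mono Bochner_Integration.integrable_diff iN iw ig) linarith
  then show "measure (\<kappa> t z) ?N - (\<integral>z. ?w z \<partial>\<kappa> t z) <= (\<integral>z. g z \<partial>\<kappa> t z)"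
   unfolding Bochner_Integration.integral_diff[OF iN iw] using Nz by simp
  have "(\<integral>z. g z \<partial>\<kappa> t z) <= (\<integral>z. indicator ?N z + ?w z \<partial>\<kappa> t z)"
   by (intro integral_mono Bochner_Integration.integrable_add iN iw ig) linarith
  then show "(\<integral>z. g z \<partial>\<kappa> t z) <= measure (\<kappa> t z) ?N + (\<integral>z. ?w z \<partial>\<kappa> t z)"
   unfolding Bochner_Integration.integral_add[OF iN iw] using Nz by simp
  \<comment> \<open>On [0,1] the convex function exp(a s) lies below its chord.\<close>
  have ex: "exp (a * g z) <= 1 + (exp a - 1) * g z" for z
   using convex_onD[OF exp_convex, of "g z" 0 a] g(2)[of z] by (simp add: algebra_simps)
  have me: "(%z. exp (a * g z)) \<in> borel_measurable (bor S)" using mg by measurable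
  have ie: "integrable (\<kappa> t z) (%z. exp (a * g z))"
   by (rule integral_bounds_prob(1)[OF kz(1) mz[OF me], of 0 "exp a"]) (use g(2) a0 in \<open>auto intro: mult_left_le\<close>)
  have "(\<integral>z. exp (a * g z) \<partial>\<kappa> t z) <= (\<integral>z. 1 + (exp a - 1) * g z \<partial>\<kappa> t z)"
   by (intro integral_mono ex ie Bochner_Integration.integrable_add integrable_mult_right ig) simp
  also have "\<dots> = 1 + (exp a - 1) * (\<integral>z. g z \<partial>\<kappa> t z)" using ig by (simp add: prob_space)
  finally show "(\<integral>z. exp (a * g z) \<partial>\<kappa> t z) <= 1 + (exp a - 1) * (\<integral>z. g z \<partial>\<kappa> t z)" .
  show "measure (\<kappa> t z) ?N = 1 - measure (\<kappa> t z) Y"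
   using prob_compl[of Y] Y kz by (simp add: kz(3))
 qed
 have gx: "(\<integral>z. g z \<partial>\<kappa> t x) <= q" using G(2)[OF xyS(1)] x(3,4) by linarith
 have gy: "1 - q <= (\<integral>z. g z \<partial>\<kappa> t y)" using G(1)[OF xyS(2)] G(4)[OF xyS(2)] y(3,4) by linarith
 have d: "dist x y <= 2 * R" using x(2) y(2) dist_triangle2[of x y p] by (simp add: dist_commute)
 have R0': "0 <= R" by (simp add: R_def)
 have "(\<integral>z. a * g z \<partial>\<kappa> t y) <= (\<integral>z. exp (a * g z) \<partial>\<kappa> t x) - 1 + L * dist x y / sqrt (1 + t) + C * (dist x y)^2"
 proof (rule harnack[OF t0(2) xyS L(1) _ L(2)])
  show "\<bar>a * g z\<bar> <= a" for z using g(2)[of z] a0 by (simp add: abs_mult mult_left_le)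
 qed
 then have "a * (\<integral>z. g z \<partial>\<kappa> t y) <= (exp a - 1) * (\<integral>z. g z \<partial>\<kappa> t x) + L * dist x y / sqrt (1 + t) + C * (dist x y)^2"
  using G(3)[OF xyS(1)] by simp
 moreover have "a * (1 - q) <= a * (\<integral>z. g z \<partial>\<kappa> t y)" using gy a0 by (intro mult_left_mono) auto
 moreover have "(exp a - 1) * (\<integral>z. g z \<partial>\<kappa> t x) <= (exp a - 1) * q" using gx a0 by (intro mult_left_mono) auto
 moreover have "L * dist x y / sqrt (1 + t) <= 1"
 proof -
  have "L * dist x y <= L * (2 * R)" by (intro mult_left_mono d L)
  also have "\<dots> <= sqrt (1 + t)" using k by (intro real_le_rsqrt) (simp add: t_def)
  finally show ?thesis using t0 by (subst pos_divide_le_eq) auto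
 qed
 moreover have "C * (dist x y)^2 <= C * (2 * R)^2"
  using d C_nonneg by (intro mult_left_mono power_mono) auto
 ultimately have "a * (1 - q) <= (exp a - 1) * q + 1 + C * (2 * R)^2" by linarith
 then have "a <= q * (a + exp a) - q + 1 + C * (2 * R)^2" by (simp add: algebra_simps)
 then show False using q by (simp add: a_def)
qed

text \<open>The kernels commute, so \<nu> moved by time t is again invariant for time 1, and
  uniqueness identifies it with \<nu>.\<close>

lemma invariant_all:
 assumes inv: "invariant \<nu> 1" and t: "0 <= t"
 shows "invariant \<nu> t"
proof -
 have \<nu>: "prob_space \<nu>" "sets \<nu> = sets (bor S)" "\<nu> \<bind> \<kappa> 1 = \<nu>" using inv by (auto simp: invariant_def)
 have "\<nu> \<bind> \<kappa> t \<bind> \<kappa> 1 = \<nu> \<bind> \<kappa> (1 + t)"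
  using bind_chapman[OF \<nu>(1,2) t, of 1] by (simp add: add.commute)
 also have "\<dots> = \<nu> \<bind> \<kappa> t" using bind_chapman[OF \<nu>(1,2) _ t, of 1] \<nu>(3) by simp
 finally have "invariant (\<nu> \<bind> \<kappa> t) 1" using bind_kernel[OF \<nu>(1,2) t] by (simp add: invariant_def)
 from invariant_unique[OF this inv] show ?thesis using \<nu> by (simp add: invariant_def)
qed

text \<open>Apply the inequality to r \<phi> with r = dist x y and divide by r: exp(r \<phi>) - 1 -
  r \<phi> is at most r^2, so every error term becomes of order r.\<close>

lemma feller_lipschitz:
 assumes \<phi>: "!!z. 0 <= \<phi> z \<and> \<phi> z <= 1" and L: "0 <= L" "!!z z'. \<bar>\<phi> z - \<phi> z'\<bar> <= L * dist z z'"
  and xy: "x \<in> S" "y \<in> S" "dist x y <= 1"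
 shows "(\<integral>z. \<phi> z \<partial>\<kappa> 1 y) <= (\<integral>z. \<phi> z \<partial>\<kappa> 1 x) + (1 + L + C) * dist x y"
proof (cases "dist x y = 0")
 case False
 define r where "r = dist x y"
 have r: "0 < r" "r <= 1" using False xy by (auto simp: r_def)
 have kx: "prob_space (\<kappa> 1 x)" "sets (\<kappa> 1 x) = sets (bor S)" using kernel_at[of 1 x] xy by auto
 have l\<phi>: "lip \<phi>" using L by (rule lipI)
 have m\<phi>: "\<phi> \<in> borel_measurable (\<kappa> 1 x)"
  using lip_measurable_bor[OF l\<phi>, of S] by (simp add: measurable_cong_sets[OF kx(2) refl])
 interpret prob_space "\<kappa> 1 x" by (rule kx)
 have i\<phi>: "integrable (\<kappa> 1 x) \<phi>" by (rule integral_bounds_prob(1)[OF kx(1) m\<phi> \<phi>])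
 have "(\<integral>z. r * \<phi> z \<partial>\<kappa> 1 y) <= (\<integral>z. exp (r * \<phi> z) \<partial>\<kappa> 1 x) - 1 + (r * L) * dist x y / sqrt (1 + 1) + C * (dist x y)^2"
 proof (rule harnack[OF _ xy(1,2)])
  show "\<bar>r * \<phi> z\<bar> <= r" for z using \<phi>[of z] r by (simp add: abs_mult mult_left_le)
  show "\<bar>r * \<phi> z - r * \<phi> z'\<bar> <= r * L * dist z z'" for z z'
   using mult_left_mono[OF L(2)[of z z'], of r] r by (simp add: right_diff_distrib[symmetric] abs_mult mult.assoc)
 qed (use r L in auto)
 moreover have "(\<integral>z. exp (r * \<phi> z) \<partial>\<kappa> 1 x) <= 1 + r * (\<integral>z. \<phi> z \<partial>\<kappa> 1 x) + r^2"
 proof -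
  have me: "(%z. exp (r * \<phi> z)) \<in> borel_measurable (\<kappa> 1 x)" using m\<phi> by measurable
  have r\<phi>: "0 <= r * \<phi> z \<and> r * \<phi> z <= r" for z using \<phi>[of z] r by (simp add: mult_left_le)
  have "exp (r * \<phi> z) <= 1 + r * \<phi> z + r^2" for z
  proof -
   have "exp (r * \<phi> z) <= 1 + r * \<phi> z + (r * \<phi> z)^2" using r\<phi>[of z] r(2) by (intro exp_bound) linarith+
   moreover have "(r * \<phi> z)^2 <= r^2" using r\<phi>[of z] by (intro power_mono) auto
   ultimately show ?thesis by linarith
  qed
  moreover have "integrable (\<kappa> 1 x) (%z. exp (r * \<phi> z))"
   by (rule integral_bounds_prob(1)[OF kx(1) me, of 0 "exp r"]) (use r\<phi> in auto)
  ultimately have "(\<integral>z. exp (r * \<phi> z) \<partial>\<kappa> 1 x) <= (\<integral>z. 1 + r * \<phi> z + r^2 \<partial>\<kappa> 1 x)"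
   by (intro integral_mono) (use i\<phi> in auto)
  then show ?thesis using i\<phi> by (simp add: prob_space)
 qed
 moreover have "(r * L) * dist x y / sqrt (1 + 1) <= r^2 * L"
 proof -
  have "(r * L) * dist x y / sqrt (1 + 1) <= (r * L) * dist x y / 1"
   using r L by (intro divide_left_mono mult_nonneg_nonneg) auto
  then show ?thesis by (simp add: r_def power2_eq_square mult_ac)
 qed
 ultimately have "r * (\<integral>z. \<phi> z \<partial>\<kappa> 1 y) <= r * (\<integral>z. \<phi> z \<partial>\<kappa> 1 x) + r^2 + r^2 * L + C * r^2"
  unfolding r_def[symmetric] by simp
 also have "\<dots> = r * ((\<integral>z. \<phi> z \<partial>\<kappa> 1 x) + (1 + L + C) * r)" by (simp add: power2_eq_square algebra_simps)
 finally show ?thesis using r by (simp add: r_def)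
qed simp

lemma feller:
 assumes \<phi>: "lip \<phi>" "!!z. 0 <= \<phi> z \<and> \<phi> z <= 1" and x: "!!n. x n \<in> S" "l \<in> S" "x \<longlonglongrightarrow> l"
 shows "(%n. \<integral>z. \<phi> z \<partial>\<kappa> 1 (x n)) \<longlonglongrightarrow> (\<integral>z. \<phi> z \<partial>\<kappa> 1 l)"
proof -
 from \<phi>(1) obtain L where L: "0 <= L" "!!z z'. \<bar>\<phi> z - \<phi> z'\<bar> <= L * dist z z'" by (auto elim: lipE)
 have d0: "(%n. dist (x n) l) \<longlonglongrightarrow> 0" by (rule tendsto_dist_iff[THEN iffD1, OF x(3)])
 have "(%n. (1 + L + C) * dist (x n) l) \<longlonglongrightarrow> (1 + L + C) * 0" by (intro tendsto_mult_left d0)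
 then have d1: "(%n. (1 + L + C) * dist (x n) l) \<longlonglongrightarrow> 0" by simp
 have "\<forall>\<^sub>F n in sequentially. dist (x n) l < 1" by (rule order_tendstoD(2)[OF d0]) simp
 then have "\<forall>\<^sub>F n in sequentially. norm ((\<integral>z. \<phi> z \<partial>\<kappa> 1 (x n)) - (\<integral>z. \<phi> z \<partial>\<kappa> 1 l)) <= (1 + L + C) * dist (x n) l"
 proof eventually_elim
  case (elim n)
  then show ?case
   using feller_lipschitz[OF \<phi>(2) L x(1)[of n] x(2)] feller_lipschitz[OF \<phi>(2) L x(2) x(1)[of n]]
   by (simp add: dist_commute abs_le_iff)
 qed
 from Lim_null_comparison[OF this d1] show ?thesis by (simp add: LIM_zero_iff)
qed

end

section \<open>Encoding of H into the real line\<close>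

lemma measurable_coef [measurable]: "(%h. coef h i) \<in> borel_measurable borel"
 by (intro borel_measurable_continuous_onI continuous_coef)

text \<open>The ternary digit at place n + 1 after the point.\<close>

definition digit :: "nat => real => int" where
 "digit n r = \<lfloor>3 ^ Suc n * r\<rfloor> - 3 * \<lfloor>3 ^ n * r\<rfloor>"

text \<open>The places \<open>prod_encode (i, l)\<close> form one stream per coordinate i, read as a
  binary expansion; for a general r digits 2 occur, so the value may reach 2.\<close>

definition bits :: "nat => real => real" where
 "bits i r = (\<Sum>l. real_of_int (digit (prod_encode (i, l)) r) / 2 ^ Suc l)"

text \<open>The integer part of r bounds i |x_i| for all i at once, and the i-th stream gives the
  position of i x_i in that range. The weight 1/i makes the sequence an element of H for every
  r.\<close>

definition decode :: "real => real => H" where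
 "decode c r = Abs_H (%i. if i = 0 then c else real_of_int \<lfloor>r\<rfloor> / real i * (2 * bits i r - 1))"

text \<open>The set of numbers whose fractional part has a ternary expansion without the digit \<open>2\<close>; on it the
 floors of \<open>3\<^sup>n r\<close> are locally constant, which makes \<^const>\<open>decode\<close> continuous there.\<close>

definition cantor :: "real => bool" where
 "cantor r \<longleftrightarrow> (\<forall>n. 3 ^ n * r - real_of_int \<lfloor>3 ^ n * r\<rfloor> <= 1 / 2)"

lemma digit_bounds: "0 <= digit n r" "digit n r <= 2"
proof -
 let ?y = "3 ^ n * r"
 have "3 * \<lfloor>?y\<rfloor> <= \<lfloor>3 * ?y\<rfloor>" unfolding le_floor_iff using of_int_floor_le[of ?y] by simp
 moreover have "\<lfloor>3 * ?y\<rfloor> < 3 * \<lfloor>?y\<rfloor> + 3"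
 proof -
  have "?y < real_of_int \<lfloor>?y\<rfloor> + 1" by linarith
  then show ?thesis unfolding floor_less_iff of_int_add of_int_mult of_int_numeral by linarith
 qed
 ultimately show "0 <= digit n r" "digit n r <= 2" by (auto simp: digit_def mult.assoc)
qed

lemma sums_halves: "(%l. k / 2 ^ Suc l) sums (k :: real)"
proof -
 have "(%l. (1 / 2 :: real) ^ Suc l) sums 1" by (rule power_half_series)
 from sums_mult[OF this, of k] show ?thesis by (simp add: power_divide)
qed

lemma bits_bound: "\<bar>real_of_int (digit n r) / 2 ^ Suc l\<bar> <= 2 / 2 ^ Suc l"
proof -
 have "0 <= real_of_int (digit n r)" "real_of_int (digit n r) <= 2" using digit_bounds[of n r] by linarith+
 moreover have "\<bar>d / p\<bar> <= 2 / p" if "0 <= d" "d <= 2" "0 < p" for d p :: real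
  using that by (simp add: divide_right_mono)
 ultimately show ?thesis by (meson zero_less_power zero_less_numeral)
qed

lemma bits_summable: "summable (%l. real_of_int (digit (prod_encode (i, l)) r) / 2 ^ Suc l)"
 by (rule summable_comparison_test'[OF sums_summable[OF sums_halves[of 2]]])
  (simp only: real_norm_def bits_bound)

lemma bits_le: "0 <= bits i r" "bits i r <= 2"
proof -
 show "0 <= bits i r" unfolding bits_def by (rule suminf_nonneg[OF bits_summable]) (simp add: digit_bounds)
 have "bits i r <= (\<Sum>l. 2 / 2 ^ Suc l)"
  unfolding bits_def
 proof (rule suminf_le[OF _ bits_summable sums_summable[OF sums_halves]])
  show "real_of_int (digit (prod_encode (i, l)) r) / 2 ^ Suc l <= 2 / 2 ^ Suc l" for l
   using bits_bound[of "prod_encode (i, l)" r l] by linarith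
 qed
 then show "bits i r <= 2" by (simp only: sums_unique[OF sums_halves, symmetric])
qed

lemma summable_inverse_squares: "summable (%i. K / (real (Suc i))^2)"
proof -
 have "summable (%i. inverse (real (Suc i) ^ 2))"
  by (subst summable_Suc_iff) (rule inverse_power_summable, simp)
 from summable_mult[OF this, of K] show ?thesis by (simp add: divide_inverse)
qed

lemma coef_decode: "coef (decode c r) i = (if i = 0 then c else real_of_int \<lfloor>r\<rfloor> / real i * (2 * bits i r - 1))"
proof -
 let ?a = "%i. if i = 0 then c else real_of_int \<lfloor>r\<rfloor> / real i * (2 * bits i r - 1)"
 let ?K = "(real_of_int \<lfloor>r\<rfloor>)^2 * 9"
 have "summable (%i. (- eig (Suc i)) powr (- 1) * (?a (Suc i))^2)"
 proof (rule summable_comparison_test'[OF summable_inverse_squares[of ?K]])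
  fix i
  have "(2 * bits (Suc i) r - 1)^2 <= 3^2" using bits_le[of "Suc i" r] by (intro power2_le_iff_abs_le[THEN iffD2]) auto
  then have "(real_of_int \<lfloor>r\<rfloor>)^2 / (real (Suc i))^2 * (2 * bits (Suc i) r - 1)^2 <= (real_of_int \<lfloor>r\<rfloor>)^2 / (real (Suc i))^2 * 3^2"
   by (intro mult_left_mono) auto
  then have sq: "(?a (Suc i))^2 <= ?K / (real (Suc i))^2" by (simp add: power_mult_distrib power_divide)
  have "(- eig (Suc i)) powr (- 1) = 1 / freq (Suc i)" by (simp add: eig_eq_freq powr_minus_divide freq_def)
  moreover have "1 / freq (Suc i) <= 1" using freq_ge_1[of "Suc i"] by simp
  ultimately have "(- eig (Suc i)) powr (- 1) * (?a (Suc i))^2 <= 1 * (?a (Suc i))^2"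
   by (intro mult_right_mono) auto
  then show "norm ((- eig (Suc i)) powr (- 1) * (?a (Suc i))^2) <= ?K / (real (Suc i))^2"
   using sq unfolding real_norm_def by (subst abs_of_nonneg) auto
 qed
 then have "?a \<in> V (- 1)" by (simp only: V_def mem_Collect_eq)
 then show ?thesis unfolding decode_def by (subst Abs_H_inverse) auto
qed

lemma decode_Hc: "decode c r \<in> Hc c"
 by (simp add: Hc_def coef_decode)

lemma measurable_decode [measurable]: "decode c \<in> borel_measurable borel"
proof (rule borel_measurable_LIMSEQ_metric[where f="%m r. emb m (start m (decode c r))"])
 show "(%m. emb m (start m (decode c r))) \<longlonglongrightarrow> decode c r" for r by (rule emb_start_tendsto)
 have [measurable]: "(%r. real_of_int (digit n r)) \<in> borel_measurable borel" for n unfolding digit_def by measurable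
 have [measurable]: "(%r. bits i r) \<in> borel_measurable borel" for i unfolding bits_def by measurable
 have "(%r. start m (decode c r)) \<in> borel_measurable borel" for m
 proof (rule measurable_coordinatewise_then_product)
  show "(%r. start m (decode c r) i) \<in> borel_measurable borel" for i
   unfolding start_def coef_decode by measurable
 qed
 then show "(%r. emb m (start m (decode c r))) \<in> borel_measurable borel" for m
  by (rule measurable_compose[OF _ measurable_emb])
qed

text \<open>Fractional parts at most 1/2 leave a gap of length 1/2 between numbers with different
  floors, so close members have equal floors; the closed bounds survive in the limit and fix its
  floor too.\<close>

lemma cantor_limit:
 assumes g: "!!l. cantor (r l)" and lim: "r \<longlonglongrightarrow> R"
 shows "\<forall>\<^sub>F l in sequentially. \<lfloor>3 ^ n * r l\<rfloor> = \<lfloor>3 ^ n * R\<rfloor>"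
proof -
 let ?y = "%l. 3 ^ n * r l" and ?Y = "3 ^ n * R"
 have ly: "?y \<longlonglongrightarrow> ?Y" by (intro tendsto_mult_left lim)
 have "\<forall>\<^sub>F l in sequentially. dist (?y l) ?Y < 1 / 4" by (rule tendstoD[OF ly]) simp
 then obtain N where N: "!!l. N <= l ==> \<bar>?y l - ?Y\<bar> < 1 / 4"
  unfolding eventually_sequentially dist_real_def by blast
 have fr: "real_of_int \<lfloor>?y l\<rfloor> <= ?y l \<and> ?y l <= real_of_int \<lfloor>?y l\<rfloor> + 1 / 2" for l
 proof -
  have "?y l - real_of_int \<lfloor>?y l\<rfloor> <= 1 / 2" using g[of l] unfolding cantor_def by blast
  then show ?thesis using of_int_floor_le[of "?y l"] by linarith
 qed
 have F: "\<lfloor>?y l\<rfloor> = \<lfloor>?y N\<rfloor>" if "N <= l" for l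
 proof -
  have "\<bar>real_of_int \<lfloor>?y l\<rfloor> - real_of_int \<lfloor>?y N\<rfloor>\<bar> < 1"
  proof -
   have "\<bar>F - F'\<bar> < 1" if "\<bar>a - Y\<bar> < 1 / 4" "\<bar>b - Y\<bar> < 1 / 4" "F <= a \<and> a <= F + 1 / 2" "F' <= b \<and> b <= F' + 1 / 2"
    for F F' a b Y :: real
    using that by linarith
   from this[OF N[OF that] N[OF order_refl] fr fr] show ?thesis .
  qed
  then show ?thesis by linarith
 qed
 have "real_of_int \<lfloor>?y N\<rfloor> <= ?Y"
  by (rule LIMSEQ_le_const[OF ly]) (use fr F in metis)
 moreover have "?Y <= real_of_int \<lfloor>?y N\<rfloor> + 1 / 2"
  by (rule LIMSEQ_le_const2[OF ly]) (use fr F in metis)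
 ultimately have Y: "\<lfloor>?Y\<rfloor> = \<lfloor>?y N\<rfloor>" by (intro floor_unique) linarith+
 show ?thesis unfolding Y eventually_sequentially using F by blast
qed

text \<open>Every digit is eventually constant. Tannery's theorem is used twice: for the binary
  series of each coordinate, and for the series over coordinates in the norm.\<close>

lemma decode_tendsto:
 assumes g: "!!l. cantor (r l)" and lim: "r \<longlonglongrightarrow> R"
 shows "(%l. decode c (r l)) \<longlonglongrightarrow> decode c R"
proof -
 obtain N where N: "!!l. N <= l ==> \<lfloor>r l\<rfloor> = \<lfloor>R\<rfloor>"
  using cantor_limit[OF g lim, of 0] unfolding eventually_sequentially power_0 mult_1 by blast
 define r' where "r' l = r (l + N)" for l
 have g': "cantor (r' l)" for l by (simp add: r'_def g)
 have lim': "r' \<longlonglongrightarrow> R" unfolding r'_def by (rule LIMSEQ_ignore_initial_segment[OF lim])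
 have fl: "\<lfloor>r' l\<rfloor> = \<lfloor>R\<rfloor>" for l by (simp add: r'_def N)
 have dg: "(%l. real_of_int (digit n (r' l))) \<longlonglongrightarrow> real_of_int (digit n R)" for n
 proof (rule tendsto_eventually)
  show "\<forall>\<^sub>F l in sequentially. real_of_int (digit n (r' l)) = real_of_int (digit n R)"
   using cantor_limit[OF g' lim', of n] cantor_limit[OF g' lim', of "Suc n"]
   by eventually_elim (simp only: digit_def)
 qed
 have bt: "(%l. bits i (r' l)) \<longlonglongrightarrow> bits i R" for i
  unfolding bits_def
 proof (rule tannerys_theorem[OF _ _ sums_summable[OF sums_halves[of 2]], THEN conjunct2, THEN conjunct2])
  show "(%n. real_of_int (digit (prod_encode (i, k)) (r' n)) / 2 ^ Suc k) \<longlonglongrightarrow> real_of_int (digit (prod_encode (i, k)) R) / 2 ^ Suc k" for k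
   by (intro tendsto_divide dg tendsto_const) simp
  show "\<forall>\<^sub>F (k, n) in at_top \<times>\<^sub>F sequentially. norm (real_of_int (digit (prod_encode (i, k)) (r' n)) / 2 ^ Suc k) <= 2 / 2 ^ Suc k"
   by (rule always_eventually) (simp only: split_paired_All prod.case real_norm_def bits_bound, simp)
 qed simp
 let ?D = "%l. decode c (r' l) - decode c R"
 let ?k = "real_of_int \<lfloor>R\<rfloor>"
 have cD: "coef (?D l) (Suc i) = ?k / real (Suc i) * (2 * (bits (Suc i) (r' l) - bits (Suc i) R))" for l i
  by (simp add: minus_H.rep_eq coef_decode fl right_diff_distrib)
 have "(%l. \<Sum>i. (coef (?D l) (Suc i))^2 / freq (Suc i)) \<longlonglongrightarrow> (\<Sum>i. 0)"
 proof (rule tannerys_theorem[OF _ _ summable_inverse_squares[of "?k^2 * 16"], THEN conjunct2, THEN conjunct2])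
  fix i
  have "(%l. (?k / real (Suc i) * (2 * (bits (Suc i) (r' l) - bits (Suc i) R)))^2 / freq (Suc i))
    \<longlonglongrightarrow> (?k / real (Suc i) * (2 * (bits (Suc i) R - bits (Suc i) R)))^2 / freq (Suc i)"
   using freq_ge_1[of "Suc i"] by (intro tendsto_divide tendsto_power tendsto_mult tendsto_diff bt tendsto_const) auto
  then show "(%l. (coef (?D l) (Suc i))^2 / freq (Suc i)) \<longlonglongrightarrow> 0" unfolding cD by simp
 next
  have le: "norm ((coef (?D l) (Suc i))^2 / freq (Suc i)) <= ?k^2 * 16 / (real (Suc i))^2" for i l
  proof -
   have "(2 * (bits (Suc i) (r' l) - bits (Suc i) R))^2 <= 4^2"
    using bits_le[of "Suc i" "r' l"] bits_le[of "Suc i" R] by (intro power2_le_iff_abs_le[THEN iffD2]) auto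
   then have "?k^2 / (real (Suc i))^2 * (2 * (bits (Suc i) (r' l) - bits (Suc i) R))^2 <= ?k^2 / (real (Suc i))^2 * 4^2"
    by (intro mult_left_mono) auto
   then have "(coef (?D l) (Suc i))^2 <= ?k^2 * 16 / (real (Suc i))^2"
    unfolding cD power_mult_distrib[of "?k / real (Suc i)"] power_divide by simp
   moreover have "(coef (?D l) (Suc i))^2 / freq (Suc i) <= (coef (?D l) (Suc i))^2 / 1"
    using freq_ge_1[of "Suc i"] by (intro divide_left_mono) auto
   moreover have "0 <= (coef (?D l) (Suc i))^2 / freq (Suc i)" by (simp add: freq_def)
   ultimately show ?thesis unfolding real_norm_def by linarith
  qed
  show "\<forall>\<^sub>F (i, l) in at_top \<times>\<^sub>F sequentially. norm ((coef (?D l) (Suc i))^2 / freq (Suc i)) <= ?k^2 * 16 / (real (Suc i))^2"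
   by (rule always_eventually) (simp only: split_paired_All prod.case le, simp)
 qed simp
 moreover have "coef (?D l) 0 = 0" for l by (simp add: minus_H.rep_eq coef_decode)
 ultimately have "(%l. (norm (?D l))^2) \<longlonglongrightarrow> 0" unfolding norm_H_sq by simp
 from tendsto_real_sqrt[OF this] have "(%l. norm (?D l)) \<longlonglongrightarrow> 0" by simp
 then have "(%l. decode c (r' l)) \<longlonglongrightarrow> decode c R" by (rule Lim_null[THEN iffD2, OF tendsto_norm_zero_cancel])
 then show ?thesis unfolding r'_def by (rule LIMSEQ_offset)
qed

text \<open>Meaningful if i |x_i| is bounded in i, which an H^1 bound guarantees; only on such x
  will the encoding be inverted.\<close>

definition level :: "H => nat" where
 "level x = (LEAST k. \<forall>i\<ge>1. real i * \<bar>coef x i\<bar> < real k)"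

definition scaled :: "nat => H => real" where
 "scaled i x = (1 + real i * coef x i / real (level x)) / 2"

definition bit :: "nat => H => int" where
 "bit n x = \<lfloor>2 ^ Suc (snd (prod_decode n)) * scaled (fst (prod_decode n)) x\<rfloor> mod 2"

definition encode :: "H => real" where
 "encode x = real (level x) + (\<Sum>n. real_of_int (bit n x) / 3 ^ Suc n)"

lemma measurable_level [measurable]: "level \<in> borel \<rightarrow>\<^sub>M count_space UNIV"
 unfolding level_def[abs_def] by measurable

lemma measurable_encode [measurable]: "encode \<in> borel_measurable borel"
proof -
 have [measurable]: "(%x. real (level x)) \<in> borel_measurable borel"
  by (rule measurable_compose[OF measurable_level]) simp
 have [measurable]: "scaled i \<in> borel_measurable borel" for i unfolding scaled_def[abs_def] by measurable
 have [measurable]: "(%x. \<lfloor>2 ^ l * scaled i x\<rfloor>) \<in> borel \<rightarrow>\<^sub>M count_space UNIV" for i l by measurable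
 have [measurable]: "(%x. real_of_int (bit n x)) \<in> borel_measurable borel" for n
  unfolding bit_def by measurable
 show ?thesis unfolding encode_def[abs_def] by measurable
qed

text \<open>These tails will be the fractional parts of 3^n times the code; the absence of the digit
  2 keeps them at most 1/2, and the recursion recovers the digits.\<close>

lemma ternary_tail:
 fixes d :: "nat => int"
 assumes d: "!!n. d n \<in> {0, 1}"
 defines "t \<equiv> %n. \<Sum>j. real_of_int (d (n + j)) / 3 ^ Suc j"
 shows "0 <= t n" "t n <= 1 / 2" "3 * t n = real_of_int (d n) + t (Suc n)"
proof -
 have s3: "(%j. 1 / 3 ^ Suc j) sums (1 / 2 :: real)"
 proof -
  have "(%j. (1 / 3 :: real) ^ j) sums (1 / (1 - 1 / 3))" by (rule geometric_sums) simp
  from sums_mult[OF this, of "1 / 3"] show ?thesis by (simp add: power_divide)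
 qed
 have bd: "0 <= real_of_int (d n) / 3 ^ Suc j" "real_of_int (d n) / 3 ^ Suc j <= 1 / 3 ^ Suc j" for n j
  using d[of n] by (auto simp: divide_right_mono)
 have S: "summable (%j. real_of_int (d (n + j)) / 3 ^ Suc j)" for n
 proof (rule summable_comparison_test'[OF sums_summable[OF s3]])
  show "norm (real_of_int (d (n + j)) / 3 ^ Suc j) <= 1 / 3 ^ Suc j" for j
   unfolding real_norm_def using bd[of "n + j" j] by (simp only: abs_of_nonneg)
 qed
 show "0 <= t n" unfolding t_def by (rule suminf_nonneg[OF S bd(1)])
 have "t n <= (\<Sum>j. 1 / 3 ^ Suc j)" unfolding t_def by (rule suminf_le[OF bd(2) S sums_summable[OF s3]])
 then show "t n <= 1 / 2" by (simp only: sums_unique[OF s3, symmetric])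
 have "t n = real_of_int (d (n + 0)) / 3 ^ Suc 0 + (\<Sum>j. real_of_int (d (n + Suc j)) / 3 ^ Suc (Suc j))"
  unfolding t_def using suminf_split_head[OF S[of n]] by simp
 also have "(\<Sum>j. real_of_int (d (n + Suc j)) / 3 ^ Suc (Suc j)) = (\<Sum>j. real_of_int (d (Suc n + j)) / 3 ^ Suc j / 3)"
  by (simp add: mult.commute)
 also have "\<dots> = t (Suc n) / 3" unfolding t_def by (rule suminf_divide[OF S])
 finally show "3 * t n = real_of_int (d n) + t (Suc n)" by simp
qed

lemma binary_expansion:
 assumes b: "0 <= b" "b < 1"
 shows "(%l. real_of_int (\<lfloor>2 ^ Suc l * b\<rfloor> mod 2) / 2 ^ Suc l) sums b"
proof -
 have part: "(\<Sum>l<n. real_of_int (\<lfloor>2 ^ Suc l * b\<rfloor> mod 2) / 2 ^ Suc l) = real_of_int \<lfloor>2 ^ n * b\<rfloor> / 2 ^ n" for n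
 proof (induction n)
  case 0
  show ?case using b by (simp add: floor_eq_iff)
 next
  case (Suc n)
  let ?y = "2 ^ n * b"
  have "2 * \<lfloor>?y\<rfloor> <= \<lfloor>2 * ?y\<rfloor>" unfolding le_floor_iff using of_int_floor_le[of ?y] by simp
  moreover have "\<lfloor>2 * ?y\<rfloor> < 2 * \<lfloor>?y\<rfloor> + 2"
  proof -
   have "?y < real_of_int \<lfloor>?y\<rfloor> + 1" by linarith
   then show ?thesis unfolding floor_less_iff of_int_add of_int_mult of_int_numeral by linarith
  qed
  ultimately have "\<lfloor>2 * ?y\<rfloor> = 2 * \<lfloor>?y\<rfloor> + \<lfloor>2 * ?y\<rfloor> mod 2" by presburger
  then have e: "\<lfloor>2 ^ Suc n * b\<rfloor> = 2 * \<lfloor>?y\<rfloor> + \<lfloor>2 ^ Suc n * b\<rfloor> mod 2" by (simp add: mult.assoc)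
  have "real_of_int \<lfloor>2 ^ Suc n * b\<rfloor> / 2 ^ Suc n
   = (2 * real_of_int \<lfloor>?y\<rfloor> + real_of_int (\<lfloor>2 ^ Suc n * b\<rfloor> mod 2)) / 2 ^ Suc n"
   by (subst e) (simp only: of_int_add of_int_mult of_int_numeral)
  also have "\<dots> = real_of_int \<lfloor>?y\<rfloor> / 2 ^ n + real_of_int (\<lfloor>2 ^ Suc n * b\<rfloor> mod 2) / 2 ^ Suc n"
   by (simp add: add_divide_distrib)
  finally show ?case unfolding sum.lessThan_Suc Suc.IH ..
 qed
 have "(%n. real_of_int \<lfloor>2 ^ n * b\<rfloor> / 2 ^ n) \<longlonglongrightarrow> b"
 proof (rule real_tendsto_sandwich[where f="%n. b - (1 / 2) ^ n" and h="%_. b"])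
  show "\<forall>\<^sub>F n in sequentially. real_of_int \<lfloor>2 ^ n * b\<rfloor> / 2 ^ n <= b"
   by (rule always_eventually) (use of_int_floor_le in \<open>simp add: pos_divide_le_eq mult.commute\<close>)
  have "b - (1 / 2) ^ n <= real_of_int \<lfloor>2 ^ n * b\<rfloor> / 2 ^ n" for n
  proof -
   have "2 ^ n * b - 1 <= real_of_int \<lfloor>2 ^ n * b\<rfloor>" using floor_correct[of "2 ^ n * b"] by linarith
   then have "(2 ^ n * b - 1) / 2 ^ n <= real_of_int \<lfloor>2 ^ n * b\<rfloor> / 2 ^ n" by (rule divide_right_mono) simp
   then show ?thesis by (simp add: diff_divide_distrib power_divide)
  qed
  then show "\<forall>\<^sub>F n in sequentially. b - (1 / 2) ^ n <= real_of_int \<lfloor>2 ^ n * b\<rfloor> / 2 ^ n" by simp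
  have "(%n. b - (1 / 2) ^ n) \<longlonglongrightarrow> b - 0" by (intro tendsto_diff tendsto_const LIMSEQ_realpow_zero) auto
  then show "(%n. b - (1 / 2) ^ n) \<longlonglongrightarrow> b" by simp
 qed simp
 then show ?thesis unfolding sums_def part .
qed

text \<open>Multiplying the code by 3^n separates an integer from a tail below 1, so the digits of
  the code are the prescribed bits, and the binary expansions return the coordinates.\<close>

lemma decode_encode:
 assumes x: "x \<in> Hc c" and k: "!!i. 1 <= i ==> real i * \<bar>coef x i\<bar> < real k"
 shows "decode c (encode x) = x" "cantor (encode x)" "0 <= encode x" "encode x <= real k + 1 / 2"
proof -
 let ?L = "real (level x)" and ?d = "%n. bit n x"
 have "\<forall>i\<ge>1. real i * \<bar>coef x i\<bar> < real (level x)" unfolding level_def by (rule LeastI[of _ k]) (use k in blast)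
 then have lev: "real i * \<bar>coef x i\<bar> < ?L" if "1 <= i" for i using that by blast
 have levk: "level x <= k" unfolding level_def by (rule Least_le) (use k in blast)
 \<comment> \<open>The strict inequality in \<open>level\<close> makes it positive even when all
   coordinates vanish, and it keeps \<open>scaled\<close> strictly below 1.\<close>
 have L0: "0 < ?L" using lev[of 1] abs_ge_zero[of "coef x 1"] by linarith
 have d01: "?d n \<in> {0, 1}" for n 
 proof -
  have "a mod 2 = 0 \<or> a mod 2 = 1" for a :: int by presburger
  then show ?thesis unfolding bit_def by blast
 qed
 define t where "t n = (\<Sum>j. real_of_int (?d (n + j)) / 3 ^ Suc j)" for n
 note tt = ternary_tail[of ?d, OF d01, folded t_def]
 have enc: "encode x = ?L + t 0" by (simp add: encode_def t_def)
 show "0 <= encode x" "encode x <= real k + 1 / 2" unfolding enc using tt(1,2)[of 0] levk by auto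
 have fl: "\<lfloor>A + t n\<rfloor> = \<lfloor>A\<rfloor>" if "A \<in> \<int>" for A n
  using that tt(1,2)[of n] by (auto elim!: Ints_cases intro!: floor_unique)
 have ex: "\<exists>A. 3 ^ n * encode x = real_of_int A + t n" for n
 proof (induction n)
  case 0
  show ?case unfolding enc by (intro exI[of _ "int (level x)"]) simp
 next
  case (Suc n)
  then obtain A where "3 ^ n * encode x = real_of_int A + t n" by blast
  then have "3 ^ Suc n * encode x = real_of_int (3 * A + ?d n) + t (Suc n)" using tt(3)[of n] by simp
  then show ?case by blast
 qed
 have F: "3 ^ n * encode x = real_of_int \<lfloor>3 ^ n * encode x\<rfloor> + t n" for n
  using ex[of n] fl by (metis Ints_of_int floor_of_int)
 show "cantor (encode x)" unfolding cantor_def using F tt(2) by (metis add_diff_cancel_left')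
 have dig: "digit n (encode x) = ?d n" for n
 proof -
  have "3 ^ Suc n * encode x = 3 * (3 ^ n * encode x)" by simp
  then have "real_of_int \<lfloor>3 ^ Suc n * encode x\<rfloor> + t (Suc n) = 3 * (real_of_int \<lfloor>3 ^ n * encode x\<rfloor> + t n)"
   using F[of n] F[of "Suc n"] by metis
  then have "real_of_int (digit n (encode x)) = real_of_int (?d n)" using tt(3)[of n] by (simp add: digit_def)
  then show ?thesis by simp
 qed
 have fl0: "\<lfloor>encode x\<rfloor> = int (level x)" unfolding enc by (subst fl) auto
 have bits: "bits i (encode x) = scaled i x" if i: "1 <= i" for i
 proof -
  have "\<bar>real i * coef x i / ?L\<bar> < 1" using lev[OF i] L0 by (simp add: abs_mult)
  moreover have "0 <= (1 + a) / 2 \<and> (1 + a) / 2 < 1" if "\<bar>a\<bar> < 1" for a :: real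
   using that by (auto simp: abs_less_iff)
  ultimately have "0 <= scaled i x" "scaled i x < 1" unfolding scaled_def by blast+
  from sums_unique[OF binary_expansion[OF this]] show ?thesis
   unfolding bits_def dig bit_def by simp
 qed
 show "decode c (encode x) = x"
 proof (rule H_eqI)
  fix i
  show "coef (decode c (encode x)) i = coef x i"
  proof (cases "i = 0")
   case True
   then show ?thesis using x by (simp add: coef_decode Hc_def)
  next
   case False
   then have "coef (decode c (encode x)) i = ?L / real i * (2 * scaled i x - 1)"
    by (simp add: coef_decode fl0 bits)
   also have "\<dots> = coef x i" using False L0 by (simp add: scaled_def field_simps)
   finally show ?thesis .
  qed
 qed
qed

section \<open>Existence of an invariant measure\<close>

text \<open>The Krylov-Bogoliubov method for the chain with kernel \<kappa> 1. The offset s J may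
  change with J, since telescoping an average over J + 1 consecutive times leaves two boundary terms
  whatever the offset is.\<close>

lemma exists_invariant:
 fixes \<kappa> :: "real => H => H measure"
 assumes hs: "harnack_semigroup (Hc c) \<kappa> C" and x0: "x0 \<in> Hc c" and s0: "!!J. 0 <= s J" and D: "0 <= D"
  and en: "!!J q. (\<Sum>j\<le>J. \<integral>x. \<psi> q x \<partial>\<kappa> (s J + real j) x0) <= real (Suc J) * D"
 shows "\<exists>\<nu>. harnack_semigroup.invariant (Hc c) \<kappa> \<nu> 1"
proof -
 interpret harnack_semigroup "Hc c" \<kappa> C by (rule hs)
 let ?S = "bor (Hc c)"
 have id: "(%x. x) \<in> ?S \<rightarrow>\<^sub>M borel" by (rule measurable_restrict_space1) simp
 \<comment> \<open>The average of J + 1 laws, written as a mixture over a uniformly distributed time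
   index.\<close>
 define \<mu> where "\<mu> J = measure_pmf (pmf_of_set {..J}) \<bind> (%j. \<kappa> (s J + real j) x0)" for J :: nat
 have kJ: "\<kappa> (s J + real j) x0 \<in> space (prob_algebra ?S)" for J j
  using kernel_at(1,2)[of "s J + real j" x0] s0[of J] x0 by (simp add: space_prob_algebra)
 have K: "(%j. \<kappa> (s J + real j) x0) \<in> count_space UNIV \<rightarrow>\<^sub>M prob_algebra ?S" for J
  using kJ by (simp add: measurable_count_space_eq1)
 have pm: "measure_pmf p \<in> space (prob_algebra (count_space UNIV))" for p :: "nat pmf"
  by (simp add: space_prob_algebra prob_space_measure_pmf)
 have p\<mu>: "prob_space (\<mu> J)" and s\<mu>: "sets (\<mu> J) = sets ?S" for J
  unfolding \<mu>_def using prob_space_bind'[OF pm K] sets_bind'[OF pm K] by auto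
 have sp\<mu>: "space (\<mu> J) = Hc c" for J using sets_eq_imp_space_eq[OF s\<mu>] by (simp add: space_bor)
 have i\<mu>: "(\<integral>x. f x \<partial>\<mu> J) = (\<Sum>j\<le>J. \<integral>x. f x \<partial>\<kappa> (s J + real j) x0) / real (Suc J)"
  if f: "f \<in> borel_measurable ?S" "!!x. \<bar>f x\<bar> <= B" for f :: "H => real" and B J
 proof -
  have "(\<integral>x. f x \<partial>\<mu> J) = (\<integral>j. (\<integral>x. f x \<partial>\<kappa> (s J + real j) x0) \<partial>measure_pmf (pmf_of_set {..J}))"
   unfolding \<mu>_def
  proof (rule integral_bind[OF f, where B'=1])
   show "(%j. \<kappa> (s J + real j) x0) \<in> measure_pmf (pmf_of_set {..J}) \<rightarrow>\<^sub>M subprob_algebra ?S"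
    using measurable_prob_algebraD[OF K] by simp
   show "finite_measure (measure_pmf (pmf_of_set {..J}))" by unfold_locales
   show "AE j in measure_pmf (pmf_of_set {..J}). emeasure (\<kappa> (s J + real j) x0) (space (\<kappa> (s J + real j) x0)) <= ennreal 1"
    using kJ by (intro AE_I2) (auto simp: space_prob_algebra prob_space.emeasure_space_1)
  qed
  also have "\<dots> = (\<Sum>j\<le>J. \<integral>x. f x \<partial>\<kappa> (s J + real j) x0) / real (Suc J)"
   by (subst integral_pmf_of_set) auto
  finally show ?thesis .
 qed
 have mS: "f \<in> borel_measurable (\<mu> J)" if "f \<in> borel_measurable ?S" for f :: "H => real" and J
  using that by (simp add: measurable_cong_sets[OF s\<mu> refl])
 have mB: "f \<in> borel_measurable ?S" if "f \<in> borel_measurable borel" for f :: "H => real"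
  using that by (rule measurable_restrict_space1)
 \<comment> \<open>The consequence of an H^1 bound that the encoding needs; the codes of A k lie in
   [0, k + 1/2].\<close>
 define A where "A k = {x \<in> Hc c. \<forall>i\<ge>1. real i * \<bar>coef x i\<bar> < real k}" for k :: nat
 have A: "A k \<in> sets ?S" for k
 proof -
  have "{x \<in> space borel. \<forall>i\<ge>1. real i * \<bar>coef x i\<bar> < real k} \<in> sets borel" by measurable
  then show ?thesis unfolding sets_restrict_space by (auto simp: A_def image_iff intro!: bexI[of _ "{x. \<forall>i\<ge>1. real i * \<bar>coef x i\<bar> < real k}"])
 qed
 \<comment> \<open>Markov's inequality for \<psi> q at level k^2, uniform in q, followed by q to
   infinity; the H^1 bound k^2 then gives i |x_i| < k.\<close>
 have tail: "1 - D / (real k)^2 <= measure (\<mu> J) (A k)" if k: "1 <= k" for J k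
 proof -
  interpret m: prob_space "\<mu> J" by (rule p\<mu>)
  let ?R = "(real k)^2"
  have R: "0 < ?R" using k by simp
  define E where "E q = {x \<in> space (\<mu> J). ?R <= \<psi> q x}" for q
  have m\<psi>: "\<psi> q \<in> borel_measurable (\<mu> J)" for q by (intro mS mB measurable_\<psi>)
  have E: "E q \<in> sets (\<mu> J)" for q unfolding E_def using m\<psi>[of q] by measurable
  have "measure (\<mu> J) (E q) <= D / ?R" for q
  proof -
   have "(\<integral>x. \<psi> q x \<partial>\<mu> J) <= D"
    using en[where J=J and q=q] i\<mu>[OF mB[OF measurable_\<psi>], of q "real q" J] \<psi>_bounds[of q]
    by (simp add: pos_divide_le_eq mult.commute del: of_nat_Suc)
   moreover have "measure (\<mu> J) (E q) <= (\<integral>x. \<psi> q x \<partial>\<mu> J) / ?R"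
    unfolding E_def
    by (rule integral_Markov_inequality_measure[where A="{}"])
     (use integral_bounds_prob(1)[OF p\<mu> m\<psi>, of 0 q "real q"] \<psi>_bounds R in auto)
   ultimately show ?thesis using divide_right_mono[of "\<integral>x. \<psi> q x \<partial>\<mu> J" D ?R] R by linarith
  qed
  moreover have "(%q. measure (\<mu> J) (E q)) \<longlonglongrightarrow> measure (\<mu> J) (\<Union>q. E q)"
  proof (rule m.finite_Lim_measure_incseq)
   show "incseq E" unfolding incseq_def E_def using \<psi>_mono by (auto intro: order_trans)
  qed (use E in auto)
  ultimately have UE: "measure (\<mu> J) (\<Union>q. E q) <= D / ?R" by (intro LIMSEQ_le_const2) auto
  have "Hc c - (\<Union>q. E q) \<subseteq> A k"
  proof
   fix x assume x: "x \<in> Hc c - (\<Union>q. E q)"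
   have "real i * \<bar>coef x i\<bar> < real k" if i: "1 <= i" for i
   proof -
    obtain q0 :: nat where q0: "?R <= real q0" using real_arch_simple by blast
    \<comment> \<open>Large enough that the truncation value exceeds k^2 and the mode i is
      included.\<close>
    define q where "q = max q0 i"
    have "\<psi> q x < ?R" using x by (auto simp: E_def sp\<mu> not_le)
    moreover have "?R <= real q" using q0 by (simp add: q_def)
    ultimately have "(\<Sum>i=1..q. freq i * (coef x i)^2) < ?R" unfolding \<psi>_def by linarith
    moreover have "freq i * (coef x i)^2 <= (\<Sum>i=1..q. freq i * (coef x i)^2)"
     by (rule member_le_sum) (use i in \<open>auto simp: q_def freq_def\<close>)
    moreover have "(real i)^2 <= freq i"
     unfolding freq_def using mult_left_mono[of 1 pi "real i"] pi_gt3 by (intro power_mono) auto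
    ultimately have "(real i)^2 * (coef x i)^2 < ?R"
     using mult_right_mono[of "(real i)^2" "freq i" "(coef x i)^2"] by simp
    then have "(real i * \<bar>coef x i\<bar>)^2 < (real k)^2" by (simp add: power_mult_distrib)
    then show ?thesis by (rule power_less_imp_less_base) simp
   qed
   then show "x \<in> A k" using x by (simp add: A_def)
  qed
  then have "measure (\<mu> J) (space (\<mu> J) - (\<Union>q. E q)) <= measure (\<mu> J) (A k)"
   using A s\<mu> by (intro m.finite_measure_mono) (auto simp: sp\<mu>)
  moreover have "measure (\<mu> J) (space (\<mu> J) - (\<Union>q. E q)) = 1 - measure (\<mu> J) (\<Union>q. E q)"
   using E by (intro m.prob_compl) auto
  ultimately show ?thesis using UE by linarith
 qed
 have small: "\<exists>k\<ge>1. D / (real k)^2 < e" if e: "0 < e" for e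
 proof -
  have "(%k. D * inverse (real (Suc k) ^ 2)) \<longlonglongrightarrow> D * 0"
   by (intro tendsto_mult_left LIMSEQ_Suc[OF tendsto_inverse_0_at_top[OF filterlim_pow_at_top[OF _ filterlim_real_sequentially]]]) simp
  then have "(%k. D * inverse (real (Suc k) ^ 2)) \<longlonglongrightarrow> 0" by simp
  from order_tendstoD(2)[OF this e] obtain k where "D * inverse (real (Suc k) ^ 2) < e"
   unfolding eventually_sequentially by blast
  then show ?thesis by (intro exI[of _ "Suc k"]) (simp add: divide_inverse del: of_nat_Suc)
 qed
 have dec: "decode c (encode x) = x" "cantor (encode x)" "0 <= encode x" "encode x <= real k + 1 / 2" if "x \<in> A k" for x k
  using that decode_encode[of x c k] by (auto simp: A_def)
 have aeA: "AE x in \<mu> J. \<exists>k. x \<in> A k" for J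
 proof -
  interpret m: prob_space "\<mu> J" by (rule p\<mu>)
  have "1 <= measure (\<mu> J) (\<Union>k. A k) + e" if e: "0 < e" for e
  proof -
   obtain k where k: "1 <= k" "D / (real k)^2 < e" using small[OF e] by blast
   have "measure (\<mu> J) (A k) <= measure (\<mu> J) (\<Union>k. A k)"
    using A s\<mu> by (intro m.finite_measure_mono) auto
   then show ?thesis using tail[OF k(1), of J] k(2) by linarith
  qed
  then have "1 <= measure (\<mu> J) (\<Union>k. A k)" by (rule field_le_epsilon)
  then have "measure (\<mu> J) (\<Union>k. A k) = 1" using m.prob_le_1 by (intro antisym)
  then have "AE x in \<mu> J. x \<in> (\<Union>k. A k)" using A s\<mu> by (intro m.AE_prob_1) 
  then show ?thesis by simp
 qed
 have mEnc: "encode \<in> borel_measurable (\<mu> J)" for J by (intro mS mB measurable_encode)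
 define \<rho> where "\<rho> J = distr (\<mu> J) borel encode" for J
 have rd: "real_distribution (\<rho> J)" for J
  unfolding \<rho>_def using p\<mu> mEnc by (simp add: real_distribution_def real_distribution_axioms_def prob_space.prob_space_distr)
 have "tight \<rho>"
  unfolding tight_def
 proof (intro conjI allI impI rd)
  fix e :: real assume e: "0 < e"
  obtain k where k: "1 <= k" "D / (real k)^2 < e" using small[OF e] by blast
  have "1 - e < measure (\<rho> J) {-1<..real k + 1}" for J
  proof -
   interpret m: prob_space "\<mu> J" by (rule p\<mu>)
   have "A k \<subseteq> encode -` {-1<..real k + 1} \<inter> space (\<mu> J)"
   proof
    fix x assume x: "x \<in> A k"
    show "x \<in> encode -` {-1<..real k + 1} \<inter> space (\<mu> J)"
     using dec(3,4)[OF x] x by (simp add: sp\<mu> A_def)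
   qed
   then have "measure (\<mu> J) (A k) <= measure (\<rho> J) {-1<..real k + 1}"
    unfolding \<rho>_def using mEnc by (subst measure_distr) (auto intro!: m.finite_measure_mono measurable_sets)
   then show ?thesis using tail[OF k(1), of J] k(2) by linarith
  qed
  then show "\<exists>a b. a < b \<and> (\<forall>n. 1 - e < measure (\<rho> n) {a<..b})"
   by (intro exI[of _ "-1"] exI[of _ "real k + 1"]) auto
 qed
 from tight_imp_convergent_subsubsequence[OF this strict_mono_id]
 obtain r Q where r: "strict_mono (r :: nat => nat)" and Q: "real_distribution Q" and wc: "weak_conv_m (%l. \<rho> (r l)) Q"
  by (auto simp: comp_def)
 \<comment> \<open>The codes converge almost surely on a common space; since they satisfy
   \<open>cantor\<close>, their decodings converge in H.\<close>
 from Skorohod[OF rd Q wc] obtain \<Omega> :: "real measure" and Yl Y where \<Omega>: "prob_space \<Omega>"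
  and sk: "\<forall>l. Yl l \<in> borel_measurable \<Omega>" "\<forall>l. distr \<Omega> borel (Yl l) = \<rho> (r l)"
  "Y \<in> \<Omega> \<rightarrow>\<^sub>M lborel" "\<forall>om\<in>space \<Omega>. (%l. Yl l om) \<longlonglongrightarrow> Y om"
  by blast
 then have Yl: "!!l. Yl l \<in> borel_measurable \<Omega>" "!!l. distr \<Omega> borel (Yl l) = \<rho> (r l)"
  and Y: "Y \<in> borel_measurable \<Omega>" and lim: "!!om. om \<in> space \<Omega> ==> (%l. Yl l om) \<longlonglongrightarrow> Y om"
  by auto
 interpret O: prob_space \<Omega> by fact
 have mD: "decode c \<in> borel \<rightarrow>\<^sub>M ?S" by (rule measurable_restrict_space2) (auto simp: decode_Hc)
 have Zl: "(%om. decode c (Yl l om)) \<in> \<Omega> \<rightarrow>\<^sub>M ?S" for l by (rule measurable_compose[OF Yl(1) mD])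
 have Z: "(%om. decode c (Y om)) \<in> \<Omega> \<rightarrow>\<^sub>M ?S" by (rule measurable_compose[OF Y mD])
 have law: "(\<integral>om. f (decode c (Yl l om)) \<partial>\<Omega>) = (\<integral>x. f x \<partial>\<mu> (r l))" if f: "f \<in> borel_measurable ?S" for f :: "H => real" and l
 proof -
  have mf: "(%y. f (decode c y)) \<in> borel_measurable borel" by (rule measurable_compose[OF mD f])
  have "(\<integral>om. f (decode c (Yl l om)) \<partial>\<Omega>) = (\<integral>y. f (decode c y) \<partial>\<rho> (r l))"
   unfolding Yl(2)[symmetric] by (rule integral_distr[OF Yl(1) mf, symmetric])
  also have "\<dots> = (\<integral>x. f (decode c (encode x)) \<partial>\<mu> (r l))"
   unfolding \<rho>_def by (rule integral_distr[OF mEnc mf])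
  also have "\<dots> = (\<integral>x. f x \<partial>\<mu> (r l))"
  proof (rule integral_cong_AE)
   show "(%x. f (decode c (encode x))) \<in> borel_measurable (\<mu> (r l))" by (rule measurable_compose[OF mEnc mf])
   show "AE x in \<mu> (r l). f (decode c (encode x)) = f x"
    using aeA[of "r l"] by eventually_elim (auto simp: dec)
  qed (rule mS[OF f])
  finally show ?thesis .
 qed
 have good: "AE om in \<Omega>. \<forall>l. cantor (Yl l om)"
  unfolding AE_all_countable
 proof
  fix l
  have [measurable]: "Measurable.pred borel cantor" unfolding cantor_def[abs_def] by measurable
  have "AE x in \<mu> (r l). cantor (encode x)" using aeA[of "r l"] by eventually_elim (auto simp: dec)
  then have "AE y in \<rho> (r l). cantor y" unfolding \<rho>_def by (subst AE_distr_iff[OF mEnc]) auto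
  then show "AE om in \<Omega>. cantor (Yl l om)"
   unfolding Yl(2)[symmetric] by (subst (asm) AE_distr_iff[OF Yl(1)]) auto
 qed
 have Zlim: "AE om in \<Omega>. (%l. decode c (Yl l om)) \<longlonglongrightarrow> decode c (Y om)"
  using good AE_space by eventually_elim (intro decode_tendsto lim, auto)
 define \<nu> where "\<nu> = distr \<Omega> ?S (%om. decode c (Y om))"
 have \<nu>: "prob_space \<nu>" "sets \<nu> = sets ?S"
  unfolding \<nu>_def using O.prob_space_distr[OF Z] by auto
 have lim\<nu>: "(%l. \<integral>x. f x \<partial>\<mu> (r l)) \<longlonglongrightarrow> (\<integral>x. f x \<partial>\<nu>)"
  if f: "f \<in> borel_measurable ?S" "!!x. x \<in> Hc c ==> \<bar>f x\<bar> <= 1"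
   and c: "!!x l. (!!n. x n \<in> Hc c) ==> l \<in> Hc c ==> x \<longlonglongrightarrow> l ==> (%n. f (x n)) \<longlonglongrightarrow> f l" for f :: "H => real"
 proof -
  have "(%l. \<integral>om. f (decode c (Yl l om)) \<partial>\<Omega>) \<longlonglongrightarrow> (\<integral>om. f (decode c (Y om)) \<partial>\<Omega>)"
  proof (rule integral_dominated_convergence[where w="%_. 1"])
   show "AE om in \<Omega>. (%l. f (decode c (Yl l om))) \<longlonglongrightarrow> f (decode c (Y om))"
    using Zlim by eventually_elim (intro c decode_Hc)
  qed (auto intro: measurable_compose[OF Zl f(1)] measurable_compose[OF Z f(1)] simp: f(2) decode_Hc)
  then show ?thesis unfolding law[OF f(1)] \<nu>_def integral_distr[OF Z f(1)] .
 qed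
 have "\<nu> \<bind> \<kappa> 1 = \<nu>"
 proof (rule lip_determines[OF closed_S bind_kernel(1)[OF \<nu>] \<nu>(1) bind_kernel(2)[OF \<nu>] \<nu>(2)])
  fix g :: "H => real" assume g: "lip g" "!!x. 0 <= g x \<and> g x <= 1"
  have mg: "g \<in> borel_measurable ?S" by (rule lip_measurable_bor[OF g(1)])
  have g1: "\<bar>g x\<bar> <= 1" for x using g(2)[of x] by simp
  define Pg where "Pg x = (if x \<in> Hc c then \<integral>y. g y \<partial>\<kappa> 1 x else 0)" for x
  have mPg: "Pg \<in> borel_measurable ?S"
  proof -
   have "(%x. \<integral>y. g y \<partial>\<kappa> 1 x) \<in> borel_measurable ?S" by (rule measurable_kernel_integral[OF kernel mg]) simp
   then show ?thesis by (rule measurable_cong[THEN iffD1, rotated]) (simp add: Pg_def space_bor)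
  qed
  have P01: "0 <= (\<integral>y. g y \<partial>\<kappa> t x) \<and> (\<integral>y. g y \<partial>\<kappa> t x) <= 1" if "0 <= t" "x \<in> Hc c" for t x
  proof -
   note k = kernel_at[OF that]
   have "g \<in> borel_measurable (\<kappa> t x)" using mg by (simp add: measurable_cong_sets[OF k(2) refl])
   from integral_bounds_prob[OF k(1) this g(2)] show ?thesis by simp
  qed
  have Pg1: "\<bar>Pg x\<bar> <= 1" for x using P01[of 1 x] by (simp add: Pg_def)
  have step: "(\<integral>x. Pg x \<partial>\<kappa> t x0) = (\<integral>x. g x \<partial>\<kappa> (t + 1) x0)" if t: "0 <= t" for t
  proof -
   note k = kernel_at[OF t x0]
   have "(\<integral>x. g x \<partial>\<kappa> (t + 1) x0) = (\<integral>x. \<integral>y. g y \<partial>\<kappa> 1 x \<partial>\<kappa> t x0)"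
    using integral_bind_kernel[OF k(1,2) kernel mg, of 1 1] g1 by (simp add: chapman[OF t _ x0])
   also have "\<dots> = (\<integral>x. Pg x \<partial>\<kappa> t x0)" by (rule Bochner_Integration.integral_cong) (auto simp: Pg_def k(3))
   finally show ?thesis ..
  qed
  \<comment> \<open>A unit time shift moves the average by its two boundary terms only.\<close>
  have diff: "\<bar>(\<integral>x. Pg x \<partial>\<mu> J) - (\<integral>x. g x \<partial>\<mu> J)\<bar> <= 1 / real (Suc J)" for J
  proof -
   let ?a = "%j. \<integral>x. g x \<partial>\<kappa> (s J + real j) x0"
   have "(\<integral>x. Pg x \<partial>\<kappa> (s J + real j) x0) = ?a (Suc j)" for j
    using step[of "s J + real j"] s0[of J] by (simp add: add_ac)
   then have "(\<integral>x. Pg x \<partial>\<mu> J) - (\<integral>x. g x \<partial>\<mu> J) = ((\<Sum>j\<le>J. ?a (Suc j)) - (\<Sum>j\<le>J. ?a j)) / real (Suc J)"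
    using i\<mu>[OF mPg Pg1] i\<mu>[OF mg g1] by (simp add: diff_divide_distrib)
   also have "(\<Sum>j\<le>J. ?a (Suc j)) - (\<Sum>j\<le>J. ?a j) = ?a (Suc J) - ?a 0"
    unfolding sum_subtractf[symmetric] lessThan_Suc_atMost[symmetric] by (rule sum_lessThan_telescope)
   finally have eq: "(\<integral>x. Pg x \<partial>\<mu> J) - (\<integral>x. g x \<partial>\<mu> J) = (?a (Suc J) - ?a 0) / real (Suc J)" .
   have "\<bar>?a (Suc J) - ?a 0\<bar> <= 1"
    using P01[of "s J + real (Suc J)" x0] P01[of "s J + real 0" x0] s0[of J] x0 by (simp add: abs_le_iff)
   then show ?thesis unfolding eq abs_divide by (simp add: divide_right_mono)
  qed
  have lg: "(%n. g (x n)) \<longlonglongrightarrow> g l" if "x \<longlonglongrightarrow> l" for x l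
   by (rule continuous_on_tendsto_compose[OF lip_continuous[OF g(1), of UNIV] that]) auto
  have l1: "(%l. \<integral>x. g x \<partial>\<mu> (r l)) \<longlonglongrightarrow> (\<integral>x. g x \<partial>\<nu>)" by (rule lim\<nu>[OF mg g1 lg])
  \<comment> \<open>The Feller property allows the weak limit to be taken inside the kernel.\<close>
  have l2: "(%l. \<integral>x. Pg x \<partial>\<mu> (r l)) \<longlonglongrightarrow> (\<integral>x. Pg x \<partial>\<nu>)"
  proof (rule lim\<nu>[OF mPg Pg1])
   show "(%n. Pg (x n)) \<longlonglongrightarrow> Pg l" if "!!n. x n \<in> Hc c" "l \<in> Hc c" "x \<longlonglongrightarrow> l" for x l
    using feller[OF g that] that by (simp add: Pg_def)
  qed
  have "(%l. 1 / real (Suc (r l))) \<longlonglongrightarrow> 0"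
   using LIMSEQ_subseq_LIMSEQ[OF LIMSEQ_inverse_real_of_nat r] by (simp add: comp_def divide_inverse)
  moreover have "\<forall>\<^sub>F l in sequentially. norm ((\<integral>x. Pg x \<partial>\<mu> (r l)) - (\<integral>x. g x \<partial>\<mu> (r l))) <= 1 / real (Suc (r l))"
   using diff by (simp add: always_eventually del: of_nat_Suc)
  ultimately have "(%l. (\<integral>x. Pg x \<partial>\<mu> (r l)) - (\<integral>x. g x \<partial>\<mu> (r l))) \<longlonglongrightarrow> 0"
   by (rule Lim_null_comparison[rotated])
  moreover have "(%l. (\<integral>x. Pg x \<partial>\<mu> (r l)) - (\<integral>x. g x \<partial>\<mu> (r l))) \<longlonglongrightarrow> (\<integral>x. Pg x \<partial>\<nu>) - (\<integral>x. g x \<partial>\<nu>)"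
   by (intro tendsto_diff l1 l2)
  ultimately have "(\<integral>x. Pg x \<partial>\<nu>) = (\<integral>x. g x \<partial>\<nu>)" using LIMSEQ_unique by fastforce
  moreover have "(\<integral>x. g x \<partial>(\<nu> \<bind> \<kappa> 1)) = (\<integral>x. \<integral>y. g y \<partial>\<kappa> 1 x \<partial>\<nu>)"
   by (rule integral_bind_kernel[OF \<nu> kernel mg g1]) simp
  moreover have "(\<integral>x. \<integral>y. g y \<partial>\<kappa> 1 x \<partial>\<nu>) = (\<integral>x. Pg x \<partial>\<nu>)"
   using sets_eq_imp_space_eq[OF \<nu>(2)] by (intro Bochner_Integration.integral_cong) (auto simp: Pg_def space_bor)
  ultimately show "(\<integral>x. g x \<partial>(\<nu> \<bind> \<kappa> 1)) = (\<integral>x. g x \<partial>\<nu>)" by simp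
 qed simp_all
 then show ?thesis using \<nu> by (auto simp: invariant_def)
qed

section \<open>The limit semigroup\<close>

lemma closed_Hc: "closed (Hc c)"
 unfolding Hc_def by (intro closed_Collect_eq continuous_coef continuous_on_const)

lemma solution_AE_Hc:
 assumes sol: "solution M W b lam n x \<Xi>" and b: "b 0 = 0" and x: "x \<in> Hc c"
 shows "AE om in M. \<forall>t\<ge>0. \<Xi> t om \<in> Hc c"
proof -
 have "AE om in M. solution_path b lam n x (%k t. W k t om) (%t. \<Xi> t om)"
  using sol by (simp add: solution_def)
 then show ?thesis
 proof eventually_elim
  case (elim om)
  then obtain u where wp: "weak_path b lam n x (%k t. W k t om) (%t. \<Xi> t om) u"
   using b unfolding solution_path_def weak_path_def by blast
  interpret weak_path b lam n x "%k t. W k t om" "%t. \<Xi> t om" u by (rule wp)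
  have "coef (\<Xi> t om) 0 = c" if "0 <= t" for t
   using y_0[OF that] y_nonneg[OF that, of 0] x by (simp add: Hc_def)
  then show ?case by (simp add: Hc_def)
 qed
qed

lemma approx_semigroup_eq:
 assumes sol: "solution M W b lam n x (X x)" and b: "b 0 = 0" and x: "x \<in> Hc c" and t: "0 <= t"
  and \<phi>: "\<phi> \<in> borel_measurable borel"
 shows "approx_semigroup M X c t \<phi> x = (\<integral>om. \<phi> (X x t om) \<partial>M)"
 unfolding approx_semigroup_def
proof (rule integral_cong_AE)
 have mX: "X x t \<in> borel_measurable M" using sol t by (simp add: solution_def)
 show m: "(%om. \<phi> (X x t om)) \<in> borel_measurable M" by (rule measurable_compose[OF mX \<phi>])
 have "{om \<in> space M. X x t om \<in> Hc c} \<in> sets M"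
  using measurable_sets[OF mX, of "Hc c"] closed_Hc by (simp add: vimage_def Int_def conj_commute)
 then show "(%om. if X x t om \<in> Hc c then \<phi> (X x t om) else 0) \<in> borel_measurable M"
  by (intro measurable_If m) auto
 show "AE om in M. (if X x t om \<in> Hc c then \<phi> (X x t om) else 0) = \<phi> (X x t om)"
  using solution_AE_Hc[where \<Xi>="X x", OF sol b x] by eventually_elim (use t in auto)
qed

lemma trace_partial_sums:
 assumes b: "!!k. 0 <= b k" and Tr: "Tr (- 1) b < \<infinity>"
 shows "(\<Sum>i=1..m. b i / freq i) <= enn2real (Tr (- 1) b)"
proof -
 have eq: "(- eig (Suc k)) powr (- 1) * b (Suc k) = b (Suc k) / freq (Suc k)" for k
  by (simp add: eig_eq_freq powr_minus_divide freq_def)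
 have "(\<Sum>i=1..m. b i / freq i) = (\<Sum>k<m. b (Suc k) / freq (Suc k))"
  using sum.atLeast1_atMost_eq[of "%i. b i / freq i" m] by simp
 also have "ennreal \<dots> = (\<Sum>k<m. ennreal (b (Suc k) / freq (Suc k)))"
  by (rule sum_ennreal[symmetric]) (simp add: b freq_def)
 also have "\<dots> <= Tr (- 1) b" unfolding Tr_def eq by (rule sum_le_suminf) auto
 also have "\<dots> = ennreal (enn2real (Tr (- 1) b))" using Tr by simp
 finally show ?thesis by (subst (asm) ennreal_le_iff) auto
qed

text \<open>Folding (0, J+1] onto (0, 1] turns the time integral into an integral over offsets. If
  at every offset some q made the sum exceed A + 1, monotone convergence in q would force the
  integral up to A + 1. A single offset thus serves all q.\<close>

lemma uniform_offset:
 fixes F :: "nat => real => real"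
 assumes F: "!!q. F q \<in> borel_measurable borel" "!!q t. 0 <= F q t" "!!q t. 0 <= t ==> F q t <= F (Suc q) t"
  and int: "!!q. (\<integral>\<^sup>+s. ennreal (F q s) * indicator {0<..real (Suc J)} s \<partial>lborel) <= ennreal A" and A: "0 <= A"
 shows "\<exists>s\<ge>0. \<forall>q. (\<Sum>j\<le>J. F q (s + real j)) <= A + 1"
proof (rule ccontr)
 assume neg: "\<not> ?thesis"
 define H where "H q s = (\<Sum>j\<le>J. ennreal (F q (s + real j))) * indicator {0<..1} s" for q and s :: real
 have mF: "(%s. F q (s + a)) \<in> borel_measurable borel" for q a using F(1)[of q] by measurable
 have mH: "H q \<in> borel_measurable lborel" for q
  unfolding H_def[abs_def] using mF by measurable
 have inc: "incseq H"
  unfolding incseq_Suc_iff le_fun_def H_def using F(3)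
  by (auto simp: indicator_def intro!: sum_mono ennreal_leI)
 have tr: "(\<integral>\<^sup>+s. ennreal (F q (s + real j)) * indicator {0<..1} s \<partial>lborel)
   = (\<integral>\<^sup>+s. ennreal (F q s) * indicator {real j<..real j + 1} s \<partial>lborel)" for q j
 proof -
  have "(\<integral>\<^sup>+s. ennreal (F q s) * indicator {real j<..real j + 1} s \<partial>lborel)
    = ennreal \<bar>1\<bar> * (\<integral>\<^sup>+s. ennreal (F q (real j + 1 * s)) * indicator {real j<..real j + 1} (real j + 1 * s) \<partial>lborel)"
   using F(1)[of q] by (intro nn_integral_real_affine) (auto intro!: borel_measurable_times_ennreal)
  also have "\<dots> = (\<integral>\<^sup>+s. ennreal (F q (s + real j)) * indicator {0<..1} s \<partial>lborel)"
   by (simp, intro nn_integral_cong) (auto simp: indicator_def add.commute)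
  finally show ?thesis ..
 qed
 have ind: "(\<Sum>j\<le>K. ennreal (F q s) * indicator {real j<..real j + 1} s) = ennreal (F q s) * indicator {0<..real (Suc K)} s" for q s K
 proof (induction K)
  case (Suc K)
  have "indicator {0<..real (Suc K)} s + indicator {real (Suc K)<..real (Suc K) + 1} s = (indicator {0<..real (Suc (Suc K))} s :: ennreal)"
   by (auto simp: indicator_def)
  then show ?case unfolding sum.atMost_Suc Suc.IH distrib_left[symmetric] by simp
 qed simp
 have "(\<integral>\<^sup>+s. H q s \<partial>lborel) <= ennreal A" for q
 proof -
  have "(\<integral>\<^sup>+s. H q s \<partial>lborel) = (\<Sum>j\<le>J. \<integral>\<^sup>+s. ennreal (F q (s + real j)) * indicator {0<..1} s \<partial>lborel)"
   unfolding H_def sum_distrib_right using mF by (intro nn_integral_sum) auto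
  also have "\<dots> = (\<integral>\<^sup>+s. (\<Sum>j\<le>J. ennreal (F q s) * indicator {real j<..real j + 1} s) \<partial>lborel)"
   unfolding tr using F(1) by (intro nn_integral_sum[symmetric]) auto
  also have "\<dots> <= ennreal A" unfolding ind by (rule int)
  finally show ?thesis .
 qed
 then have sup: "(\<integral>\<^sup>+s. (SUP q. H q s) \<partial>lborel) <= ennreal A"
  unfolding nn_integral_monotone_convergence_SUP[OF inc mH] by (intro SUP_least)
 have "ennreal (A + 1) = (\<integral>\<^sup>+s. ennreal (A + 1) * indicator {0<..1 :: real} s \<partial>lborel)"
  by (subst nn_integral_cmult_indicator) auto
 also have "\<dots> <= (\<integral>\<^sup>+s. (SUP q. H q s) \<partial>lborel)"
 proof (rule nn_integral_mono)
  fix s :: real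
  show "ennreal (A + 1) * indicator {0<..1} s <= (SUP q. H q s)"
  proof (cases "s \<in> {0<..1}")
   case True
   then have "0 <= s" by simp
   then obtain q where "\<not> (\<Sum>j\<le>J. F q (s + real j)) <= A + 1" using neg by blast
   then have "ennreal (A + 1) <= ennreal (\<Sum>j\<le>J. F q (s + real j))" by (intro ennreal_leI) simp
   also have "\<dots> = H q s" using True F(2) by (simp add: H_def)
   also have "\<dots> <= (SUP q. H q s)" by (rule SUP_upper) simp
   finally show ?thesis using True by simp
  qed simp
 qed
 also note sup
 finally show False using A by simp
qed

theorem theorem3p2:
  fixes M :: "'w measure"
    and W :: "nat \<Rightarrow> real \<Rightarrow> 'w \<Rightarrow> real"
    and b :: "nat \<Rightarrow> real"
    and lam c :: real
    and N :: nat
    and X :: "nat \<Rightarrow> H \<Rightarrow> real \<Rightarrow> 'w \<Rightarrow> H"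
    and P :: "real \<Rightarrow> (H \<Rightarrow> real) \<Rightarrow> H \<Rightarrow> real"
  assumes "cylindrical_wiener M W"
    and "b 0 = 0"
    and "\<And>k. 0 \<le> b k"
    and "Tr (- 1) b < \<infinity>"
    and "\<And>n x. solution M W b lam n x (X n x)"
    and "\<And>k. k \<in> {1..N} \<Longrightarrow> 0 < b k"
    and "1/2 * (real N + 1)\<^sup>2 - lam > 0"
    and "c \<in> {-1<..<1}"
    and "limit_semigroup (\<lambda>n. approx_semigroup M (X n) c) c P"
  shows "\<exists>!\<nu>. invariant_measure (borel_Hc c) P \<nu>"
proof -
 note W = assms(1) and b = assms(2,3) and sol = assms(5) and bN = assms(6)
 interpret M: prob_space M using W by (simp add: cylindrical_wiener_def)
 let ?S = "borel_Hc c"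
 have spS: "space ?S = Hc c" by (simp add: space_restrict_space)
 have ts: "transition_semigroup ?S P" using assms(9) by (simp add: limit_semigroup_def)
 note ts' = ts[unfolded transition_semigroup_def spS]
 from conjunct1[OF ts'] obtain \<kappa> where \<kappa>0: "(\<forall>t\<ge>0. \<kappa> t \<in> ?S \<rightarrow>\<^sub>M prob_algebra ?S) \<and>
   (\<forall>t\<ge>0. \<forall>\<phi>\<in>Bb ?S. \<forall>x\<in>Hc c. P t \<phi> x = (\<integral>y. \<phi> y \<partial>\<kappa> t x))" by (rule exE)
 have \<kappa>: "\<kappa> t \<in> ?S \<rightarrow>\<^sub>M prob_algebra ?S" if "0 <= t" for t
  using conjunct1[OF \<kappa>0] that by (elim allE impE)
 have P\<kappa>: "P t \<phi> x = (\<integral>y. \<phi> y \<partial>\<kappa> t x)" if "0 <= t" "\<phi> \<in> Bb ?S" "x \<in> Hc c" for t \<phi> x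
  by (rule conjunct2[OF \<kappa>0, rule_format, OF that])
 have PP: "P (s + t) \<phi> x = P s (P t \<phi>) x" if "0 <= s" "0 <= t" "\<phi> \<in> Bb ?S" "x \<in> Hc c" for s t \<phi> x
  by (rule conjunct2[OF conjunct2[OF ts'], rule_format, OF that])
 obtain r0 where r0: "strict_mono (r0 :: nat => nat)"
  and Plim0: "!!\<phi> x t. \<phi> \<in> Bb ?S ==> x \<in> Hc c ==> 0 <= t ==> (%k. approx_semigroup M (X (r0 k)) c t \<phi> x) \<longlonglongrightarrow> P t \<phi> x"
  using assms(9) unfolding limit_semigroup_def by blast
 \<comment> \<open>Dropping one term guarantees n >= 1, where the nonlinearity has its cubic term
   and the dissipation bound holds.\<close>
 define r where "r k = r0 (Suc k)" for k
 have r1: "1 <= r k" for k using seq_suble[OF r0, of "Suc k"] by (simp add: r_def)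
 have BbI: "\<phi> \<in> Bb ?S" if "\<phi> \<in> borel_measurable borel" "!!x. \<bar>\<phi> x\<bar> <= B" for \<phi> :: "H => real" and B
  using that unfolding Bb_def by (auto intro: measurable_restrict_space1)
 have Elim: "(%k. \<integral>om. \<phi> (X (r k) x t om) \<partial>M) \<longlonglongrightarrow> (\<integral>y. \<phi> y \<partial>\<kappa> t x)"
  if \<phi>: "\<phi> \<in> borel_measurable borel" "!!x. \<bar>\<phi> x\<bar> <= B" and x: "x \<in> Hc c" and t: "0 <= t" for \<phi> :: "H => real" and B x t
 proof -
  have "(%k. approx_semigroup M (X (r k)) c t \<phi> x) \<longlonglongrightarrow> P t \<phi> x"
   unfolding r_def using LIMSEQ_Suc[OF Plim0[OF BbI[OF \<phi>] x t]] .
  moreover have "approx_semigroup M (X (r k)) c t \<phi> x = (\<integral>om. \<phi> (X (r k) x t om) \<partial>M)" for k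
   by (rule approx_semigroup_eq[where X="X (r k)", OF sol b(1) x t \<phi>(1)])
  ultimately show ?thesis
   by (simp add: P\<kappa>[OF t BbI[OF \<phi>] x])
 qed
 have BbP: "P t \<phi> \<in> Bb ?S" if t: "0 <= t" and \<phi>: "\<phi> \<in> Bb ?S" for t \<phi>
 proof -
  obtain B where B: "!!x. x \<in> Hc c ==> \<bar>\<phi> x\<bar> <= B" and m: "\<phi> \<in> borel_measurable ?S" using \<phi> by (auto simp: Bb_def spS)
  have "(%x. \<integral>y. \<phi> y \<partial>\<kappa> t x) \<in> borel_measurable ?S" by (rule measurable_kernel_integral[OF \<kappa>[OF t] m])
  then have mP: "P t \<phi> \<in> borel_measurable ?S"
   by (rule measurable_cong[THEN iffD1, rotated]) (simp add: spS P\<kappa>[OF t \<phi>])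
  have "\<bar>P t \<phi> x\<bar> <= B" if x: "x \<in> Hc c" for x
  proof -
   note k = kernel_props[OF \<kappa>[OF t], unfolded spS, OF x]
   have "- B <= \<phi> y \<and> \<phi> y <= B" if "y \<in> space (\<kappa> t x)" for y using B[of y] that k(3) by (simp add: abs_le_iff)
   moreover have "\<phi> \<in> borel_measurable (\<kappa> t x)" using m by (simp add: measurable_cong_sets[OF k(2) refl])
   ultimately show ?thesis using integral_bounds_prob(2,3)[OF k(1), of \<phi> "- B" B] by (simp add: P\<kappa>[OF t \<phi> x] abs_le_iff)
  qed
  then show ?thesis using mP by (auto simp: Bb_def spS)
 qed
 have IndBb: "indicator A \<in> Bb ?S" if "A \<in> sets ?S" for A
  using that borel_measurable_indicator[OF that] by (auto simp: Bb_def indicator_def intro!: exI[of _ 1])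
 have bindP: "(\<integral>x. P t \<phi> x \<partial>\<nu>) = (\<integral>x. \<phi> x \<partial>(\<nu> \<bind> \<kappa> t))"
  if t: "0 <= t" and \<phi>: "\<phi> \<in> Bb ?S" and \<nu>: "prob_space \<nu>" "sets \<nu> = sets ?S" for t \<phi> \<nu>
 proof -
  obtain B where B: "!!x. x \<in> space ?S ==> \<bar>\<phi> x\<bar> <= B" and m: "\<phi> \<in> borel_measurable ?S" using \<phi> by (auto simp: Bb_def)
  have "(\<integral>x. P t \<phi> x \<partial>\<nu>) = (\<integral>x. \<integral>y. \<phi> y \<partial>\<kappa> t x \<partial>\<nu>)"
   using sets_eq_imp_space_eq[OF \<nu>(2)] by (intro Bochner_Integration.integral_cong refl P\<kappa>[OF t \<phi>]) (simp add: spS)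
  also have "\<dots> = (\<integral>x. \<phi> x \<partial>(\<nu> \<bind> \<kappa> t))" by (rule integral_bind_kernel[OF \<nu> \<kappa>[OF t] m B, symmetric])
  finally show ?thesis .
 qed
 have meas_eqI: "\<mu> = \<nu>" if "prob_space \<mu>" "prob_space \<nu>" "sets \<mu> = sets ?S" "sets \<nu> = sets ?S"
  "!!A. A \<in> sets ?S ==> (\<integral>x. indicator A x \<partial>\<mu>) = (\<integral>x. indicator A x \<partial>\<nu> :: real)" for \<mu> \<nu> :: "H measure"
 proof (rule measure_eqI)
  interpret m: prob_space \<mu> by fact
  interpret n: prob_space \<nu> by fact
  show "emeasure \<mu> A = emeasure \<nu> A" if "A \<in> sets \<mu>" for A
   using that \<open>sets \<mu> = sets ?S\<close> \<open>sets \<nu> = sets ?S\<close> \<open>!!A. A \<in> sets ?S ==> (\<integral>x. indicator A x \<partial>\<mu>) = (\<integral>x. indicator A x \<partial>\<nu> :: real)\<close>[of A]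
   by (simp add: m.emeasure_eq_measure n.emeasure_eq_measure)
 qed (use that in simp)
 have bind_prob: "prob_space (\<nu> \<bind> \<kappa> t)" "sets (\<nu> \<bind> \<kappa> t) = sets ?S"
  if "prob_space \<nu>" "sets \<nu> = sets ?S" "0 <= t" for \<nu> t
 proof -
  have "\<nu> \<in> space (prob_algebra ?S)" using that by (simp add: space_prob_algebra)
  from prob_space_bind'[OF this \<kappa>[OF that(3)]] sets_bind'[OF this \<kappa>[OF that(3)]]
  show "prob_space (\<nu> \<bind> \<kappa> t)" "sets (\<nu> \<bind> \<kappa> t) = sets ?S" .
 qed
 have N: "lam < 1 / 2 * (real N + 1)^2" using assms(7) by simp
 let ?C = "2 * ctrl_cost lam b N"
 have C0: "0 <= ?C"
  unfolding ctrl_cost_def using bN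
  by (intro mult_nonneg_nonneg sum_nonneg divide_nonneg_nonneg) (auto simp: freq_def less_imp_le)
 \<comment> \<open>The constants of \<open>approx_harnack\<close> are free of n and both sides are
   expectations of bounded Borel functions, so the inequality passes to the limit.\<close>
 have hs: "harnack_semigroup (Hc c) \<kappa> ?C"
 proof
  show "closed (Hc c)" by (rule closed_Hc)
  show "\<kappa> t \<in> ?S \<rightarrow>\<^sub>M prob_algebra ?S" if "0 <= t" for t by (rule \<kappa>[OF that])
  show "0 <= ?C" by (rule C0)
  show "\<kappa> (s + t) x = \<kappa> s x \<bind> \<kappa> t" if st: "0 <= s" "0 <= t" and x: "x \<in> Hc c" for s t x
  proof -
   note k = kernel_props[OF \<kappa>, unfolded spS, OF _ x]
   have st': "0 <= s + t" using st by simp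
   show ?thesis
   proof (rule meas_eqI[OF k(1)[OF st'] bind_prob(1)[OF k(1,2)[OF st(1)] st(2)] k(2)[OF st'] bind_prob(2)[OF k(1,2)[OF st(1)] st(2)]])
    fix A assume A: "A \<in> sets ?S"
    have "(\<integral>x. indicator A x \<partial>\<kappa> (s + t) x) = P (s + t) (indicator A) x"
     by (rule P\<kappa>[OF st' IndBb[OF A] x, symmetric])
    also have "\<dots> = P s (P t (indicator A)) x" by (rule PP[OF st IndBb[OF A] x])
    also have "\<dots> = (\<integral>y. P t (indicator A) y \<partial>\<kappa> s x)" by (rule P\<kappa>[OF st(1) BbP[OF st(2) IndBb[OF A]] x])
    also have "\<dots> = (\<integral>y. indicator A y \<partial>(\<kappa> s x \<bind> \<kappa> t))"
     by (rule bindP[OF st(2) IndBb[OF A] k(1,2)[OF st(1)]])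
    finally show "(\<integral>x. indicator A x \<partial>\<kappa> (s + t) x) = (\<integral>y. indicator A y \<partial>(\<kappa> s x \<bind> \<kappa> t) :: real)" .
   qed
  qed
  fix t :: real and x y L B and g :: "H => real"
  assume t: "0 < t" and xy: "x \<in> Hc c" "y \<in> Hc c" and L: "0 <= L" and g: "!!z. \<bar>g z\<bar> <= B" "!!z z'. \<bar>g z - g z'\<bar> <= L * dist z z'"
  have mg: "g \<in> borel_measurable borel" by (rule lip_measurable[OF lipI[OF L g(2)]])
  have me: "(%z. exp (g z)) \<in> borel_measurable borel" using mg by measurable
  have eB: "\<bar>exp (g z)\<bar> <= exp B" for z using g(1)[of z] by simp
  have t': "0 <= t" using t by simp
  let ?R = "L * dist x y / sqrt (1 + t) + ?C * (dist x y)^2"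
  have "(\<integral>z. g z \<partial>\<kappa> t y) <= (\<integral>z. exp (g z) \<partial>\<kappa> t x) - 1 + ?R"
  proof (rule LIMSEQ_le[OF Elim[OF mg g(1) xy(2) t']])
   show "(%k. (\<integral>om. exp (g (X (r k) x t om)) \<partial>M) - 1 + ?R) \<longlonglongrightarrow> (\<integral>z. exp (g z) \<partial>\<kappa> t x) - 1 + ?R"
    by (intro tendsto_add tendsto_diff tendsto_const Elim[OF me eB xy(1) t'])
   have "(\<integral>om. g (X (r k) y t om) \<partial>M) <= (\<integral>om. exp (g (X (r k) x t om)) \<partial>M) - 1 + ?R" for k
    using approx_harnack[where g=g, OF W b bN N sol[of "r k" x] sol[of "r k" y] xy t g(1) L g(2)] by (simp add: add.assoc)
   then show "\<exists>K. \<forall>k\<ge>K. (\<integral>om. g (X (r k) y t om) \<partial>M) <= (\<integral>om. exp (g (X (r k) x t om)) \<partial>M) - 1 + ?R" by blast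
  qed
  then show "(\<integral>z. g z \<partial>\<kappa> t y) <= (\<integral>z. exp (g z) \<partial>\<kappa> t x) - 1 + L * dist x y / sqrt (1 + t) + ?C * (dist x y)^2"
   by (simp add: add.assoc)
 qed
 interpret harnack_semigroup "Hc c" \<kappa> ?C by (rule hs)
 \<comment> \<open>The backward direction rests on \<open>invariant_all\<close>, so uniqueness for
   time 1 is already used here.\<close>
 have inv_iff: "invariant_measure ?S P \<nu> \<longleftrightarrow> invariant \<nu> 1" for \<nu>
 proof
  assume "invariant_measure ?S P \<nu>"
  then have \<nu>: "prob_space \<nu>" "sets \<nu> = sets ?S" "!!\<phi>. \<phi> \<in> Bb ?S ==> (\<integral>x. P 1 \<phi> x \<partial>\<nu>) = (\<integral>x. \<phi> x \<partial>\<nu>)"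
   by (auto simp: invariant_measure_def)
  have "\<nu> \<bind> \<kappa> 1 = \<nu>"
  proof (rule meas_eqI[OF bind_prob(1)[OF \<nu>(1,2)] \<nu>(1) bind_prob(2)[OF \<nu>(1,2)] \<nu>(2)])
   show "(\<integral>x. indicator A x \<partial>(\<nu> \<bind> \<kappa> 1)) = (\<integral>x. indicator A x \<partial>\<nu> :: real)" if "A \<in> sets ?S" for A
    using \<nu>(3)[OF IndBb[OF that]] bindP[OF _ IndBb[OF that] \<nu>(1,2), of 1] by simp
  qed simp_all
  then show "invariant \<nu> 1" using \<nu> by (simp add: invariant_def)
 next
  assume inv: "invariant \<nu> 1"
  have \<nu>: "prob_space \<nu>" "sets \<nu> = sets ?S" using inv by (auto simp: invariant_def)
  have "(\<integral>x. P t \<phi> x \<partial>\<nu>) = (\<integral>x. \<phi> x \<partial>\<nu>)" if "0 <= t" "\<phi> \<in> Bb ?S" for t \<phi>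
   using bindP[OF that \<nu>] invariant_all[OF inv that(1)] by (simp add: invariant_def)
  then show "invariant_measure ?S P \<nu>" using \<nu> by (auto simp: invariant_measure_def)
 qed
 have c: "\<bar>c\<bar> < 1" using assms(8) by auto
 obtain C1 where C1: "0 <= C1" "!!n u. 1 <= n ==> fpoly lam n u * (u - c) <= C1"
  using fpoly_dissipative[OF c, of lam] by blast
 define tr where "tr = enn2real (Tr (- 1) b)"
 have tr: "(\<Sum>i=1..m. b i / freq i) <= tr" "0 <= tr" for m
  unfolding tr_def using trace_partial_sums[OF b(2) assms(4)] by auto
 \<comment> \<open>An explicit element of \<open>Hc c\<close>; any starting point would do.\<close>
 define x0 where "x0 = decode c 0"
 have x0: "x0 \<in> Hc c" unfolding x0_def by (rule decode_Hc)
 define F where "F q t = (\<integral>y. \<psi> q y \<partial>\<kappa> (max 0 t) x0)" for q and t :: real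
 have \<psi>B: "\<bar>\<psi> q y\<bar> <= real q" for q y using \<psi>_bounds[of q y] by simp
 have \<psi>cont: "continuous_on UNIV (\<psi> q)" for q using \<psi>_lipschitz[of q] by (intro lip_continuous) (auto simp: lip_def)
 have Flim: "(%k. \<integral>om. \<psi> q (X (r k) x0 (max 0 t) om) \<partial>M) \<longlonglongrightarrow> F q t" for q t
  unfolding F_def by (rule Elim[OF measurable_\<psi> \<psi>B x0]) simp
 have mE: "(%t. \<integral>om. \<psi> q (X (r k) x0 (max 0 t) om) \<partial>M) \<in> borel_measurable borel" for q k
  by (rule borel_measurable_continuous_onI[OF continuous_expect[OF M.prob_space_axioms sol \<psi>cont \<psi>B]])
 \<comment> \<open>Borel in time as a limit of functions continuous in time; the kernels themselves
   carry no regularity in t.\<close>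
 have mF: "F q \<in> borel_measurable borel" for q by (rule borel_measurable_LIMSEQ_real[OF Flim mE])
 have F0: "0 <= F q t" for q t unfolding F_def by (rule integral_nonneg_AE) (simp add: \<psi>_bounds)
 have Fmono: "F q t <= F (Suc q) t" for q t
 proof -
  have k: "prob_space (\<kappa> (max 0 t) x0)" "sets (\<kappa> (max 0 t) x0) = sets ?S" using kernel_at(1,2)[of "max 0 t" x0] x0 by auto
  have "\<psi> q \<in> borel_measurable (\<kappa> (max 0 t) x0)" for q
   using measurable_restrict_space1[OF measurable_\<psi>, of q] by (simp add: measurable_cong_sets[OF k(2) refl])
  then have "integrable (\<kappa> (max 0 t) x0) (\<psi> q)" for q
   by (rule integral_bounds_prob(1)[OF k(1), of _ 0 "real q"]) (simp add: \<psi>_bounds)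
  then show ?thesis unfolding F_def by (intro integral_mono \<psi>_mono) auto
 qed
 \<comment> \<open>Fatou's lemma along the subsequence.\<close>
 have Fint: "(\<integral>\<^sup>+s. ennreal (F q s) * indicator {0<..T} s \<partial>lborel) <= ennreal ((norm x0)^2 + T * (C1 + tr))" if T: "0 < T" for q T
 proof -
  let ?E = "%k s. ennreal (\<integral>om. \<psi> q (X (r k) x0 (max 0 s) om) \<partial>M) * indicator {0<..T} s"
  have lim: "liminf (%k. ?E k s) = ennreal (F q s) * indicator {0<..T} s" for s
  proof (rule lim_imp_Liminf[OF sequentially_bot])
   show "(%k. ?E k s) \<longlonglongrightarrow> ennreal (F q s) * indicator {0<..T} s"
    using tendsto_ennrealI[OF Flim[of q s]] by (cases "s \<in> {0<..T}") auto
  qed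
  have "(\<integral>\<^sup>+s. ennreal (F q s) * indicator {0<..T} s \<partial>lborel) = (\<integral>\<^sup>+s. liminf (%k. ?E k s) \<partial>lborel)"
   unfolding lim ..
  also have "\<dots> <= liminf (%k. \<integral>\<^sup>+s. ?E k s \<partial>lborel)"
   by (rule nn_integral_liminf) (use mE in auto)
  also have "\<dots> <= ennreal ((norm x0)^2 + T * (C1 + tr))"
  proof (rule Liminf_le)
   show "\<forall>\<^sub>F k in sequentially. (\<integral>\<^sup>+s. ?E k s \<partial>lborel) <= ennreal ((norm x0)^2 + T * (C1 + tr))"
    by (rule always_eventually) (intro allI approx_energy[OF W b sol x0 T C1(2)[OF r1] C1(1) tr])
  qed (rule sequentially_bot)
  finally show ?thesis .
 qed
 \<comment> \<open>The initial energy and the 1 from \<open>uniform_offset\<close> are needed once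
   but granted in each of the J + 1 terms.\<close>
 let ?D = "(norm x0)^2 + (C1 + tr) + 1"
 have D0: "0 <= ?D" using C1(1) tr(2) by simp
 have "\<exists>s\<ge>0. \<forall>q. (\<Sum>j\<le>J. \<integral>x. \<psi> q x \<partial>\<kappa> (s + real j) x0) <= real (Suc J) * ?D" for J
 proof -
  let ?A = "(norm x0)^2 + real (Suc J) * (C1 + tr)"
  have "\<exists>s\<ge>0. \<forall>q. (\<Sum>j\<le>J. F q (s + real j)) <= ?A + 1"
  proof (rule uniform_offset[where F=F, OF mF F0 Fmono])
   show "(\<integral>\<^sup>+s. ennreal (F q s) * indicator {0<..real (Suc J)} s \<partial>lborel) <= ennreal ?A" for q
    by (rule Fint) simp
   show "0 <= ?A" using C1(1) tr(2) by simp
  qed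
  then obtain s where s: "0 <= s" "!!q. (\<Sum>j\<le>J. F q (s + real j)) <= ?A + 1" by blast
  have "?A + 1 <= real (Suc J) * ?D"
  proof -
   have "1 * ((norm x0)^2 + 1) <= real (Suc J) * ((norm x0)^2 + 1)" by (intro mult_right_mono) auto
   then show ?thesis by (simp add: algebra_simps)
  qed
  moreover have "F q (s + real j) = (\<integral>x. \<psi> q x \<partial>\<kappa> (s + real j) x0)" for q j
   using s(1) by (simp add: F_def max_absorb2)
  ultimately show ?thesis using s by (intro exI[of _ s]) (auto intro: order_trans)
 qed
 then have "\<forall>J. \<exists>s\<ge>0. \<forall>q. (\<Sum>j\<le>J. \<integral>x. \<psi> q x \<partial>\<kappa> (s + real j) x0) <= real (Suc J) * ?D" by blast
 from choice[OF this] obtain s where s: "!!J. 0 <= s J" "!!J q. (\<Sum>j\<le>J. \<integral>x. \<psi> q x \<partial>\<kappa> (s J + real j) x0) <= real (Suc J) * ?D" by blast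
 obtain \<nu> where "invariant \<nu> 1" using exists_invariant[OF hs x0 s(1) D0 s(2)] by blast
 then show ?thesis unfolding inv_iff using invariant_unique by blast
qed

end
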